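(* Let $d$ be a positive integer and let $\delta>\max(1,\,d/2)$ be a real number. Let $$\Phi_{d,\delta}(t)=\frac{1}{B(2\delta-d,\,\delta)}\int_t^1(s^2-t^2)^{\delta-\frac{d+1}{2}}(1-s)^{\delta-1}\,ds\quad\text{for }0\le t\le1,\qquad \Phi_{d,\delta}(t)=0\ \text{ for } t>1,$$ and write also $\Phi_{d,\delta}(\mathbf{x})=\Phi_{d,\delta}(|\mathbf{x}|)$ for $\mathbf{x}\in\mathbb{R}^d$. Let $$W_\delta(r)={}_1F_2\left(\delta;\,\frac{3\delta}{2},\,\frac{3\delta+1}{2};\,-\frac{r^2}{4}\right)\quad(r\ge0),$$ $$\omega_{d,\delta}=\frac{2^{1-d}\,\Gamma(3\delta)\,\Gamma\left(\delta-\frac d2\right)}{\Gamma(\delta)\,\Gamma(3\delta-d)\,\Gamma\left(\frac d2\right)},\qquad \zeta_{d,\delta}=\frac{2\pi^{d/2}}{\Gamma(d/2)}\cdot\frac{1}{\omega_{d,\delta}}.$$ Then $\Phi_{d,\delta}$ is continuous and positive definite on $\mathbb{R}^d$, with $$\widehat{\Phi_{d,\delta}}(\xi)=\zeta_{d,\delta}\,W_\delta(|\xi|)\qquad(\xi\in\mathbb{R}^d).$$ As a consequence, $\Phi_{d,\delta}(\mathbf{x}-\mathbf{y})$ is a reproducing kernel for the Sobolev space $H^\delta(\mathbb{R}^d)$ with respect to the inner product $$(u,v)_{\Phi_{d,\delta}(\mathbb{R}^d)}=(2\pi)^{-d}\cdot\frac{1}{\zeta_{d,\delta}}\int_{\mathbb{R}^d}\frac{\widehat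 u(\xi)\,\overline{\widehat v(\xi)}}{W_\delta(|\xi|)}\,d\xi.$$
   Context: Notation. $|\cdot|$ is the Euclidean norm, $B(a,b)=\int_0^1 t^{a-1}(1-t)^{b-1}dt$ is the Euler beta function, and the Fourier transform is $\widehat f(\xi)=\int_{\mathbb{R}^d}e^{-i\xi\cdot\mathbf{x}}f(\mathbf{x})\,d\mathbf{x}$ for $f\in L^1(\mathbb{R}^d)$, extended to $L^2(\mathbb{R}^d)$ as usual. The generalized hypergeometric function is ${}_pF_q(a_1,\dots,a_p;b_1,\dots,b_q;r)=\sum_{k\ge0}\frac{(a_1)_k\cdots(a_p)_k}{k!\,(b_1)_k\cdots(b_q)_k}r^k$, with $(a)_0=1$ and $(a)_k=a(a+1)\cdots(a+k-1)$ for $k\ge1$. A function $\Phi$ on $\mathbb{R}^d$ is positive definite if $\sum_{j,k=1}^N\Phi(\mathbf{x}_j-\mathbf{x}_k)z_j\overline{z_k}\ge0$ for every $N$, all (pairwise distinct) $\mathbf{x}_1,\dots,\mathbf{x}_N\in\mathbb{R}^d$ and all $z_1,\dots,z_N\in\mathbb{C}$, with equality only when $z_1=\cdots=z_N=0$. For $\delta>0$, $H^\delta(\mathbb{R}^d)=\{u\in L^2(\mathbb{R}^d):(1+|\cdot|^2)^{\delta/2}\,\widehat u\in L^2(\mathbb{R}^d)\}$; when $\delta>d/2$ one has $H^\delta(\mathbb{R}^d)\subset C(\mathbb{R}^d)$, and elements are identified with their continuous representatives. For $\delta > d/2$, saying that $\Phi(\mathbf{x}-\mathbf{y})$ is a reproducing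 kernel for $H^\delta(\mathbb{R}^d)$ with respect to an inner product $(\cdot,\cdot)$ means that $H^\delta(\mathbb{R}^d)$ is a Hilbert space under $(\cdot,\cdot)$ and, for every $u\in H^\delta(\mathbb{R}^d)$ and $\mathbf{x}\in\mathbb{R}^d$, (i) $\Phi(\cdot-\mathbf{x})\in H^\delta(\mathbb{R}^d)$ and (ii) $u(\mathbf{x})=(u,\Phi(\cdot-\mathbf{x}))$. *)

theory Defs
  imports "HOL-Analysis.Analysis"
begin

section \<open>Fourier transform on $L^1$ and $L^2$\<close>

definition L1_fun :: "('a::euclidean_space \<Rightarrow> complex) set" where
  "L1_fun = {f. integrable lborel f}"

definition L2_fun :: "('a::euclidean_space \<Rightarrow> complex) set" where
  "L2_fun = {f. f \<in> borel_measurable lborel \<and> integrable lborel (\<lambda>x. (cmod (f x))\<^sup>2)}"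

definition fourier :: "('a::euclidean_space \<Rightarrow> complex) \<Rightarrow> 'a \<Rightarrow> complex" where
  "fourier f \<xi> = (LINT x|lborel. exp (- \<i> * complex_of_real (\<xi> \<bullet> x)) * f x)"

text \<open>The squared distance is taken in \<open>ennreal\<close>, so that it is \<open>\<infinity>\<close>
  (and not the default value 0 of the Bochner integral) when the difference is not
  square integrable.\<close>

definition L2_tendsto ::
    "(nat \<Rightarrow> 'a::euclidean_space \<Rightarrow> complex) \<Rightarrow> ('a \<Rightarrow> complex) \<Rightarrow> bool" where
  "L2_tendsto F f \<longleftrightarrow>
     (\<lambda>n. \<integral>\<^sup>+x. ennreal ((cmod (F n x - f x))\<^sup>2) \<partial>lborel) \<longlonglongrightarrow> 0"

text \<open>Extension of the transform by density of $L^1 \cap L^2$ in $L^2$. It determines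
  \<open>g\<close> only up to a null set; \<open>fourier_L2 f\<close> is an arbitrarily chosen representative.\<close>

definition is_fourier_L2 ::
    "('a::euclidean_space \<Rightarrow> complex) \<Rightarrow> ('a \<Rightarrow> complex) \<Rightarrow> bool" where
  "is_fourier_L2 f g \<longleftrightarrow> f \<in> L2_fun \<and> g \<in> L2_fun \<and>
     (\<exists>F. (\<forall>n. F n \<in> L1_fun \<inter> L2_fun) \<and> L2_tendsto F f \<and>
          L2_tendsto (\<lambda>n. fourier (F n)) g)"

definition fourier_L2 :: "('a::euclidean_space \<Rightarrow> complex) \<Rightarrow> 'a \<Rightarrow> complex" where
  "fourier_L2 f = (SOME g. is_fourier_L2 f g)"


section \<open>Sobolev spaces and reproducing kernels\<close>

text \<open>Used for \<open>\<delta> > d / 2\<close> only: each Sobolev class is represented by its unique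
  continuous member, so that the elements are genuine functions.\<close>

definition sobolev_space :: "real \<Rightarrow> ('a::euclidean_space \<Rightarrow> complex) set" where
  "sobolev_space \<delta> = {u. continuous_on UNIV u \<and> u \<in> L2_fun \<and>
     (\<lambda>\<xi>. complex_of_real ((1 + (norm \<xi>)\<^sup>2) powr (\<delta> / 2)) * fourier_L2 u \<xi>) \<in> L2_fun}"

definition inner_product_on ::
    "('a \<Rightarrow> complex) set \<Rightarrow> (('a \<Rightarrow> complex) \<Rightarrow> ('a \<Rightarrow> complex) \<Rightarrow> complex) \<Rightarrow> bool" where
  "inner_product_on H ip \<longleftrightarrow>
     (\<lambda>x. 0) \<in> H \<and>
     (\<forall>u\<in>H. \<forall>v\<in>H. (\<lambda>x. u x + v x) \<in> H) \<and>
     (\<forall>c. \<forall>u\<in>H. (\<lambda>x. c * u x) \<in> H) \<and>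
     (\<forall>u\<in>H. \<forall>v\<in>H. \<forall>w\<in>H. ip (\<lambda>x. u x + v x) w = ip u w + ip v w) \<and>
     (\<forall>c. \<forall>u\<in>H. \<forall>v\<in>H. ip (\<lambda>x. c * u x) v = c * ip u v) \<and>
     (\<forall>u\<in>H. \<forall>v\<in>H. ip v u = cnj (ip u v)) \<and>
     (\<forall>u\<in>H. ip u u \<in> \<real> \<and> Re (ip u u) \<ge> 0) \<and>
     (\<forall>u\<in>H. ip u u = 0 \<longrightarrow> u = (\<lambda>x. 0))"

definition ip_dist ::
    "(('a \<Rightarrow> complex) \<Rightarrow> ('a \<Rightarrow> complex) \<Rightarrow> complex) \<Rightarrow> ('a \<Rightarrow> complex) \<Rightarrow> ('a \<Rightarrow> complex) \<Rightarrow> real" where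
  "ip_dist ip u v = sqrt (Re (ip (\<lambda>x. u x - v x) (\<lambda>x. u x - v x)))"

definition hilbert_space_on ::
    "('a \<Rightarrow> complex) set \<Rightarrow> (('a \<Rightarrow> complex) \<Rightarrow> ('a \<Rightarrow> complex) \<Rightarrow> complex) \<Rightarrow> bool" where
  "hilbert_space_on H ip \<longleftrightarrow>
     inner_product_on H ip \<and> Metric_space.mcomplete H (ip_dist ip)"

definition translation_reproducing_kernel ::
    "('a::euclidean_space \<Rightarrow> complex) \<Rightarrow> ('a \<Rightarrow> complex) set \<Rightarrow>
     (('a \<Rightarrow> complex) \<Rightarrow> ('a \<Rightarrow> complex) \<Rightarrow> complex) \<Rightarrow> bool" where
  "translation_reproducing_kernel \<Phi> H ip \<longleftrightarrow>
     hilbert_space_on H ip \<and>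
     (\<forall>u\<in>H. \<forall>x. (\<lambda>y. \<Phi> (y - x)) \<in> H \<and> u x = ip u (\<lambda>y. \<Phi> (y - x)))"

text \<open>Strict version: the form vanishes only for zero coefficients.\<close>

definition positive_definite_fun :: "('a::euclidean_space \<Rightarrow> complex) \<Rightarrow> bool" where
  "positive_definite_fun \<Phi> \<longleftrightarrow>
     (\<forall>N. \<forall>x :: nat \<Rightarrow> 'a. \<forall>z :: nat \<Rightarrow> complex. inj_on x {1..N} \<longrightarrow>
       (let S = (\<Sum>j=1..N. \<Sum>k=1..N. \<Phi> (x j - x k) * z j * cnj (z k)) in
          S \<in> \<real> \<and> Re S \<ge> 0 \<and> (S = 0 \<longrightarrow> (\<forall>j\<in>{1..N}. z j = 0))))"


section \<open>The kernel and its transform\<close>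

definition hypergeom :: "real list \<Rightarrow> real list \<Rightarrow> real \<Rightarrow> real" where
  "hypergeom as bs r =
     (\<Sum>k. (\<Prod>a\<leftarrow>as. pochhammer a k) / (fact k * (\<Prod>b\<leftarrow>bs. pochhammer b k)) * r ^ k)"

definition Phi_radial :: "nat \<Rightarrow> real \<Rightarrow> real \<Rightarrow> real" where
  "Phi_radial d \<delta> t =
     (if 0 \<le> t \<and> t \<le> 1
      then 1 / Beta (2 * \<delta> - real d) \<delta> *
           (LINT s:{t..1}|lborel.
              (s\<^sup>2 - t\<^sup>2) powr (\<delta> - (real d + 1) / 2) * (1 - s) powr (\<delta> - 1))
      else 0)"

definition Phi :: "real \<Rightarrow> real ^ 'n \<Rightarrow> complex" where
  "Phi \<delta> x = complex_of_real (Phi_radial CARD('n) \<delta> (norm x))"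

definition W_fun :: "real \<Rightarrow> real \<Rightarrow> real" where
  "W_fun \<delta> r = hypergeom [\<delta>] [3 * \<delta> / 2, (3 * \<delta> + 1) / 2] (- r\<^sup>2 / 4)"

definition omega_const :: "nat \<Rightarrow> real \<Rightarrow> real" where
  "omega_const d \<delta> =
     2 powr (1 - real d) * Gamma (3 * \<delta>) * Gamma (\<delta> - real d / 2) /
     (Gamma \<delta> * Gamma (3 * \<delta> - real d) * Gamma (real d / 2))"

definition zeta_const :: "nat \<Rightarrow> real \<Rightarrow> real" where
  "zeta_const d \<delta> = 2 * pi powr (real d / 2) / Gamma (real d / 2) * (1 / omega_const d \<delta>)"

definition Phi_inner ::
    "real \<Rightarrow> (real ^ 'n \<Rightarrow> complex) \<Rightarrow> (real ^ 'n \<Rightarrow> complex) \<Rightarrow> complex" where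
  "Phi_inner \<delta> u v =
     complex_of_real ((2 * pi) powr (- real CARD('n)) * (1 / zeta_const CARD('n) \<delta>)) *
     (LINT \<xi>|lborel. fourier_L2 u \<xi> * cnj (fourier_L2 v \<xi>) / complex_of_real (W_fun \<delta> (norm \<xi>)))"

end

theory Submission
  imports Defs "HOL-Probability.Probability"
begin

text \<open>
  Up to positive factors, Gasper's expansion writes \<open>W r\<close> as a sum of squares of Bessel functions
  \<open>J\<^bsub>\<delta> - 1/2 + n\<^esub> (r / 2)\<close>; comparing coefficients, it is Dougall's summation of a terminating
  well-poised \<open>5F4\<close>. The first two squares already give \<open>W r \<ge> c (1 + r\<^sup>2) powr - \<delta>\<close>, because the
  squared length of the corresponding vector, which solves a first-order system that is asymptotically a
  rotation, stays away from zero. The same kind of energy estimate for the third-order equation of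
  \<open>r powr (2 \<delta>) * W r\<close> gives the matching upper bound, so the norm of the native space is
  equivalent to the Sobolev norm.

  The Fourier transform of \<open>\<Phi>\<close> is computed by expanding the cosine. The moments of \<open>(\<xi> \<bullet> x) ^ (2 k)\<close>
  against the kernels \<open>(s\<^sup>2 - |x|\<^sup>2) powr \<beta>\<close> are known up to a constant by homogeneity; mixing the kernels
  with a Gaussian weight in \<open>s\<close> fixes the constant, and mixing them with \<open>(1 - s) powr (\<delta> - 1)\<close> gives the
  moments of \<open>\<Phi>\<close>, which are the coefficients of \<open>\<zeta> W\<close>.

  Plancherel's theorem and Fourier inversion are obtained by Gaussian regularisation, and completeness of the
  native space from completeness of \<open>L\<^sup>2\<close>. Positive definiteness is the nonnegativity of the norm of
  a linear combination of translates of \<open>\<Phi>\<close>. It is strict because \<open>\<Phi>\<close> has compact support: the rescaled copies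
  \<open>\<Phi> (N (x - a))\<close> lie in the Sobolev space and separate finitely many points.
\<close>

section \<open>Gaussian integrals\<close>

text \<open>A recurring obstacle is that \<open>fourier_L2\<close> is an arbitrary representative,
  known only almost everywhere. The arguments therefore run through \<open>is_fourier_L2\<close>,
  which accepts any version of the transform, and pointwise values come back only by continuity:
  since 2 \<delta> exceeds the dimension,
  \<open>(1 + (norm \<xi>)\<^sup>2) powr (- \<delta>)\<close> is integrable, so the transform of a
  Sobolev function is integrable and the function equals its inversion integral everywhere.

  Two squares of Gasper's expansion are kept because a single Bessel square has zeros, while Bessel
  functions of consecutive order have no common positive zero. The condition \<delta> > 1 enters
  here: \<open>gasper_coeff\<close> contains \<open>pochhammer ((\<delta> - 1) / 2) n\<close>, which
  for \<delta> = 1 vanishes for all n > 0, and a single square would remain.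

  Polar coordinates are avoided: radial integrals are reduced to Gaussian ones, which factorise over
  the coordinates. Moments are evaluated in \<open>ennreal\<close>, so that integrability is a
  consequence of the value and not a precondition.\<close>

lemma nn_integral_lborel_affine:
  fixes f :: "'a::euclidean_space \<Rightarrow> ennreal"
  assumes [measurable]: "f \<in> borel_measurable borel" and c: "c \<noteq> 0"
  shows "(\<integral>\<^sup>+x. f x \<partial>lborel) = ennreal (\<bar>c\<bar> ^ DIM('a)) * (\<integral>\<^sup>+x. f (t + c *\<^sub>R x) \<partial>lborel)"
  by (subst lborel_affine[OF c, of t])
    (simp add: nn_integral_density nn_integral_distr nn_integral_cmult ennreal_power)

lemma integrable_lborel_affine:
  fixes f :: "'a::euclidean_space \<Rightarrow> 'b::{banach, second_countable_topology}"
  assumes f: "integrable lborel f" and c: "c \<noteq> 0"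
  shows "integrable lborel (\<lambda>x. f (t + c *\<^sub>R x))"
proof -
  have m[measurable]: "f \<in> borel_measurable borel" using borel_measurable_integrable[OF f] by simp
  show ?thesis
    unfolding integrable_iff_bounded
  proof
    show "(\<lambda>x. f (t + c *\<^sub>R x)) \<in> borel_measurable lborel" by measurable
    have "(\<integral>\<^sup>+x. ennreal (norm (f x)) \<partial>lborel) < \<infinity>" using f by (simp add: integrable_iff_bounded)
    then show "(\<integral>\<^sup>+x. ennreal (norm (f (t + c *\<^sub>R x))) \<partial>lborel) < \<infinity>"
      using c by (subst (asm) nn_integral_lborel_affine[OF _ c, of _ t])
        (auto simp: ennreal_mult_less_top ennreal_mult_eq_top_iff less_top zero_less_power)
  qed
qed

lemma integral_lborel_affine:
  fixes f :: "'a::euclidean_space \<Rightarrow> 'b::{banach, second_countable_topology}"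
  assumes f[measurable]: "f \<in> borel_measurable borel" and c: "c \<noteq> 0"
  shows "(\<integral>x. f x \<partial>lborel) = (\<bar>c\<bar> ^ DIM('a)) *\<^sub>R (\<integral>x. f (t + c *\<^sub>R x) \<partial>lborel)"
  using c
  by (subst lborel_affine[OF c, of t])
    (simp add: integral_density integral_distr)

lemma integral_lborel_translate:
  fixes f :: "'a::euclidean_space \<Rightarrow> 'b::{banach, second_countable_topology}"
  assumes "f \<in> borel_measurable borel"
  shows "(\<integral>x. f (t + x) \<partial>lborel) = (\<integral>x. f x \<partial>lborel)"
  using integral_lborel_affine[OF assms, of 1 t] by simp

lemma integral_lborel_reflect:
  fixes f :: "'a::euclidean_space \<Rightarrow> 'b::{banach, second_countable_topology}"
  assumes "f \<in> borel_measurable borel"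
  shows "(\<integral>x. f (- x) \<partial>lborel) = (\<integral>x. f x \<partial>lborel)"
  using integral_lborel_affine[OF assms, of "-1" 0] by simp

lemma nn_integral_lborel_reflect:
  fixes f :: "'a::euclidean_space \<Rightarrow> ennreal"
  assumes "f \<in> borel_measurable borel"
  shows "(\<integral>\<^sup>+x. f (- x) \<partial>lborel) = (\<integral>\<^sup>+x. f x \<partial>lborel)"
  using nn_integral_lborel_affine[OF assms, of "-1" 0] by simp

lemma integrable_lborel_translate:
  fixes f :: "'a::euclidean_space \<Rightarrow> 'b::{banach, second_countable_topology}"
  assumes "integrable lborel f" shows "integrable lborel (\<lambda>x. f (t + x))"
  using integrable_lborel_affine[OF assms, of 1 t] by simp

lemma norm_fourier_kernel [simp]: "cmod (exp (- (\<i> * complex_of_real t))) = 1"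
  "cmod (exp (\<i> * complex_of_real t)) = 1"
  using norm_exp_i_times[of "-t"] norm_exp_i_times[of t] by simp_all

lemma integrable_fourier_kernel:
  assumes "integrable lborel f"
  shows "integrable lborel (\<lambda>x. exp (- \<i> * complex_of_real (\<xi> \<bullet> x)) * f x)"
proof (rule Bochner_Integration.integrable_bound[OF assms])
  show "(\<lambda>x. exp (- \<i> * complex_of_real (\<xi> \<bullet> x)) * f x) \<in> borel_measurable lborel"
    using borel_measurable_integrable[OF assms] by measurable
qed (simp add: norm_mult)

text \<open>\<open>lborel\<close> is the image of a product of one-dimensional measures under the
  coordinate map, so both claims are those of the product measure.\<close>

lemma product_lborel_prod:
  fixes f :: "'a::euclidean_space \<Rightarrow> real \<Rightarrow> complex"
  assumes f: "\<And>b. b \<in> Basis \<Longrightarrow> integrable lborel (f b)"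
  shows "integrable lborel (\<lambda>x::'a. \<Prod>b\<in>Basis. f b (x \<bullet> b))"
    and "(\<integral>x. (\<Prod>b\<in>Basis. f b (x \<bullet> b)) \<partial>(lborel :: 'a measure)) = (\<Prod>b\<in>Basis. \<integral>t. f b t \<partial>lborel)"
proof -
  interpret product_sigma_finite "\<lambda>_::'a. lborel :: real measure" ..
  have [measurable]: "\<And>b. b \<in> Basis \<Longrightarrow> f b \<in> borel_measurable borel"
    using borel_measurable_integrable[OF f] by simp
  have T[measurable]: "(\<lambda>f. \<Sum>b\<in>Basis. f b *\<^sub>R b) \<in> (\<Pi>\<^sub>M b\<in>Basis. lborel) \<rightarrow>\<^sub>M (borel :: 'a measure)"
    by (intro borel_measurable_sum borel_measurable_scaleR measurable_component_singleton) auto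
  have m: "(\<lambda>x::'a. \<Prod>b\<in>Basis. f b (x \<bullet> b)) \<in> borel_measurable borel" by measurable
  have e: "(\<Prod>b\<in>Basis. f b ((\<Sum>b\<in>Basis. g b *\<^sub>R b) \<bullet> b)) = (\<Prod>b\<in>Basis. f b (g b))" for g
    by (intro prod.cong refl) simp
  show "integrable lborel (\<lambda>x::'a. \<Prod>b\<in>Basis. f b (x \<bullet> b))"
    unfolding lborel_eq[where 'a = 'a]
    by (subst integrable_distr_eq[OF T m], unfold e) (intro product_integrable_prod f finite_Basis)
  show "(\<integral>x. (\<Prod>b\<in>Basis. f b (x \<bullet> b)) \<partial>(lborel :: 'a measure)) = (\<Prod>b\<in>Basis. \<integral>t. f b t \<partial>lborel)"
    unfolding lborel_eq[where 'a = 'a]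
    by (subst integral_distr[OF T m], unfold e) (intro product_integral_prod f finite_Basis)
qed

text \<open>Up to the factor \<open>sqrt (2 * pi)\<close> this is the characteristic function of the
  standard normal distribution, taken at \<open>- t\<close> because of the sign convention of
  \<open>fourier\<close>.\<close>

lemma gauss_fourier_real:
  "integrable lborel (\<lambda>x. exp (- \<i> * complex_of_real (t * x)) * complex_of_real (exp (- x\<^sup>2 / 2)))"
  "(\<integral>x. exp (- \<i> * complex_of_real (t * x)) * complex_of_real (exp (- x\<^sup>2 / 2)) \<partial>lborel)
     = complex_of_real (sqrt (2 * pi) * exp (- t\<^sup>2 / 2))"
proof -
  have s: "sqrt (2 * pi) \<noteq> 0" by simp
  have eq: "exp (- \<i> * complex_of_real (t * x)) * complex_of_real (exp (- x\<^sup>2 / 2))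
     = complex_of_real (sqrt (2 * pi)) * (std_normal_density x *\<^sub>R iexp ((- t) * x))" for x
    using s by (simp add: std_normal_density_def scaleR_conv_of_real)
  interpret prob_space std_normal_distribution
    by (rule prob_space_normal_density) simp
  have "integrable std_normal_distribution (\<lambda>x. iexp ((- t) * x))"
    by (intro integrable_const_bound[where B = 1]) auto
  then have "integrable lborel (\<lambda>x. std_normal_density x *\<^sub>R iexp ((- t) * x))"
    by (subst (asm) integrable_density) (auto simp: normal_density_nonneg)
  then show "integrable lborel (\<lambda>x. exp (- \<i> * complex_of_real (t * x)) * complex_of_real (exp (- x\<^sup>2 / 2)))"
    unfolding eq by (rule integrable_mult_right)
  have "char std_normal_distribution (- t) = (\<integral>x. std_normal_density x *\<^sub>R iexp ((- t) * x) \<partial>lborel)"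
    unfolding char_def by (subst integral_density) (auto simp: normal_density_nonneg)
  then show "(\<integral>x. exp (- \<i> * complex_of_real (t * x)) * complex_of_real (exp (- x\<^sup>2 / 2)) \<partial>lborel)
     = complex_of_real (sqrt (2 * pi) * exp (- t\<^sup>2 / 2))"
    unfolding eq integral_mult_right_zero by (simp add: char_std_normal_distribution)
qed

text \<open>The 1/2 in the exponent makes \<open>gauss 1\<close> a multiple of the standard normal
  density and an eigenfunction of \<open>fourier\<close>.\<close>

definition gauss :: "real \<Rightarrow> 'a::euclidean_space \<Rightarrow> real" where
  "gauss \<epsilon> x = exp (- \<epsilon> * (norm x)\<^sup>2 / 2)"

lemma gauss_pos [simp]: "gauss \<epsilon> x > 0" by (simp add: gauss_def)

lemma gauss_nonneg [simp]: "gauss \<epsilon> x \<ge> 0" by (simp add: gauss_def)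

lemma gauss_le_1: "\<epsilon> \<ge> 0 \<Longrightarrow> gauss \<epsilon> x \<le> 1" by (simp add: gauss_def)

lemma gauss_measurable [measurable]: "gauss \<epsilon> \<in> borel_measurable borel"
  unfolding gauss_def[abs_def] by measurable

lemma gauss_scale: "gauss 1 (c *\<^sub>R x) = gauss (c\<^sup>2) x"
  by (simp add: gauss_def power_mult_distrib)

text \<open>The character and the Gaussian both split into one factor per basis vector, which leaves
  the one-dimensional integral of \<open>gauss_fourier_real\<close>.\<close>

lemma gauss_1_fourier:
  fixes \<xi> :: "'a::euclidean_space"
  shows "integrable lborel (\<lambda>x::'a. exp (- \<i> * complex_of_real (\<xi> \<bullet> x)) * complex_of_real (gauss 1 x))"
    and "fourier (\<lambda>x. complex_of_real (gauss 1 x)) \<xi>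
      = complex_of_real ((2 * pi) powr (real DIM('a) / 2) * gauss 1 \<xi>)"
proof -
  let ?f = "\<lambda>b t. exp (- \<i> * complex_of_real ((\<xi> \<bullet> b) * t)) * complex_of_real (exp (- t\<^sup>2 / 2))"
  have sq: "exp (- (norm x)\<^sup>2 / 2) = (\<Prod>b\<in>Basis. exp (- (x \<bullet> b)\<^sup>2 / 2))" for x :: 'a
  proof -
    have "(norm x)\<^sup>2 = (\<Sum>b\<in>Basis. (x \<bullet> b)\<^sup>2)"
      by (subst power2_norm_eq_inner, subst euclidean_inner) (simp add: power2_eq_square)
    then have "- (norm x)\<^sup>2 / 2 = (\<Sum>b\<in>Basis. - (x \<bullet> b)\<^sup>2 / 2)"
      by (simp add: sum_negf sum_divide_distrib)
    then show ?thesis by (simp add: exp_sum)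
  qed
  have eq: "exp (- \<i> * complex_of_real (\<xi> \<bullet> x)) * complex_of_real (gauss 1 x) = (\<Prod>b\<in>Basis. ?f b (x \<bullet> b))" for x :: 'a
  proof -
    have "- \<i> * complex_of_real (\<xi> \<bullet> x) = (\<Sum>b\<in>Basis. - \<i> * complex_of_real ((\<xi> \<bullet> b) * (x \<bullet> b)))"
      by (subst euclidean_inner) (simp add: sum_negf sum_distrib_left)
    then have "exp (- \<i> * complex_of_real (\<xi> \<bullet> x)) = (\<Prod>b\<in>Basis. exp (- \<i> * complex_of_real ((\<xi> \<bullet> b) * (x \<bullet> b))))"
      by (simp only: exp_sum[OF finite_Basis])
    moreover have "gauss 1 x = (\<Prod>b\<in>Basis. exp (- (x \<bullet> b)\<^sup>2 / 2))"
      unfolding sq[symmetric] by (simp add: gauss_def)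
    ultimately show ?thesis by (simp only: of_real_prod prod.distrib)
  qed
  show "integrable lborel (\<lambda>x::'a. exp (- \<i> * complex_of_real (\<xi> \<bullet> x)) * complex_of_real (gauss 1 x))"
    unfolding eq by (intro product_lborel_prod(1) gauss_fourier_real(1))
  have "fourier (\<lambda>x. complex_of_real (gauss 1 x)) \<xi> = (\<Prod>b\<in>Basis. complex_of_real (sqrt (2 * pi) * exp (- (\<xi> \<bullet> b)\<^sup>2 / 2)))"
    unfolding fourier_def eq by (subst product_lborel_prod(2)) (auto simp only: gauss_fourier_real)
  also have "\<dots> = complex_of_real (sqrt (2 * pi) ^ DIM('a) * exp (- (norm \<xi>)\<^sup>2 / 2))"
    unfolding sq by (simp add: prod.distrib)
  also have "sqrt (2 * pi) ^ DIM('a) = (2 * pi) powr (real DIM('a) / 2)"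
    by (simp add: powr_half_sqrt[symmetric] powr_realpow[symmetric] powr_powr)
  finally show "fourier (\<lambda>x. complex_of_real (gauss 1 x)) \<xi> = complex_of_real ((2 * pi) powr (real DIM('a) / 2) * gauss 1 \<xi>)"
    by (simp add: gauss_def)
qed

lemma integrable_gauss:
  assumes \<epsilon>: "\<epsilon> > 0" shows "integrable lborel (gauss \<epsilon> :: 'a::euclidean_space \<Rightarrow> real)"
proof -
  have "integrable lborel (\<lambda>x::'a. complex_of_real (gauss 1 x))"
    using gauss_1_fourier(1)[of "0::'a"] by simp
  then have 1: "integrable lborel (gauss 1 :: 'a \<Rightarrow> real)" by (simp add: complex_of_real_integrable_eq)
  show ?thesis
    using integrable_lborel_affine[OF 1, of "sqrt \<epsilon>" 0] \<epsilon> by (simp add: gauss_scale)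
qed

lemma integral_gauss_1:
  "(\<integral>x. gauss 1 x \<partial>(lborel :: 'a::euclidean_space measure)) = (2 * pi) powr (real DIM('a) / 2)"
proof -
  have "complex_of_real (\<integral>x. gauss 1 x \<partial>(lborel :: 'a measure)) = complex_of_real ((2 * pi) powr (real DIM('a) / 2))"
    using gauss_1_fourier(2)[of "0::'a"] unfolding fourier_def by (simp add: gauss_def)
  then show ?thesis using of_real_eq_iff by blast
qed

lemma gauss_fourier:
  fixes \<xi> :: "'a::euclidean_space"
  assumes \<epsilon>: "\<epsilon> > 0"
  shows "fourier (\<lambda>x. complex_of_real (gauss \<epsilon> x)) \<xi>
    = complex_of_real ((2 * pi / \<epsilon>) powr (real DIM('a) / 2) * gauss (1 / \<epsilon>) \<xi>)"
proof -
  let ?s = "sqrt \<epsilon>"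
  have s: "?s > 0" using \<epsilon> by simp
  have "fourier (\<lambda>x. complex_of_real (gauss 1 x)) ((1 / ?s) *\<^sub>R \<xi>)
    = (\<bar>?s\<bar> ^ DIM('a)) *\<^sub>R (\<integral>x. exp (- \<i> * complex_of_real (((1 / ?s) *\<^sub>R \<xi>) \<bullet> (0 + ?s *\<^sub>R x))) * complex_of_real (gauss 1 (0 + ?s *\<^sub>R x)) \<partial>lborel)"
    unfolding fourier_def using s by (intro integral_lborel_affine) auto
  also have "\<dots> = (?s ^ DIM('a)) *\<^sub>R fourier (\<lambda>x. complex_of_real (gauss \<epsilon> x)) \<xi>"
    unfolding fourier_def using s \<epsilon> by (simp add: gauss_scale)
  finally have "(?s ^ DIM('a)) *\<^sub>R fourier (\<lambda>x. complex_of_real (gauss \<epsilon> x)) \<xi>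
    = complex_of_real ((2 * pi) powr (real DIM('a) / 2) * gauss (1 / \<epsilon>) \<xi>)"
    unfolding gauss_1_fourier(2) using \<epsilon> by (simp add: gauss_scale power_divide)
  moreover have "?s ^ DIM('a) = \<epsilon> powr (real DIM('a) / 2)"
    using \<epsilon> by (simp add: powr_half_sqrt[symmetric] powr_realpow[symmetric] powr_powr)
  ultimately show ?thesis using \<epsilon> by (simp add: powr_divide scaleR_conv_of_real field_simps)
qed

lemma integrable_kernel:
  fixes u v :: "'a::euclidean_space \<Rightarrow> complex"
  assumes u: "integrable lborel u" and v: "integrable lborel v"
    and k[measurable]: "(\<lambda>(x, y). k x y) \<in> borel_measurable (borel \<Otimes>\<^sub>M borel)"
    and B: "\<And>x y. cmod (k x y) \<le> B"
  shows "integrable (lborel \<Otimes>\<^sub>M lborel) (\<lambda>(x, y). u x * v y * k x y)"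
proof -
  have [measurable]: "u \<in> borel_measurable borel" "v \<in> borel_measurable borel"
    using borel_measurable_integrable[OF u] borel_measurable_integrable[OF v] by simp_all
  have 1: "integrable (lborel \<Otimes>\<^sub>M lborel) (\<lambda>(x, y). u x * v y)"
  proof (rule lborel_pair.Fubini_integrable)
    show "(\<lambda>(x, y). u x * v y) \<in> borel_measurable (lborel \<Otimes>\<^sub>M lborel)" by measurable
    show "integrable lborel (\<lambda>x. \<integral>y. norm (case (x, y) of (x, y) \<Rightarrow> u x * v y) \<partial>lborel)"
      using u by (simp add: norm_mult)
    show "AE x in lborel. integrable lborel (\<lambda>y. case (x, y) of (x, y) \<Rightarrow> u x * v y)"
      using v by simp
  qed
  have "B \<ge> 0" using B norm_ge_zero order_trans by blast
  have "integrable (lborel \<Otimes>\<^sub>M lborel) (\<lambda>p. complex_of_real B * (case p of (x, y) \<Rightarrow> u x * v y))"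
    using 1 by (rule integrable_mult_right)
  then show ?thesis
  proof (rule Bochner_Integration.integrable_bound)
    show "(\<lambda>(x, y). u x * v y * k x y) \<in> borel_measurable (lborel \<Otimes>\<^sub>M lborel)" by measurable
    have "cmod (u x * v y * k x y) \<le> cmod (complex_of_real B * (u x * v y))" for x y
      using mult_left_mono[OF B[of x y], of "cmod (u x * v y)"] \<open>B \<ge> 0\<close> by (simp add: norm_mult mult_ac)
    then show "AE p in lborel \<Otimes>\<^sub>M lborel. cmod (case p of (x, y) \<Rightarrow> u x * v y * k x y)
        \<le> cmod (complex_of_real B * (case p of (x, y) \<Rightarrow> u x * v y))"
      by (auto simp: split_beta)
  qed
qed

text \<open>One exchange of integrals for all uses below: there \<open>k\<close> is a character or a
  shifted copy of a bounded function, so a bound on \<open>k\<close> is all that can be asked of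
  it.\<close>

lemma fubini_kernel:
  fixes u v :: "'a::euclidean_space \<Rightarrow> complex"
  assumes "integrable lborel u" "integrable lborel v"
    and "(\<lambda>(x, y). k x y) \<in> borel_measurable (borel \<Otimes>\<^sub>M borel)" "\<And>x y. cmod (k x y) \<le> B"
  shows "(\<integral>x. u x * (\<integral>y. v y * k x y \<partial>lborel) \<partial>lborel) = (\<integral>y. v y * (\<integral>x. u x * k x y \<partial>lborel) \<partial>lborel)"
proof -
  have "(\<integral>y. (\<integral>x. u x * v y * k x y \<partial>lborel) \<partial>lborel) = (\<integral>x. (\<integral>y. u x * v y * k x y \<partial>lborel) \<partial>lborel)"
    using lborel_pair.Fubini_integral[of "\<lambda>x y. u x * v y * k x y"] integrable_kernel[OF assms] by simp
  moreover have "(\<integral>x. u x * v y * k x y \<partial>lborel) = v y * (\<integral>x. u x * k x y \<partial>lborel)" for y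
    by (subst integral_mult_right_zero[symmetric]) (simp add: mult_ac)
  moreover have "(\<integral>y. u x * v y * k x y \<partial>lborel) = u x * (\<integral>y. v y * k x y \<partial>lborel)" for x
    by (subst integral_mult_right_zero[symmetric]) (simp add: mult_ac)
  ultimately show ?thesis by simp
qed

text \<open>The substitution y = x + sqrt(\<epsilon>) z turns the Gaussian of growing height into a
  fixed weight and moves \<epsilon> into the argument of \<open>g\<close>. Letting \<epsilon> tend
  to 0 then becomes a question about translations of \<open>g\<close>.\<close>

lemma gauss_convolution:
  fixes g :: "'a::euclidean_space \<Rightarrow> complex"
  assumes [measurable]: "g \<in> borel_measurable borel" and \<epsilon>: "\<epsilon> > 0"
  shows "(\<integral>y. g y * fourier (\<lambda>x. complex_of_real (gauss \<epsilon> x)) (x - y) \<partial>lborel)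
    = complex_of_real ((2 * pi) powr (real DIM('a) / 2)) * (\<integral>z. complex_of_real (gauss 1 z) * g (x + sqrt \<epsilon> *\<^sub>R z) \<partial>lborel)"
proof -
  let ?s = "sqrt \<epsilon>" and ?C = "(2 * pi / \<epsilon>) powr (real DIM('a) / 2)"
  have s: "?s > 0" using \<epsilon> by simp
  have C: "?s ^ DIM('a) * ?C = (2 * pi) powr (real DIM('a) / 2)"
  proof -
    have "?s ^ DIM('a) = \<epsilon> powr (real DIM('a) / 2)"
      using \<epsilon> by (simp add: powr_half_sqrt[symmetric] powr_realpow[symmetric] powr_powr)
    then show ?thesis using \<epsilon> by (simp add: powr_divide)
  qed
  have "(\<integral>y. g y * fourier (\<lambda>x. complex_of_real (gauss \<epsilon> x)) (x - y) \<partial>lborel)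
      = (\<integral>y. g y * complex_of_real (?C * gauss (1 / \<epsilon>) (x - y)) \<partial>lborel)"
    by (simp add: gauss_fourier[OF \<epsilon>])
  also have "\<dots> = (\<bar>?s\<bar> ^ DIM('a)) *\<^sub>R (\<integral>z. g (x + ?s *\<^sub>R z) * complex_of_real (?C * gauss (1 / \<epsilon>) (x - (x + ?s *\<^sub>R z))) \<partial>lborel)"
    using s by (intro integral_lborel_affine) auto
  also have "\<dots> = (\<bar>?s\<bar> ^ DIM('a)) *\<^sub>R (\<integral>z. complex_of_real ?C * (complex_of_real (gauss 1 z) * g (x + ?s *\<^sub>R z)) \<partial>lborel)"
  proof -
    have "gauss (1 / \<epsilon>) (x - (x + ?s *\<^sub>R z)) = gauss 1 z" for z
      using \<epsilon> by (simp add: gauss_def power_mult_distrib)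
    then show ?thesis by (simp add: mult_ac)
  qed
  also have "\<dots> = complex_of_real (?s ^ DIM('a) * ?C) * (\<integral>z. complex_of_real (gauss 1 z) * g (x + ?s *\<^sub>R z) \<partial>lborel)"
    using s by (simp add: scaleR_conv_of_real)
  finally show ?thesis unfolding C .
qed

section \<open>Plancherel's theorem\<close>

lemma translation_diff_integrable:
  fixes f :: "'a::euclidean_space \<Rightarrow> 'b::{banach, second_countable_topology}"
  assumes "integrable lborel f"
  shows "integrable lborel (\<lambda>x. norm (f (t + x) - f x))"
  using assms by (intro integrable_norm Bochner_Integration.integrable_diff integrable_lborel_translate)

text \<open>Phrased with sequences, since it is established and applied through dominated
  convergence along sequences.\<close>

definition L1_translation_continuous :: "('a::euclidean_space \<Rightarrow> 'b::{banach, second_countable_topology}) \<Rightarrow> bool" where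
  "L1_translation_continuous f \<longleftrightarrow>
    (\<forall>y. y \<longlonglongrightarrow> 0 \<longrightarrow> (\<lambda>n::nat. \<integral>x. norm (f (y n + x) - f x) \<partial>lborel) \<longlonglongrightarrow> 0)"

lemma L1_translation_continuous_approx:
  fixes f :: "'a::euclidean_space \<Rightarrow> 'b::{banach, second_countable_topology}"
  assumes f: "integrable lborel f"
    and g: "\<And>e. e > 0 \<Longrightarrow> \<exists>g. integrable lborel g \<and> L1_translation_continuous g \<and> (\<integral>x. norm (f x - g x) \<partial>lborel) \<le> e"
  shows "L1_translation_continuous f"
  unfolding L1_translation_continuous_def
proof (intro allI impI)
  fix y :: "nat \<Rightarrow> 'a" assume y: "y \<longlonglongrightarrow> 0"
  show "(\<lambda>n. \<integral>x. norm (f (y n + x) - f x) \<partial>lborel) \<longlonglongrightarrow> 0"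
  proof (rule LIMSEQ_I)
    fix e :: real assume e: "e > 0"
    \<comment> \<open>The approximation error enters twice, once shifted and once unshifted; with
      the middle term this makes three quarters of \<open>e\<close>.\<close>
    obtain g where g: "integrable lborel g" "L1_translation_continuous g" "(\<integral>x. norm (f x - g x) \<partial>lborel) \<le> e / 4"
      using assms(2)[of "e / 4"] e by auto
    have fg: "integrable lborel (\<lambda>x. f x - g x)" using f g by auto
    have [measurable]: "(\<lambda>x. norm (f x - g x)) \<in> borel_measurable borel"
      using borel_measurable_integrable[OF fg] by simp
    obtain N where N: "\<And>n. n \<ge> N \<Longrightarrow> norm (\<integral>x. norm (g (y n + x) - g x) \<partial>lborel) < e / 4"
    proof -
      have "(\<lambda>n. \<integral>x. norm (g (y n + x) - g x) \<partial>lborel) \<longlonglongrightarrow> 0"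
        using g(2) y unfolding L1_translation_continuous_def by blast
      from LIMSEQ_D[OF this, of "e / 4"] e that show ?thesis by auto
    qed
    show "\<exists>no. \<forall>n\<ge>no. norm ((\<integral>x. norm (f (y n + x) - f x) \<partial>lborel) - 0) < e"
    proof (intro exI[of _ N] allI impI)
      fix n assume n: "n \<ge> N"
      have "(\<integral>x. norm (f (y n + x) - f x) \<partial>lborel)
         \<le> (\<integral>x. norm (f (y n + x) - g (y n + x)) + norm (g (y n + x) - g x) + norm (f x - g x) \<partial>lborel)"
      proof (rule integral_mono)
        show "integrable lborel (\<lambda>x. norm (f (y n + x) - g (y n + x)) + norm (g (y n + x) - g x) + norm (f x - g x))"
          using f g(1) by (intro Bochner_Integration.integrable_add integrable_norm Bochner_Integration.integrable_diff integrable_lborel_translate)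
        show "norm (f (y n + x) - f x) \<le> norm (f (y n + x) - g (y n + x)) + norm (g (y n + x) - g x) + norm (f x - g x)" for x
          using norm_triangle_ineq[of "f (y n + x) - g (y n + x) + (g (y n + x) - g x)" "g x - f x"]
            norm_triangle_ineq[of "f (y n + x) - g (y n + x)" "g (y n + x) - g x"]
          by (simp add: norm_minus_commute)
      qed (rule translation_diff_integrable[OF f])
      also have "\<dots> = (\<integral>x. norm (f (y n + x) - g (y n + x)) \<partial>lborel) + (\<integral>x. norm (g (y n + x) - g x) \<partial>lborel) + (\<integral>x. norm (f x - g x) \<partial>lborel)"
        using f g(1) by (simp add: integrable_lborel_translate)
      also have "(\<integral>x. norm (f (y n + x) - g (y n + x)) \<partial>lborel) = (\<integral>x. norm (f x - g x) \<partial>lborel)"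
        by (rule integral_lborel_translate) measurable
      also have "(\<integral>x. norm (f x - g x) \<partial>lborel) + (\<integral>x. norm (g (y n + x) - g x) \<partial>lborel) + (\<integral>x. norm (f x - g x) \<partial>lborel) < e"
        using N[OF n] g(3) e by (simp add: abs_less_iff)
      finally show "norm ((\<integral>x. norm (f (y n + x) - f x) \<partial>lborel) - 0) < e"
        by simp
    qed
  qed
qed

text \<open>For indicators the absolute difference is the sum of both minus twice their product. The
  two sums have equal integrals by translation invariance, and the product converges pointwise
  because a point of an open set stays inside under small shifts.\<close>

lemma L1_translation_continuous_open:
  fixes U :: "'a::euclidean_space set" and c :: "'b::{banach, second_countable_topology}"
  assumes U: "open U" "emeasure lborel U < \<infinity>"
  shows "L1_translation_continuous (\<lambda>x. indicator U x *\<^sub>R c)"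
  unfolding L1_translation_continuous_def
proof (intro allI impI)
  fix y :: "nat \<Rightarrow> 'a" assume y: "y \<longlonglongrightarrow> 0"
  let ?I = "indicator U :: 'a \<Rightarrow> real"
  have [measurable]: "U \<in> sets borel" using U by simp
  have i: "integrable lborel ?I" using U by (simp add: integrable_indicator_iff)
  have it: "integrable lborel (\<lambda>x. ?I (t + x))" for t by (rule integrable_lborel_translate[OF i])
  have im: "integrable lborel (\<lambda>x. ?I (t + x) * ?I x)" for t
    by (rule Bochner_Integration.integrable_bound[OF i]) (auto simp: indicator_def)
  have lim: "(\<lambda>n. \<integral>x. ?I (y n + x) * ?I x \<partial>lborel) \<longlonglongrightarrow> (\<integral>x. ?I x \<partial>lborel)"
  proof (rule integral_dominated_convergence[OF _ _ i])
    show "AE x in lborel. (\<lambda>n. ?I (y n + x) * ?I x) \<longlonglongrightarrow> ?I x"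
    proof (rule AE_I2)
      fix x
      show "(\<lambda>n. ?I (y n + x) * ?I x) \<longlonglongrightarrow> ?I x"
      proof (cases "x \<in> U")
        case True
        have "(\<lambda>n. y n + x) \<longlonglongrightarrow> 0 + x" by (intro tendsto_intros y)
        then have "eventually (\<lambda>n. y n + x \<in> U) sequentially"
          using U(1) True by (simp add: topological_tendstoD)
        then have "eventually (\<lambda>n. ?I (y n + x) * ?I x = ?I x) sequentially"
          by eventually_elim simp
        then show ?thesis by (rule tendsto_eventually)
      qed simp
    qed
    show "AE x in lborel. norm (?I (y n + x) * ?I x) \<le> ?I x" for n by (auto simp: indicator_def)
  qed measurable
  have "(\<integral>x. norm (?I (t + x) *\<^sub>R c - ?I x *\<^sub>R c) \<partial>lborel) = norm c * (2 * (\<integral>x. ?I x \<partial>lborel) - 2 * (\<integral>x. ?I (t + x) * ?I x \<partial>lborel))" for t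
  proof -
    have "norm (?I (t + x) *\<^sub>R c - ?I x *\<^sub>R c) = norm c * (?I (t + x) + ?I x - 2 * (?I (t + x) * ?I x))" for x
      by (simp add: indicator_def)
    then have "(\<integral>x. norm (?I (t + x) *\<^sub>R c - ?I x *\<^sub>R c) \<partial>lborel)
      = norm c * ((\<integral>x. ?I (t + x) \<partial>lborel) + (\<integral>x. ?I x \<partial>lborel) - 2 * (\<integral>x. ?I (t + x) * ?I x \<partial>lborel))"
      using i it im by simp
    also have "(\<integral>x. ?I (t + x) \<partial>lborel) = (\<integral>x. ?I x \<partial>lborel)" by (rule integral_lborel_translate) simp
    finally show ?thesis by simp
  qed
  moreover have "(\<lambda>n. norm c * (2 * (\<integral>x. ?I x \<partial>lborel) - 2 * (\<integral>x. ?I (y n + x) * ?I x \<partial>lborel)))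
     \<longlonglongrightarrow> norm c * (2 * (\<integral>x. ?I x \<partial>lborel) - 2 * (\<integral>x. ?I x \<partial>lborel))"
    by (intro tendsto_intros lim)
  ultimately show "(\<lambda>n. \<integral>x. norm (?I (y n + x) *\<^sub>R c - ?I x *\<^sub>R c) \<partial>lborel) \<longlonglongrightarrow> 0" by simp
qed

lemma L1_translation_continuous_add:
  fixes f g :: "'a::euclidean_space \<Rightarrow> 'b::{banach, second_countable_topology}"
  assumes f: "integrable lborel f" "L1_translation_continuous f" and g: "integrable lborel g" "L1_translation_continuous g"
  shows "L1_translation_continuous (\<lambda>x. f x + g x)"
  unfolding L1_translation_continuous_def
proof (intro allI impI)
  fix y :: "nat \<Rightarrow> 'a" assume y: "y \<longlonglongrightarrow> 0"
  have fy: "integrable lborel (\<lambda>x. norm (f (t + x) - f x))" "integrable lborel (\<lambda>x. norm (g (t + x) - g x))" for t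
    using f g by (auto intro: translation_diff_integrable)
  have "(\<lambda>n. (\<integral>x. norm (f (y n + x) - f x) \<partial>lborel) + (\<integral>x. norm (g (y n + x) - g x) \<partial>lborel)) \<longlonglongrightarrow> 0 + 0"
    using f(2) g(2) y unfolding L1_translation_continuous_def by (intro tendsto_add) auto
  then have lim: "(\<lambda>n. (\<integral>x. norm (f (y n + x) - f x) \<partial>lborel) + (\<integral>x. norm (g (y n + x) - g x) \<partial>lborel)) \<longlonglongrightarrow> 0" by simp
  show "(\<lambda>n. \<integral>x. norm (f (y n + x) + g (y n + x) - (f x + g x)) \<partial>lborel) \<longlonglongrightarrow> 0"
  proof (rule tendsto_sandwich[OF _ _ tendsto_const lim])
    show "eventually (\<lambda>n. (\<integral>x. norm (f (y n + x) + g (y n + x) - (f x + g x)) \<partial>lborel)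
       \<le> (\<integral>x. norm (f (y n + x) - f x) \<partial>lborel) + (\<integral>x. norm (g (y n + x) - g x) \<partial>lborel)) sequentially"
    proof (rule always_eventually, rule allI)
      fix n
      have "(\<integral>x. norm (f (y n + x) + g (y n + x) - (f x + g x)) \<partial>lborel)
        \<le> (\<integral>x. norm (f (y n + x) - f x) + norm (g (y n + x) - g x) \<partial>lborel)"
      proof (rule integral_mono)
        show "integrable lborel (\<lambda>x. norm (f (y n + x) + g (y n + x) - (f x + g x)))"
          using translation_diff_integrable[of "\<lambda>x. f x + g x" "y n"] f g by simp
        show "norm (f (y n + x) + g (y n + x) - (f x + g x)) \<le> norm (f (y n + x) - f x) + norm (g (y n + x) - g x)" for x
          using norm_triangle_ineq[of "f (y n + x) - f x" "g (y n + x) - g x"] by (simp add: algebra_simps)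
      qed (use fy in auto)
      also have "\<dots> = (\<integral>x. norm (f (y n + x) - f x) \<partial>lborel) + (\<integral>x. norm (g (y n + x) - g x) \<partial>lborel)"
        using fy by simp
      finally show "(\<integral>x. norm (f (y n + x) + g (y n + x) - (f x + g x)) \<partial>lborel)
        \<le> (\<integral>x. norm (f (y n + x) - f x) \<partial>lborel) + (\<integral>x. norm (g (y n + x) - g x) \<partial>lborel)" .
    qed
  qed auto
qed

text \<open>Induction over integrable functions: outer regularity replaces a measurable set by an
  open one, and the limit step is again an approximation in L1.\<close>

lemma L1_translation_continuous:
  fixes f :: "'a::euclidean_space \<Rightarrow> 'b::{banach, second_countable_topology}"
  assumes "integrable lborel f"
  shows "L1_translation_continuous f"
  using assms
proof (induction rule: integrable_induct)
  case (base A c)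
  then have A[measurable]: "A \<in> sets borel" and fin: "emeasure lborel A < \<infinity>" by auto
  have iA: "integrable lborel (indicator A :: 'a \<Rightarrow> real)" using fin by (simp add: integrable_indicator_iff)
  show ?case
  proof (rule L1_translation_continuous_approx)
    show "integrable lborel (\<lambda>x. indicator A x *\<^sub>R c)" using iA by auto
    fix e :: real assume e: "e > 0"
    \<comment> \<open>Adding 1 keeps the divisor positive when \<open>c\<close> is 0.\<close>
    define e' where "e' = e / (norm c + 1)"
    have e': "e' > 0" using e by (simp add: e'_def add_nonneg_pos)
    obtain U where U: "open U" "A \<subseteq> U" "emeasure lborel (U - A) < e'"
      using outer_regular_lborel[OF A e'] by auto
    have [measurable]: "U \<in> sets borel" using U by simp
    have "emeasure lborel U = emeasure lborel A + emeasure lborel (U - A)"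
      using U(2) by (subst plus_emeasure) (auto intro!: arg_cong[where f = "emeasure lborel"])
    also have "\<dots> < \<infinity>" using fin U(3) by (simp add: ennreal_add_less_top order_less_trans[OF _ ennreal_less_top])
    finally have fU: "emeasure lborel U < \<infinity>" .
    have iU: "integrable lborel (indicator U :: 'a \<Rightarrow> real)" using fU by (simp add: integrable_indicator_iff)
    show "\<exists>g. integrable lborel g \<and> L1_translation_continuous g \<and> (\<integral>x. norm (indicator A x *\<^sub>R c - g x) \<partial>lborel) \<le> e"
    proof (intro exI[of _ "\<lambda>x. indicator U x *\<^sub>R c"] conjI)
      show "integrable lborel (\<lambda>x. indicator U x *\<^sub>R c)" using iU by auto
      show "L1_translation_continuous (\<lambda>x. indicator U x *\<^sub>R c)" using U fU by (intro L1_translation_continuous_open) auto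
      have "norm (indicator A x *\<^sub>R c - indicator U x *\<^sub>R c) = norm c * indicator (U - A) x" for x
        using U(2) by (auto simp: indicator_def)
      then have "(\<integral>x. norm (indicator A x *\<^sub>R c - indicator U x *\<^sub>R c) \<partial>lborel) = norm c * measure lborel (U - A)"
        by simp
      also have "\<dots> \<le> norm c * e'"
        using U(3) e' by (intro mult_left_mono) (auto simp: measure_def intro!: enn2real_leI)
      also have "\<dots> \<le> (norm c + 1) * e'" using e' by (intro mult_right_mono) auto
      also have "\<dots> = e" using norm_ge_zero[of c] unfolding e'_def by (simp add: add_nonneg_eq_0_iff)
      finally show "(\<integral>x. norm (indicator A x *\<^sub>R c - indicator U x *\<^sub>R c) \<partial>lborel) \<le> e" .
    qed
  qed
next
  case (add f g)
  then show ?case by (intro L1_translation_continuous_add)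
next
  case (lim f s)
  have si: "integrable lborel (s i)" and sc: "L1_translation_continuous (s i)" for i
    using lim by auto
  have sl: "(\<lambda>i. s i x) \<longlonglongrightarrow> f x" and sb: "norm (s i x) \<le> 2 * norm (f x)" for i x
    using lim by auto
  have fi: "integrable lborel f" using lim by auto
  have "(\<lambda>i. \<integral>x. norm (f x - s i x) \<partial>lborel) \<longlonglongrightarrow> (\<integral>x. 0 \<partial>(lborel :: 'a measure))"
  proof (rule integral_dominated_convergence)
    show "integrable lborel (\<lambda>x. 3 * norm (f x))" using fi by auto
    show "AE x in lborel. (\<lambda>i. norm (f x - s i x)) \<longlonglongrightarrow> 0"
    proof (rule AE_I2)
      fix x
      have "(\<lambda>i. norm (f x - s i x)) \<longlonglongrightarrow> norm (f x - f x)" by (intro tendsto_intros sl)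
      then show "(\<lambda>i. norm (f x - s i x)) \<longlonglongrightarrow> 0" by simp
    qed
    show "AE x in lborel. norm (norm (f x - s i x)) \<le> 3 * norm (f x)" for i
    proof (rule AE_I2)
      fix x show "norm (norm (f x - s i x)) \<le> 3 * norm (f x)"
        using norm_triangle_ineq4[of "f x" "s i x"] sb[where i = i and x = x] by simp
    qed
    show "(\<lambda>x. norm (f x - s i x)) \<in> borel_measurable lborel" for i
      using si[of i] fi by auto
  qed auto
  then have L: "(\<lambda>i. \<integral>x. norm (f x - s i x) \<partial>lborel) \<longlonglongrightarrow> 0" by simp
  show ?case
  proof (rule L1_translation_continuous_approx[OF fi])
    fix e :: real assume "e > 0"
    then have "eventually (\<lambda>i. (\<integral>x. norm (f x - s i x) \<partial>lborel) < e) sequentially"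
      using L by (rule order_tendstoD(2)[rotated])
    then obtain i where "(\<integral>x. norm (f x - s i x) \<partial>lborel) < e" by (auto simp: eventually_sequentially)
    then show "\<exists>g. integrable lborel g \<and> L1_translation_continuous g \<and> (\<integral>x. norm (f x - g x) \<partial>lborel) \<le> e"
      using si sc by (intro exI[of _ "s i"]) auto
  qed
qed

section \<open>Plancherel's identity for bounded integrable functions\<close>

lemma cnj_borel_measurable [measurable]: "cnj \<in> borel_measurable borel"
  by (intro borel_measurable_continuous_onI continuous_intros)

lemma fourier_bound:
  assumes "integrable lborel f"
  shows "cmod (fourier f \<xi>) \<le> (\<integral>x. cmod (f x) \<partial>lborel)"
proof -
  have "cmod (fourier f \<xi>) \<le> (\<integral>x. cmod (exp (- \<i> * complex_of_real (\<xi> \<bullet> x)) * f x) \<partial>lborel)"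
    unfolding fourier_def by (rule integral_norm_bound)
  also have "\<dots> = (\<integral>x. cmod (f x) \<partial>lborel)" by (simp add: norm_mult)
  finally show ?thesis .
qed

lemma continuous_fourier:
  fixes f :: "'a::euclidean_space \<Rightarrow> complex"
  assumes f: "integrable lborel f"
  shows "continuous_on UNIV (fourier f)"
proof -
  have [measurable]: "f \<in> borel_measurable borel" using borel_measurable_integrable[OF f] by simp
  have "(\<lambda>n. fourier f (y n)) \<longlonglongrightarrow> fourier f a" if y: "y \<longlonglongrightarrow> a" for y a
    unfolding fourier_def
  proof (rule integral_dominated_convergence)
    show "integrable lborel (\<lambda>x. cmod (f x))" using f by simp
    show "AE x in lborel. (\<lambda>n. exp (- \<i> * complex_of_real (y n \<bullet> x)) * f x) \<longlonglongrightarrow> exp (- \<i> * complex_of_real (a \<bullet> x)) * f x"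
      by (intro AE_I2 tendsto_intros y)
    show "(\<lambda>x. exp (- \<i> * complex_of_real (a \<bullet> x)) * f x) \<in> borel_measurable lborel" by measurable
    show "(\<lambda>x. exp (- \<i> * complex_of_real (y n \<bullet> x)) * f x) \<in> borel_measurable lborel" for n by measurable
  qed (simp add: norm_mult)
  then show ?thesis by (auto simp: continuous_on_sequentially o_def)
qed

lemma fourier_measurable:
  "integrable lborel f \<Longrightarrow> fourier f \<in> borel_measurable borel"
  by (intro borel_measurable_continuous_onI continuous_fourier)

text \<open>The squared transform is not yet known to be integrable. The Gaussian factor makes every
  exchange of integrals legitimate; integrating over the frequency first yields the transform of a
  Gaussian, that is an approximate identity, and what remains is a Gaussian average of the
  autocorrelation of \<open>f\<close>. The bound \<open>M\<close> serves as kernel bound in the last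
  exchange.\<close>

lemma plancherel_regularised:
  fixes f :: "'a::euclidean_space \<Rightarrow> complex"
  assumes f: "integrable lborel f" and M: "\<And>x. cmod (f x) \<le> M" and \<epsilon>: "\<epsilon> > 0"
  shows "(\<integral>\<xi>. complex_of_real ((cmod (fourier f \<xi>))\<^sup>2 * gauss \<epsilon> \<xi>) \<partial>lborel)
    = complex_of_real ((2 * pi) powr (real DIM('a) / 2)) *
      (\<integral>z. complex_of_real (gauss 1 z) * (\<integral>x. f x * cnj (f (x + sqrt \<epsilon> *\<^sub>R z)) \<partial>lborel) \<partial>lborel)"
proof -
  have fm[measurable]: "f \<in> borel_measurable borel" using borel_measurable_integrable[OF f] by simp
  have ffm[measurable]: "fourier f \<in> borel_measurable borel" by (rule fourier_measurable[OF f])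
  have ig: "integrable lborel (\<lambda>\<xi>::'a. complex_of_real (gauss \<epsilon> \<xi>))"
    using integrable_gauss[OF \<epsilon>] by (simp add: complex_of_real_integrable_eq)
  have ic: "integrable lborel (\<lambda>x. cnj (f x))" using f by simp
  define v where "v = (\<lambda>\<xi>. complex_of_real (gauss \<epsilon> \<xi>) * cnj (fourier f \<xi>))"
  have vm[measurable]: "v \<in> borel_measurable borel" unfolding v_def by measurable
  have iv: "integrable lborel v"
  proof (rule Bochner_Integration.integrable_bound)
    show "integrable lborel (\<lambda>\<xi>::'a. (\<integral>x. cmod (f x) \<partial>lborel) * gauss \<epsilon> \<xi>)"
      using integrable_gauss[OF \<epsilon>] by (rule integrable_mult_right)
    have "0 \<le> (\<integral>x. cmod (f x) \<partial>lborel)" by simp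
    then show "AE \<xi> in lborel. norm (v \<xi>) \<le> norm ((\<integral>x. cmod (f x) \<partial>lborel) * gauss \<epsilon> \<xi>)"
      by (intro AE_I2) (simp add: v_def norm_mult abs_mult mult.commute mult_right_mono fourier_bound[OF f])
  qed simp
  let ?k = "\<lambda>\<xi> x. exp (- \<i> * complex_of_real (\<xi> \<bullet> x))"
  have km: "(\<lambda>(\<xi>::'a, x). ?k \<xi> x) \<in> borel_measurable (borel \<Otimes>\<^sub>M borel)"
    unfolding borel_prod split_beta by (intro borel_measurable_continuous_onI continuous_intros)
  have inner: "(\<integral>\<xi>. v \<xi> * ?k \<xi> x \<partial>lborel) = complex_of_real ((2 * pi) powr (real DIM('a) / 2)) *
     (\<integral>z. complex_of_real (gauss 1 z) * cnj (f (x + sqrt \<epsilon> *\<^sub>R z)) \<partial>lborel)" for x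
  proof -
    let ?k2 = "\<lambda>\<xi> y. exp (- \<i> * complex_of_real (\<xi> \<bullet> (x - y)))"
    have k2: "(\<lambda>(\<xi>::'a, y). ?k2 \<xi> y) \<in> borel_measurable (borel \<Otimes>\<^sub>M borel)"
      unfolding borel_prod split_beta by (intro borel_measurable_continuous_onI continuous_intros)
    have "v \<xi> * ?k \<xi> x = complex_of_real (gauss \<epsilon> \<xi>) * (\<integral>y. cnj (f y) * ?k2 \<xi> y \<partial>lborel)" for \<xi>
    proof -
      have "cnj (fourier f \<xi>) = (\<integral>y. exp (\<i> * complex_of_real (\<xi> \<bullet> y)) * cnj (f y) \<partial>lborel)"
        unfolding fourier_def by (subst Bochner_Integration.integral_cnj[symmetric]) (simp add: exp_cnj)
      then have "v \<xi> * ?k \<xi> x = complex_of_real (gauss \<epsilon> \<xi>) * (\<integral>y. ?k \<xi> x * (exp (\<i> * complex_of_real (\<xi> \<bullet> y)) * cnj (f y)) \<partial>lborel)"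
        unfolding v_def by simp
      also have "(\<integral>y. ?k \<xi> x * (exp (\<i> * complex_of_real (\<xi> \<bullet> y)) * cnj (f y)) \<partial>lborel) = (\<integral>y. cnj (f y) * ?k2 \<xi> y \<partial>lborel)"
      proof (rule Bochner_Integration.integral_cong[OF refl])
        fix y
        have "?k2 \<xi> y = ?k \<xi> x * exp (\<i> * complex_of_real (\<xi> \<bullet> y))"
          unfolding exp_add[symmetric] by (simp add: inner_diff_right algebra_simps)
        then show "?k \<xi> x * (exp (\<i> * complex_of_real (\<xi> \<bullet> y)) * cnj (f y)) = cnj (f y) * ?k2 \<xi> y" by simp
      qed
      finally show ?thesis .
    qed
    then have "(\<integral>\<xi>. v \<xi> * ?k \<xi> x \<partial>lborel) = (\<integral>\<xi>. complex_of_real (gauss \<epsilon> \<xi>) * (\<integral>y. cnj (f y) * ?k2 \<xi> y \<partial>lborel) \<partial>lborel)"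
      by simp
    also have "\<dots> = (\<integral>y. cnj (f y) * (\<integral>\<xi>. complex_of_real (gauss \<epsilon> \<xi>) * ?k2 \<xi> y \<partial>lborel) \<partial>lborel)"
      by (rule fubini_kernel[OF ig ic k2, of 1]) simp
    also have "(\<lambda>y. \<integral>\<xi>. complex_of_real (gauss \<epsilon> \<xi>) * ?k2 \<xi> y \<partial>lborel) = (\<lambda>y. fourier (\<lambda>x. complex_of_real (gauss \<epsilon> x)) (x - y))"
      unfolding fourier_def by (simp add: mult.commute inner_commute)
    also have "(\<integral>y. cnj (f y) * fourier (\<lambda>x. complex_of_real (gauss \<epsilon> x)) (x - y) \<partial>lborel)
      = complex_of_real ((2 * pi) powr (real DIM('a) / 2)) * (\<integral>z. complex_of_real (gauss 1 z) * cnj (f (x + sqrt \<epsilon> *\<^sub>R z)) \<partial>lborel)"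
      by (rule gauss_convolution[OF _ \<epsilon>]) measurable
    finally show ?thesis .
  qed
  have "(\<integral>\<xi>. complex_of_real ((cmod (fourier f \<xi>))\<^sup>2 * gauss \<epsilon> \<xi>) \<partial>lborel) = (\<integral>\<xi>. v \<xi> * (\<integral>x. f x * ?k \<xi> x \<partial>lborel) \<partial>lborel)"
  proof (rule Bochner_Integration.integral_cong[OF refl])
    fix \<xi>
    have "(\<integral>x. f x * ?k \<xi> x \<partial>lborel) = fourier f \<xi>" unfolding fourier_def by (simp add: mult.commute)
    then show "complex_of_real ((cmod (fourier f \<xi>))\<^sup>2 * gauss \<epsilon> \<xi>) = v \<xi> * (\<integral>x. f x * ?k \<xi> x \<partial>lborel)"
      using complex_norm_square[of "fourier f \<xi>"] by (simp add: v_def mult_ac)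
  qed
  also have "\<dots> = (\<integral>x. f x * (\<integral>\<xi>. v \<xi> * ?k \<xi> x \<partial>lborel) \<partial>lborel)"
    by (rule fubini_kernel[OF iv f km, of 1]) simp
  also have "\<dots> = (\<integral>x. complex_of_real ((2 * pi) powr (real DIM('a) / 2)) *
     (f x * (\<integral>z. complex_of_real (gauss 1 z) * cnj (f (x + sqrt \<epsilon> *\<^sub>R z)) \<partial>lborel)) \<partial>lborel)"
    unfolding inner by (simp add: mult_ac)
  also have "\<dots> = complex_of_real ((2 * pi) powr (real DIM('a) / 2)) *
     (\<integral>x. f x * (\<integral>z. complex_of_real (gauss 1 z) * cnj (f (x + sqrt \<epsilon> *\<^sub>R z)) \<partial>lborel) \<partial>lborel)"
    by simp
  also have "(\<integral>x. f x * (\<integral>z. complex_of_real (gauss 1 z) * cnj (f (x + sqrt \<epsilon> *\<^sub>R z)) \<partial>lborel) \<partial>lborel)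
    = (\<integral>z. complex_of_real (gauss 1 z) * (\<integral>x. f x * cnj (f (x + sqrt \<epsilon> *\<^sub>R z)) \<partial>lborel) \<partial>lborel)"
  proof (rule fubini_kernel[OF f, of _ _ M])
    show "integrable lborel (\<lambda>z::'a. complex_of_real (gauss 1 z))"
      using integrable_gauss[of 1] by (simp add: complex_of_real_integrable_eq)
    show "(\<lambda>(x, z). cnj (f (x + sqrt \<epsilon> *\<^sub>R z))) \<in> borel_measurable (borel \<Otimes>\<^sub>M borel)" by measurable
  qed (simp add: M)
  finally show ?thesis .
qed

text \<open>The regularisation is removed by monotone convergence on the side of the transform and
  by continuity of the autocorrelation at 0 on the other side.\<close>

lemma plancherel_bounded:
  fixes f :: "'a::euclidean_space \<Rightarrow> complex"
  assumes f: "integrable lborel f" and M: "\<And>x. cmod (f x) \<le> M"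
  shows "(\<integral>\<^sup>+\<xi>. ennreal ((cmod (fourier f \<xi>))\<^sup>2) \<partial>lborel)
    = ennreal ((2 * pi) ^ DIM('a)) * (\<integral>\<^sup>+x. ennreal ((cmod (f x))\<^sup>2) \<partial>lborel)"
proof -
  have fm[measurable]: "f \<in> borel_measurable borel" using borel_measurable_integrable[OF f] by simp
  have ffm[measurable]: "fourier f \<in> borel_measurable borel" by (rule fourier_measurable[OF f])
  have M0: "M \<ge> 0" using M norm_ge_zero order_trans by blast
  define e where "e = (\<lambda>n::nat. 1 / real (Suc n))"
  have e: "e n > 0" for n by (simp add: e_def)
  have e0: "e \<longlonglongrightarrow> 0" unfolding e_def using LIMSEQ_inverse_real_of_nat by (simp add: inverse_eq_divide)
  \<comment> \<open>\<open>C\<close> occurs twice in the limit, once from the transform of the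
    Gaussian and once as the total mass of \<open>gauss 1\<close>; together they give the power of 2
    pi in the claim.\<close>
  define C where "C = (2 * pi) powr (real DIM('a) / 2)"
  have C2: "C * C = (2 * pi) ^ DIM('a)"
    by (simp add: C_def powr_add[symmetric] powr_realpow)
  have MM: "cmod (f x * cnj (f y)) \<le> M * cmod (f x)" for x y
  proof -
    have "cmod (f x) * cmod (f y) \<le> cmod (f x) * M" by (intro mult_left_mono M norm_ge_zero)
    then show ?thesis by (simp add: norm_mult mult.commute[of M])
  qed
  have if2: "integrable lborel (\<lambda>x. (cmod (f x))\<^sup>2)"
  proof (rule Bochner_Integration.integrable_bound)
    show "integrable lborel (\<lambda>x. M * cmod (f x))" using f by simp
    show "AE x in lborel. norm ((cmod (f x))\<^sup>2) \<le> norm (M * cmod (f x))"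
      using M M0 by (intro AE_I2) (simp add: power2_eq_square mult_right_mono)
  qed simp
  \<comment> \<open>The autocorrelation of \<open>f\<close>. Its value at 0 is the squared norm, and
    it is continuous there because \<open>f\<close> is bounded and translation is continuous in
    L1.\<close>
  define h where "h = (\<lambda>t. \<integral>x. f x * cnj (f (x + t)) \<partial>lborel)"
  have ih: "integrable lborel (\<lambda>x. f x * cnj (f (x + t)))" for t
  proof (rule Bochner_Integration.integrable_bound)
    show "integrable lborel (\<lambda>x. M * cmod (f x))" using f by simp
    show "AE x in lborel. norm (f x * cnj (f (x + t))) \<le> norm (M * cmod (f x))"
      using M0 by (intro AE_I2) (simp add: order_trans[OF MM])
  qed simp
  have h0: "h 0 = complex_of_real (\<integral>x. (cmod (f x))\<^sup>2 \<partial>lborel)"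
    unfolding h_def by (simp add: complex_norm_square[symmetric] del: of_real_power)
  have hb: "cmod (h t - h 0) \<le> M * (\<integral>x. cmod (f (t + x) - f x) \<partial>lborel)" for t
  proof -
    have "h t - h 0 = (\<integral>x. f x * cnj (f (x + t)) - f x * cnj (f (x + 0)) \<partial>lborel)"
      unfolding h_def by (rule Bochner_Integration.integral_diff[symmetric]) (rule ih)+
    also have "cmod \<dots> \<le> (\<integral>x. M * cmod (f (t + x) - f x) \<partial>lborel)"
    proof (rule Bochner_Integration.integral_norm_bound_integral)
      show "integrable lborel (\<lambda>x. f x * cnj (f (x + t)) - f x * cnj (f (x + 0)))" using ih by (intro Bochner_Integration.integrable_diff)
      show "integrable lborel (\<lambda>x. M * cmod (f (t + x) - f x))" using translation_diff_integrable[OF f] by simp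
      fix x
      have "f x * cnj (f (x + t)) - f x * cnj (f (x + 0)) = f x * cnj (f (t + x) - f x)" by (simp add: algebra_simps)
      then show "cmod (f x * cnj (f (x + t)) - f x * cnj (f (x + 0))) \<le> M * cmod (f (t + x) - f x)"
        using M[of x] by (simp only: norm_mult complex_mod_cnj) (intro mult_right_mono norm_ge_zero)
    qed
    finally show ?thesis by simp
  qed
  have hlim: "(\<lambda>n. h (sqrt (e n) *\<^sub>R z)) \<longlonglongrightarrow> h 0" for z
  proof -
    have "(\<lambda>n. sqrt (e n) *\<^sub>R z) \<longlonglongrightarrow> sqrt 0 *\<^sub>R z" by (intro tendsto_intros e0)
    then have "(\<lambda>n. \<integral>x. cmod (f (sqrt (e n) *\<^sub>R z + x) - f x) \<partial>lborel) \<longlonglongrightarrow> 0"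
      using L1_translation_continuous[OF f] by (simp add: L1_translation_continuous_def)
    then have "(\<lambda>n. M * (\<integral>x. cmod (f (sqrt (e n) *\<^sub>R z + x) - f x) \<partial>lborel)) \<longlonglongrightarrow> M * 0"
      by (intro tendsto_intros)
    then have "(\<lambda>n. h (sqrt (e n) *\<^sub>R z) - h 0) \<longlonglongrightarrow> 0"
      by (intro Lim_null_comparison[OF always_eventually[OF allI[OF hb]]]) simp
    then show ?thesis by (simp add: LIM_zero_iff)
  qed
  have hbd: "cmod (h t) \<le> M * (\<integral>x. cmod (f x) \<partial>lborel)" for t
  proof -
    have "cmod (h t) \<le> (\<integral>x. M * cmod (f x) \<partial>lborel)"
      unfolding h_def
    proof (rule Bochner_Integration.integral_norm_bound_integral[OF ih])
      show "integrable lborel (\<lambda>x. M * cmod (f x))" using f by simp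
      show "cmod (f x * cnj (f (x + t))) \<le> M * cmod (f x)" for x
        by (rule MM)
    qed
    then show ?thesis by simp
  qed
  have hm: "h \<in> borel_measurable borel"
  proof -
    have "(\<lambda>(t, x). f x * cnj (f (x + t))) \<in> borel_measurable (borel \<Otimes>\<^sub>M lborel)" by measurable
    then show ?thesis unfolding h_def by (rule sigma_finite_measure.borel_measurable_lebesgue_integral[OF sigma_finite_lborel])
  qed
  note [measurable] = hm
  have lim: "(\<lambda>n. \<integral>z. complex_of_real (gauss 1 z) * h (sqrt (e n) *\<^sub>R z) \<partial>lborel) \<longlonglongrightarrow> (\<integral>z. complex_of_real (gauss 1 z) * h 0 \<partial>(lborel :: 'a measure))"
  proof (rule integral_dominated_convergence)
    show "integrable lborel (\<lambda>z::'a. gauss 1 z * (M * (\<integral>x. cmod (f x) \<partial>lborel)))"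
      by (intro integrable_mult_left integrable_gauss) simp
    show "AE z in lborel. (\<lambda>n. complex_of_real (gauss 1 z) * h (sqrt (e n) *\<^sub>R z)) \<longlonglongrightarrow> complex_of_real (gauss 1 z) * h 0"
      by (intro AE_I2 tendsto_intros hlim)
    show "AE z in lborel. norm (complex_of_real (gauss 1 z) * h (sqrt (e n) *\<^sub>R z)) \<le> gauss 1 z * (M * (\<integral>x. cmod (f x) \<partial>lborel))" for n
      by (intro AE_I2) (simp add: norm_mult hbd mult_left_mono)
  qed measurable
  have "(\<integral>z. complex_of_real (gauss 1 z) * h 0 \<partial>(lborel :: 'a measure)) = complex_of_real C * h 0"
    by (simp add: integral_gauss_1 C_def)
  note eq0 = this
  have lim2: "(\<lambda>n. complex_of_real C * (\<integral>z. complex_of_real (gauss 1 z) * h (sqrt (e n) *\<^sub>R z) \<partial>lborel))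
      \<longlonglongrightarrow> complex_of_real C * (complex_of_real C * h 0)"
    by (intro tendsto_mult tendsto_const lim[unfolded eq0])
  define R where "R = (\<lambda>n. \<integral>\<xi>. (cmod (fourier f \<xi>))\<^sup>2 * gauss (e n) \<xi> \<partial>lborel)"
  have "complex_of_real (R n) = complex_of_real C * (\<integral>z. complex_of_real (gauss 1 z) * h (sqrt (e n) *\<^sub>R z) \<partial>lborel)" for n
    using plancherel_regularised[OF f M e[of n]] unfolding R_def C_def h_def by (simp del: of_real_mult)
  then have "(\<lambda>n. complex_of_real (R n)) \<longlonglongrightarrow> complex_of_real C * (complex_of_real C * h 0)"
    using lim2 by simp
  also have "complex_of_real C * (complex_of_real C * h 0) = complex_of_real ((2 * pi) ^ DIM('a) * (\<integral>x. (cmod (f x))\<^sup>2 \<partial>lborel))"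
    unfolding h0 C2[symmetric] by simp
  finally have "R \<longlonglongrightarrow> (2 * pi) ^ DIM('a) * (\<integral>x. (cmod (f x))\<^sup>2 \<partial>lborel)"
    by (simp add: tendsto_of_real_iff del: of_real_mult of_real_power)
  then have R1: "(\<lambda>n. ennreal (R n)) \<longlonglongrightarrow> ennreal ((2 * pi) ^ DIM('a) * (\<integral>x. (cmod (f x))\<^sup>2 \<partial>lborel))"
    by (rule tendsto_ennrealI)
  have "ennreal (R n) = (\<integral>\<^sup>+\<xi>. ennreal ((cmod (fourier f \<xi>))\<^sup>2 * gauss (e n) \<xi>) \<partial>lborel)" for n
    unfolding R_def
  proof (rule nn_integral_eq_integral[symmetric])
    show "integrable lborel (\<lambda>\<xi>. (cmod (fourier f \<xi>))\<^sup>2 * gauss (e n) \<xi>)"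
    proof (rule Bochner_Integration.integrable_bound)
      show "integrable lborel (\<lambda>\<xi>::'a. (\<integral>x. cmod (f x) \<partial>lborel)\<^sup>2 * gauss (e n) \<xi>)"
        by (intro integrable_mult_right integrable_gauss e)
      show "AE \<xi> in lborel. norm ((cmod (fourier f \<xi>))\<^sup>2 * gauss (e n) \<xi>) \<le> norm ((\<integral>x. cmod (f x) \<partial>lborel)\<^sup>2 * gauss (e n) \<xi>)"
        using fourier_bound[OF f] by (intro AE_I2) (simp add: abs_mult mult_right_mono power_mono)
    qed simp
  qed simp
  moreover have "(\<lambda>n. \<integral>\<^sup>+\<xi>. ennreal ((cmod (fourier f \<xi>))\<^sup>2 * gauss (e n) \<xi>) \<partial>lborel) \<longlonglongrightarrow> (\<integral>\<^sup>+\<xi>. ennreal ((cmod (fourier f \<xi>))\<^sup>2) \<partial>lborel)"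
  proof (rule nn_integral_LIMSEQ)
    show "incseq (\<lambda>n \<xi>. ennreal ((cmod (fourier f \<xi>))\<^sup>2 * gauss (e n) \<xi>))"
    proof (intro incseq_SucI le_funI ennreal_leI mult_left_mono)
      fix n and \<xi> :: 'a
      have "e (Suc n) \<le> e n" by (simp add: e_def frac_le)
      then have "e (Suc n) * (norm \<xi>)\<^sup>2 \<le> e n * (norm \<xi>)\<^sup>2" by (intro mult_right_mono) auto
      then show "gauss (e n) \<xi> \<le> gauss (e (Suc n)) \<xi>" by (simp add: gauss_def)
    qed simp
    fix \<xi> :: 'a
    have "(\<lambda>n. ennreal ((cmod (fourier f \<xi>))\<^sup>2 * gauss (e n) \<xi>)) \<longlonglongrightarrow> ennreal ((cmod (fourier f \<xi>))\<^sup>2 * exp (- 0 * (norm \<xi>)\<^sup>2 / 2))"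
      unfolding gauss_def by (intro tendsto_intros tendsto_ennrealI e0) auto
    then show "(\<lambda>n. ennreal ((cmod (fourier f \<xi>))\<^sup>2 * gauss (e n) \<xi>)) \<longlonglongrightarrow> ennreal ((cmod (fourier f \<xi>))\<^sup>2)" by simp
  qed simp
  ultimately have "(\<integral>\<^sup>+\<xi>. ennreal ((cmod (fourier f \<xi>))\<^sup>2) \<partial>lborel) = ennreal ((2 * pi) ^ DIM('a) * (\<integral>x. (cmod (f x))\<^sup>2 \<partial>lborel))"
    using LIMSEQ_unique R1 by fastforce
  also have "\<dots> = ennreal ((2 * pi) ^ DIM('a)) * (\<integral>\<^sup>+x. ennreal ((cmod (f x))\<^sup>2) \<partial>lborel)"
    by (subst nn_integral_eq_integral[OF if2]) (auto simp: ennreal_mult)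
  finally show ?thesis .
qed

section \<open>The Fourier transform on $L^2$ and its inversion\<close>

text \<open>The value is infinite outside L2, so estimates need no prior membership. No square root
  is taken: the triangle inequality appears as \<open>L2_sq_add_le\<close> with factors 2, which is
  the source of the constants 4 and 16 below.\<close>

definition L2_sq :: "('a::euclidean_space \<Rightarrow> complex) \<Rightarrow> ennreal" where
  "L2_sq f = (\<integral>\<^sup>+x. ennreal ((cmod (f x))\<^sup>2) \<partial>lborel)"

lemma L2_fun_iff: "f \<in> L2_fun \<longleftrightarrow> f \<in> borel_measurable borel \<and> L2_sq f < \<infinity>"
  by (auto simp: L2_fun_def L2_sq_def integrable_iff_bounded)

lemma L2_measurable: "f \<in> L2_fun \<Longrightarrow> f \<in> borel_measurable borel"
  by (simp add: L2_fun_iff)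

lemma L2_tendsto_iff: "L2_tendsto F f \<longleftrightarrow> (\<lambda>n. L2_sq (\<lambda>x. F n x - f x)) \<longlonglongrightarrow> 0"
  by (simp add: L2_tendsto_def L2_sq_def)

lemma L2_sq_cmult: "L2_sq (\<lambda>x. c * f x) = ennreal ((cmod c)\<^sup>2) * L2_sq f"
  if [measurable]: "f \<in> borel_measurable borel"
  unfolding L2_sq_def by (subst nn_integral_cmult[symmetric]) (auto simp: norm_mult power_mult_distrib ennreal_mult)

lemma L2_sq_minus: "L2_sq (\<lambda>x. f x - g x) = L2_sq (\<lambda>x. g x - f x)"
  by (simp add: L2_sq_def norm_minus_commute)

lemma norm_add_sq_le: "(norm (a + b))\<^sup>2 \<le> 2 * (norm a)\<^sup>2 + 2 * (norm b)\<^sup>2" for a b :: "'a::real_normed_vector"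
proof -
  have "(norm (a + b))\<^sup>2 \<le> (norm a + norm b)\<^sup>2" by (intro power_mono norm_triangle_ineq) simp
  also have "\<dots> \<le> 2 * (norm a)\<^sup>2 + 2 * (norm b)\<^sup>2"
    using abs_le_square_iff zero_le_power2[of "norm a - norm b"] by (simp add: power2_sum power2_diff)
  finally show ?thesis .
qed

lemma L2_sq_add_le:
  assumes [measurable]: "f \<in> borel_measurable borel" "g \<in> borel_measurable borel"
  shows "L2_sq (\<lambda>x. f x + g x) \<le> 2 * L2_sq f + 2 * L2_sq g"
proof -
  have "L2_sq (\<lambda>x. f x + g x) \<le> (\<integral>\<^sup>+x. 2 * ennreal ((cmod (f x))\<^sup>2) + 2 * ennreal ((cmod (g x))\<^sup>2) \<partial>lborel)"
    unfolding L2_sq_def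
  proof (rule nn_integral_mono)
    fix x
    have "ennreal ((cmod (f x + g x))\<^sup>2) \<le> ennreal (2 * (cmod (f x))\<^sup>2 + 2 * (cmod (g x))\<^sup>2)"
      by (intro ennreal_leI norm_add_sq_le)
    also have "\<dots> = 2 * ennreal ((cmod (f x))\<^sup>2) + 2 * ennreal ((cmod (g x))\<^sup>2)"
      by (simp add: ennreal_plus ennreal_mult)
    finally show "ennreal ((cmod (f x + g x))\<^sup>2) \<le> 2 * ennreal ((cmod (f x))\<^sup>2) + 2 * ennreal ((cmod (g x))\<^sup>2)" .
  qed
  also have "\<dots> = 2 * L2_sq f + 2 * L2_sq g"
    unfolding L2_sq_def by (simp add: nn_integral_add nn_integral_cmult)
  finally show ?thesis .
qed

lemma L2_sq_diff_le:
  assumes [measurable]: "f \<in> borel_measurable borel" "g \<in> borel_measurable borel" "h \<in> borel_measurable borel"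
  shows "L2_sq (\<lambda>x. f x - g x) \<le> 2 * L2_sq (\<lambda>x. f x - h x) + 2 * L2_sq (\<lambda>x. h x - g x)"
  using L2_sq_add_le[of "\<lambda>x. f x - h x" "\<lambda>x. h x - g x"] by simp

lemma L2_sq_Fatou:
  assumes [measurable]: "\<And>n. F n \<in> borel_measurable borel"
    and lim: "AE x in lborel. (\<lambda>n. F n x) \<longlonglongrightarrow> f x"
  shows "L2_sq f \<le> liminf (\<lambda>n. L2_sq (F n))"
proof -
  have "L2_sq f = (\<integral>\<^sup>+x. liminf (\<lambda>n. ennreal ((cmod (F n x))\<^sup>2)) \<partial>lborel)"
    unfolding L2_sq_def
  proof (rule nn_integral_cong_AE)
    show "AE x in lborel. ennreal ((cmod (f x))\<^sup>2) = liminf (\<lambda>n. ennreal ((cmod (F n x))\<^sup>2))"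
      using lim
    proof eventually_elim
      case (elim x)
      then have "(\<lambda>n. ennreal ((cmod (F n x))\<^sup>2)) \<longlonglongrightarrow> ennreal ((cmod (f x))\<^sup>2)"
        by (intro tendsto_ennrealI tendsto_intros)
      then show ?case by (rule lim_imp_Liminf[symmetric, rotated]) simp
    qed
  qed
  also have "\<dots> \<le> liminf (\<lambda>n. L2_sq (F n))"
    unfolding L2_sq_def by (rule nn_integral_liminf) measurable
  finally show ?thesis .
qed

lemma L2_sq_eq_0_iff:
  assumes [measurable]: "f \<in> borel_measurable borel"
  shows "L2_sq f = 0 \<longleftrightarrow> (AE x in lborel. f x = 0)"
  unfolding L2_sq_def by (subst nn_integral_0_iff_AE) auto

lemma ennreal_tendsto_0D: "f \<longlonglongrightarrow> (0::ennreal) \<Longrightarrow> e > 0 \<Longrightarrow> \<exists>N. \<forall>n\<ge>N. f n < e"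
  using order_tendstoD(2)[of f 0 sequentially e] by (simp add: eventually_sequentially)

lemma ennreal_tendsto_0I: "(\<And>e::real. e > 0 \<Longrightarrow> \<exists>N. \<forall>n\<ge>N. f n \<le> ennreal e) \<Longrightarrow> f \<longlonglongrightarrow> (0::ennreal)"
proof (rule order_tendstoI)
  fix a :: ennreal assume *: "\<And>e::real. e > 0 \<Longrightarrow> \<exists>N. \<forall>n\<ge>N. f n \<le> ennreal e" and a: "0 < a"
  obtain b where b: "0 < b" "b < a" using dense[OF a] by blast
  then have "b < top" using top.not_eq_extremum order.strict_trans by fastforce
  then obtain e where e: "b = ennreal e" "e \<ge> 0" by (cases b) auto
  then have "e > 0" using b by (cases "e = 0") auto
  then obtain N where "\<forall>n\<ge>N. f n \<le> ennreal e" using * by blast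
  then show "eventually (\<lambda>n. f n < a) sequentially"
    using b e by (auto simp: eventually_sequentially intro!: exI[of _ N] intro: le_less_trans)
qed simp

definition L2_Cauchy :: "(nat \<Rightarrow> 'a::euclidean_space \<Rightarrow> complex) \<Rightarrow> bool" where
  "L2_Cauchy F \<longleftrightarrow> (\<forall>e::real. e > 0 \<longrightarrow> (\<exists>N. \<forall>m\<ge>N. \<forall>n\<ge>N. L2_sq (\<lambda>x. F m x - F n x) \<le> ennreal e))"

lemma two_mult_ennreal: "x \<ge> 0 \<Longrightarrow> 2 * ennreal x = ennreal (2 * x)"
  by (simp add: ennreal_mult)

lemma L2_tendsto_Cauchy:
  assumes F: "\<And>n. F n \<in> borel_measurable borel" and f: "f \<in> borel_measurable borel" and lim: "L2_tendsto F f"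
  shows "L2_Cauchy F"
  unfolding L2_Cauchy_def
proof (intro allI impI)
  fix e :: real assume e: "e > 0"
  then obtain N where N: "\<And>n. n \<ge> N \<Longrightarrow> L2_sq (\<lambda>x. F n x - f x) < ennreal (e / 4)"
    using ennreal_tendsto_0D[of "\<lambda>n. L2_sq (\<lambda>x. F n x - f x)" "ennreal (e / 4)"] lim unfolding L2_tendsto_iff by auto
  show "\<exists>N. \<forall>m\<ge>N. \<forall>n\<ge>N. L2_sq (\<lambda>x. F m x - F n x) \<le> ennreal e"
  proof (intro exI[of _ N] allI impI)
    fix m n assume mn: "m \<ge> N" "n \<ge> N"
    have "L2_sq (\<lambda>x. F m x - F n x) \<le> 2 * L2_sq (\<lambda>x. F m x - f x) + 2 * L2_sq (\<lambda>x. f x - F n x)"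
      by (intro L2_sq_diff_le F f)
    also have "\<dots> \<le> 2 * ennreal (e / 4) + 2 * ennreal (e / 4)"
      using N[OF mn(1)] N[OF mn(2)] by (subst L2_sq_minus[of f]) (intro add_mono mult_left_mono; simp)
    also have "\<dots> = ennreal (2 * (e / 4) + 2 * (e / 4))"
      using e two_mult_ennreal[of "e / 4"] ennreal_plus[of "2 * (e / 4)" "2 * (e / 4)"] by simp
    also have "2 * (e / 4) + 2 * (e / 4) = e" by simp
    finally show "L2_sq (\<lambda>x. F m x - F n x) \<le> ennreal e" .
  qed
qed

text \<open>Fatou's lemma with one index fixed and the other running along the subsequence. The
  condition \<open>k \<le> r k\<close> ensures that the running index passes the Cauchy
  threshold.\<close>

lemma L2_Cauchy_AE_limit:
  assumes [measurable]: "\<And>n. F n \<in> borel_measurable borel" and C: "L2_Cauchy F"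
    and rk: "\<And>k. k \<le> r k" and lim: "AE x in lborel. (\<lambda>k. F (r k) x) \<longlonglongrightarrow> f x"
  shows "L2_tendsto F f"
  unfolding L2_tendsto_iff
proof (rule ennreal_tendsto_0I)
  fix e :: real assume e: "e > 0"
  obtain M where M: "\<And>m n. m \<ge> M \<Longrightarrow> n \<ge> M \<Longrightarrow> L2_sq (\<lambda>x. F m x - F n x) \<le> ennreal e"
    using C e unfolding L2_Cauchy_def by blast
  show "\<exists>M. \<forall>n\<ge>M. L2_sq (\<lambda>x. F n x - f x) \<le> ennreal e"
  proof (intro exI[of _ M] allI impI)
    fix n assume n: "n \<ge> M"
    have "L2_sq (\<lambda>x. F n x - f x) \<le> liminf (\<lambda>k. L2_sq (\<lambda>x. F n x - F (r k) x))"
    proof (rule L2_sq_Fatou)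
      show "AE x in lborel. (\<lambda>k. F n x - F (r k) x) \<longlonglongrightarrow> F n x - f x"
        using lim by eventually_elim (intro tendsto_intros)
    qed measurable
    also have "\<dots> \<le> ennreal e"
    proof (rule Liminf_le)
      show "eventually (\<lambda>k. L2_sq (\<lambda>x. F n x - F (r k) x) \<le> ennreal e) sequentially"
      proof (rule eventually_sequentiallyI)
        fix k assume "k \<ge> M"
        then have "r k \<ge> M" using rk[of k] by simp
        then show "L2_sq (\<lambda>x. F n x - F (r k) x) \<le> ennreal e" by (rule M[OF n])
      qed
    qed simp
    finally show "L2_sq (\<lambda>x. F n x - f x) \<le> ennreal e" .
  qed
qed

text \<open>Along a fast subsequence the differences \<open>D k\<close> have squared norm at most
  4^-k. Then the sum of 2^k |D k|^2 has a finite integral, hence is finite almost everywhere, and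
  this forces |D k| to decay like 2^(-k/2) pointwise. Minkowski's inequality is avoided in this
  way.\<close>

lemma riesz_fischer:
  fixes F :: "nat \<Rightarrow> 'a::euclidean_space \<Rightarrow> complex"
  assumes F: "\<And>n. F n \<in> L2_fun" and C: "L2_Cauchy F"
  shows "\<exists>f\<in>L2_fun. L2_tendsto F f"
proof -
  have Fm[measurable]: "F n \<in> borel_measurable borel" for n using F L2_measurable by blast
  have "\<exists>N. \<forall>m\<ge>N. \<forall>n\<ge>N. L2_sq (\<lambda>x. F m x - F n x) \<le> ennreal ((1/4) ^ k)" for k
    using C unfolding L2_Cauchy_def by simp
  then obtain N where N: "\<And>k m n. m \<ge> N k \<Longrightarrow> n \<ge> N k \<Longrightarrow> L2_sq (\<lambda>x. F m x - F n x) \<le> ennreal ((1/4) ^ k)"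
    by metis
  \<comment> \<open>Summing \<open>N i + 1\<close> gives at once \<open>r k \<ge> k\<close>,
    \<open>r k \<ge> N k\<close> and \<open>r (Suc k) \<ge> N k\<close>.\<close>
  define r where "r = (\<lambda>k. \<Sum>i\<le>k. N i + 1)"
  have rN: "r k \<ge> N k" for k unfolding r_def by (induction k) auto
  have rS: "r (Suc k) \<ge> N k" for k using rN[of k] by (simp add: r_def)
  have rk: "r k \<ge> k" for k unfolding r_def by (induction k) auto
  define D where "D = (\<lambda>k x. F (r (Suc k)) x - F (r k) x)"
  have D: "L2_sq (D k) \<le> ennreal ((1/4) ^ k)" for k unfolding D_def by (intro N rN rS)
  have [measurable]: "D k \<in> borel_measurable borel" for k unfolding D_def by measurable
  have "(\<integral>\<^sup>+x. (\<Sum>k. ennreal (2 ^ k * (cmod (D k x))\<^sup>2)) \<partial>lborel) = (\<Sum>k. \<integral>\<^sup>+x. ennreal (2 ^ k * (cmod (D k x))\<^sup>2) \<partial>lborel)"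
    by (rule nn_integral_suminf) measurable
  also have "\<dots> \<le> (\<Sum>k. ennreal ((1/2) ^ k))"
  proof (rule suminf_le)
    fix k
    have "(\<integral>\<^sup>+x. ennreal (2 ^ k * (cmod (D k x))\<^sup>2) \<partial>lborel) = ennreal (2 ^ k) * L2_sq (D k)"
      unfolding L2_sq_def by (simp add: ennreal_mult nn_integral_cmult)
    also have "\<dots> \<le> ennreal (2 ^ k) * ennreal ((1/4) ^ k)" by (intro mult_left_mono D) simp
    also have "\<dots> = ennreal ((1/2) ^ k)"
      by (subst ennreal_mult[symmetric]) (auto simp flip: power_mult_distrib)
    finally show "(\<integral>\<^sup>+x. ennreal (2 ^ k * (cmod (D k x))\<^sup>2) \<partial>lborel) \<le> ennreal ((1/2) ^ k)" .
  qed auto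
  also have "\<dots> = ennreal (\<Sum>k. (1/2) ^ k)"
    by (rule suminf_ennreal2) auto
  also have "\<dots> < \<infinity>" by simp
  finally have "AE x in lborel. (\<Sum>k. ennreal (2 ^ k * (cmod (D k x))\<^sup>2)) \<noteq> \<infinity>"
    by (intro nn_integral_noteq_infinite) auto
  then have conv: "AE x in lborel. convergent (\<lambda>k. F (r k) x)"
  proof eventually_elim
    case (elim x)
    then have "summable (\<lambda>k. 2 ^ k * (cmod (D k x))\<^sup>2)"
      by (intro summable_suminf_not_top) auto
    then have "(\<lambda>k. 2 ^ k * (cmod (D k x))\<^sup>2) \<longlonglongrightarrow> 0" by (rule summable_LIMSEQ_zero)
    then have "Bseq (\<lambda>k. 2 ^ k * (cmod (D k x))\<^sup>2)" by (intro convergent_imp_Bseq convergentI)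
    then obtain B where B: "B > 0" "\<And>k. norm (2 ^ k * (cmod (D k x))\<^sup>2) \<le> B" by (auto elim: BseqE)
    have bnd: "cmod (D k x) \<le> sqrt B * (sqrt (1/2)) ^ k" for k
    proof -
      have "(cmod (D k x))\<^sup>2 \<le> B * (1/2) ^ k" using B(2)[of k] by (simp add: field_simps)
      also have "\<dots> = (sqrt B * (sqrt (1/2)) ^ k)\<^sup>2"
      proof -
        have "((sqrt (1/2)) ^ k)\<^sup>2 = ((sqrt (1/2))\<^sup>2) ^ k" by (simp only: power_mult[symmetric] mult.commute)
        also have "(sqrt (1/2))\<^sup>2 = (1/2 :: real)" by (rule real_sqrt_pow2) simp
        finally show ?thesis using B(1) by (simp only: power_mult_distrib real_sqrt_pow2 less_imp_le)
      qed
      finally show ?thesis by (rule power2_le_imp_le) (use B(1) in simp)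
    qed
    have sm: "summable (\<lambda>k. sqrt B * (sqrt (1/2)) ^ k)"
      by (intro summable_mult summable_geometric) (simp add: real_sqrt_lt_1_iff)
    have "summable (\<lambda>k. D k x)"
      by (rule summable_comparison_test'[OF sm, of 0]) (rule bnd)
    then have "convergent (\<lambda>n. \<Sum>k<n. D k x)" by (simp add: summable_iff_convergent)
    moreover have "(\<Sum>k<n. D k x) = F (r n) x - F (r 0) x" for n
      unfolding D_def using sum_lessThan_telescope[of "\<lambda>k. F (r k) x" n] by simp
    ultimately have "convergent (\<lambda>n. F (r n) x - F (r 0) x)" by simp
    then show ?case by (simp add: convergent_diff_const_right_iff)
  qed
  define f where "f = (\<lambda>x. lim (\<lambda>k. F (r k) x))"
  have fm[measurable]: "f \<in> borel_measurable borel" unfolding f_def by measurable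
  have lim: "AE x in lborel. (\<lambda>k. F (r k) x) \<longlonglongrightarrow> f x"
    using conv unfolding f_def by eventually_elim (simp add: convergent_LIMSEQ_iff)
  have t: "L2_tendsto F f" by (rule L2_Cauchy_AE_limit[OF Fm C rk lim])
  obtain M where "\<forall>n\<ge>M. L2_sq (\<lambda>x. F n x - f x) < 1"
    using ennreal_tendsto_0D[OF t[unfolded L2_tendsto_iff], of 1] by auto
  then have M: "L2_sq (\<lambda>x. F M x - f x) < 1" by simp
  have "L2_sq f \<le> 2 * L2_sq (\<lambda>x. f x - F M x) + 2 * L2_sq (F M)"
    using L2_sq_add_le[of "\<lambda>x. f x - F M x" "F M"] by simp
  also have "\<dots> < \<infinity>" using M F[of M] unfolding L2_fun_iff
    by (subst L2_sq_minus) (auto simp: ennreal_mult_less_top intro: order.strict_trans[OF _ ennreal_one_less_top])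
  finally show ?thesis using t fm by (auto simp: L2_fun_iff)
qed

text \<open>Removes an error term that tends to 0. The factor \<open>k\<close> has to be finite, as
  multiplication by infinity is not continuous at 0 in \<open>ennreal\<close>.\<close>

lemma ennreal_le_limit_0:
  fixes a b k :: ennreal
  assumes le: "\<And>n. a \<le> b + k * x n" and x: "x \<longlonglongrightarrow> 0" and k: "k < top"
  shows "a \<le> b"
proof -
  have "(\<lambda>n. b + k * x n) \<longlonglongrightarrow> b + k * 0"
    by (intro tendsto_add tendsto_const ennreal_tendsto_cmult x k)
  then show ?thesis by (intro LIMSEQ_le_const[of "\<lambda>n. b + k * x n"]) (use le in auto)
qed

lemma L2_tendsto_dominated:
  assumes f: "f \<in> L2_fun" and F[measurable]: "\<And>n. F n \<in> borel_measurable borel"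
    and lim: "\<And>x. (\<lambda>n. F n x) \<longlonglongrightarrow> f x" and bd: "\<And>n x. cmod (F n x) \<le> cmod (f x)"
  shows "L2_tendsto F f"
proof -
  have [measurable]: "f \<in> borel_measurable borel" using f by (rule L2_measurable)
  have "(\<lambda>n. \<integral>\<^sup>+x. ennreal ((cmod (F n x - f x))\<^sup>2) \<partial>lborel) \<longlonglongrightarrow> (\<integral>\<^sup>+x. 0 \<partial>(lborel :: 'a measure))"
  proof (rule nn_integral_dominated_convergence)
    show "(\<integral>\<^sup>+x. ennreal (4 * (cmod (f x))\<^sup>2) \<partial>lborel) < \<infinity>"
      using f unfolding L2_fun_iff L2_sq_def
      by (simp add: ennreal_mult nn_integral_cmult ennreal_mult_less_top)
    show "AE x in lborel. ennreal ((cmod (F n x - f x))\<^sup>2) \<le> ennreal (4 * (cmod (f x))\<^sup>2)" for n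
    proof (intro AE_I2 ennreal_leI)
      fix x
      have "cmod (F n x - f x) \<le> 2 * cmod (f x)" using norm_triangle_ineq4[of "F n x" "f x"] bd[of n x] by simp
      then have "(cmod (F n x - f x))\<^sup>2 \<le> (2 * cmod (f x))\<^sup>2" by (intro power_mono) auto
      then show "(cmod (F n x - f x))\<^sup>2 \<le> 4 * (cmod (f x))\<^sup>2" by (simp add: power_mult_distrib)
    qed
    show "AE x in lborel. (\<lambda>n. ennreal ((cmod (F n x - f x))\<^sup>2)) \<longlonglongrightarrow> 0"
    proof (rule AE_I2)
      fix x
      have "(\<lambda>n. ennreal ((cmod (F n x - f x))\<^sup>2)) \<longlonglongrightarrow> ennreal ((cmod (f x - f x))\<^sup>2)"
        by (intro tendsto_ennrealI tendsto_intros lim)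
      then show "(\<lambda>n. ennreal ((cmod (F n x - f x))\<^sup>2)) \<longlonglongrightarrow> 0" by simp
    qed
  qed measurable
  then show ?thesis by (simp add: L2_tendsto_def)
qed

section \<open>Plancherel inequalities on the intersection of L1 and L2\<close>

lemma fourier_add_cmult:
  assumes "integrable lborel f" "integrable lborel g"
  shows "fourier (\<lambda>x. f x + c * g x) \<xi> = fourier f \<xi> + c * fourier g \<xi>"
proof -
  have "fourier (\<lambda>x. f x + c * g x) \<xi> = (\<integral>x. exp (- \<i> * complex_of_real (\<xi> \<bullet> x)) * f x + c * (exp (- \<i> * complex_of_real (\<xi> \<bullet> x)) * g x) \<partial>lborel)"
    unfolding fourier_def by (simp add: algebra_simps)
  also have "\<dots> = fourier f \<xi> + c * fourier g \<xi>"
    unfolding fourier_def using integrable_fourier_kernel[OF assms(1), of \<xi>] integrable_fourier_kernel[OF assms(2), of \<xi>]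
    by (subst Bochner_Integration.integral_add) auto
  finally show ?thesis .
qed

lemma fourier_diff:
  assumes "integrable lborel f" "integrable lborel g"
  shows "fourier (\<lambda>x. f x - g x) \<xi> = fourier f \<xi> - fourier g \<xi>"
  using fourier_add_cmult[OF assms, of "-1" \<xi>] by simp

lemma fourier_tendsto:
  fixes f :: "'a::euclidean_space \<Rightarrow> complex"
  assumes f: "integrable lborel f" and F[measurable]: "\<And>n. F n \<in> borel_measurable borel"
    and lim: "\<And>x. (\<lambda>n. F n x) \<longlonglongrightarrow> f x" and bd: "\<And>n x. cmod (F n x) \<le> cmod (f x)"
  shows "(\<lambda>n. fourier (F n) \<xi>) \<longlonglongrightarrow> fourier f \<xi>"
  unfolding fourier_def
proof (rule integral_dominated_convergence)
  have [measurable]: "f \<in> borel_measurable borel" using borel_measurable_integrable[OF f] by simp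
  show "integrable lborel (\<lambda>x. cmod (f x))" using f by simp
  show "AE x in lborel. (\<lambda>n. exp (- \<i> * complex_of_real (\<xi> \<bullet> x)) * F n x) \<longlonglongrightarrow> exp (- \<i> * complex_of_real (\<xi> \<bullet> x)) * f x"
    by (intro AE_I2 tendsto_intros lim)
  show "(\<lambda>x. exp (- \<i> * complex_of_real (\<xi> \<bullet> x)) * f x) \<in> borel_measurable lborel" by measurable
  show "(\<lambda>x. exp (- \<i> * complex_of_real (\<xi> \<bullet> x)) * F n x) \<in> borel_measurable lborel" for n by measurable
qed (simp add: norm_mult bd)

text \<open>The values are cut off, not the domain: boundedness is what
  \<open>plancherel_bounded\<close> asks for.\<close>

definition truncate :: "nat \<Rightarrow> ('a \<Rightarrow> complex) \<Rightarrow> 'a \<Rightarrow> complex" where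
  "truncate n f x = (if cmod (f x) \<le> real n then f x else 0)"

lemma truncate_measurable [measurable]:
  fixes f :: "'a::topological_space \<Rightarrow> complex"
  assumes [measurable]: "f \<in> borel_measurable borel"
  shows "truncate n f \<in> borel_measurable borel"
  unfolding truncate_def[abs_def] by measurable

lemma truncate_le: "cmod (truncate n f x) \<le> cmod (f x)" "cmod (truncate n f x) \<le> real n"
  by (auto simp: truncate_def)

lemma truncate_tendsto: "(\<lambda>n. truncate n f x) \<longlonglongrightarrow> f x"
proof (rule tendsto_eventually)
  obtain N where N: "cmod (f x) \<le> real N" using real_arch_simple by blast
  show "eventually (\<lambda>n. truncate n f x = f x) sequentially"
  proof (rule eventually_sequentiallyI)
    fix n assume "N \<le> n"
    then have "real N \<le> real n" by simp
    then have "cmod (f x) \<le> real n" using N by linarith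
    then show "truncate n f x = f x" by (simp add: truncate_def)
  qed
qed

lemma integrable_truncate:
  fixes f :: "'a::euclidean_space \<Rightarrow> complex"
  assumes "integrable lborel f" shows "integrable lborel (truncate n f)"
  using borel_measurable_integrable[OF assms]
  by (intro Bochner_Integration.integrable_bound[OF assms]) (auto simp: truncate_le)

text \<open>The transforms of the truncations converge pointwise, and Fatou's lemma carries the
  identity over as an inequality.\<close>

lemma plancherel_le:
  fixes f :: "'a::euclidean_space \<Rightarrow> complex"
  assumes f: "integrable lborel f" "f \<in> L2_fun"
  shows "L2_sq (fourier f) \<le> ennreal ((2 * pi) ^ DIM('a)) * L2_sq f"
proof -
  have [measurable]: "f \<in> borel_measurable borel" using f(2) by (rule L2_measurable)
  have "L2_sq (fourier f) \<le> liminf (\<lambda>n. L2_sq (fourier (truncate n f)))"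
  proof (rule L2_sq_Fatou)
    show "fourier (truncate n f) \<in> borel_measurable borel" for n
      by (intro fourier_measurable integrable_truncate f)
    show "AE \<xi> in lborel. (\<lambda>n. fourier (truncate n f) \<xi>) \<longlonglongrightarrow> fourier f \<xi>"
      by (intro AE_I2 fourier_tendsto f truncate_tendsto truncate_le) measurable
  qed
  also have "\<dots> \<le> ennreal ((2 * pi) ^ DIM('a)) * L2_sq f"
  proof -
    have "L2_sq (fourier (truncate n f)) \<le> ennreal ((2 * pi) ^ DIM('a)) * L2_sq f" for n
    proof -
    have "L2_sq (fourier (truncate n f)) = ennreal ((2 * pi) ^ DIM('a)) * L2_sq (truncate n f)"
      unfolding L2_sq_def by (rule plancherel_bounded[OF integrable_truncate[OF f(1)] truncate_le(2)])
    also have "\<dots> \<le> ennreal ((2 * pi) ^ DIM('a)) * L2_sq f"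
      unfolding L2_sq_def by (intro mult_left_mono nn_integral_mono ennreal_leI power_mono truncate_le) auto
    finally show ?thesis .
    qed
    then show ?thesis by (intro Liminf_le) auto
  qed
  finally show ?thesis .
qed

lemma fourier_in_L2:
  assumes "integrable lborel f" "f \<in> L2_fun"
  shows "fourier f \<in> L2_fun"
proof -
  have "L2_sq (fourier f) < \<infinity>"
    using plancherel_le[OF assms] assms(2) unfolding L2_fun_iff
    by (auto intro: le_less_trans simp: ennreal_mult_less_top)
  then show ?thesis using fourier_measurable[OF assms(1)] by (simp add: L2_fun_iff)
qed

lemma L2_fun_add_cmult:
  assumes "f \<in> L2_fun" "g \<in> L2_fun"
  shows "(\<lambda>x. f x + c * g x) \<in> L2_fun"
proof -
  have [measurable]: "f \<in> borel_measurable borel" "g \<in> borel_measurable borel" using assms L2_measurable by auto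
  have "L2_sq (\<lambda>x. f x + c * g x) \<le> 2 * L2_sq f + 2 * L2_sq (\<lambda>x. c * g x)" by (rule L2_sq_add_le) measurable
  also have "\<dots> < \<infinity>" using assms by (simp add: L2_sq_cmult L2_fun_iff ennreal_mult_less_top)
  finally show ?thesis by (simp add: L2_fun_iff)
qed

lemma L2_fun_diff: "f \<in> L2_fun \<Longrightarrow> g \<in> L2_fun \<Longrightarrow> (\<lambda>x. f x - g x) \<in> L2_fun"
  using L2_fun_add_cmult[of f g "-1"] by simp

lemma L2_fun_cmult: "g \<in> L2_fun \<Longrightarrow> (\<lambda>x. c * g x) \<in> L2_fun"
  using L2_fun_add_cmult[of "\<lambda>_. 0" g c] by (simp add: L2_fun_iff L2_sq_def)

lemma L2_sq_le_split:
  assumes [measurable]: "f \<in> borel_measurable borel" "g \<in> borel_measurable borel"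
  shows "L2_sq f \<le> 2 * L2_sq g + 2 * L2_sq (\<lambda>x. f x - g x)"
  using L2_sq_add_le[of g "\<lambda>x. f x - g x"] by simp

lemma plancherel_ge:
  fixes f :: "'a::euclidean_space \<Rightarrow> complex"
  assumes f: "integrable lborel f" "f \<in> L2_fun"
  shows "L2_sq f \<le> 4 * L2_sq (fourier f)"
proof (rule ennreal_le_limit_0)
  let ?c = "ennreal ((2 * pi) ^ DIM('a))"
  have [measurable]: "f \<in> borel_measurable borel" using f(2) by (rule L2_measurable)
  have "1 \<le> (2 * pi) ^ DIM('a)" by (rule one_le_power) (use pi_gt3 in linarith)
  from ennreal_leI[OF this] have c1: "1 \<le> ?c" unfolding ennreal_1 .
  show "(\<lambda>n. L2_sq (\<lambda>x. truncate n f x - f x)) \<longlonglongrightarrow> 0"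
    unfolding L2_tendsto_iff[symmetric]
    by (rule L2_tendsto_dominated[OF f(2)]) (auto simp: truncate_tendsto truncate_le)
  fix n
  let ?x = "L2_sq (\<lambda>x. truncate n f x - f x)"
  have it: "integrable lborel (truncate n f)" by (rule integrable_truncate[OF f(1)])
  have tL: "truncate n f \<in> L2_fun"
  proof -
    have "L2_sq (truncate n f) \<le> L2_sq f" unfolding L2_sq_def by (intro nn_integral_mono ennreal_leI power_mono truncate_le) auto
    then show ?thesis using f(2) by (auto simp: L2_fun_iff intro: le_less_trans)
  qed
  have "L2_sq (truncate n f) \<le> ?c * L2_sq (truncate n f)" using mult_right_mono[OF c1, of "L2_sq (truncate n f)"] by simp
  also have "\<dots> = L2_sq (fourier (truncate n f))"
    unfolding L2_sq_def by (rule plancherel_bounded[OF it truncate_le(2), symmetric])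
  also have "\<dots> \<le> 2 * L2_sq (fourier f) + 2 * L2_sq (\<lambda>\<xi>. fourier (truncate n f) \<xi> - fourier f \<xi>)"
    by (intro L2_sq_le_split fourier_measurable it f)
  also have "(\<lambda>\<xi>. fourier (truncate n f) \<xi> - fourier f \<xi>) = fourier (\<lambda>x. truncate n f x - f x)"
    using fourier_diff[OF it f(1)] by auto
  also have "L2_sq (fourier (\<lambda>x. truncate n f x - f x)) \<le> ?c * ?x"
    by (intro plancherel_le Bochner_Integration.integrable_diff it f L2_fun_diff tL)
  finally have t: "L2_sq (truncate n f) \<le> 2 * L2_sq (fourier f) + 2 * (?c * ?x)"
    by (simp add: add_left_mono mult_left_mono)
  have "L2_sq f \<le> 2 * L2_sq (truncate n f) + 2 * L2_sq (\<lambda>x. f x - truncate n f x)"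
    by (intro L2_sq_le_split) measurable
  also have "\<dots> \<le> 2 * (2 * L2_sq (fourier f) + 2 * (?c * ?x)) + 2 * ?x"
    using t by (subst L2_sq_minus[of f]) (intro add_mono mult_left_mono; simp)
  also have "\<dots> = 4 * L2_sq (fourier f) + (4 * ?c + 2) * ?x"
    by (simp add: algebra_simps)
  finally show "L2_sq f \<le> 4 * L2_sq (fourier f) + (4 * ?c + 2) * ?x" .
  show "4 * ?c + 2 < top" by (simp add: ennreal_mult_less_top)
qed

text \<open>Passing to the limit along the defining sequence, with one split on each side of the
  Plancherel inequalities.\<close>

lemma is_fourier_L2_bounds:
  fixes f g :: "'a::euclidean_space \<Rightarrow> complex"
  assumes "is_fourier_L2 f g"
  shows "L2_sq g \<le> 4 * ennreal ((2 * pi) ^ DIM('a)) * L2_sq f" "L2_sq f \<le> 16 * L2_sq g"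
proof -
  let ?c = "ennreal ((2 * pi) ^ DIM('a))"
  obtain F where F: "\<And>n. integrable lborel (F n)" "\<And>n. F n \<in> L2_fun" "L2_tendsto F f" "L2_tendsto (\<lambda>n. fourier (F n)) g"
    and fg: "f \<in> L2_fun" "g \<in> L2_fun"
    using assms unfolding is_fourier_L2_def L1_fun_def by auto
  have [measurable]: "f \<in> borel_measurable borel" "g \<in> borel_measurable borel" "F n \<in> borel_measurable borel"
    "fourier (F n) \<in> borel_measurable borel" for n
    using fg F(2) fourier_in_L2[OF F(1,2)] L2_measurable by auto
  let ?x = "\<lambda>n. L2_sq (\<lambda>x. F n x - f x)" and ?y = "\<lambda>n. L2_sq (\<lambda>\<xi>. fourier (F n) \<xi> - g \<xi>)"
  have "(\<lambda>n. ?x n + ?y n) \<longlonglongrightarrow> 0 + 0"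
    using F(3,4) unfolding L2_tendsto_iff by (intro tendsto_add)
  then have lim: "(\<lambda>n. ?x n + ?y n) \<longlonglongrightarrow> 0" by simp
  have 1: "L2_sq g \<le> 2 * L2_sq (fourier (F n)) + 2 * ?y n" for n
    using L2_sq_le_split[of g "fourier (F n)"] L2_sq_minus[of g] by simp
  have 2: "L2_sq (fourier (F n)) \<le> 2 * L2_sq g + 2 * ?y n" for n
    by (intro L2_sq_le_split) measurable
  have 3: "L2_sq f \<le> 2 * L2_sq (F n) + 2 * ?x n" for n
    using L2_sq_le_split[of f "F n"] L2_sq_minus[of f] by simp
  have 4: "L2_sq (F n) \<le> 2 * L2_sq f + 2 * ?x n" for n
    by (intro L2_sq_le_split) measurable
  show "L2_sq g \<le> 4 * ?c * L2_sq f"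
  proof (rule ennreal_le_limit_0[OF _ lim])
    fix n
    have "L2_sq g \<le> 2 * (?c * (2 * L2_sq f + 2 * ?x n)) + 2 * ?y n"
      using plancherel_le[OF F(1,2)] 4[of n]
      by (intro order_trans[OF 1[of n]] add_mono mult_left_mono order_refl order_trans[OF plancherel_le[OF F(1,2)]]) auto
    also have "\<dots> = 4 * ?c * L2_sq f + (4 * ?c * ?x n + 2 * ?y n)" by (simp add: algebra_simps)
    also have "\<dots> \<le> 4 * ?c * L2_sq f + (4 * ?c + 2) * (?x n + ?y n)"
      by (intro add_left_mono) (simp add: algebra_simps add_increasing2)
    finally show "L2_sq g \<le> 4 * ?c * L2_sq f + (4 * ?c + 2) * (?x n + ?y n)" .
  qed (simp add: ennreal_mult_less_top)
  show "L2_sq f \<le> 16 * L2_sq g"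
  proof (rule ennreal_le_limit_0[OF _ lim])
    fix n
    have "L2_sq f \<le> 2 * (4 * (2 * L2_sq g + 2 * ?y n)) + 2 * ?x n"
      using 2[of n]
      by (intro order_trans[OF 3[of n]] add_mono mult_left_mono order_refl order_trans[OF plancherel_ge[OF F(1,2)]]) auto
    also have "\<dots> = 16 * L2_sq g + (16 * ?y n + 2 * ?x n)" by (simp add: algebra_simps)
    also have "\<dots> \<le> 16 * L2_sq g + 18 * (?x n + ?y n)"
    proof (intro add_left_mono)
      have "18 * (?x n + ?y n) = (16 * ?y n + 2 * ?x n) + (16 * ?x n + 2 * ?y n)"
      proof -
        have "(18::ennreal) = 16 + 2" by simp
        then show ?thesis by (simp only: distrib_left distrib_right ac_simps)
      qed
      then show "16 * ?y n + 2 * ?x n \<le> 18 * (?x n + ?y n)" by simp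
    qed
    finally show "L2_sq f \<le> 16 * L2_sq g + 18 * (?x n + ?y n)" .
  qed simp
qed

section \<open>Linearity, uniqueness and existence of the transform on L2\<close>

lemma L2_tendsto_add_cmult:
  assumes [measurable]: "\<And>n. F n \<in> borel_measurable borel" "\<And>n. G n \<in> borel_measurable borel"
    "f \<in> borel_measurable borel" "g \<in> borel_measurable borel"
    and F: "L2_tendsto F f" and G: "L2_tendsto G g"
  shows "L2_tendsto (\<lambda>n x. F n x + c * G n x) (\<lambda>x. f x + c * g x)"
proof -
  have "(\<lambda>n. 2 * L2_sq (\<lambda>x. F n x - f x) + 2 * (ennreal ((cmod c)\<^sup>2) * L2_sq (\<lambda>x. G n x - g x))) \<longlonglongrightarrow> 2 * 0 + 2 * (ennreal ((cmod c)\<^sup>2) * 0)"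
    using F G unfolding L2_tendsto_iff by (intro tendsto_add ennreal_tendsto_cmult) auto
  then have lim: "(\<lambda>n. 2 * L2_sq (\<lambda>x. F n x - f x) + 2 * (ennreal ((cmod c)\<^sup>2) * L2_sq (\<lambda>x. G n x - g x))) \<longlonglongrightarrow> 0" by simp
  show ?thesis
    unfolding L2_tendsto_iff
  proof (rule tendsto_sandwich[OF _ _ tendsto_const lim])
    show "eventually (\<lambda>n. L2_sq (\<lambda>x. F n x + c * G n x - (f x + c * g x))
      \<le> 2 * L2_sq (\<lambda>x. F n x - f x) + 2 * (ennreal ((cmod c)\<^sup>2) * L2_sq (\<lambda>x. G n x - g x))) sequentially"
    proof (rule always_eventually, rule allI)
      fix n
      have "L2_sq (\<lambda>x. F n x + c * G n x - (f x + c * g x)) = L2_sq (\<lambda>x. (F n x - f x) + c * (G n x - g x))"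
        by (simp add: algebra_simps)
      also have "\<dots> \<le> 2 * L2_sq (\<lambda>x. F n x - f x) + 2 * L2_sq (\<lambda>x. c * (G n x - g x))"
        by (rule L2_sq_add_le) measurable
      also have "L2_sq (\<lambda>x. c * (G n x - g x)) = ennreal ((cmod c)\<^sup>2) * L2_sq (\<lambda>x. G n x - g x)"
        by (rule L2_sq_cmult) measurable
      finally show "L2_sq (\<lambda>x. F n x + c * G n x - (f x + c * g x))
        \<le> 2 * L2_sq (\<lambda>x. F n x - f x) + 2 * (ennreal ((cmod c)\<^sup>2) * L2_sq (\<lambda>x. G n x - g x))" .
    qed
  qed auto
qed

lemma is_fourier_L2_add_cmult:
  assumes "is_fourier_L2 f g" "is_fourier_L2 f' g'"
  shows "is_fourier_L2 (\<lambda>x. f x + c * f' x) (\<lambda>x. g x + c * g' x)"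
proof -
  obtain F where F: "\<And>n. integrable lborel (F n)" "\<And>n. F n \<in> L2_fun" "L2_tendsto F f" "L2_tendsto (\<lambda>n. fourier (F n)) g"
    and fg: "f \<in> L2_fun" "g \<in> L2_fun"
    using assms(1) unfolding is_fourier_L2_def L1_fun_def by auto
  obtain G where G: "\<And>n. integrable lborel (G n)" "\<And>n. G n \<in> L2_fun" "L2_tendsto G f'" "L2_tendsto (\<lambda>n. fourier (G n)) g'"
    and fg': "f' \<in> L2_fun" "g' \<in> L2_fun"
    using assms(2) unfolding is_fourier_L2_def L1_fun_def by auto
  have 1: "L2_tendsto (\<lambda>n x. F n x + c * G n x) (\<lambda>x. f x + c * f' x)"
    using F G fg fg' by (intro L2_tendsto_add_cmult) (auto intro!: L2_measurable)
  have 2: "L2_tendsto (\<lambda>n \<xi>. fourier (F n) \<xi> + c * fourier (G n) \<xi>) (\<lambda>x. g x + c * g' x)"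
    using F G fg fg' by (intro L2_tendsto_add_cmult) (auto intro!: L2_measurable fourier_in_L2)
  show ?thesis
    unfolding is_fourier_L2_def
  proof (intro conjI exI[of _ "\<lambda>n x. F n x + c * G n x"] allI)
    show "(\<lambda>x. F n x + c * G n x) \<in> L1_fun \<inter> L2_fun" for n
      using F G by (auto simp: L1_fun_def L2_fun_add_cmult)
    have "fourier (\<lambda>x. F n x + c * G n x) = (\<lambda>\<xi>. fourier (F n) \<xi> + c * fourier (G n) \<xi>)" for n
      using fourier_add_cmult[OF F(1) G(1)] by auto
    then show "L2_tendsto (\<lambda>n. fourier (\<lambda>x. F n x + c * G n x)) (\<lambda>x. g x + c * g' x)" using 2 by simp
  qed (use 1 fg fg' in \<open>auto intro: L2_fun_add_cmult\<close>)
qed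

lemma is_fourier_L2_diff:
  "is_fourier_L2 f g \<Longrightarrow> is_fourier_L2 f' g' \<Longrightarrow> is_fourier_L2 (\<lambda>x. f x - f' x) (\<lambda>x. g x - g' x)"
  using is_fourier_L2_add_cmult[of f g f' g' "-1"] by simp

lemma is_fourier_L2_cmult:
  assumes "is_fourier_L2 f g" shows "is_fourier_L2 (\<lambda>x. c * f x) (\<lambda>x. c * g x)"
  using is_fourier_L2_add_cmult[OF assms assms, of "c - 1"] by (simp add: algebra_simps)

text \<open>Linearity reduces this to the bounds for a difference. One direction says that the
  transform is well defined, the other that it is injective.\<close>

lemma is_fourier_L2_unique:
  assumes "is_fourier_L2 f g" "is_fourier_L2 f' g'"
  shows "(AE x in lborel. f x = f' x) \<longleftrightarrow> (AE x in lborel. g x = g' x)"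
proof -
  have d: "is_fourier_L2 (\<lambda>x. f x - f' x) (\<lambda>x. g x - g' x)" by (rule is_fourier_L2_diff[OF assms])
  have [measurable]: "f \<in> borel_measurable borel" "g \<in> borel_measurable borel" "f' \<in> borel_measurable borel" "g' \<in> borel_measurable borel"
    using assms L2_measurable unfolding is_fourier_L2_def by auto
  have "L2_sq (\<lambda>x. f x - f' x) = 0 \<longleftrightarrow> L2_sq (\<lambda>x. g x - g' x) = 0"
    using is_fourier_L2_bounds[OF d] by auto
  then show ?thesis by (simp add: L2_sq_eq_0_iff)
qed

lemma is_fourier_L2_L1:
  assumes "integrable lborel f" "f \<in> L2_fun"
  shows "is_fourier_L2 f (fourier f)"
  unfolding is_fourier_L2_def
  using assms fourier_in_L2[OF assms]
  by (auto simp: L1_fun_def L2_tendsto_iff L2_sq_def intro!: exI[of _ "\<lambda>_. f"])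

lemma L2_Cauchy_fourier:
  fixes F :: "nat \<Rightarrow> 'a::euclidean_space \<Rightarrow> complex"
  assumes FI: "\<And>n. integrable lborel (F n)" and FL: "\<And>n. F n \<in> L2_fun" and C: "L2_Cauchy F"
  shows "L2_Cauchy (\<lambda>n. fourier (F n))"
  unfolding L2_Cauchy_def
proof (intro allI impI)
  fix e :: real assume e: "e > 0"
  let ?c = "(2 * pi) ^ DIM('a)"
  have c: "?c > 0" by simp
  then obtain N where N: "\<And>m n. m \<ge> N \<Longrightarrow> n \<ge> N \<Longrightarrow> L2_sq (\<lambda>x. F m x - F n x) \<le> ennreal (e / ?c)"
    using C e unfolding L2_Cauchy_def by (meson divide_pos_pos)
  show "\<exists>N. \<forall>m\<ge>N. \<forall>n\<ge>N. L2_sq (\<lambda>x. fourier (F m) x - fourier (F n) x) \<le> ennreal e"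
  proof (intro exI[of _ N] allI impI)
    fix m n assume mn: "m \<ge> N" "n \<ge> N"
    have "(\<lambda>x. fourier (F m) x - fourier (F n) x) = fourier (\<lambda>x. F m x - F n x)"
      using fourier_diff[OF FI FI] by auto
    then have "L2_sq (\<lambda>x. fourier (F m) x - fourier (F n) x) \<le> ennreal ?c * L2_sq (\<lambda>x. F m x - F n x)"
      using plancherel_le[of "\<lambda>x. F m x - F n x"] FI FL by (simp add: L2_fun_diff)
    also have "\<dots> \<le> ennreal ?c * ennreal (e / ?c)" by (intro mult_left_mono N mn) simp
    also have "\<dots> = ennreal e" using c e by (subst ennreal_mult[symmetric]) auto
    finally show "L2_sq (\<lambda>x. fourier (F m) x - fourier (F n) x) \<le> ennreal e" .
  qed
qed

text \<open>Cutting \<open>f\<close> off outside balls gives integrable functions that converge to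
  \<open>f\<close> in L2; their transforms are Cauchy by Plancherel and converge by
  completeness.\<close>

lemma is_fourier_L2_exists:
  fixes f :: "'a::euclidean_space \<Rightarrow> complex"
  assumes f: "f \<in> L2_fun" shows "\<exists>g. is_fourier_L2 f g"
proof -
  let ?c = "ennreal ((2 * pi) ^ DIM('a))"
  have [measurable]: "f \<in> borel_measurable borel" using f by (rule L2_measurable)
  define F where "F = (\<lambda>n x. f x * indicator (ball 0 (real n)) x)"
  have [measurable]: "ball (0::'a) (real n) \<in> sets borel" for n by simp
  have Fm[measurable]: "F n \<in> borel_measurable borel" for n unfolding F_def by measurable
  have Fle: "cmod (F n x) \<le> cmod (f x)" for n x by (simp add: F_def indicator_def)
  have FL: "F n \<in> L2_fun" for n
  proof -
    have "L2_sq (F n) \<le> L2_sq f" unfolding L2_sq_def by (intro nn_integral_mono ennreal_leI power_mono Fle) auto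
    then show ?thesis using f by (auto simp: L2_fun_iff intro: le_less_trans)
  qed
  have FI: "integrable lborel (F n)" for n
  proof (rule Bochner_Integration.integrable_bound)
    have "emeasure lborel (ball (0::'a) (real n)) < \<infinity>" by (rule emeasure_bounded_finite) simp
    then show "integrable lborel (\<lambda>x. (cmod (f x))\<^sup>2 + indicator (ball 0 (real n)) x)"
      using f by (simp add: L2_fun_def integrable_indicator_iff)
    show "AE x in lborel. cmod (F n x) \<le> norm ((cmod (f x))\<^sup>2 + indicator (ball 0 (real n)) x :: real)"
    proof (rule AE_I2)
      fix x
      have "cmod (f x) \<le> (cmod (f x))\<^sup>2 + 1"
      proof -
        \<comment> \<open>With this elementary inequality, finite measure of the ball makes the
          square integrable \<open>F n\<close> integrable.\<close>
        have "2 * cmod (f x) \<le> (cmod (f x))\<^sup>2 + 1" using zero_le_power2[of "cmod (f x) - 1"] by (simp add: power2_diff)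
        then show ?thesis using norm_ge_zero[of "f x"] by linarith
      qed
      then show "cmod (F n x) \<le> norm ((cmod (f x))\<^sup>2 + indicator (ball 0 (real n)) x :: real)"
        by (simp add: F_def indicator_def)
    qed
  qed simp
  have Fl: "(\<lambda>n. F n x) \<longlonglongrightarrow> f x" for x
  proof (rule tendsto_eventually)
    obtain N where N: "norm x < real N" using reals_Archimedean2 by blast
    show "eventually (\<lambda>n. F n x = f x) sequentially"
    proof (rule eventually_sequentiallyI)
      fix n assume "N \<le> n"
      then have "real N \<le> real n" by simp
      then have "norm x < real n" using N by linarith
      then show "F n x = f x" by (simp add: F_def)
    qed
  qed
  have lim: "L2_tendsto F f" by (rule L2_tendsto_dominated[OF f Fm Fl Fle])
  have CF: "L2_Cauchy F" by (rule L2_tendsto_Cauchy[OF Fm _ lim]) simp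
  have "L2_Cauchy (\<lambda>n. fourier (F n))" by (rule L2_Cauchy_fourier[OF FI FL CF])
  then obtain g where "g \<in> L2_fun" "L2_tendsto (\<lambda>n. fourier (F n)) g"
    using riesz_fischer[of "\<lambda>n. fourier (F n)"] fourier_in_L2[OF FI FL] by blast
  then show ?thesis
    using f lim FI FL unfolding is_fourier_L2_def by (auto simp: L1_fun_def intro!: exI[of _ g] exI[of _ F])
qed

text \<open>On \<open>L2_fun\<close> the representative chosen by \<open>SOME\<close> is accessible
  only through this property and the almost everywhere uniqueness.\<close>

lemma is_fourier_L2_fourier_L2: "f \<in> L2_fun \<Longrightarrow> is_fourier_L2 f (fourier_L2 f)"
  unfolding fourier_L2_def by (rule someI_ex[OF is_fourier_L2_exists])

lemma fourier_L2_AE_eq: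
  assumes "is_fourier_L2 f g" shows "AE x in lborel. fourier_L2 f x = g x"
proof -
  have "f \<in> L2_fun" using assms by (simp add: is_fourier_L2_def)
  from is_fourier_L2_unique[OF is_fourier_L2_fourier_L2[OF this] assms] show ?thesis by simp
qed

text \<open>By Tonelli the L1 distance between the Gaussian average \<open>G n\<close> and
  \<open>g\<close> is at most the Gaussian average of the translation modulus of \<open>g\<close>,
  which is bounded and tends to 0.\<close>

lemma gauss_approx_identity_L1:
  fixes g :: "'a::euclidean_space \<Rightarrow> complex"
  assumes g: "integrable lborel g" and e: "\<And>n. e n > 0" "e \<longlonglongrightarrow> 0"
  defines "C \<equiv> (2 * pi) powr (real DIM('a) / 2)"
  defines "G \<equiv> \<lambda>n x. complex_of_real (1 / C) * (\<integral>z. complex_of_real (gauss 1 z) * g (x + sqrt (e n) *\<^sub>R z) \<partial>lborel)"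
  shows "integrable lborel (\<lambda>x. G n x - g x)" "(\<lambda>n. \<integral>x. cmod (G n x - g x) \<partial>lborel) \<longlonglongrightarrow> 0"
proof -
  have [measurable]: "g \<in> borel_measurable borel" using borel_measurable_integrable[OF g] by simp
  have C: "C > 0" by (simp add: C_def)
  then have cC: "cmod (complex_of_real (1 / C)) = 1 / C" unfolding norm_of_real by simp
  have gi: "integrable lborel (gauss 1 :: 'a \<Rightarrow> real)" by (rule integrable_gauss) simp
  \<comment> \<open>The L1 modulus of translation; it is at most twice the norm of \<open>g\<close>,
    which is the bound used for dominated convergence.\<close>
  define T where "T = (\<lambda>t. \<integral>x. cmod (g (x + t) - g x) \<partial>lborel)"
  have Tn: "ennreal (T t) = (\<integral>\<^sup>+x. ennreal (cmod (g (x + t) - g x)) \<partial>lborel)" for t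
    unfolding T_def using translation_diff_integrable[OF g, of t]
    by (subst nn_integral_eq_integral) (simp_all add: add.commute)
  have Tm[measurable]: "T \<in> borel_measurable borel"
  proof -
    have "(\<lambda>(t, x). cmod (g (x + t) - g x)) \<in> borel_measurable (borel \<Otimes>\<^sub>M lborel)" by measurable
    then show ?thesis unfolding T_def by (rule sigma_finite_measure.borel_measurable_lebesgue_integral[OF sigma_finite_lborel])
  qed
  have T0: "T t \<ge> 0" for t by (simp add: T_def)
  have Tb: "T t \<le> 2 * (\<integral>x. cmod (g x) \<partial>lborel)" for t
  proof -
    have i: "integrable lborel (\<lambda>x. cmod (g (t + x)))" using g by (intro integrable_norm integrable_lborel_translate)
    have "T t \<le> (\<integral>x. cmod (g (t + x)) + cmod (g x) \<partial>lborel)"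
      unfolding T_def using translation_diff_integrable[OF g, of t] i g
      by (intro integral_mono) (auto simp: add.commute intro: order_trans[OF norm_triangle_ineq4])
    also have "\<dots> = (\<integral>x. cmod (g (t + x)) \<partial>lborel) + (\<integral>x. cmod (g x) \<partial>lborel)" using i g by simp
    also have "(\<integral>x. cmod (g (t + x)) \<partial>lborel) = (\<integral>x. cmod (g x) \<partial>lborel)" by (rule integral_lborel_translate) measurable
    finally show ?thesis by simp
  qed
  have Tlim: "(\<lambda>n. T (sqrt (e n) *\<^sub>R z)) \<longlonglongrightarrow> 0" for z
  proof -
    have "(\<lambda>n. sqrt (e n) *\<^sub>R z) \<longlonglongrightarrow> sqrt 0 *\<^sub>R z" by (intro tendsto_intros e)
    then show ?thesis
      using L1_translation_continuous[OF g] by (simp add: L1_translation_continuous_def T_def add.commute)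
  qed
  have i1: "integrable lborel (\<lambda>z. complex_of_real (gauss 1 z) * g (x + sqrt (e n) *\<^sub>R z))" for x n
  proof (rule Bochner_Integration.integrable_bound)
    show "integrable lborel (\<lambda>z. g (x + sqrt (e n) *\<^sub>R z))" using e(1)[of n] by (intro integrable_lborel_affine[OF g]) simp
    show "AE z in lborel. cmod (complex_of_real (gauss 1 z) * g (x + sqrt (e n) *\<^sub>R z)) \<le> cmod (g (x + sqrt (e n) *\<^sub>R z))"
      by (intro AE_I2) (simp add: norm_mult mult_left_le_one_le gauss_le_1)
  qed measurable
  have Gd: "G n x - g x = complex_of_real (1 / C) * (\<integral>z. complex_of_real (gauss 1 z) * (g (x + sqrt (e n) *\<^sub>R z) - g x) \<partial>lborel)" for n x
  proof -
    have "(\<integral>z. complex_of_real (gauss 1 z) * (g (x + sqrt (e n) *\<^sub>R z) - g x) \<partial>lborel)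
      = (\<integral>z. complex_of_real (gauss 1 z) * g (x + sqrt (e n) *\<^sub>R z) \<partial>lborel) - (\<integral>z. complex_of_real (gauss 1 z) * g x \<partial>(lborel :: 'a measure))"
      unfolding right_diff_distrib using gi by (intro Bochner_Integration.integral_diff i1) (simp add: complex_of_real_integrable_eq)
    also have "(\<integral>z. complex_of_real (gauss 1 z) * g x \<partial>(lborel :: 'a measure)) = complex_of_real C * g x"
      by (simp add: integral_gauss_1 C_def)
    finally show ?thesis using C by (simp add: G_def right_diff_distrib)
  qed
  have Gm[measurable]: "G n \<in> borel_measurable borel" for n
  proof -
    have "(\<lambda>(x, z). complex_of_real (gauss 1 z) * g (x + sqrt (e n) *\<^sub>R z)) \<in> borel_measurable (borel \<Otimes>\<^sub>M lborel)" by measurable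
    from sigma_finite_measure.borel_measurable_lebesgue_integral[OF sigma_finite_lborel this]
    have [measurable]: "(\<lambda>x. \<integral>z. complex_of_real (gauss 1 z) * g (x + sqrt (e n) *\<^sub>R z) \<partial>lborel) \<in> borel_measurable borel" .
    show ?thesis unfolding G_def by measurable
  qed
  have iT: "integrable lborel (\<lambda>z. gauss 1 z * T (sqrt (e n) *\<^sub>R z))" for n
  proof (rule Bochner_Integration.integrable_bound)
    show "integrable lborel (\<lambda>z::'a. gauss 1 z * (2 * (\<integral>x. cmod (g x) \<partial>lborel)))" using gi by (intro integrable_mult_left) auto
    show "AE z in lborel. norm (gauss 1 z * T (sqrt (e n) *\<^sub>R z)) \<le> norm (gauss 1 z * (2 * (\<integral>x. cmod (g x) \<partial>lborel)))"
      using T0 Tb by (intro AE_I2) (simp add: abs_mult mult_left_mono)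
  qed measurable
  have main: "(\<integral>\<^sup>+x. ennreal (cmod (G n x - g x)) \<partial>lborel) \<le> ennreal (1 / C * (\<integral>z. gauss 1 z * T (sqrt (e n) *\<^sub>R z) \<partial>lborel))" for n
  proof -
    have "(\<integral>\<^sup>+x. ennreal (cmod (G n x - g x)) \<partial>lborel)
      \<le> (\<integral>\<^sup>+x. ennreal (1 / C) * (\<integral>\<^sup>+z. ennreal (gauss 1 z * cmod (g (x + sqrt (e n) *\<^sub>R z) - g x)) \<partial>lborel) \<partial>lborel)"
    proof (rule nn_integral_mono)
      fix x
      have "integrable lborel (\<lambda>z. complex_of_real (gauss 1 z) * (g (x + sqrt (e n) *\<^sub>R z) - g x))"
        unfolding right_diff_distrib using gi by (intro Bochner_Integration.integrable_diff i1) (simp add: complex_of_real_integrable_eq)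
      from integral_norm_bound_ennreal[OF this]
      have "ennreal (cmod (\<integral>z. complex_of_real (gauss 1 z) * (g (x + sqrt (e n) *\<^sub>R z) - g x) \<partial>lborel))
        \<le> (\<integral>\<^sup>+z. ennreal (gauss 1 z * cmod (g (x + sqrt (e n) *\<^sub>R z) - g x)) \<partial>lborel)"
        by (simp add: norm_mult)
      then have "ennreal (1 / C) * ennreal (cmod (\<integral>z. complex_of_real (gauss 1 z) * (g (x + sqrt (e n) *\<^sub>R z) - g x) \<partial>lborel))
        \<le> ennreal (1 / C) * (\<integral>\<^sup>+z. ennreal (gauss 1 z * cmod (g (x + sqrt (e n) *\<^sub>R z) - g x)) \<partial>lborel)"
        by (intro mult_left_mono) auto
      moreover have "ennreal (cmod (G n x - g x)) = ennreal (1 / C) * ennreal (cmod (\<integral>z. complex_of_real (gauss 1 z) * (g (x + sqrt (e n) *\<^sub>R z) - g x) \<partial>lborel))"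
        unfolding Gd norm_mult cC by (rule ennreal_mult) (use C in auto)
      ultimately show "ennreal (cmod (G n x - g x)) \<le> ennreal (1 / C) * (\<integral>\<^sup>+z. ennreal (gauss 1 z * cmod (g (x + sqrt (e n) *\<^sub>R z) - g x)) \<partial>lborel)"
        by simp
    qed
    also have "\<dots> = ennreal (1 / C) * (\<integral>\<^sup>+x. (\<integral>\<^sup>+z. ennreal (gauss 1 z * cmod (g (x + sqrt (e n) *\<^sub>R z) - g x)) \<partial>lborel) \<partial>lborel)"
      by (rule nn_integral_cmult) measurable
    also have "(\<integral>\<^sup>+x. (\<integral>\<^sup>+z. ennreal (gauss 1 z * cmod (g (x + sqrt (e n) *\<^sub>R z) - g x)) \<partial>lborel) \<partial>lborel)
      = (\<integral>\<^sup>+z. (\<integral>\<^sup>+x. ennreal (gauss 1 z * cmod (g (x + sqrt (e n) *\<^sub>R z) - g x)) \<partial>lborel) \<partial>lborel)"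
      by (rule lborel_pair.Fubini'[symmetric]) measurable
    also have "\<dots> = (\<integral>\<^sup>+z. ennreal (gauss 1 z * T (sqrt (e n) *\<^sub>R z)) \<partial>lborel)"
    proof (rule nn_integral_cong)
      fix z :: 'a
      show "(\<integral>\<^sup>+x. ennreal (gauss 1 z * cmod (g (x + sqrt (e n) *\<^sub>R z) - g x)) \<partial>lborel) = ennreal (gauss 1 z * T (sqrt (e n) *\<^sub>R z))"
        unfolding ennreal_mult[OF gauss_nonneg T0] Tn
        by (subst nn_integral_cmult[symmetric]) (auto simp: ennreal_mult)
    qed
    also have "\<dots> = ennreal (\<integral>z. gauss 1 z * T (sqrt (e n) *\<^sub>R z) \<partial>lborel)"
      by (rule nn_integral_eq_integral[OF iT]) (simp add: T0)
    finally show ?thesis using C by (simp add: ennreal_mult[symmetric] T0)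
  qed
  show I: "integrable lborel (\<lambda>x. G n x - g x)" for n
    unfolding integrable_iff_bounded using main[of n] by (auto intro: le_less_trans)
  have "(\<lambda>n. \<integral>z. gauss 1 z * T (sqrt (e n) *\<^sub>R z) \<partial>lborel) \<longlonglongrightarrow> (\<integral>z. gauss 1 z * 0 \<partial>(lborel :: 'a measure))"
  proof (rule integral_dominated_convergence)
    show "integrable lborel (\<lambda>z::'a. gauss 1 z * (2 * (\<integral>x. cmod (g x) \<partial>lborel)))" using gi by (intro integrable_mult_left) auto
    show "AE z in lborel. (\<lambda>n. gauss 1 z * T (sqrt (e n) *\<^sub>R z)) \<longlonglongrightarrow> gauss 1 z * 0"
      by (intro AE_I2 tendsto_intros Tlim)
    show "AE z in lborel. norm (gauss 1 z * T (sqrt (e n) *\<^sub>R z)) \<le> gauss 1 z * (2 * (\<integral>x. cmod (g x) \<partial>lborel))" for n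
      using T0 Tb by (intro AE_I2) (simp add: abs_mult mult_left_mono)
  qed measurable
  then have "(\<lambda>n. 1 / C * (\<integral>z. gauss 1 z * T (sqrt (e n) *\<^sub>R z) \<partial>lborel)) \<longlonglongrightarrow> 1 / C * 0"
    by (intro tendsto_mult tendsto_const) simp
  then have lim: "(\<lambda>n. 1 / C * (\<integral>z. gauss 1 z * T (sqrt (e n) *\<^sub>R z) \<partial>lborel)) \<longlonglongrightarrow> 0" by simp
  show "(\<lambda>n. \<integral>x. cmod (G n x - g x) \<partial>lborel) \<longlonglongrightarrow> 0"
  proof (rule tendsto_sandwich[OF _ _ tendsto_const lim])
    show "eventually (\<lambda>n. (\<integral>x. cmod (G n x - g x) \<partial>lborel) \<le> 1 / C * (\<integral>z. gauss 1 z * T (sqrt (e n) *\<^sub>R z) \<partial>lborel)) sequentially"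
    proof (rule always_eventually, rule allI)
      fix n
      have "ennreal (\<integral>x. cmod (G n x - g x) \<partial>lborel) \<le> ennreal (1 / C * (\<integral>z. gauss 1 z * T (sqrt (e n) *\<^sub>R z) \<partial>lborel))"
        using main[of n] I[of n] by (subst nn_integral_eq_integral[symmetric]) auto
      then show "(\<integral>x. cmod (G n x - g x) \<partial>lborel) \<le> 1 / C * (\<integral>z. gauss 1 z * T (sqrt (e n) *\<^sub>R z) \<partial>lborel)"
        using C T0 by (subst (asm) ennreal_le_iff) (auto intro!: mult_nonneg_nonneg integral_nonneg)
    qed
  qed auto
qed

text \<open>Expressed through \<open>fourier\<close> at the reflected point, so that continuity and
  the L2 bounds carry over.\<close>

definition inverse_fourier :: "('a::euclidean_space \<Rightarrow> complex) \<Rightarrow> 'a \<Rightarrow> complex" where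
  "inverse_fourier g x = complex_of_real (1 / (2 * pi) ^ DIM('a)) * fourier g (- x)"

lemma L2_sq_reflect:
  assumes "f \<in> borel_measurable borel" shows "L2_sq (\<lambda>x. f (- x)) = L2_sq f"
  unfolding L2_sq_def using assms by (intro nn_integral_lborel_reflect) measurable

lemma continuous_inverse_fourier:
  fixes g :: "'a::euclidean_space \<Rightarrow> complex"
  assumes "integrable lborel g" shows "continuous_on UNIV (inverse_fourier g)"
  unfolding inverse_fourier_def[abs_def]
  by (intro continuous_intros continuous_on_compose2[OF continuous_fourier[OF assms]]) auto

lemma inverse_fourier_in_L2:
  fixes g :: "'a::euclidean_space \<Rightarrow> complex"
  assumes "integrable lborel g" "g \<in> L2_fun" shows "inverse_fourier g \<in> L2_fun"
proof -
  have m[measurable]: "fourier g \<in> borel_measurable borel" by (rule fourier_measurable[OF assms(1)])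
  have "(\<lambda>x. fourier g (- x)) \<in> L2_fun"
    using fourier_in_L2[OF assms] L2_sq_reflect[OF m] by (auto simp: L2_fun_iff)
  then show ?thesis unfolding inverse_fourier_def[abs_def] by (rule L2_fun_cmult)
qed

text \<open>The function \<open>u\<close> need not be integrable, so it is damped by Gaussians. By
  \<open>gauss_convolution\<close> the transforms of the damped functions are Gaussian averages of
  \<open>g\<close>.\<close>

lemma is_fourier_L2_inverse_fourier:
  fixes g :: "'a::euclidean_space \<Rightarrow> complex"
  assumes g: "integrable lborel g" "g \<in> L2_fun"
  shows "is_fourier_L2 (inverse_fourier g) g"
proof -
  define u where "u = inverse_fourier g"
  have [measurable]: "g \<in> borel_measurable borel" using borel_measurable_integrable[OF g(1)] by simp
  have uL: "u \<in> L2_fun" unfolding u_def by (rule inverse_fourier_in_L2[OF g])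
  have um[measurable]: "u \<in> borel_measurable borel" by (rule L2_measurable[OF uL])
  define C where "C = (2 * pi) powr (real DIM('a) / 2)"
  have C: "C > 0" by (simp add: C_def)
  have C2: "(2 * pi) ^ DIM('a) = C * C"
    by (simp add: C_def powr_add[symmetric] powr_realpow)
  define e where "e = (\<lambda>n::nat. 1 / real (Suc n))"
  have e: "e n > 0" for n by (simp add: e_def)
  have e0: "e \<longlonglongrightarrow> 0" unfolding e_def using LIMSEQ_inverse_real_of_nat by (simp add: inverse_eq_divide)
  define F where "F = (\<lambda>n x. u x * complex_of_real (gauss (e n) x))"
  have Fm[measurable]: "F n \<in> borel_measurable borel" for n unfolding F_def by measurable
  have Fle: "cmod (F n x) \<le> cmod (u x)" for n x
    using less_imp_le[OF e[of n]] by (simp add: F_def norm_mult mult_right_le_one_le gauss_le_1)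
  have ig: "integrable lborel (\<lambda>x::'a. complex_of_real (gauss (e n) x))" for n
    using integrable_gauss[OF e[of n], where 'a = 'a] by (simp add: complex_of_real_integrable_eq)
  define B where "B = (1 / (2 * pi) ^ DIM('a)) * (\<integral>x. cmod (g x) \<partial>lborel)"
  have ub: "cmod (u x) \<le> B" for x
  proof -
    have "cmod (u x) = (1 / (2 * pi) ^ DIM('a)) * cmod (fourier g (- x))"
      unfolding u_def inverse_fourier_def norm_mult by (simp add: norm_divide norm_power norm_mult)
    also have "\<dots> \<le> B" unfolding B_def by (intro mult_left_mono fourier_bound g) simp
    finally show ?thesis .
  qed
  have FI: "integrable lborel (F n)" for n
  proof (rule Bochner_Integration.integrable_bound)
    show "integrable lborel (\<lambda>x::'a. B * gauss (e n) x)" by (intro integrable_mult_right integrable_gauss e)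
    have "0 \<le> B" using ub[of 0] norm_ge_zero order_trans by blast
    then show "AE x in lborel. cmod (F n x) \<le> norm (B * gauss (e n) x)"
      using ub by (intro AE_I2) (simp add: F_def norm_mult abs_mult mult_right_mono)
  qed measurable
  have FL: "F n \<in> L2_fun" for n
  proof -
    have "L2_sq (F n) \<le> L2_sq u" unfolding L2_sq_def by (intro nn_integral_mono ennreal_leI power_mono Fle) auto
    then show ?thesis using uL by (auto simp: L2_fun_iff intro: le_less_trans)
  qed
  have Fl: "(\<lambda>n. F n x) \<longlonglongrightarrow> u x" for x
  proof -
    have "(\<lambda>n. F n x) \<longlonglongrightarrow> u x * complex_of_real (exp (- 0 * (norm x)\<^sup>2 / 2))"
      unfolding F_def gauss_def by (intro tendsto_intros e0) auto
    then show ?thesis by simp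
  qed
  have lim: "L2_tendsto F u" by (rule L2_tendsto_dominated[OF uL Fm Fl Fle])
  have CF: "L2_Cauchy F" by (rule L2_tendsto_Cauchy[OF Fm um lim])
  have CF': "L2_Cauchy (\<lambda>n. fourier (F n))" by (rule L2_Cauchy_fourier[OF FI FL CF])
  have FF: "fourier (F n) \<eta> = complex_of_real (1 / C) * (\<integral>z. complex_of_real (gauss 1 z) * g (\<eta> + sqrt (e n) *\<^sub>R z) \<partial>lborel)" for n \<eta>
  proof -
    let ?k = "\<lambda>x \<xi>. exp (- \<i> * complex_of_real ((\<eta> - \<xi>) \<bullet> x))"
    have km: "(\<lambda>(x::'a, \<xi>). ?k x \<xi>) \<in> borel_measurable (borel \<Otimes>\<^sub>M borel)"
      unfolding borel_prod split_beta by (intro borel_measurable_continuous_onI continuous_intros)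
    have "fourier (F n) \<eta> = (\<integral>x. complex_of_real (1 / (2 * pi) ^ DIM('a)) * (complex_of_real (gauss (e n) x) * (\<integral>\<xi>. g \<xi> * ?k x \<xi> \<partial>lborel)) \<partial>lborel)"
      unfolding fourier_def[of "F n"]
    proof (rule Bochner_Integration.integral_cong[OF refl])
      fix x
      have "exp (- \<i> * complex_of_real (\<eta> \<bullet> x)) * fourier g (- x) = (\<integral>\<xi>. exp (- \<i> * complex_of_real (\<eta> \<bullet> x)) * (exp (- \<i> * complex_of_real (- x \<bullet> \<xi>)) * g \<xi>) \<partial>lborel)"
        unfolding fourier_def by simp
      also have "\<dots> = (\<integral>\<xi>. g \<xi> * ?k x \<xi> \<partial>lborel)"
      proof (rule Bochner_Integration.integral_cong[OF refl])
        fix \<xi>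
        have "?k x \<xi> = exp (- \<i> * complex_of_real (\<eta> \<bullet> x)) * exp (- \<i> * complex_of_real (- x \<bullet> \<xi>))"
          unfolding exp_add[symmetric] by (simp add: inner_diff_left inner_commute algebra_simps)
        then show "exp (- \<i> * complex_of_real (\<eta> \<bullet> x)) * (exp (- \<i> * complex_of_real (- x \<bullet> \<xi>)) * g \<xi>) = g \<xi> * ?k x \<xi>" by simp
      qed
      finally have eq: "exp (- \<i> * complex_of_real (\<eta> \<bullet> x)) * fourier g (- x) = (\<integral>\<xi>. g \<xi> * ?k x \<xi> \<partial>lborel)" .
      have "a * (b * c * d) = b * (d * (a * c))" for a b c d :: complex by (simp only: mult_ac)
      then show "exp (- \<i> * complex_of_real (\<eta> \<bullet> x)) * F n x
        = complex_of_real (1 / (2 * pi) ^ DIM('a)) * (complex_of_real (gauss (e n) x) * (\<integral>\<xi>. g \<xi> * ?k x \<xi> \<partial>lborel))"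
        unfolding F_def u_def inverse_fourier_def eq[symmetric] .
    qed
    also have "\<dots> = complex_of_real (1 / (2 * pi) ^ DIM('a)) * (\<integral>x. complex_of_real (gauss (e n) x) * (\<integral>\<xi>. g \<xi> * ?k x \<xi> \<partial>lborel) \<partial>lborel)"
      by (rule integral_mult_right_zero)
    also have "(\<integral>x. complex_of_real (gauss (e n) x) * (\<integral>\<xi>. g \<xi> * ?k x \<xi> \<partial>lborel) \<partial>lborel)
      = (\<integral>\<xi>. g \<xi> * (\<integral>x. complex_of_real (gauss (e n) x) * ?k x \<xi> \<partial>lborel) \<partial>lborel)"
      by (rule fubini_kernel[OF ig g(1) km, of 1]) simp
    also have "\<dots> = (\<integral>\<xi>. g \<xi> * fourier (\<lambda>x. complex_of_real (gauss (e n) x)) (\<eta> - \<xi>) \<partial>lborel)"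
      unfolding fourier_def by (simp add: mult.commute)
    also have "\<dots> = complex_of_real C * (\<integral>z. complex_of_real (gauss 1 z) * g (\<eta> + sqrt (e n) *\<^sub>R z) \<partial>lborel)"
      unfolding C_def by (rule gauss_convolution[OF _ e]) measurable
    finally show ?thesis unfolding C2 using C by simp
  qed
  \<comment> \<open>The averages tend to \<open>g\<close> in L1, whereas the definition asks for L2.
    A subsequence converges almost everywhere, and together with the Cauchy property in L2 this
    identifies the L2 limit as \<open>g\<close>.\<close>
  have "\<exists>r::nat \<Rightarrow> nat. strict_mono r \<and> (AE x in lborel. (\<lambda>n. fourier (F (r n)) x - g x) \<longlonglongrightarrow> 0)"
  proof (rule tendsto_L1_AE_subseq[of lborel "\<lambda>n x. fourier (F n) x - g x"])
    show "integrable lborel (\<lambda>x. fourier (F n) x - g x)" for n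
      unfolding FF C_def by (rule gauss_approx_identity_L1(1)[OF g(1) e e0])
    show "(\<lambda>n. \<integral>x. cmod (fourier (F n) x - g x) \<partial>lborel) \<longlonglongrightarrow> 0"
      unfolding FF C_def by (rule gauss_approx_identity_L1(2)[OF g(1) e e0])
  qed
  then obtain r :: "nat \<Rightarrow> nat" where r: "strict_mono r" "AE x in lborel. (\<lambda>n. fourier (F (r n)) x - g x) \<longlonglongrightarrow> 0" by blast
  from r(2) have "AE x in lborel. (\<lambda>n. fourier (F (r n)) x) \<longlonglongrightarrow> g x"
    by eventually_elim (simp add: LIM_zero_iff)
  then have "L2_tendsto (\<lambda>n. fourier (F n)) g"
    by (intro L2_Cauchy_AE_limit[OF _ CF', of r] seq_suble[OF r(1)] fourier_measurable FI)
  then show ?thesis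
    using uL g(2) FI FL lim unfolding is_fourier_L2_def u_def[symmetric]
    by (auto simp: L1_fun_def intro!: exI[of _ F])
qed

text \<open>The set where the functions differ is open and null, hence empty.\<close>

lemma continuous_AE_eq:
  fixes f g :: "'a::euclidean_space \<Rightarrow> 'b::real_normed_vector"
  assumes f: "continuous_on UNIV f" and g: "continuous_on UNIV g" and ae: "AE x in lborel. f x = g x"
  shows "f = g"
proof -
  let ?U = "{x. f x \<noteq> g x}"
  have "open ?U" by (rule open_Collect_neq[OF f g])
  moreover have "negligible ?U"
  proof -
    have "emeasure lborel ?U = 0"
      using ae \<open>open ?U\<close> by (subst (asm) AE_iff_measurable[OF _ refl]) auto
    then show ?thesis using \<open>open ?U\<close> by (intro null_sets_completionI[THEN negligible_iff_null_sets[THEN iffD2]]) auto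
  qed
  ultimately have "?U = {}" using open_not_negligible by blast
  then show ?thesis by auto
qed

lemma fourier_inversion:
  fixes u g :: "'a::euclidean_space \<Rightarrow> complex"
  assumes u: "continuous_on UNIV u" and ug: "is_fourier_L2 u g" and g: "integrable lborel g"
  shows "u = inverse_fourier g"
proof (rule continuous_AE_eq[OF u continuous_inverse_fourier[OF g]])
  have "g \<in> L2_fun" using ug by (simp add: is_fourier_L2_def)
  then show "AE x in lborel. u x = inverse_fourier g x"
    using is_fourier_L2_unique[OF ug is_fourier_L2_inverse_fourier[OF g]] by simp
qed

section \<open>Gasper's sum of squares\<close>

text \<open>In hypergeometric notation \<open>(-1) ^ n * real (k choose n)\<close> is (-k)_n / n!,
  the factor \<open>(a + 2 * real n) / a\<close> is the very-well-poised pair (1 + a/2)_n / (a/2)_n,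
  and the quotient of the two symbols with base \<open>1 + a\<close> is 1 / (1 + a + k)_n. The sum
  is thus a terminating 5F4 at 1.\<close>

lemma dougall_5F4:
  fixes a b c :: real
  assumes a: "a > 0" and ab: "1 + a - b > 0" and ac: "1 + a - c > 0"
  defines "T \<equiv> \<lambda>k n. (-1) ^ n * real (k choose n) * pochhammer a n * (a + 2 * real n) * pochhammer b n
      * pochhammer c n * pochhammer (1 + a) k
      / (pochhammer (1 + a - b) n * pochhammer (1 + a - c) n * a * pochhammer (1 + a) (k + n))"
  shows "(\<Sum>n\<le>k. T k n) = pochhammer (1 + a) k * pochhammer (1 + a - b - c) k
      / (pochhammer (1 + a - b) k * pochhammer (1 + a - c) k)"
proof (induction k)
  case 0
  show ?case using a by (simp add: T_def)
next
  case (Suc k)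
  \<comment> \<open>Zeilberger's algorithm: \<open>A * T (Suc k) n - B * T k n\<close> telescopes in \<open>n\<close> with certificate \<open>G\<close>.\<close>
  define A where "A = (1 + a - b + real k) * (1 + a - c + real k)"
  define B where "B = (1 + a + real k) * (1 + a - b - c + real k)"
  define G where "G = (\<lambda>m. (a + real k + 1) * ((-1) ^ m * real (k choose m) * pochhammer a (Suc m)
      * pochhammer b (Suc m) * pochhammer c (Suc m) * pochhammer (1 + a) k
      / (pochhammer (1 + a - b) m * pochhammer (1 + a - c) m * a * pochhammer (1 + a) (Suc (k + m)))))"
  have pos: "pochhammer (1 + a - b) n > 0" "pochhammer (1 + a - c) n > 0"
      "pochhammer (1 + a) n > 0" for n
    using a ab ac by (auto intro!: pochhammer_pos)
  have "(\<Sum>n\<le>m. A * T (Suc k) n - B * T k n) = G m" for m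
  proof (induction m)
    case 0
    have "A - B = b * c" unfolding A_def B_def by algebra
    moreover have "T (Suc k) 0 = 1" "T k 0 = 1"
      using a pos(3)[of k] pos(3)[of "Suc k"] by (simp_all add: T_def)
    moreover have "G 0 = b * c"
      using a pos(3)[of k] by (simp add: G_def pochhammer_Suc add.commute divide_simps)
    ultimately show ?case by simp
  next
    case (Suc m)
    \<comment> \<open>All three binomials of the recurrence are polynomial multiples of
      \<open>D\<close>, for m > k as well. After \<open>P\<close> and \<open>D\<close> are factored
      out, the certificate is the polynomial identity \<open>poly\<close>.\<close>
    define D where "D = real (k choose m) / (real m + 1)"
    have C: "real (k choose m) = (real m + 1) * D" by (simp add: D_def)
    have "real (Suc m) * real (k choose Suc m) = (real k - real m) * real (k choose m)"
    proof (cases "m \<le> k")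
      case True
      have "Suc m * (k choose Suc m) = (k - m) * (k choose m)"
        using binomial_absorb_comp[of k m] binomial_absorption[of m "k - 1"]
        by (metis Suc_times_binomial binomial_absorb_comp binomial_absorption)
      then have "real (Suc m * (k choose Suc m)) = real ((k - m) * (k choose m))" by simp
      then show ?thesis using True by (simp add: of_nat_diff distrib_right)
    next
      case False then show ?thesis by (simp add: binomial_eq_0)
    qed
    then have C': "real (k choose Suc m) = (real k - real m) * D"
      by (simp add: D_def field_simps)
    have C'': "real (Suc k choose Suc m) = (real k + 1) * D"
      using C C' by (simp add: algebra_simps)
    define P where "P = (-1) ^ m * pochhammer a (Suc m) * pochhammer b (Suc m) * pochhammer c (Suc m)
        * pochhammer (1 + a) k
        / (pochhammer (1 + a - b) m * pochhammer (1 + a - c) m * a * pochhammer (1 + a) (Suc (k + m)))"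
    define u where "u = 1 + a - b + real m"
    define v where "v = 1 + a - c + real m"
    define w where "w = a + real k + real m + 2"
    have uvw: "u > 0" "v > 0" "w > 0" using a ab ac by (auto simp: u_def v_def w_def)
    note nz = pos(1)[of m] pos(2)[of m] pos(3)[of "Suc (k + m)"]
    have pu: "pochhammer (1 + a - b) (Suc m) = pochhammer (1 + a - b) m * u"
      "pochhammer (1 + a - c) (Suc m) = pochhammer (1 + a - c) m * v"
      by (simp_all add: pochhammer_Suc u_def v_def)
    have pw: "pochhammer (1 + a) (Suc (Suc (k + m))) = pochhammer (1 + a) (Suc (k + m)) * w"
      by (subst pochhammer_Suc) (simp add: w_def algebra_simps)
    have pk: "pochhammer (1 + a) (Suc k) = pochhammer (1 + a) k * (1 + a + real k)"
      by (simp add: pochhammer_Suc)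
    have pa: "pochhammer x (Suc (Suc m)) = pochhammer x (Suc m) * (x + real m + 1)" for x :: real
      by (subst pochhammer_Suc) (simp add: algebra_simps)
    have T1: "T (Suc k) (Suc m) = - P * ((real k + 1) * D) * (a + 2 * real m + 2) * (1 + a + real k) / (u * v * w)"
      unfolding T_def C'' P_def add_Suc add_Suc_right pu pw pk using nz uvw a
      by (simp add: divide_simps)
    have T2: "T k (Suc m) = - P * ((real k - real m) * D) * (a + 2 * real m + 2) / (u * v)"
      unfolding T_def C' P_def add_Suc add_Suc_right pu using nz uvw a
      by (simp add: divide_simps)
    have G2: "G (Suc m) = - (a + real k + 1) * P * ((real k - real m) * D) * ((a + real m + 1) * (b + real m + 1) * (c + real m + 1)) / (u * v * w)"
      unfolding G_def C' P_def add_Suc add_Suc_right pu pw pa using nz uvw a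
      by (simp add: divide_simps) (simp add: algebra_simps)
    have G1: "G m = (a + real k + 1) * P * ((real m + 1) * D)"
      unfolding G_def C P_def using nz a by (simp add: divide_simps)
    have poly: "A * (- P * ((real k + 1) * D) * (a + 2 * real m + 2) * (1 + a + real k))
        - B * (- P * ((real k - real m) * D) * (a + 2 * real m + 2)) * w
      = - (a + real k + 1) * P * ((real k - real m) * D) * ((a + real m + 1) * (b + real m + 1) * (c + real m + 1))
        - (a + real k + 1) * P * ((real m + 1) * D) * (u * v * w)"
      unfolding A_def B_def u_def v_def w_def by algebra
    have "A * T (Suc k) (Suc m) - B * T k (Suc m) = G (Suc m) - G m"
    proof -
      have "(A * T (Suc k) (Suc m) - B * T k (Suc m)) * (u * v * w) = (G (Suc m) - G m) * (u * v * w)"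
      proof -
        have "A * T (Suc k) (Suc m) * (u * v * w) = A * (- P * ((real k + 1) * D) * (a + 2 * real m + 2) * (1 + a + real k))"
          unfolding T1 using uvw by simp
        moreover have "B * T k (Suc m) * (u * v * w) = B * (- P * ((real k - real m) * D) * (a + 2 * real m + 2)) * w"
          unfolding T2 using uvw by simp
        moreover have "G (Suc m) * (u * v * w) = - (a + real k + 1) * P * ((real k - real m) * D) * ((a + real m + 1) * (b + real m + 1) * (c + real m + 1))"
          unfolding G2 using uvw by simp
        moreover have "G m * (u * v * w) = (a + real k + 1) * P * ((real m + 1) * D) * (u * v * w)"
          unfolding G1 by simp
        ultimately show ?thesis using poly by (simp only: left_diff_distrib)
      qed
      then show ?thesis using uvw by simp
    qed
    then show ?case using Suc.IH by simp
  qed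
  \<comment> \<open>The telescoped sum ends in \<open>G (Suc k)\<close>, which contains
    \<open>k choose Suc k = 0\<close>.\<close>
  from this[of "Suc k"] have "(\<Sum>n\<le>Suc k. A * T (Suc k) n - B * T k n) = 0"
    by (simp add: G_def)
  moreover have "T k (Suc k) = 0" by (simp add: T_def)
  ultimately have "A * (\<Sum>n\<le>Suc k. T (Suc k) n) = B * (\<Sum>n\<le>k. T k n)"
    by (simp add: sum_subtractf sum_distrib_left distrib_left)
  moreover have "A > 0" using ab ac by (simp add: A_def add_pos_nonneg)
  ultimately have "(\<Sum>n\<le>Suc k. T (Suc k) n) = B * (\<Sum>n\<le>k. T k n) / A" by (simp add: field_simps)
  then show ?case unfolding Suc.IH A_def B_def by (simp add: pochhammer_Suc ac_simps)
qed

text \<open>Thus \<open>J\<^sub>\<nu> z = (z / 2) powr \<nu> / Gamma (\<nu> + 1) * bessel_series \<nu> (z\<^sup>2 / 4)\<close>.\<close>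

definition bessel_series :: "real \<Rightarrow> real \<Rightarrow> real" where
  "bessel_series \<nu> x = (\<Sum>k. (-x) ^ k / (fact k * pochhammer (\<nu> + 1) k))"

section \<open>Squares of Bessel series and bounds for their coefficients\<close>

lemma pochhammer_ge_1: "pochhammer (x + 1 :: real) k \<ge> 1" if "x \<ge> 0"
proof (induction k)
  case (Suc k)
  have "1 * 1 \<le> pochhammer (x + 1) k * (x + 1 + real k)"
    using Suc that by (intro mult_mono) auto
  then show ?case by (simp add: pochhammer_Suc)
qed simp

lemma pochhammer_mono: "0 < x \<Longrightarrow> x \<le> y \<Longrightarrow> pochhammer x k \<le> pochhammer (y :: real) k"
  by (induction k) (auto simp: pochhammer_Suc intro!: mult_mono pochhammer_nonneg)

lemma summable_exp_bound:
  fixes f :: "nat \<Rightarrow> real"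
  assumes "\<And>k. \<bar>f k\<bar> \<le> C ^ k / fact k"
  shows "summable (\<lambda>k. \<bar>f k\<bar>)"
proof (rule summable_comparison_test')
  show "summable (\<lambda>k. C ^ k / fact k)"
    using summable_exp[of C] by (simp add: field_simps)
  show "norm \<bar>f k\<bar> \<le> C ^ k / fact k" if "k \<ge> 0" for k using assms by simp
qed

lemma bessel_term_bound:
  fixes \<nu> x :: real
  assumes "\<nu> \<ge> 0"
  shows "\<bar>(-x) ^ k / (fact k * pochhammer (\<nu> + 1) k)\<bar> \<le> \<bar>x\<bar> ^ k / fact k"
proof -
  have "1 \<le> pochhammer (\<nu> + 1) k" using pochhammer_ge_1[OF assms] .
  then have "\<bar>x\<bar> ^ k / (fact k * pochhammer (\<nu> + 1) k) \<le> \<bar>x\<bar> ^ k / (fact k * 1)"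
    by (intro divide_left_mono mult_left_mono) auto
  then show ?thesis using \<open>1 \<le> pochhammer (\<nu> + 1) k\<close> by (simp add: abs_mult power_abs)
qed

lemma summable_bessel:
  fixes \<nu> x :: real
  assumes "\<nu> \<ge> 0"
  shows "summable (\<lambda>k. \<bar>(-x) ^ k / (fact k * pochhammer (\<nu> + 1) k)\<bar>)"
  using bessel_term_bound[OF assms] by (rule summable_exp_bound)

definition bessel_sq_coeff :: "real \<Rightarrow> nat \<Rightarrow> real" where
  "bessel_sq_coeff \<nu> k = pochhammer (2 * \<nu> + real k + 1) k / (fact k * (pochhammer (\<nu> + 1) k)\<^sup>2)"

text \<open>With p = (\<nu> + 1)_k, multiplying by p^2 turns each summand into a product of two
  generalised binomials with upper entry \<nu> + k, and the sum is Vandermonde's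
  convolution.\<close>

lemma bessel_cauchy_coeff:
  assumes "\<nu> \<ge> 0"
  shows "(\<Sum>i\<le>k. 1 / (fact i * pochhammer (\<nu> + 1) i) * (1 / (fact (k - i) * pochhammer (\<nu> + 1) (k - i))))
    = bessel_sq_coeff \<nu> k"
proof -
  have pos: "pochhammer (\<nu> + 1) n > 0" for n using assms by (intro pochhammer_pos) simp
  define p where "p = pochhammer (\<nu> + 1) k"
  have p: "p > 0" using pos p_def by auto
  have g: "((\<nu> + real k) gchoose i) = p / (fact i * pochhammer (\<nu> + 1) (k - i))" if "i \<le> k" for i
  proof -
    have "p = pochhammer (\<nu> + 1) (k - i) * pochhammer (\<nu> + 1 + real (k - i)) i"
      unfolding p_def using pochhammer_product'[of "\<nu> + 1" "k - i" i] that by simp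
    then show ?thesis using pos[of "k - i"] that
      by (simp add: gbinomial_pochhammer' of_nat_diff add_ac field_simps)
  qed
  have "(\<Sum>i\<le>k. 1 / (fact i * pochhammer (\<nu> + 1) i) * (1 / (fact (k - i) * pochhammer (\<nu> + 1) (k - i))))
    = (\<Sum>i\<le>k. ((\<nu> + real k) gchoose i) * ((\<nu> + real k) gchoose (k - i)) / p\<^sup>2)"
  proof (intro sum.cong refl)
    fix i assume "i \<in> {..k}"
    then have "i \<le> k" by simp
    then show "1 / (fact i * pochhammer (\<nu> + 1) i) * (1 / (fact (k - i) * pochhammer (\<nu> + 1) (k - i)))
       = ((\<nu> + real k) gchoose i) * ((\<nu> + real k) gchoose (k - i)) / p\<^sup>2"
      using g[of i] g[of "k - i"] p pos[of i] pos[of "k - i"]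
      by (simp add: power2_eq_square)
  qed
  also have "\<dots> = ((2 * \<nu> + 2 * real k) gchoose k) / p\<^sup>2"
    using gbinomial_Vandermonde[of "\<nu> + real k" "\<nu> + real k" k]
    by (simp add: atLeast0AtMost sum_divide_distrib[symmetric])
  also have "\<dots> = bessel_sq_coeff \<nu> k"
    by (simp add: gbinomial_pochhammer' bessel_sq_coeff_def p_def algebra_simps)
  finally show ?thesis .
qed

lemma bessel_sq_coeff_nonneg: "\<nu> \<ge> 0 \<Longrightarrow> bessel_sq_coeff \<nu> k \<ge> 0"
  unfolding bessel_sq_coeff_def by (intro divide_nonneg_nonneg pochhammer_nonneg) auto

text \<open>All Pochhammer factors are at least 1; dropping them leaves a row sum of binomial
  coefficients. The bound serves the absolute convergence of the double series in Gasper's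
  expansion.\<close>

lemma bessel_sq_coeff_bound:
  assumes "\<nu> \<ge> 0"
  shows "bessel_sq_coeff \<nu> k \<le> 2 ^ k / fact k"
proof -
  have ge: "pochhammer (\<nu> + 1) n \<ge> 1" for n using pochhammer_ge_1[OF assms] .
  have "bessel_sq_coeff \<nu> k = (\<Sum>i\<le>k. 1 / (fact i * pochhammer (\<nu> + 1) i) * (1 / (fact (k - i) * pochhammer (\<nu> + 1) (k - i))))"
    using bessel_cauchy_coeff[OF assms] by simp
  also have "\<dots> \<le> (\<Sum>i\<le>k. 1 / (fact i * 1) * (1 / (fact (k - i) * 1)))"
  proof (intro sum_mono mult_mono divide_left_mono mult_left_mono)
    fix i show "0 < fact i * pochhammer (\<nu> + 1) i * (fact i * 1)"
      "0 < fact (k-i) * pochhammer (\<nu> + 1) (k-i) * (fact (k-i) * 1)"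
      "0 \<le> 1 / (fact (k - i) * pochhammer (\<nu> + 1) (k - i))"
      using ge[of i] ge[of "k-i"] by auto
  qed (use ge in auto)
  also have "\<dots> = (\<Sum>i\<le>k. real (k choose i) / fact k)"
    by (intro sum.cong refl) (simp add: binomial_fact)
  also have "\<dots> = 2 ^ k / fact k"
    using choose_row_sum[of k] by (simp add: sum_divide_distrib[symmetric] flip: of_nat_sum)
  finally show ?thesis .
qed

lemma bessel_series_squared:
  assumes "\<nu> \<ge> 0"
  shows "(\<lambda>k. bessel_sq_coeff \<nu> k * (-x) ^ k) sums (bessel_series \<nu> x)\<^sup>2"
proof -
  let ?a = "\<lambda>k. (-x) ^ k / (fact k * pochhammer (\<nu> + 1) k)"
  have "summable (\<lambda>k. norm (?a k))" using summable_bessel[OF assms, of x] by simp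
  from Cauchy_product_sums[OF this this]
  have "(\<lambda>k. \<Sum>i\<le>k. ?a i * ?a (k - i)) sums (bessel_series \<nu> x * bessel_series \<nu> x)"
    by (simp add: bessel_series_def)
  moreover have "(\<Sum>i\<le>k. ?a i * ?a (k - i)) = bessel_sq_coeff \<nu> k * (-x) ^ k" for k
  proof -
    have "(\<Sum>i\<le>k. ?a i * ?a (k - i)) = (\<Sum>i\<le>k. (1 / (fact i * pochhammer (\<nu> + 1) i) * (1 / (fact (k - i) * pochhammer (\<nu> + 1) (k - i)))) * (-x) ^ k)"
    proof (intro sum.cong refl)
      fix i assume "i \<in> {..k}"
      then have "(-x) ^ i * (-x) ^ (k - i) = (-x) ^ k" by (simp flip: power_add)
      then show "?a i * ?a (k - i) = (1 / (fact i * pochhammer (\<nu> + 1) i) * (1 / (fact (k - i) * pochhammer (\<nu> + 1) (k - i)))) * (-x) ^ k"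
        by simp
    qed
    then show ?thesis unfolding sum_distrib_right[symmetric] bessel_cauchy_coeff[OF assms] .
  qed
  ultimately show ?thesis by (simp add: power2_eq_square)
qed

section \<open>Gasper's expansion of W\<close>

definition W_coeff :: "real \<Rightarrow> nat \<Rightarrow> real" where
  "W_coeff \<delta> k = pochhammer \<delta> k / (fact k * (pochhammer (3 * \<delta> / 2) k * pochhammer ((3 * \<delta> + 1) / 2) k))"

lemma W_fun_eq: "W_fun \<delta> r = (\<Sum>k. W_coeff \<delta> k * (- r\<^sup>2 / 4) ^ k)"
  by (simp add: W_fun_def hypergeom_def W_coeff_def)

text \<open>The coefficients in \<open>W r = (\<Sum>n. gasper_coeff \<delta> n * y ^ n * (bessel_series (\<delta> - 1/2 + n) y)\<^sup>2)\<close>, \<open>y = r\<^sup>2 / 16\<close>.\<close>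

definition gasper_coeff :: "real \<Rightarrow> nat \<Rightarrow> real" where
  "gasper_coeff \<delta> n = pochhammer (2 * \<delta> - 1) n * (2 * \<delta> - 1 + 2 * real n) * pochhammer (\<delta> / 2) n
      * pochhammer ((\<delta> - 1) / 2) n
      / (fact n * (2 * \<delta> - 1) * pochhammer (3 * \<delta> / 2) n * pochhammer ((3 * \<delta> + 1) / 2) n
         * (pochhammer (\<delta> + 1 / 2) n)\<^sup>2)"

lemma gasper_coeff_pos: "\<delta> > 1 \<Longrightarrow> gasper_coeff \<delta> n > 0"
  unfolding gasper_coeff_def
  by (intro divide_pos_pos mult_pos_pos pochhammer_pos zero_less_power) auto

lemma gasper_coeff_0 [simp]: "\<delta> > 1 \<Longrightarrow> gasper_coeff \<delta> 0 = 1"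
  by (simp add: gasper_coeff_def)

text \<open>Here 6 is 2 times 3: a power of 2 from comparing (2 \<delta> - 1)_n with (\<delta> +
  1/2)_n and a power of 3 from the linear factor by Bernoulli's inequality; the other quotients are
  at most 1.\<close>

lemma gasper_coeff_bound:
  assumes "\<delta> > 1"
  shows "gasper_coeff \<delta> n \<le> 6 ^ n / fact n"
proof -
  let ?p = "\<lambda>x. pochhammer x n :: real"
  have pos: "?p (3 * \<delta> / 2) > 0" "?p ((3 * \<delta> + 1) / 2) > 0" "?p (\<delta> / 2) > 0" "?p ((\<delta> - 1) / 2) > 0"
    "?p (2 * \<delta> - 1) > 0" using assms by (auto intro!: pochhammer_pos)
  have q: "?p (\<delta> + 1/2) \<ge> 1" using pochhammer_ge_1[of "\<delta> - 1/2" n] assms by (simp add: algebra_simps)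
  have 1: "?p (\<delta> / 2) / ?p (3 * \<delta> / 2) \<le> 1" "?p ((\<delta> - 1) / 2) / ?p ((3 * \<delta> + 1) / 2) \<le> 1"
    using pos assms by (auto intro!: pochhammer_mono)
  have 2: "?p (2 * \<delta> - 1) \<le> 2 ^ n * ?p (\<delta> + 1/2)"
  proof (induction n)
    case (Suc n)
    have "pochhammer (2 * \<delta> - 1) n * (2 * \<delta> - 1 + real n)
       \<le> (2 ^ n * pochhammer (\<delta> + 1/2) n) * (2 * (\<delta> + 1/2 + real n))"
      using Suc assms by (intro mult_mono) (auto intro!: mult_nonneg_nonneg pochhammer_nonneg)
    then show ?case by (simp add: pochhammer_Suc algebra_simps)
  qed simp
  have 3: "(2 * \<delta> - 1 + 2 * real n) / (2 * \<delta> - 1) \<le> 3 ^ n"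
  proof -
    have "1 + real n * 2 \<le> (1 + 2) ^ n" by (rule Bernoulli_inequality) simp
    moreover have "(2 * \<delta> - 1 + 2 * real n) / (2 * \<delta> - 1) \<le> 1 + real n * 2"
      using assms mult_nonneg_nonneg[of "real n" "\<delta> - 1"] by (simp add: field_simps)
    ultimately show ?thesis by simp
  qed
  have "gasper_coeff \<delta> n = (?p (2 * \<delta> - 1) / ?p (\<delta> + 1/2)) * (1 / ?p (\<delta> + 1/2))
      * ((2 * \<delta> - 1 + 2 * real n) / (2 * \<delta> - 1)) * (?p (\<delta> / 2) / ?p (3 * \<delta> / 2))
      * (?p ((\<delta> - 1) / 2) / ?p ((3 * \<delta> + 1) / 2)) / fact n"
    unfolding gasper_coeff_def power2_eq_square by simp
  also have "\<dots> \<le> 2 ^ n * 1 * 3 ^ n * 1 * 1 / fact n"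
    using 1 2 3 q pos assms by (intro divide_right_mono mult_mono) (auto simp: field_simps)
  also have "\<dots> = 6 ^ n / fact n" by (simp flip: power_mult_distrib)
  finally show ?thesis .
qed

text \<open>Dougall's sum with a = 2 \<delta> - 1, b = \<delta> / 2 and c = (\<delta> - 1) / 2: then
  1 + a - b and 1 + a - c are the lower parameters of W. The factor \<open>Q\<close> collects what
  does not depend on n.\<close>

lemma gasper_coefficient_identity:
  assumes "\<delta> > 1"
  shows "(\<Sum>n\<le>k. (-1) ^ n * gasper_coeff \<delta> n * bessel_sq_coeff (\<delta> - 1/2 + real n) (k - n))
    = 4 ^ k * W_coeff \<delta> k"
proof -
  define a where "a = 2 * \<delta> - 1"
  have pos: "pochhammer x n > 0" if "x > 0" for n and x :: real using that by (rule pochhammer_pos)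
  define Q where "Q = pochhammer (1 + a) (2 * k) / (pochhammer (\<delta> + 1/2) k ^ 2 * fact k * pochhammer (1 + a) k)"
  have "(-1) ^ n * gasper_coeff \<delta> n * bessel_sq_coeff (\<delta> - 1/2 + real n) (k - n)
    = Q * ((-1) ^ n * real (k choose n) * pochhammer a n * (a + 2 * real n) * pochhammer (\<delta>/2) n
      * pochhammer ((\<delta> - 1)/2) n * pochhammer (1 + a) k
      / (pochhammer (1 + a - \<delta>/2) n * pochhammer (1 + a - (\<delta> - 1)/2) n * a * pochhammer (1 + a) (k + n)))"
    if n: "n \<le> k" for n
  proof -
    have e: "1 + a - \<delta>/2 = 3 * \<delta> / 2" "1 + a - (\<delta> - 1)/2 = (3 * \<delta> + 1) / 2" by (simp_all add: a_def field_simps)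
    have 1: "pochhammer (\<delta> + 1/2) k = pochhammer (\<delta> + 1/2) n * pochhammer (\<delta> + 1/2 + real n) (k - n)"
      using pochhammer_product[OF n, of "\<delta> + 1/2"] by simp
    have "2 * k = (k + n) + (k - n)" using n by simp
    then have "pochhammer (1 + a) (2 * k) = pochhammer (1 + a) ((k + n) + (k - n))" by (rule arg_cong)
    then have 2: "pochhammer (1 + a) (2 * k) = pochhammer (1 + a) (k + n) * pochhammer (1 + a + real k + real n) (k - n)"
      unfolding pochhammer_product'[of "1 + a" "k + n" "k - n"] by (simp add: add_ac)
    have 3: "2 * (\<delta> - 1/2 + real n) + real (k - n) + 1 = 1 + a + real k + real n"
      using n by (simp add: a_def of_nat_diff)
    have 4: "\<delta> - 1/2 + real n + 1 = \<delta> + 1/2 + real n" by simp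
    have 5: "real (k choose n) = fact k / (fact n * fact (k - n))" using n by (simp add: binomial_fact)
    have p: "pochhammer (\<delta> + 1/2) n > 0" "pochhammer (\<delta> + 1/2 + real n) (k - n) > 0"
      "pochhammer (1 + a) (k + n) > 0" "pochhammer (1 + a) k > 0" "pochhammer (3 * \<delta> / 2) n > 0"
      "pochhammer ((3 * \<delta> + 1) / 2) n > 0" "a > 0"
      using assms by (auto intro!: pos simp: a_def)
    show ?thesis
      unfolding Q_def gasper_coeff_def bessel_sq_coeff_def a_def[symmetric] e 1 2 3 4 5
      using p by (simp add: divide_simps power2_eq_square)
  qed
  then have "(\<Sum>n\<le>k. (-1) ^ n * gasper_coeff \<delta> n * bessel_sq_coeff (\<delta> - 1/2 + real n) (k - n))
    = Q * (\<Sum>n\<le>k. ((-1) ^ n * real (k choose n) * pochhammer a n * (a + 2 * real n) * pochhammer (\<delta>/2) n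
      * pochhammer ((\<delta> - 1)/2) n * pochhammer (1 + a) k
      / (pochhammer (1 + a - \<delta>/2) n * pochhammer (1 + a - (\<delta> - 1)/2) n * a * pochhammer (1 + a) (k + n))))"
    unfolding sum_distrib_left by (intro sum.cong refl) auto
  also have "\<dots> = Q * (pochhammer (1 + a) k * pochhammer (1 + a - \<delta>/2 - (\<delta> - 1)/2) k
      / (pochhammer (1 + a - \<delta>/2) k * pochhammer (1 + a - (\<delta> - 1)/2) k))"
    using assms by (subst dougall_5F4) (auto simp: a_def field_simps)
  also have "\<dots> = 4 ^ k * W_coeff \<delta> k"
  proof -
    have e: "1 + a - \<delta>/2 = 3 * \<delta> / 2" "1 + a - (\<delta> - 1)/2 = (3 * \<delta> + 1) / 2"
      "1 + a - \<delta>/2 - (\<delta> - 1)/2 = \<delta> + 1/2" by (simp_all add: a_def field_simps)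
    have a: "1 + a = 2 * \<delta>" by (simp add: a_def)
    \<comment> \<open>Duplication brings in the upper parameter \<delta> of W; the remaining symbols
      with base \<delta> + 1/2 and 1 + a cancel.\<close>
    have d: "pochhammer (1 + a) (2 * k) = 4 ^ k * pochhammer \<delta> k * pochhammer (\<delta> + 1/2) k"
      unfolding a using pochhammer_double[of \<delta> k] by (simp add: power_mult)
    have p: "pochhammer (\<delta> + 1/2) k > 0" "pochhammer (1 + a) k > 0"
      using assms by (auto intro!: pos simp: a_def)
    show ?thesis
      unfolding Q_def e(3) unfolding e(1,2) d W_coeff_def using p by (simp add: power2_eq_square)
  qed
  finally show ?thesis .
qed

text \<open>Each square is expanded into its power series and the double series is summed along
  diagonals. Absolute convergence follows from domination by the product of the exponential series
  \<open>u\<close> and \<open>v\<close>.\<close>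

lemma W_sum_of_squares_lower:
  fixes \<delta> r :: real
  assumes \<delta>: "\<delta> > 1"
  defines "y \<equiv> r\<^sup>2 / 16"
  shows "(bessel_series (\<delta> - 1/2) y)\<^sup>2 + gasper_coeff \<delta> 1 * y * (bessel_series (\<delta> + 1/2) y)\<^sup>2 \<le> W_fun \<delta> r"
proof -
  have y: "y \<ge> 0" by (simp add: y_def)
  let ?q = "\<lambda>n m. bessel_sq_coeff (\<delta> - 1/2 + real n) m"
  define f where "f = (\<lambda>(n, m). gasper_coeff \<delta> n * y ^ n * (?q n m * (-y) ^ m))"
  define u where "u = (\<lambda>n. (6 * y) ^ n / fact n)"
  define v where "v = (\<lambda>n. (2 * y) ^ n / fact n)"
  have su: "summable (\<lambda>n. \<bar>u n\<bar>)" "summable (\<lambda>n. \<bar>v n\<bar>)"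
    using y unfolding u_def v_def
    by (intro summable_exp_bound[where C = "6 * y"] summable_exp_bound[where C = "2 * y"]; simp add: power_mult_distrib)+
  have "(\<lambda>n. norm (u n)) summable_on UNIV" "(\<lambda>n. norm (v n)) summable_on UNIV"
    using su by (simp_all add: summable_on_UNIV_nonneg_real_iff)
  then have "(\<lambda>p. norm (case p of (n, m) \<Rightarrow> u n * v m)) summable_on UNIV \<times> UNIV"
    by (subst Infinite_Sum.abs_summable_on_Sigma_iff)
      (auto simp: abs_mult infsum_cmult_right' intro!: summable_on_cmult_right summable_on_cmult_left)
  then have "(\<lambda>p. norm (f p)) summable_on UNIV \<times> UNIV"
  proof (rule Infinite_Sum.abs_summable_on_comparison_test)
    fix p :: "nat \<times> nat" obtain n m where p: "p = (n, m)" by (cases p)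
    have nn: "\<delta> - 1/2 + real n \<ge> 0" using \<delta> by simp
    have "norm (f p) = gasper_coeff \<delta> n * y ^ n * (?q n m * y ^ m)"
      using y gasper_coeff_pos[OF \<delta>, of n] bessel_sq_coeff_nonneg[OF nn, of m]
      by (simp add: p f_def abs_mult power_abs)
    also have "\<dots> \<le> (6 ^ n / fact n) * y ^ n * ((2 ^ m / fact m) * y ^ m)"
      using gasper_coeff_bound[OF \<delta>, of n] bessel_sq_coeff_bound[OF nn, of m] y
        bessel_sq_coeff_nonneg[OF nn, of m]
      by (intro mult_mono) auto
    also have "\<dots> = norm (case p of (n, m) \<Rightarrow> u n * v m)"
      using y by (simp add: p u_def v_def power_mult_distrib)
    finally show "norm (f p) \<le> norm (case p of (n, m) \<Rightarrow> u n * v m)" .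
  qed
  then have fs: "f summable_on UNIV \<times> UNIV" by (rule abs_summable_summable)
  have inner: "(\<Sum>\<^sub>\<infinity>m. f (n, m)) = gasper_coeff \<delta> n * y ^ n * (bessel_series (\<delta> - 1/2 + real n) y)\<^sup>2" for n
  proof -
    have nn: "\<delta> - 1/2 + real n \<ge> 0" using \<delta> by simp
    have s: "(\<lambda>m. f (n, m)) summable_on UNIV"
      using summable_on_Sigma_banach[of "\<lambda>n m. f (n, m)" UNIV "\<lambda>_. UNIV"] fs
        summable_on_SigmaD1[of "\<lambda>n m. f (n, m)" UNIV "\<lambda>_. UNIV" n] by simp
    have "(\<lambda>m. f (n, m)) sums (\<Sum>\<^sub>\<infinity>m. f (n, m))" using s
      by (intro has_sum_imp_sums has_sum_infsum)
    moreover have "(\<lambda>m. f (n, m)) sums (gasper_coeff \<delta> n * y ^ n * (bessel_series (\<delta> - 1/2 + real n) y)\<^sup>2)"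
      unfolding f_def prod.case by (intro sums_mult bessel_series_squared nn)
    ultimately show ?thesis by (rule sums_unique2)
  qed
  have T: "(\<lambda>n. gasper_coeff \<delta> n * y ^ n * (bessel_series (\<delta> - 1/2 + real n) y)\<^sup>2) summable_on UNIV"
    using summable_on_Sigma_banach[of "\<lambda>n m. f (n, m)" UNIV "\<lambda>_. UNIV"] fs by (simp add: inner)
  have S1: "infsum f (UNIV \<times> UNIV) = (\<Sum>\<^sub>\<infinity>n. gasper_coeff \<delta> n * y ^ n * (bessel_series (\<delta> - 1/2 + real n) y)\<^sup>2)"
    using infsum_Sigma'_banach[of "\<lambda>n m. f (n, m)" UNIV "\<lambda>_. UNIV"] fs by (simp add: inner)
  \<comment> \<open>Pairs (k, n) with n \<le> k enumerate the diagonals n + m = k, on which all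
    terms carry the same power of y.\<close>
  let ?S = "SIGMA k:UNIV. {..k::nat}"
  have bij: "bij_betw (\<lambda>(k, n). (n, k - n)) ?S (UNIV \<times> UNIV)"
    by (rule bij_betw_byWitness[where f' = "\<lambda>(n, m). (n + m, n)"]) auto
  have S2: "infsum f (UNIV \<times> UNIV) = infsum (\<lambda>(k, n). f (n, k - n)) ?S"
    using infsum_reindex_bij_betw[OF bij, of f] by (simp add: case_prod_unfold)
  have S3: "(\<lambda>(k, n). f (n, k - n)) summable_on ?S"
    using summable_on_reindex_bij_betw[OF bij, of f] fs by (simp add: case_prod_unfold)
  have fin: "(\<Sum>n\<le>k. f (n, k - n)) = W_coeff \<delta> k * (- r\<^sup>2 / 4) ^ k" for k
  proof -
    have "(\<Sum>n\<le>k. f (n, k - n)) = (\<Sum>n\<le>k. (-y) ^ k * ((-1) ^ n * gasper_coeff \<delta> n * ?q n (k - n)))"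
    proof (intro sum.cong refl)
      fix n assume "n \<in> {..k}"
      then have "y ^ n * (-y) ^ (k - n) = (-y) ^ k * (-1) ^ n"
      proof -
        assume "n \<in> {..k}"
        then have "(-y) ^ k = (-y) ^ n * (-y) ^ (k - n)" by (simp flip: power_add)
        moreover have "(-y) ^ n * (-1) ^ n = y ^ n" by (simp flip: power_mult_distrib)
        ultimately show ?thesis by (simp add: mult_ac)
      qed
      then show "f (n, k - n) = (-y) ^ k * ((-1) ^ n * gasper_coeff \<delta> n * ?q n (k - n))"
        by (simp add: f_def mult_ac)
    qed
    also have "\<dots> = (-y) ^ k * (4 ^ k * W_coeff \<delta> k)"
      using gasper_coefficient_identity[OF \<delta>, of k] by (simp flip: sum_distrib_left)
    also have "(-y) ^ k * 4 ^ k = (- r\<^sup>2 / 4) ^ k"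
      by (simp add: y_def flip: power_mult_distrib)
    then have "(-y) ^ k * (4 ^ k * W_coeff \<delta> k) = W_coeff \<delta> k * (- r\<^sup>2 / 4) ^ k"
      by (simp add: mult_ac)
    finally show ?thesis .
  qed
  have S4: "infsum (\<lambda>(k, n). f (n, k - n)) ?S = (\<Sum>\<^sub>\<infinity>k. W_coeff \<delta> k * (- r\<^sup>2 / 4) ^ k)"
    using infsum_Sigma'_banach[OF S3] by (simp add: fin)
  have "(\<lambda>k. W_coeff \<delta> k * (- r\<^sup>2 / 4) ^ k) summable_on UNIV"
    using summable_on_Sigma_banach[OF S3] by (simp add: fin)
  then have "(\<lambda>k. W_coeff \<delta> k * (- r\<^sup>2 / 4) ^ k) sums (\<Sum>\<^sub>\<infinity>k. W_coeff \<delta> k * (- r\<^sup>2 / 4) ^ k)"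
    by (intro has_sum_imp_sums has_sum_infsum)
  then have W: "W_fun \<delta> r = (\<Sum>\<^sub>\<infinity>k. W_coeff \<delta> k * (- r\<^sup>2 / 4) ^ k)"
    unfolding W_fun_eq by (simp add: sums_iff)
  \<comment> \<open>All terms of Gasper's series are nonnegative, so any finite part of it is a
    lower bound.\<close>
  have "(\<Sum>n\<in>{0,1}. gasper_coeff \<delta> n * y ^ n * (bessel_series (\<delta> - 1/2 + real n) y)\<^sup>2)
    \<le> (\<Sum>\<^sub>\<infinity>n. gasper_coeff \<delta> n * y ^ n * (bessel_series (\<delta> - 1/2 + real n) y)\<^sup>2)"
    using T y less_imp_le[OF gasper_coeff_pos[OF \<delta>]]
    by (intro finite_sum_le_infsum mult_nonneg_nonneg) auto
  then show ?thesis using W S4 S2 S1 \<delta> by (simp add: algebra_simps)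
qed

section \<open>Two-sided bounds for $W$\<close>

definition powser :: "(nat \<Rightarrow> real) \<Rightarrow> real \<Rightarrow> real" where
  "powser c x = (\<Sum>k. c k * x ^ k)"

definition entire_coeffs :: "(nat \<Rightarrow> real) \<Rightarrow> bool" where
  "entire_coeffs c \<longleftrightarrow> (\<forall>x. summable (\<lambda>k. c k * x ^ k))"

lemma entire_coeffsI:
  assumes "\<And>k. \<bar>c k\<bar> \<le> 1 / fact k"
  shows "entire_coeffs c"
  unfolding entire_coeffs_def
proof
  fix x
  have "summable (\<lambda>k. \<bar>c k * x ^ k\<bar>)"
  proof (rule summable_exp_bound)
    fix k show "\<bar>c k * x ^ k\<bar> \<le> \<bar>x\<bar> ^ k / fact k"
      using mult_right_mono[OF assms[of k], of "\<bar>x\<bar> ^ k"] by (simp add: abs_mult power_abs)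
  qed
  then show "summable (\<lambda>k. c k * x ^ k)" by (rule summable_rabs_cancel)
qed

lemma powser_sums: "entire_coeffs c \<Longrightarrow> (\<lambda>k. c k * x ^ k) sums powser c x"
  by (simp add: entire_coeffs_def powser_def summable_sums)

lemma powser_eqI:
  assumes "(\<lambda>k. c k * x ^ k) sums s" shows "powser c x = s"
  using assms by (simp add: powser_def sums_iff)

lemma powser_0 [simp]: "powser c 0 = c 0"
  by (simp add: powser_def)

text \<open>The operator x d/dx multiplies the k-th coefficient by k. Working with
  \<open>x * D\<close> instead of \<open>D\<close> avoids an index shift, and differential equations
  become identities between coefficients.\<close>

lemma euler_sums:
  assumes "entire_coeffs c"
  shows "\<exists>D. (powser c has_real_derivative D) (at x) \<and> (\<lambda>k. (real k * c k) * x ^ k) sums (x * D)"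
proof -
  have s: "\<And>y. summable (\<lambda>k. c k * y ^ k)" using assms by (simp add: entire_coeffs_def)
  define D where "D = (\<Sum>n. diffs c n * x ^ n)"
  have "(powser c has_real_derivative D) (at x)"
    using termdiffs_strong_converges_everywhere[OF s, of x] unfolding D_def
    by (simp add: powser_def[abs_def])
  moreover have "summable (\<lambda>n. diffs c n * x ^ n)"
    by (rule termdiff_converges_all[OF s])
  from sums_mult[OF diffs_equiv[OF this], of x]
  have "(\<lambda>k. x * (real k * c k * x ^ (k - Suc 0))) sums (x * D)" by (simp add: D_def)
  moreover have "x * (real k * c k * x ^ (k - Suc 0)) = (real k * c k) * x ^ k" for k
    by (cases k) auto
  ultimately show ?thesis by auto
qed

lemma entire_coeffs_euler: "entire_coeffs c \<Longrightarrow> entire_coeffs (\<lambda>k. real k * c k)"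
  using euler_sums unfolding entire_coeffs_def[of "\<lambda>k. real k * c k"] by (meson sums_summable)

lemma entire_coeffs_affine:
  assumes "entire_coeffs c" shows "entire_coeffs (\<lambda>k. (s + t * real k) * c k)"
proof -
  have "summable (\<lambda>k. s * (c k * x ^ k) + t * (real k * c k * x ^ k))" for x
    using assms entire_coeffs_euler[OF assms] unfolding entire_coeffs_def
    by (intro summable_add summable_mult) auto
  then show ?thesis by (simp add: entire_coeffs_def algebra_simps)
qed

lemma powser_add_smult:
  assumes "entire_coeffs c" "entire_coeffs d"
  shows "powser (\<lambda>k. s * c k + t * d k) x = s * powser c x + t * powser d x"
proof (rule powser_eqI)
  have "(\<lambda>k. s * (c k * x ^ k) + t * (d k * x ^ k)) sums (s * powser c x + t * powser d x)"
    using assms by (intro sums_add sums_mult powser_sums)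
  then show "(\<lambda>k. (s * c k + t * d k) * x ^ k) sums (s * powser c x + t * powser d x)"
    by (simp add: algebra_simps)
qed

lemma powser_shift:
  assumes "entire_coeffs c" "d 0 = 0" "\<And>k. d (Suc k) = c k"
  shows "powser d x = x * powser c x"
proof (rule powser_eqI)
  have "(\<lambda>k. x * (c k * x ^ k)) sums (x * powser c x)"
    using assms by (intro sums_mult powser_sums)
  then have "(\<lambda>k. d (Suc k) * x ^ Suc k) sums (x * powser c x)"
    using assms by (simp add: mult_ac)
  then show "(\<lambda>k. d k * x ^ k) sums (x * powser c x)"
    by (subst (asm) sums_Suc_iff) (simp add: assms)
qed

lemma isCont_powser: "entire_coeffs c \<Longrightarrow> isCont (powser c) x"
  using euler_sums DERIV_isCont by blast

text \<open>The k-th term is a multiple of r^(s + 2k); differentiation multiplies it by this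
  exponent and lowers the power of r by one.\<close>

lemma DERIV_powr_powser:
  assumes c: "entire_coeffs c" and r: "r > 0"
  shows "((\<lambda>r. r powr s * powser c (K * r\<^sup>2)) has_real_derivative
          r powr (s - 1) * powser (\<lambda>k. (s + 2 * real k) * c k) (K * r\<^sup>2)) (at r)"
proof -
  define x where "x = K * r\<^sup>2"
  obtain D where D: "(powser c has_real_derivative D) (at x)" "(\<lambda>k. (real k * c k) * x ^ k) sums (x * D)"
    using euler_sums[OF c] by blast
  have xD: "powser (\<lambda>k. real k * c k) x = x * D" using D(2) by (rule powser_eqI)
  have "((\<lambda>r. K * r\<^sup>2) has_real_derivative (2 * K * r)) (at r)"
    by (auto intro!: derivative_eq_intros)
  then have "((\<lambda>r. powser c (K * r\<^sup>2)) has_real_derivative D * (2 * K * r)) (at r)"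
    using D(1) unfolding x_def by (rule DERIV_chain2[rotated])
  then have "((\<lambda>r. r powr s * powser c (K * r\<^sup>2)) has_real_derivative
      s * r powr (s - 1) * powser c x + D * (2 * K * r) * r powr s) (at r)"
    using r unfolding x_def
    by (intro DERIV_mult has_real_derivative_powr)
  moreover have "powser (\<lambda>k. (s + 2 * real k) * c k) x = s * powser c x + 2 * (x * D)"
    using powser_add_smult[OF c entire_coeffs_euler[OF c], of s 2 x] xD by (simp add: algebra_simps)
  moreover have "r powr s = r powr (s - 1) * r" using r by (simp add: powr_diff)
  ultimately show ?thesis
    by (simp add: x_def algebra_simps power2_eq_square)
qed

section \<open>The lower bound of W through two Bessel functions\<close>

definition bessel_coeff :: "real \<Rightarrow> nat \<Rightarrow> real" where
  "bessel_coeff \<nu> k = (-1) ^ k / (fact k * pochhammer (\<nu> + 1) k)"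

lemma bessel_series_powser: "bessel_series \<nu> x = powser (bessel_coeff \<nu>) x"
proof -
  have "(-x) ^ k / (fact k * pochhammer (\<nu> + 1) k) = bessel_coeff \<nu> k * x ^ k" for k
    unfolding power_minus[of x] bessel_coeff_def by simp
  then show ?thesis by (simp add: bessel_series_def powser_def)
qed

lemma entire_bessel: "\<nu> \<ge> 0 \<Longrightarrow> entire_coeffs (bessel_coeff \<nu>)"
  using bessel_term_bound[of \<nu> 1] by (intro entire_coeffsI) (auto simp: bessel_coeff_def)

lemma W_fun_powser: "W_fun \<delta> r = powser (W_coeff \<delta>) (- 1 / 4 * r\<^sup>2)"
  by (simp add: W_fun_eq powser_def)

lemma entire_W: "\<delta> > 1 \<Longrightarrow> entire_coeffs (W_coeff \<delta>)"
proof (rule entire_coeffsI)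
  fix k assume \<delta>: "\<delta> > 1"
  have "pochhammer \<delta> k / pochhammer (3 * \<delta> / 2) k \<le> 1"
    using \<delta> pochhammer_mono[of \<delta> "3 * \<delta> / 2" k] by (simp add: pochhammer_pos)
  moreover have "1 / pochhammer ((3 * \<delta> + 1) / 2) k \<le> 1"
    using \<delta> pochhammer_ge_1[of "(3 * \<delta> - 1) / 2" k] by (simp add: field_simps)
  ultimately have "pochhammer \<delta> k / pochhammer (3 * \<delta> / 2) k * (1 / pochhammer ((3 * \<delta> + 1) / 2) k) \<le> 1 * 1"
    using \<delta> by (intro mult_mono) (auto intro!: divide_nonneg_nonneg pochhammer_nonneg)
  then have "W_coeff \<delta> k \<le> 1 / fact k"
    using divide_right_mono[of _ 1 "fact k"] by (fastforce simp: W_coeff_def mult_ac)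
  moreover have "W_coeff \<delta> k \<ge> 0" using \<delta> unfolding W_coeff_def
    by (auto intro!: divide_nonneg_nonneg mult_nonneg_nonneg pochhammer_nonneg)
  ultimately show "\<bar>W_coeff \<delta> k\<bar> \<le> 1 / fact k" by simp
qed

lemma W_fun_0 [simp]: "W_fun \<delta> 0 = 1"
  by (simp add: W_fun_powser W_coeff_def)

lemma continuous_W: "\<delta> > 1 \<Longrightarrow> continuous_on UNIV (W_fun \<delta>)"
  unfolding W_fun_powser continuous_on_eq_continuous_at[OF open_UNIV]
  by (intro ballI isCont_o2[OF _ isCont_powser] continuous_intros entire_W)

text \<open>Up to one common constant factor these are \<open>sqrt z * J\<close> of orders \<open>\<delta> - 1/2\<close> and \<open>\<delta> + 1/2\<close>.\<close>

definition "bes_a \<delta> z = z powr \<delta> * powser (bessel_coeff (\<delta> - 1/2)) (1/4 * z\<^sup>2)"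
definition "bes_b \<delta> z = z powr (\<delta> + 1) * powser (bessel_coeff (\<delta> + 1/2)) (1/4 * z\<^sup>2) / (2 * \<delta> + 1)"

text \<open>For \<nu> = \<delta> - 1/2 this is J_\<nu>' = (\<nu> / z) J_\<nu> - J_(\<nu>+1); the
  factor sqrt z changes \<nu> into \<nu> + 1/2 = \<delta>.\<close>

lemma DERIV_bes_a:
  assumes \<delta>: "\<delta> > 1" and z: "z > 0"
  shows "(bes_a \<delta> has_real_derivative \<delta> * bes_a \<delta> z / z - bes_b \<delta> z) (at z)"
proof -
  let ?b = "bessel_coeff (\<delta> - 1/2)" and ?x = "1/4 * z\<^sup>2"
  have ent: "entire_coeffs ?b" "entire_coeffs (bessel_coeff (\<delta> + 1/2))"
    using \<delta> by (auto intro!: entire_bessel)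
  have "powser (\<lambda>k. real k * ?b k) ?x = ?x * powser (\<lambda>k. (- 1 / (\<delta> + 1/2)) * bessel_coeff (\<delta> + 1/2) k + 0 * bessel_coeff (\<delta> + 1/2) k) ?x"
  proof (rule powser_shift)
    show "entire_coeffs (\<lambda>k. - 1 / (\<delta> + 1 / 2) * bessel_coeff (\<delta> + 1 / 2) k + 0 * bessel_coeff (\<delta> + 1 / 2) k)"
      using entire_coeffs_affine[OF ent(2), of "- 1 / (\<delta> + 1 / 2)" 0] by simp
    fix k
    define P where "P = pochhammer (\<delta> + 3/2) k"
    have "P > 0" using \<delta> unfolding P_def by (intro pochhammer_pos) simp
    have 1: "?b (Suc k) = - ((-1) ^ k) / (real (Suc k) * fact k * ((\<delta> + 1/2) * P))"
      by (simp add: bessel_coeff_def pochhammer_rec P_def add_ac)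
    have 2: "bessel_coeff (\<delta> + 1/2) k = (-1) ^ k / (fact k * P)"
      by (simp add: bessel_coeff_def P_def add_ac)
    show "real (Suc k) * ?b (Suc k) = - 1 / (\<delta> + 1 / 2) * bessel_coeff (\<delta> + 1 / 2) k + 0 * bessel_coeff (\<delta> + 1 / 2) k"
      unfolding 1 2 using \<delta> \<open>P > 0\<close> by (simp del: of_nat_Suc)
  qed simp
  also have "\<dots> = ?x * ((- 1 / (\<delta> + 1/2)) * powser (bessel_coeff (\<delta> + 1/2)) ?x)"
    by (subst powser_add_smult[OF ent(2,2)]) simp
  finally have 1: "powser (\<lambda>k. real k * ?b k) ?x = - ?x / (\<delta> + 1/2) * powser (bessel_coeff (\<delta> + 1/2)) ?x" by simp
  have 2: "powser (\<lambda>k. (\<delta> + 2 * real k) * ?b k) ?x = \<delta> * powser ?b ?x + 2 * powser (\<lambda>k. real k * ?b k) ?x"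
    using powser_add_smult[OF ent(1) entire_coeffs_euler[OF ent(1)], of \<delta> 2 ?x] by (simp add: algebra_simps)
  have p: "z powr \<delta> = z powr (\<delta> - 1) * z" "z powr (\<delta> + 1) = z powr (\<delta> - 1) * z * z"
    using z by (simp_all add: powr_diff powr_add)
  have "z powr (\<delta> - 1) * powser (\<lambda>k. (\<delta> + 2 * real k) * ?b k) ?x = \<delta> * bes_a \<delta> z / z - bes_b \<delta> z"
    unfolding 1 2 bes_a_def bes_b_def p using z \<delta> by (simp add: field_simps power2_eq_square)
  then show ?thesis
    using DERIV_powr_powser[OF ent(1) z, of \<delta> "1/4"] by (simp add: bes_a_def[abs_def])
qed

text \<open>The companion recurrence J_(\<nu>+1)' = J_\<nu> - ((\<nu> + 1) / z) J_(\<nu>+1), where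
  sqrt z changes \<nu> + 1 into \<nu> + 1/2 = \<delta>. Without the terms in 1 / z the two equations
  describe a rotation.\<close>

lemma DERIV_bes_b:
  assumes \<delta>: "\<delta> > 1" and z: "z > 0"
  shows "(bes_b \<delta> has_real_derivative bes_a \<delta> z - \<delta> * bes_b \<delta> z / z) (at z)"
proof -
  let ?b = "bessel_coeff (\<delta> + 1/2)" and ?a = "bessel_coeff (\<delta> - 1/2)" and ?x = "1/4 * z\<^sup>2"
  have ent: "entire_coeffs ?a" "entire_coeffs ?b"
    using \<delta> by (auto intro!: entire_bessel)
  have "(\<delta> + 1 + 2 * real k) * ?b k = (2 * \<delta> + 1) * ?a k + (- \<delta>) * ?b k" for k
  proof -
    have "pochhammer (\<delta> + 1/2) k * (\<delta> + 1/2 + real k) = (\<delta> + 1/2) * pochhammer (\<delta> + 3/2) k"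
      using pochhammer_rec[of "\<delta> + 1/2" k] pochhammer_Suc[of "\<delta> + 1/2" k] by (simp add: add_ac)
    moreover have "pochhammer (\<delta> + 3/2) k > 0" "pochhammer (\<delta> + 1/2) k > 0"
      using \<delta> by (auto intro!: pochhammer_pos)
    ultimately have "(\<delta> + 1/2 + real k) / pochhammer (\<delta> + 3/2) k = (\<delta> + 1/2) / pochhammer (\<delta> + 1/2) k"
      using \<delta> by (simp add: field_simps)
    then have "(-1) ^ k / fact k * ((\<delta> + 1/2 + real k) / pochhammer (\<delta> + 3/2) k) = (-1) ^ k / fact k * ((\<delta> + 1/2) / pochhammer (\<delta> + 1/2) k)"
      by simp
    then have "(\<delta> + 1/2 + real k) * ?b k = (\<delta> + 1/2) * ?a k"
      by (simp add: bessel_coeff_def add_ac mult_ac)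
    then show ?thesis by (simp add: algebra_simps)
  qed
  then have 1: "powser (\<lambda>k. (\<delta> + 1 + 2 * real k) * ?b k) ?x = (2 * \<delta> + 1) * powser ?a ?x + (- \<delta>) * powser ?b ?x"
    using powser_add_smult[OF ent, of "2 * \<delta> + 1" "- \<delta>" ?x] by simp
  have "((\<lambda>z. z powr (\<delta> + 1) * powser ?b (1/4 * z\<^sup>2)) has_real_derivative
      z powr \<delta> * ((2 * \<delta> + 1) * powser ?a ?x + (- \<delta>) * powser ?b ?x)) (at z)"
    using DERIV_powr_powser[OF ent(2) z, of "\<delta> + 1" "1/4"] 1 by simp
  from DERIV_cdivide[OF this, of "2 * \<delta> + 1"]
  have "(bes_b \<delta> has_real_derivative z powr \<delta> * ((2 * \<delta> + 1) * powser ?a ?x + (- \<delta>) * powser ?b ?x) / (2 * \<delta> + 1)) (at z)"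
    by (simp add: bes_b_def[abs_def])
  moreover have "z powr \<delta> * ((2 * \<delta> + 1) * powser ?a ?x + (- \<delta>) * powser ?b ?x) / (2 * \<delta> + 1)
      = bes_a \<delta> z - \<delta> * bes_b \<delta> z / z"
  proof -
    define D where "D = 2 * \<delta> + 1"
    have "D > 0" using \<delta> by (simp add: D_def)
    then show ?thesis
      unfolding bes_a_def bes_b_def D_def[symmetric] using z by (simp add: powr_add field_simps)
  qed
  ultimately show ?thesis by simp
qed

text \<open>The derivative of the sum of squares is 2 \<delta> (a^2 - b^2) / z; the weight z^(2
  \<delta>) removes its negative part.\<close>

lemma bes_pos:
  assumes \<delta>: "\<delta> > 1" and z: "z > 0"
  shows "(bes_a \<delta> z)\<^sup>2 + (bes_b \<delta> z)\<^sup>2 > 0"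
proof (rule ccontr)
  assume "\<not> ?thesis"
  then have z0: "(bes_a \<delta> z)\<^sup>2 + (bes_b \<delta> z)\<^sup>2 = 0" by (smt (verit) zero_le_power2)
  \<comment> \<open>The monotone quantity \<open>?G\<close> would force \<open>bes_a\<close> to vanish near \<open>0\<close>, where it behaves like \<open>z powr \<delta>\<close>.\<close>
  let ?G = "\<lambda>z. z powr (2 * \<delta>) * ((bes_a \<delta> z)\<^sup>2 + (bes_b \<delta> z)\<^sup>2)"
  have mono: "?G t \<le> ?G z" if t: "0 < t" "t \<le> z" for t
  proof (rule DERIV_nonneg_imp_nondecreasing[OF t(2)])
    fix x assume x: "t \<le> x" "x \<le> z"
    then have x0: "x > 0" using t by simp
    let ?a = "bes_a \<delta> x" and ?b = "bes_b \<delta> x"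
    have "(?G has_real_derivative (2 * \<delta> * x powr (2 * \<delta> - 1) * (?a\<^sup>2 + ?b\<^sup>2)
       + (2 * ?a * (\<delta> * ?a / x - ?b) + 2 * ?b * (?a - \<delta> * ?b / x)) * x powr (2 * \<delta>))) (at x)"
      using DERIV_bes_a[OF \<delta> x0] DERIV_bes_b[OF \<delta> x0] x0
      by (auto intro!: derivative_eq_intros simp: algebra_simps)
    moreover have "x powr (2 * \<delta>) = x powr (2 * \<delta> - 1) * x" using x0 by (simp add: powr_diff)
    then have "2 * \<delta> * x powr (2 * \<delta> - 1) * (?a\<^sup>2 + ?b\<^sup>2)
       + (2 * ?a * (\<delta> * ?a / x - ?b) + 2 * ?b * (?a - \<delta> * ?b / x)) * x powr (2 * \<delta>)
      = x powr (2 * \<delta> - 1) * (4 * \<delta> * ?a\<^sup>2)"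
      using x0 by (simp add: field_simps power2_eq_square)
    ultimately have "(?G has_real_derivative x powr (2 * \<delta> - 1) * (4 * \<delta> * ?a\<^sup>2)) (at x)" by simp
    then show "\<exists>y. DERIV ?G x :> y \<and> 0 \<le> y" using \<delta> by (intro exI[of _ "x powr (2 * \<delta> - 1) * (4 * \<delta> * ?a\<^sup>2)"]) auto
  qed
  have zero: "powser (bessel_coeff (\<delta> - 1/2)) (1/4 * t\<^sup>2) = 0" if t: "0 < t" "t \<le> z" for t
  proof -
    have "?G t \<le> 0" using mono[OF t] z0 by simp
    then have "(bes_a \<delta> t)\<^sup>2 + (bes_b \<delta> t)\<^sup>2 \<le> 0" using t by (simp add: mult_le_0_iff)
    then have "bes_a \<delta> t = 0" by (smt (verit) zero_le_power2 zero_eq_power2)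
    then show ?thesis using t by (simp add: bes_a_def)
  qed
  have "isCont (\<lambda>t. powser (bessel_coeff (\<delta> - 1/2)) (1/4 * t\<^sup>2)) 0"
    using \<delta> by (intro isCont_o2[OF _ isCont_powser] continuous_intros entire_bessel) auto
  then have "((\<lambda>t. powser (bessel_coeff (\<delta> - 1/2)) (1/4 * t\<^sup>2)) \<longlongrightarrow> 1) (at_right 0)"
    by (simp add: isCont_def bessel_coeff_def filterlim_at_split)
  moreover have "eventually (\<lambda>t. powser (bessel_coeff (\<delta> - 1/2)) (1/4 * t\<^sup>2) = 0) (at_right 0)"
    using zero z by (auto simp: eventually_at_right_field intro!: exI[of _ z])
  then have "((\<lambda>t. powser (bessel_coeff (\<delta> - 1/2)) (1/4 * t\<^sup>2)) \<longlongrightarrow> 0) (at_right 0)"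
    by (rule tendsto_eventually)
  ultimately show False using tendsto_unique trivial_limit_at_right_real by fastforce
qed

lemma abs_mult_le_squares: "\<bar>x * y\<bar> \<le> (x\<^sup>2 + y\<^sup>2) / (2::real)"
  using zero_le_power2[of "\<bar>x\<bar> - \<bar>y\<bar>"] by (simp add: power2_diff abs_mult)

lemma bes_lower:
  assumes \<delta>: "\<delta> > 1"
  shows "\<exists>c>0. \<forall>z\<ge>2 * \<delta>. c \<le> (bes_a \<delta> z)\<^sup>2 + (bes_b \<delta> z)\<^sup>2"
proof -
  let ?a = "bes_a \<delta>" and ?b = "bes_b \<delta>"
  \<comment> \<open>The mixed term cancels the \<open>1 / z\<close> part of the derivative, leaving \<open>O(E / z\<^sup>2)\<close>, which is integrable.\<close>
  define E where "E = (\<lambda>z. (?a z)\<^sup>2 + (?b z)\<^sup>2 - 2 * \<delta> * (?a z * ?b z) / z)"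
  have small: "\<bar>2 * \<delta> * (?a z * ?b z) / z\<bar> \<le> ((?a z)\<^sup>2 + (?b z)\<^sup>2) / 2" if z: "z \<ge> 2 * \<delta>" for z
  proof -
    have "\<bar>2 * \<delta> * (?a z * ?b z) / z\<bar> = (2 * \<delta> / z) * \<bar>?a z * ?b z\<bar>"
      using z \<delta> by (simp add: abs_mult)
    also have "\<dots> \<le> 1 * \<bar>?a z * ?b z\<bar>" using z \<delta> by (intro mult_right_mono) auto
    also have "\<dots> \<le> ((?a z)\<^sup>2 + (?b z)\<^sup>2) / 2" using abs_mult_le_squares by simp
    finally show ?thesis .
  qed
  \<comment> \<open>An integrating factor: E' = 2 \<delta> a b / z^2 is at least - (2 \<delta> /
    z^2) E, since a b is at most half of a^2 + b^2 in absolute value and \<open>E\<close> is at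
    least that half.\<close>
  define H where "H = (\<lambda>z. E z * exp (- (2 * \<delta> / z)))"
  define z0 where "z0 = 2 * \<delta>"
  have z0: "z0 > 0" using \<delta> by (simp add: z0_def)
  have mono: "H z0 \<le> H z" if z: "z0 \<le> z" for z
  proof (rule DERIV_nonneg_imp_nondecreasing[OF z])
    fix x assume x: "z0 \<le> x" "x \<le> z"
    then have x0: "x > 0" using z0 by simp
    have "(E has_real_derivative (2 * ?a x * (\<delta> * ?a x / x - ?b x) + 2 * ?b x * (?a x - \<delta> * ?b x / x)
       - ((2 * \<delta> * ((\<delta> * ?a x / x - ?b x) * ?b x + (?a x - \<delta> * ?b x / x) * ?a x)) * x - 2 * \<delta> * (?a x * ?b x)) / (x * x))) (at x)"
      unfolding E_def using DERIV_bes_a[OF \<delta> x0] DERIV_bes_b[OF \<delta> x0] x0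
      by (auto intro!: derivative_eq_intros)
    also have "(2 * ?a x * (\<delta> * ?a x / x - ?b x) + 2 * ?b x * (?a x - \<delta> * ?b x / x)
       - ((2 * \<delta> * ((\<delta> * ?a x / x - ?b x) * ?b x + (?a x - \<delta> * ?b x / x) * ?a x)) * x - 2 * \<delta> * (?a x * ?b x)) / (x * x))
       = 2 * \<delta> * (?a x * ?b x) / x\<^sup>2"
      using x0 by (simp add: field_simps power2_eq_square)
    finally have "(H has_real_derivative (2 * \<delta> * (?a x * ?b x) / x\<^sup>2 * exp (- (2 * \<delta> / x))
        + exp (- (2 * \<delta> / x)) * (2 * \<delta> / x\<^sup>2) * E x)) (at x)"
      unfolding H_def using x0
      by (auto intro!: derivative_eq_intros simp: power2_eq_square)
    moreover have "2 * \<delta> * (?a x * ?b x) / x\<^sup>2 * exp (- (2 * \<delta> / x))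
        + exp (- (2 * \<delta> / x)) * (2 * \<delta> / x\<^sup>2) * E x = exp (- (2 * \<delta> / x)) * (2 * \<delta> / x\<^sup>2) * (?a x * ?b x + E x)"
      using x0 by (simp add: field_simps)
    moreover have "?a x * ?b x + E x \<ge> 0"
    proof -
      have "0 \<le> u + (s - t)" if "\<bar>t\<bar> \<le> s / 2" "\<bar>u\<bar> \<le> s / 2" for s t u :: real using that by linarith
      from this[OF small[OF x(1)[unfolded z0_def]] abs_mult_le_squares]
      show ?thesis unfolding E_def .
    qed
    ultimately show "\<exists>y. DERIV H x :> y \<and> 0 \<le> y"
      using \<delta> by (metis (no_types, lifting) exp_ge_zero less_eq_real_def less_trans mult_nonneg_nonneg zero_less_one
        divide_nonneg_nonneg zero_le_power2 zero_le_numeral)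
  qed
  have "0 < s - t" if "\<bar>t\<bar> \<le> s / 2" "0 < s" for s t :: real using that by linarith
  from this[OF small bes_pos[OF \<delta> z0]] have "E z0 > 0" by (simp add: E_def z0_def)
  then have H0: "H z0 > 0" by (simp add: H_def)
  show ?thesis
  proof (intro exI[of _ "H z0 / 2"] conjI allI impI)
    show "H z0 / 2 > 0" using H0 by simp
    fix z assume z: "z \<ge> 2 * \<delta>"
    then have "H z0 \<le> H z" by (intro mono) (simp add: z0_def)
    then have "E z > 0" using H0 by (smt (verit) H_def exp_gt_zero mult_nonpos_nonneg)
    then have "H z \<le> E z" using z \<delta> by (simp add: H_def mult_le_cancel_left1)
    then have "H z0 \<le> E z" using \<open>H z0 \<le> H z\<close> by simp
    have "h / 2 \<le> s" if "h \<le> s - t" "\<bar>t\<bar> \<le> s / 2" "0 \<le> s" for h s t :: real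
      using that by linarith
    from this[OF \<open>H z0 \<le> E z\<close>[unfolded E_def] small[OF z]]
    show "H z0 / 2 \<le> (?a z)\<^sup>2 + (?b z)\<^sup>2" by simp
  qed
qed

lemma W_ge_bes:
  assumes \<delta>: "\<delta> > 1"
  shows "\<exists>m>0. \<forall>z>0. m * ((bes_a \<delta> z)\<^sup>2 + (bes_b \<delta> z)\<^sup>2) \<le> W_fun \<delta> (2 * z) * z powr (2 * \<delta>)"
proof -
  \<comment> \<open>The smaller coefficient of the two squares once both are expressed by
    \<open>bes_a\<close> and \<open>bes_b\<close>; (2 \<delta> + 1)^2 undoes the normalisation of
    \<open>bes_b\<close>, and 1/4 comes from y = z^2 / 4 at r = 2 z.\<close>
  define m where "m = min 1 (gasper_coeff \<delta> 1 * (2 * \<delta> + 1)\<^sup>2 / 4)"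
  have m: "m > 0" "m \<le> 1" "m \<le> gasper_coeff \<delta> 1 * (2 * \<delta> + 1)\<^sup>2 / 4"
    using gasper_coeff_pos[OF \<delta>] \<delta> by (auto simp: m_def)
  have "m * ((bes_a \<delta> z)\<^sup>2 + (bes_b \<delta> z)\<^sup>2) \<le> W_fun \<delta> (2 * z) * z powr (2 * \<delta>)" if z: "z > 0" for z
  proof -
    let ?x = "1/4 * z\<^sup>2"
    let ?j = "powser (bessel_coeff (\<delta> - 1/2)) ?x" and ?k = "powser (bessel_coeff (\<delta> + 1/2)) ?x"
    have p: "(z powr \<delta>)\<^sup>2 = z powr (2 * \<delta>)" using z by (simp add: powr_power)
    have p': "(z powr (\<delta> + 1))\<^sup>2 = z powr (2 * \<delta>) * z\<^sup>2" using z
      by (simp add: powr_power powr_add power_mult_distrib)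
    have "m * ((bes_a \<delta> z)\<^sup>2 + (bes_b \<delta> z)\<^sup>2) = z powr (2 * \<delta>) * (m * ?j\<^sup>2 + m * (z\<^sup>2 * ?k\<^sup>2 / (2 * \<delta> + 1)\<^sup>2))"
      unfolding bes_a_def bes_b_def power_mult_distrib power_divide p p' by (simp add: algebra_simps)
    also have "\<dots> \<le> z powr (2 * \<delta>) * (1 * ?j\<^sup>2 + (gasper_coeff \<delta> 1 * (2 * \<delta> + 1)\<^sup>2 / 4) * (z\<^sup>2 * ?k\<^sup>2 / (2 * \<delta> + 1)\<^sup>2))"
      using m by (intro mult_left_mono add_mono mult_right_mono) auto
    also have "(gasper_coeff \<delta> 1 * (2 * \<delta> + 1)\<^sup>2 / 4) * (z\<^sup>2 * ?k\<^sup>2 / (2 * \<delta> + 1)\<^sup>2) = gasper_coeff \<delta> 1 * ?x * ?k\<^sup>2"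
      using \<delta> by (simp add: field_simps)
    also have "1 * ?j\<^sup>2 + gasper_coeff \<delta> 1 * ?x * ?k\<^sup>2 \<le> W_fun \<delta> (2 * z)"
      using W_sum_of_squares_lower[OF \<delta>, of "2 * z"] by (simp add: bessel_series_powser power_mult_distrib)
    finally show ?thesis using z by (simp add: mult.commute)
  qed
  then show ?thesis using m by blast
qed

lemma W_pos:
  assumes \<delta>: "\<delta> > 1" and r: "r \<ge> 0" shows "W_fun \<delta> r > 0"
proof (cases "r = 0")
  case False
  then have z: "r / 2 > 0" using r by simp
  obtain m where m: "m > 0" "\<And>z. z > 0 \<Longrightarrow> m * ((bes_a \<delta> z)\<^sup>2 + (bes_b \<delta> z)\<^sup>2) \<le> W_fun \<delta> (2 * z) * z powr (2 * \<delta>)"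
    using W_ge_bes[OF \<delta>] by blast
  have "0 < m * ((bes_a \<delta> (r/2))\<^sup>2 + (bes_b \<delta> (r/2))\<^sup>2)" using m(1) bes_pos[OF \<delta> z] by simp
  also have "\<dots> \<le> W_fun \<delta> r * (r/2) powr (2 * \<delta>)" using m(2)[OF z] by simp
  finally show ?thesis using z by (simp add: zero_less_mult_iff)
qed simp

lemma powr_two_mult: "r > 0 \<Longrightarrow> r powr (2 * \<delta>) = (r\<^sup>2) powr \<delta>" for r :: real
  by (simp add: powr_powr flip: powr_numeral)

text \<open>For r \<ge> 4 \<delta> the argument z = r / 2 lies in the range of
  \<open>bes_lower\<close>; on the remaining compact interval W is continuous and positive.\<close>

lemma W_lower:
  assumes \<delta>: "\<delta> > 1"
  shows "\<exists>c>0. \<forall>r\<ge>0. c \<le> W_fun \<delta> r * (1 + r\<^sup>2) powr \<delta>"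
proof -
  obtain m where m: "m > 0" "\<And>z. z > 0 \<Longrightarrow> m * ((bes_a \<delta> z)\<^sup>2 + (bes_b \<delta> z)\<^sup>2) \<le> W_fun \<delta> (2 * z) * z powr (2 * \<delta>)"
    using W_ge_bes[OF \<delta>] by blast
  obtain c where c: "c > 0" "\<And>z. z \<ge> 2 * \<delta> \<Longrightarrow> c \<le> (bes_a \<delta> z)\<^sup>2 + (bes_b \<delta> z)\<^sup>2"
    using bes_lower[OF \<delta>] by blast
  have big: "m * c \<le> W_fun \<delta> r * (1 + r\<^sup>2) powr \<delta>" if r: "r \<ge> 4 * \<delta>" for r
  proof -
    have r0: "r > 0" using r \<delta> by simp
    have "m * c \<le> m * ((bes_a \<delta> (r/2))\<^sup>2 + (bes_b \<delta> (r/2))\<^sup>2)" using c(2)[of "r/2"] m r by simp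
    also have "\<dots> \<le> W_fun \<delta> r * (r / 2) powr (2 * \<delta>)" using m(2)[of "r/2"] r0 by simp
    also have "\<dots> \<le> W_fun \<delta> r * (1 + r\<^sup>2) powr \<delta>"
    proof (rule mult_left_mono)
      show "0 \<le> W_fun \<delta> r" using W_pos[OF \<delta>, of r] r0 by simp
      have "(r / 2) powr (2 * \<delta>) = ((r/2)\<^sup>2) powr \<delta>" using r0 by (intro powr_two_mult) simp
      also have "\<dots> \<le> (1 + r\<^sup>2) powr \<delta>" using \<delta> by (intro powr_mono2) (auto simp: power_divide)
      finally show "(r / 2) powr (2 * \<delta>) \<le> (1 + r\<^sup>2) powr \<delta>" .
    qed
    finally show ?thesis .
  qed
  have "\<exists>x\<in>{0..4 * \<delta>}. \<forall>y\<in>{0..4 * \<delta>}. W_fun \<delta> x \<le> W_fun \<delta> y"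
    using \<delta> by (intro continuous_attains_inf continuous_on_subset[OF continuous_W]) auto
  then obtain x where x: "x \<ge> 0" "\<And>y. 0 \<le> y \<Longrightarrow> y \<le> 4 * \<delta> \<Longrightarrow> W_fun \<delta> x \<le> W_fun \<delta> y"
    by auto
  have Wx: "W_fun \<delta> x > 0" using W_pos[OF \<delta> x(1)] .
  show ?thesis
  proof (intro exI[of _ "min (m * c) (W_fun \<delta> x)"] conjI allI impI)
    show "min (m * c) (W_fun \<delta> x) > 0" using m c Wx by simp
    fix r :: real assume r: "r \<ge> 0"
    show "min (m * c) (W_fun \<delta> x) \<le> W_fun \<delta> r * (1 + r\<^sup>2) powr \<delta>"
    proof (cases "r \<le> 4 * \<delta>")
      case True
      have "W_fun \<delta> x * 1 \<le> W_fun \<delta> r * (1 + r\<^sup>2) powr \<delta>"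
        using x(2)[OF r True] Wx \<delta> by (intro mult_mono) (auto intro!: ge_one_powr_ge_zero)
      then show ?thesis by simp
    next
      case False then show ?thesis using big[of r] by simp
    qed
  qed
qed

text \<open>The third-order hypergeometric equation as a first-order system, with Q = A' + \<alpha>
  A / r and S = Q' + \<alpha> Q / r. These corrections make the coefficients of \<open>Q\<close> and
  \<open>S\<close> simple multiples of those of \<open>A\<close>.\<close>

lemma W_ODE_system:
  assumes \<delta>: "\<delta> > 1"
  defines "\<alpha> \<equiv> \<delta> - 1"
  obtains A Q S :: "real \<Rightarrow> real" where
    "\<And>r. r > 0 \<Longrightarrow> A r = r powr (2 * \<delta>) * W_fun \<delta> r"
    "\<And>r. r > 0 \<Longrightarrow> (A has_real_derivative Q r - \<alpha> * A r / r) (at r)"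
    "\<And>r. r > 0 \<Longrightarrow> (Q has_real_derivative S r - \<alpha> * Q r / r) (at r)"
    "\<And>r. r > 0 \<Longrightarrow> (S has_real_derivative - Q r + \<alpha> * (A r + 2 * S r) / r) (at r)"
proof -
  let ?c = "W_coeff \<delta>"
  \<comment> \<open>The shift by \<alpha> = \<delta> - 1 turns the exponents 2 \<delta> + 2k and 2
    \<delta> - 1 + 2k into 3 \<delta> - 1 + 2k and 3 \<delta> - 2 + 2k. With k + 1 in place of k
    their product cancels the new denominators of \<open>W_coeff\<close>, which closes the
    system.\<close>
  define c1 where "c1 = (\<lambda>k. (3 * \<delta> - 1 + 2 * real k) * ?c k)"
  define c2 where "c2 = (\<lambda>k. (3 * \<delta> - 2 + 2 * real k) * c1 k)"
  have e0: "entire_coeffs ?c" by (rule entire_W[OF \<delta>])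
  have e1: "entire_coeffs c1" unfolding c1_def using e0 by (rule entire_coeffs_affine)
  have e2: "entire_coeffs c2" unfolding c2_def using e1 by (rule entire_coeffs_affine)
  let ?K = "- 1 / 4 :: real"
  define A where "A = (\<lambda>r. r powr (2 * \<delta>) * powser ?c (?K * r\<^sup>2))"
  define Q where "Q = (\<lambda>r. r powr (2 * \<delta> - 1) * powser c1 (?K * r\<^sup>2))"
  define S where "S = (\<lambda>r. r powr (2 * \<delta> - 2) * powser c2 (?K * r\<^sup>2))"
  have p: "r powr (2 * \<delta>) = r powr (2 * \<delta> - 3) * r ^ 3" "r powr (2 * \<delta> - 1) = r powr (2 * \<delta> - 3) * r ^ 2"
    "r powr (2 * \<delta> - 2) = r powr (2 * \<delta> - 3) * r" if "r > 0" for r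
  proof -
    have "r powr ((2 * \<delta> - 3) + real n) = r powr (2 * \<delta> - 3) * r ^ n" for n
      using that by (simp add: powr_add powr_realpow)
    from this[of 3] this[of 2] this[of 1]
    show "r powr (2 * \<delta>) = r powr (2 * \<delta> - 3) * r ^ 3" "r powr (2 * \<delta> - 1) = r powr (2 * \<delta> - 3) * r ^ 2"
      "r powr (2 * \<delta> - 2) = r powr (2 * \<delta> - 3) * r"
      by simp_all
  qed
  have 1: "(A has_real_derivative Q r - \<alpha> * A r / r) (at r)" if r: "r > 0" for r
  proof -
    let ?x = "?K * r\<^sup>2"
    have "(\<lambda>k. (2 * \<delta> + 2 * real k) * ?c k) = (\<lambda>k. 1 * c1 k + (- \<alpha>) * ?c k)"
      by (auto simp: c1_def \<alpha>_def algebra_simps)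
    then have e: "powser (\<lambda>k. (2 * \<delta> + 2 * real k) * ?c k) ?x = 1 * powser c1 ?x + (- \<alpha>) * powser ?c ?x"
      using powser_add_smult[OF e1 e0] by metis
    have "r powr (2 * \<delta> - 1) * powser (\<lambda>k. (2 * \<delta> + 2 * real k) * ?c k) ?x = Q r - \<alpha> * A r / r"
    proof -
      have "R * r\<^sup>2 * (1 * X + (- \<alpha>) * Y) = R * r\<^sup>2 * X - \<alpha> * (R * r ^ 3 * Y) / r" for R X Y :: real
        using r by (simp add: field_simps power2_eq_square power3_eq_cube)
      then show ?thesis unfolding e A_def Q_def p[OF r] .
    qed
    then show ?thesis using DERIV_powr_powser[OF e0 r, of "2 * \<delta>" ?K] by (simp add: A_def)
  qed
  have 2: "(Q has_real_derivative S r - \<alpha> * Q r / r) (at r)" if r: "r > 0" for r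
  proof -
    let ?x = "?K * r\<^sup>2"
    have "(\<lambda>k. (2 * \<delta> - 1 + 2 * real k) * c1 k) = (\<lambda>k. 1 * c2 k + (- \<alpha>) * c1 k)"
      by (auto simp: c2_def \<alpha>_def algebra_simps)
    then have e: "powser (\<lambda>k. (2 * \<delta> - 1 + 2 * real k) * c1 k) ?x = 1 * powser c2 ?x + (- \<alpha>) * powser c1 ?x"
      using powser_add_smult[OF e2 e1] by metis
    have e': "2 * \<delta> - 1 - 1 = 2 * \<delta> - 2" by simp
    have "r powr (2 * \<delta> - 1 - 1) * powser (\<lambda>k. (2 * \<delta> - 1 + 2 * real k) * c1 k) ?x = S r - \<alpha> * Q r / r"
    proof -
      have "R * r * (1 * X + (- \<alpha>) * Y) = R * r * X - \<alpha> * (R * r\<^sup>2 * Y) / r" for R X Y :: real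
        using r by (simp add: field_simps power2_eq_square power3_eq_cube)
      then show ?thesis unfolding e e' S_def Q_def p[OF r] .
    qed
    then show ?thesis using DERIV_powr_powser[OF e1 r, of "2 * \<delta> - 1" ?K] by (simp add: Q_def)
  qed
  have 3: "(S has_real_derivative - Q r + \<alpha> * (A r + 2 * S r) / r) (at r)" if r: "r > 0" for r
  proof -
    let ?x = "?K * r\<^sup>2"
    define d where "d = (\<lambda>k. (8 * \<delta> + 8 * real k) * ?c k)"
    have ed: "entire_coeffs d" unfolding d_def using e0 by (rule entire_coeffs_affine)
    have "(2 * real (Suc k)) * c2 (Suc k) = d k" for k
    proof -
      define P where "P = pochhammer (3 * \<delta> / 2) k * pochhammer ((3 * \<delta> + 1) / 2) k"
      have P: "P > 0" using \<delta> unfolding P_def by (intro mult_pos_pos pochhammer_pos) auto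
      have "?c (Suc k) = pochhammer \<delta> k * (\<delta> + real k) / (real (Suc k) * fact k * (P * ((3 * \<delta> / 2 + real k) * ((3 * \<delta> + 1) / 2 + real k))))"
        by (simp add: W_coeff_def pochhammer_Suc P_def mult_ac)
      moreover have "c2 (Suc k) = 4 * ((3 * \<delta> / 2 + real k) * ((3 * \<delta> + 1) / 2 + real k)) * ?c (Suc k)"
      proof -
        have q: "4 * ((3 * \<delta> / 2 + real k) * ((3 * \<delta> + 1) / 2 + real k)) = (3 * \<delta> + 2 * real k) * (3 * \<delta> + 1 + 2 * real k)"
          by (simp add: field_simps)
        show ?thesis unfolding q by (simp add: c2_def c1_def algebra_simps)
      qed
      moreover have "3 * \<delta> / 2 + real k > 0" "(3 * \<delta> + 1) / 2 + real k > 0"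
        using \<delta> by (auto intro!: add_pos_nonneg)
      ultimately have "(2 * real (Suc k)) * c2 (Suc k) = 8 * (\<delta> + real k) * (pochhammer \<delta> k / (fact k * P))"
        using P by (simp del: of_nat_Suc)
      then show ?thesis by (simp add: d_def W_coeff_def P_def algebra_simps)
    qed
    then have sh: "powser (\<lambda>k. (2 * real k) * c2 k) ?x = ?x * powser d ?x"
      by (intro powser_shift ed) auto
    have "d = (\<lambda>k. 4 * c1 k + (- 4 * \<alpha>) * ?c k)"
      by (auto simp: d_def c1_def \<alpha>_def algebra_simps)
    then have pd: "powser d ?x = 4 * powser c1 ?x + (- 4 * \<alpha>) * powser ?c ?x"
      using powser_add_smult[OF e1 e0] by metis
    have "(\<lambda>k. (2 * \<delta> - 2 + 2 * real k) * c2 k) = (\<lambda>k. 2 * \<alpha> * c2 k + 2 * (real k * c2 k))"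
      by (auto simp: \<alpha>_def algebra_simps)
    then have "powser (\<lambda>k. (2 * \<delta> - 2 + 2 * real k) * c2 k) ?x = 2 * \<alpha> * powser c2 ?x + 2 * powser (\<lambda>k. real k * c2 k) ?x"
      using powser_add_smult[OF e2 entire_coeffs_euler[OF e2]] by metis
    also have "2 * powser (\<lambda>k. real k * c2 k) ?x = powser (\<lambda>k. (2 * real k) * c2 k) ?x"
      using powser_add_smult[OF entire_coeffs_euler[OF e2] e2, of 2 0 ?x] by (simp add: mult.assoc)
    also have "\<dots> = - r\<^sup>2 * (powser c1 ?x - \<alpha> * powser ?c ?x)"
      unfolding sh pd by (simp add: algebra_simps)
    finally have e: "powser (\<lambda>k. (2 * \<delta> - 2 + 2 * real k) * c2 k) ?x = 2 * \<alpha> * powser c2 ?x + - r\<^sup>2 * (powser c1 ?x - \<alpha> * powser ?c ?x)" .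
    have e': "2 * \<delta> - 2 - 1 = 2 * \<delta> - 3" by simp
    have "r powr (2 * \<delta> - 2 - 1) * powser (\<lambda>k. (2 * \<delta> - 2 + 2 * real k) * c2 k) ?x = - Q r + \<alpha> * (A r + 2 * S r) / r"
    proof -
      have "R * (2 * \<alpha> * X + - r\<^sup>2 * (Y - \<alpha> * Z)) = - (R * r\<^sup>2 * Y) + \<alpha> * (R * r ^ 3 * Z + 2 * (R * r * X)) / r"
        for R X Y Z :: real
        using r by (simp add: field_simps power2_eq_square power3_eq_cube)
      then show ?thesis unfolding e e' S_def Q_def A_def p[OF r] .
    qed
    then show ?thesis using DERIV_powr_powser[OF e2 r, of "2 * \<delta> - 2" ?K] by (simp add: S_def)
  qed
  show ?thesis
  proof (rule that[of A Q S])
    show "A r = r powr (2 * \<delta>) * W_fun \<delta> r" if "r > 0" for r by (simp add: A_def W_fun_powser)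
  qed (use 1 2 3 in auto)
qed

text \<open>For large r the system tends to A' = Q, Q' = S, S' = - Q. There P = A + S is constant
  and (Q, S) rotates, so the sum of squares \<open>M\<close> is conserved; the terms in 1 / r act as
  a perturbation.\<close>

lemma W_upper_large:
  assumes \<delta>: "\<delta> > 1"
  shows "\<exists>C R. R > 0 \<and> (\<forall>r\<ge>R. r powr (2 * \<delta>) * W_fun \<delta> r \<le> C)"
proof -
  define \<alpha> where "\<alpha> = \<delta> - 1"
  have \<alpha>: "\<alpha> > 0" using \<delta> by (simp add: \<alpha>_def)
  obtain A Q S :: "real \<Rightarrow> real" where
    A: "\<And>r. r > 0 \<Longrightarrow> A r = r powr (2 * \<delta>) * W_fun \<delta> r" and
    dA: "\<And>r. r > 0 \<Longrightarrow> (A has_real_derivative Q r - \<alpha> * A r / r) (at r)" and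
    dQ: "\<And>r. r > 0 \<Longrightarrow> (Q has_real_derivative S r - \<alpha> * Q r / r) (at r)" and
    dS: "\<And>r. r > 0 \<Longrightarrow> (S has_real_derivative - Q r + \<alpha> * (A r + 2 * S r) / r) (at r)"
    using W_ODE_system[OF \<delta>] unfolding \<alpha>_def by blast
  define P where "P = (\<lambda>r. A r + S r)"
  have A_eq: "A r = P r - S r" for r by (simp add: P_def)
  have dP: "(P has_real_derivative 2 * \<alpha> * S r / r) (at r)" if r: "r > 0" for r
  proof -
    have "(P has_real_derivative (Q r - \<alpha> * A r / r) + (- Q r + \<alpha> * (A r + 2 * S r) / r)) (at r)"
      unfolding P_def by (intro DERIV_add dA dS r)
    then show ?thesis using r by (simp add: field_simps)
  qed
  have dS': "(S has_real_derivative - Q r + \<alpha> * (P r + S r) / r) (at r)" if r: "r > 0" for r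
  proof -
    have e: "A r + 2 * S r = P r + S r" by (simp add: P_def)
    show ?thesis using dS[OF r] unfolding e .
  qed
  define M where "M = (\<lambda>r. (P r)\<^sup>2 + (Q r)\<^sup>2 + (S r)\<^sup>2)"
  \<comment> \<open>\<open>N\<close> is \<open>M\<close> with corrections of relative size \<open>1 / r\<close> chosen such that its derivative is \<open>O(M / r\<^sup>2)\<close>.\<close>
  define N where "N = (\<lambda>r. (P r - 2 * \<alpha> * Q r / r)\<^sup>2 + (Q r)\<^sup>2 + (S r)\<^sup>2 - 2 * \<alpha> * Q r * S r / r - 2 * \<alpha> * P r * Q r / r)"
  \<comment> \<open>Chosen so that the numerator of the derivative of \<open>N\<close> is at most
    \<open>K * M r\<close>: the first summand covers the term with P - 2 \<alpha> Q / r, the second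
    the mixed products.\<close>
  define K where "K = 4 * \<alpha> * (\<alpha> + 1) * (1 + 2 * \<alpha>) + 2 * \<alpha> * (2 + 2 * \<alpha>)"
  have K: "K > 0" using \<alpha> by (simp add: K_def add_pos_pos)
  have dN: "(N has_real_derivative (4 * \<alpha> * (\<alpha> + 1) * Q r * (P r - 2 * \<alpha> * Q r / r) + 2 * \<alpha> * ((1 - 2 * \<alpha>) * (Q r * S r) + P r * Q r)) / r\<^sup>2) (at r)"
    if r: "r > 0" for r
  proof -
    \<comment> \<open>Writing 1 / r as a quantity of its own makes the simplification of the
      derivative a polynomial identity.\<close>
    let ?q = "S r - \<alpha> * Q r * inverse r" and ?p = "2 * \<alpha> * S r * inverse r" and ?s = "- Q r + \<alpha> * (P r + S r) * inverse r"
    have d: "(P has_real_derivative ?p) (at r)" "(Q has_real_derivative ?q) (at r)" "(S has_real_derivative ?s) (at r)"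
      using dP[OF r] dQ[OF r] dS'[OF r] by (simp_all add: divide_inverse)
    have di: "(inverse has_real_derivative - ((inverse r)\<^sup>2)) (at r)"
      using DERIV_inverse[of r UNIV] r by (simp add: numeral_2_eq_2)
    have N_inv: "N = (\<lambda>r. (P r - 2 * \<alpha> * (Q r * inverse r))\<^sup>2 + (Q r)\<^sup>2 + (S r)\<^sup>2 - 2 * \<alpha> * (Q r * S r * inverse r) - 2 * \<alpha> * (P r * Q r * inverse r))"
      by (simp add: N_def divide_inverse mult.assoc)
    have "(N has_real_derivative (2 * (P r - 2 * \<alpha> * (Q r * inverse r)) * (?p - 2 * \<alpha> * (?q * inverse r + Q r * - ((inverse r)\<^sup>2)))
        + 2 * Q r * ?q + 2 * S r * ?s - 2 * \<alpha> * ((?q * S r + Q r * ?s) * inverse r + Q r * S r * - ((inverse r)\<^sup>2))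
        - 2 * \<alpha> * ((?p * Q r + P r * ?q) * inverse r + P r * Q r * - ((inverse r)\<^sup>2)))) (at r)"
      unfolding N_inv
      by (rule derivative_eq_intros d di refl)+ (simp add: mult_ac)
    also have "2 * (p - 2 * \<alpha> * (q * i)) * (2 * \<alpha> * s * i - 2 * \<alpha> * ((s - \<alpha> * q * i) * i + q * - (i\<^sup>2)))
        + 2 * q * (s - \<alpha> * q * i) + 2 * s * (- q + \<alpha> * (p + s) * i)
        - 2 * \<alpha> * (((s - \<alpha> * q * i) * s + q * (- q + \<alpha> * (p + s) * i)) * i + q * s * - (i\<^sup>2))
        - 2 * \<alpha> * ((2 * \<alpha> * s * i * q + p * (s - \<alpha> * q * i)) * i + p * q * - (i\<^sup>2))
      = (4 * \<alpha> * (\<alpha> + 1) * q * (p - 2 * \<alpha> * q * i) + 2 * \<alpha> * ((1 - 2 * \<alpha>) * (q * s) + p * q)) * i\<^sup>2" for p q s i :: real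
      by algebra
    finally show ?thesis by (simp add: divide_inverse power_inverse)
  qed
  \<comment> \<open>This bounds \<alpha> / r by 1/8, and then the mixed terms take away at most half
    of each square in \<open>M\<close>; for the square of \<open>Q\<close> the estimate is just
    enough.\<close>
  define R where "R = max 1 (8 * \<alpha>)"
  have R: "R \<ge> 1" "R \<ge> 8 * \<alpha>" by (auto simp: R_def)
  have NM: "M r / 2 \<le> N r" if r: "r \<ge> R" for r
  proof -
    have r0: "r > 0" using r R by simp
    define t where "t = \<alpha> / r"
    have t: "0 \<le> t" "t \<le> 1/8" using r R \<alpha> r0 by (auto simp: t_def field_simps)
    have N: "N r = (P r - 2 * t * Q r)\<^sup>2 + (Q r)\<^sup>2 + (S r)\<^sup>2 - 2 * t * (Q r * S r) - 2 * t * (P r * Q r)"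
      by (simp add: N_def t_def)
    have aux: "(a + q + s) / 2 \<le> D + q + s - 2 * t * y - 2 * t * x"
      if "D \<ge> a - 4 * (t * x)" "t * x \<le> 1/8 * ((a + q) / 2)" "t * y \<le> 1/8 * ((q + s) / 2)" "a \<ge> 0" "q \<ge> 0" "s \<ge> 0"
      for D a q s x y :: real
      using that unfolding mult.assoc by argo
    have 1: "(P r - 2 * t * Q r)\<^sup>2 \<ge> (P r)\<^sup>2 - 4 * (t * (P r * Q r))"
      by (simp add: power2_diff)
    have 2: "t * (P r * Q r) \<le> 1/8 * (((P r)\<^sup>2 + (Q r)\<^sup>2) / 2)"
      using t abs_mult_le_squares[of "P r" "Q r"]
      by (intro order_trans[OF mult_left_mono[of _ "((P r)\<^sup>2 + (Q r)\<^sup>2) / 2" t] mult_right_mono]) auto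
    have 3: "t * (Q r * S r) \<le> 1/8 * (((Q r)\<^sup>2 + (S r)\<^sup>2) / 2)"
      using t abs_mult_le_squares[of "Q r" "S r"]
      by (intro order_trans[OF mult_left_mono[of _ "((Q r)\<^sup>2 + (S r)\<^sup>2) / 2" t] mult_right_mono]) auto
    show ?thesis unfolding N M_def by (rule aux[OF 1 2 3]) auto
  qed
  have dN_le: "(4 * \<alpha> * (\<alpha> + 1) * Q r * (P r - 2 * \<alpha> * Q r / r) + 2 * \<alpha> * ((1 - 2 * \<alpha>) * (Q r * S r) + P r * Q r)) \<le> K * M r"
    if r: "r \<ge> R" for r
  proof -
    have r1: "r \<ge> 1" using r R by simp
    have PQ: "\<bar>P r * Q r\<bar> \<le> M r" unfolding M_def by (rule order_trans[OF abs_mult_le_squares]) simp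
    have QS: "\<bar>Q r * S r\<bar> \<le> M r" unfolding M_def by (rule order_trans[OF abs_mult_le_squares]) simp
    have M0: "M r \<ge> 0" by (simp add: M_def)
    have "Q r * (P r - 2 * \<alpha> * Q r / r) = P r * Q r - 2 * \<alpha> * ((Q r)\<^sup>2 / r)" by (simp add: power2_eq_square algebra_simps)
    also have "\<dots> \<le> P r * Q r" using \<alpha> r1 by simp
    also have "\<dots> \<le> M r" using PQ by simp
    also have "\<dots> \<le> (1 + 2 * \<alpha>) * M r" using M0 \<alpha> by (simp add: algebra_simps)
    finally have a: "4 * \<alpha> * (\<alpha> + 1) * (Q r * (P r - 2 * \<alpha> * Q r / r)) \<le> 4 * \<alpha> * (\<alpha> + 1) * ((1 + 2 * \<alpha>) * M r)"
      using \<alpha> by (intro mult_left_mono) auto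
    have "(1 - 2 * \<alpha>) * (Q r * S r) \<le> \<bar>1 - 2 * \<alpha>\<bar> * \<bar>Q r * S r\<bar>" by (simp flip: abs_mult)
    also have "\<dots> \<le> (1 + 2 * \<alpha>) * M r" using QS \<alpha> M0 by (intro mult_mono) auto
    finally have "(1 - 2 * \<alpha>) * (Q r * S r) + P r * Q r \<le> (2 + 2 * \<alpha>) * M r" using PQ by (simp add: algebra_simps)
    then have "2 * \<alpha> * ((1 - 2 * \<alpha>) * (Q r * S r) + P r * Q r) \<le> 2 * \<alpha> * ((2 + 2 * \<alpha>) * M r)"
      using \<alpha> by (intro mult_left_mono) auto
    with a show ?thesis unfolding K_def by (simp add: algebra_simps)
  qed
  \<comment> \<open>The integrating factor for N' \<le> K M / r^2 \<le> 2 K N / r^2.\<close>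
  define H where "H = (\<lambda>r. N r * exp (2 * K / r))"
  have mono: "H r \<le> H R" if r: "r \<ge> R" for r
  proof (rule DERIV_nonpos_imp_nonincreasing[OF r])
    fix x assume x: "R \<le> x" "x \<le> r"
    then have x0: "x > 0" using R by simp
    let ?D = "4 * \<alpha> * (\<alpha> + 1) * Q x * (P x - 2 * \<alpha> * Q x / x) + 2 * \<alpha> * ((1 - 2 * \<alpha>) * (Q x * S x) + P x * Q x)"
    have "((\<lambda>r. exp (2 * K / r)) has_real_derivative exp (2 * K / x) * (- (2 * K) / x\<^sup>2)) (at x)"
      using x0 by (auto intro!: derivative_eq_intros simp: power2_eq_square)
    from DERIV_mult[OF dN[OF x0] this]
    have "(H has_real_derivative ?D / x\<^sup>2 * exp (2 * K / x) + exp (2 * K / x) * (- (2 * K) / x\<^sup>2) * N x) (at x)"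
      unfolding H_def .
    moreover have "?D / x\<^sup>2 * exp (2 * K / x) + exp (2 * K / x) * (- (2 * K) / x\<^sup>2) * N x = exp (2 * K / x) / x\<^sup>2 * (?D - 2 * K * N x)"
      by (simp add: algebra_simps diff_divide_distrib add_divide_distrib)
    moreover have "?D - 2 * K * N x \<le> 0"
    proof -
      have "K * M x \<le> K * (2 * N x)" using NM[OF x(1)] K by (intro mult_left_mono) auto
      then show ?thesis using order_trans[OF dN_le[OF x(1)], of "K * (2 * N x)"] by (simp add: mult_ac)
    qed
    then have "exp (2 * K / x) / x\<^sup>2 * (?D - 2 * K * N x) \<le> 0"
      by (intro mult_nonneg_nonpos) auto
    ultimately have "DERIV H x :> exp (2 * K / x) / x\<^sup>2 * (?D - 2 * K * N x)" by simp
    then show "\<exists>y. DERIV H x :> y \<and> y \<le> 0"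
      using \<open>exp (2 * K / x) / x\<^sup>2 * (?D - 2 * K * N x) \<le> 0\<close> by blast
  qed
  have "r powr (2 * \<delta>) * W_fun \<delta> r \<le> 4 * H R + 1" if r: "r \<ge> R" for r
  proof -
    have r0: "r > 0" using r R by simp
    have "M r \<ge> 0" by (simp add: M_def)
    then have N0: "N r \<ge> 0" using NM[OF r] by simp
    have "N r * 1 \<le> N r * exp (2 * K / r)" using N0 K r0 by (intro mult_left_mono) auto
    then have "N r \<le> H R" using mono[OF r] by (simp add: H_def)
    then have "M r \<le> 2 * H R" using NM[OF r] by simp
    moreover have "(A r)\<^sup>2 \<le> 2 * M r"
    proof -
      have "(P r - S r)\<^sup>2 + (P r + S r)\<^sup>2 = 2 * ((P r)\<^sup>2 + (S r)\<^sup>2)" by algebra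
      then have "(P r - S r)\<^sup>2 \<le> 2 * ((P r)\<^sup>2 + (S r)\<^sup>2)" using zero_le_power2[of "P r + S r"] by linarith
      then show ?thesis unfolding A_eq M_def by (rule order_trans) simp
    qed
    ultimately have "(A r)\<^sup>2 \<le> 4 * H R" by simp
    moreover have "A r \<le> (A r)\<^sup>2 + 1" using abs_mult_le_squares[of "A r" 1] zero_le_power2[of "A r"] by simp
    ultimately show ?thesis using A[OF r0] by simp
  qed
  then show ?thesis using R by (intro exI[of _ "4 * H R + 1"] exI[of _ R]) auto
qed

lemma W_upper:
  assumes \<delta>: "\<delta> > 1"
  shows "\<exists>C>0. \<forall>r\<ge>0. W_fun \<delta> r * (1 + r\<^sup>2) powr \<delta> \<le> C"
proof -
  obtain C R where R: "R > 0" "\<And>r. r \<ge> R \<Longrightarrow> r powr (2 * \<delta>) * W_fun \<delta> r \<le> C"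
    using W_upper_large[OF \<delta>] by blast
  define R' where "R' = max 1 R"
  have big: "W_fun \<delta> r * (1 + r\<^sup>2) powr \<delta> \<le> 2 powr \<delta> * C" if r: "r \<ge> R'" for r
  proof -
    have r0: "r \<ge> 1" "r \<ge> R" using r by (auto simp: R'_def)
    have "1 \<le> r\<^sup>2" using r0 by (simp add: one_le_power)
    then have "(1 + r\<^sup>2) powr \<delta> \<le> (2 * r\<^sup>2) powr \<delta>" using \<delta> by (intro powr_mono2) auto
    also have "\<dots> = 2 powr \<delta> * r powr (2 * \<delta>)" using r0 by (simp add: powr_mult powr_two_mult)
    finally have "W_fun \<delta> r * (1 + r\<^sup>2) powr \<delta> \<le> W_fun \<delta> r * (2 powr \<delta> * r powr (2 * \<delta>))"
      using W_pos[OF \<delta>, of r] r0 by (intro mult_left_mono) auto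
    also have "\<dots> = 2 powr \<delta> * (r powr (2 * \<delta>) * W_fun \<delta> r)" by simp
    also have "\<dots> \<le> 2 powr \<delta> * C" using R(2)[OF r0(2)] by (intro mult_left_mono) auto
    finally show ?thesis .
  qed
  have "continuous_on {0..R'} (\<lambda>r. W_fun \<delta> r * (1 + r\<^sup>2) powr \<delta>)"
    by (intro continuous_intros continuous_on_subset[OF continuous_W[OF \<delta>]])
      (auto simp: add_nonneg_eq_0_iff)
  then have "\<exists>x\<in>{0..R'}. \<forall>y\<in>{0..R'}. W_fun \<delta> y * (1 + y\<^sup>2) powr \<delta> \<le> W_fun \<delta> x * (1 + x\<^sup>2) powr \<delta>"
    by (intro continuous_attains_sup) (auto simp: R'_def)
  then obtain B where B: "\<And>y. 0 \<le> y \<Longrightarrow> y \<le> R' \<Longrightarrow> W_fun \<delta> y * (1 + y\<^sup>2) powr \<delta> \<le> B" by force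
  show ?thesis
  proof (intro exI[of _ "max 1 (max B (2 powr \<delta> * C))"] conjI allI impI)
    fix r :: real assume "r \<ge> 0"
    then show "W_fun \<delta> r * (1 + r\<^sup>2) powr \<delta> \<le> max 1 (max B (2 powr \<delta> * C))"
      using big[of r] B[of r] by (cases "r \<le> R'") auto
  qed simp
qed

section \<open>Moments of the kernel\<close>

text \<open>As a function of r = |x| it lives on the ball of radius s. The exponent may be negative;
  \<open>0 powr \<beta> = 0\<close> then gives the value 0 on the sphere.\<close>

definition ball_kernel :: "real \<Rightarrow> real \<Rightarrow> real \<Rightarrow> real" where
  "ball_kernel \<beta> r s = indicator {r..} s * (s\<^sup>2 - r\<^sup>2) powr \<beta>"

lemma ball_kernel_nonneg [simp]: "ball_kernel \<beta> r s \<ge> 0"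
  by (simp add: ball_kernel_def)

lemma ball_kernel_measurable [measurable]:
  "f \<in> borel_measurable M \<Longrightarrow> g \<in> borel_measurable M \<Longrightarrow> (\<lambda>x. ball_kernel \<beta> (f x) (g x)) \<in> borel_measurable M"
proof -
  assume [measurable]: "f \<in> borel_measurable M" "g \<in> borel_measurable M"
  have "(\<lambda>x. if f x \<le> g x then ((g x)\<^sup>2 - (f x)\<^sup>2) powr \<beta> else 0) \<in> borel_measurable M" by measurable
  moreover have "(\<lambda>x. ball_kernel \<beta> (f x) (g x)) = (\<lambda>x. if f x \<le> g x then ((g x)\<^sup>2 - (f x)\<^sup>2) powr \<beta> else 0)"
    by (auto simp: ball_kernel_def)
  ultimately show ?thesis by simp
qed

text \<open>The substitution u = (s^2 - r^2) / 2 produces a Gamma integral and leaves the Gaussian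
  in r as a factor. A Gaussian mixture of the kernels is therefore a Gaussian.\<close>

lemma gauss_kernel_1d:
  assumes r: "r \<ge> 0" and \<beta>: "\<beta> > -1"
  shows "(\<integral>\<^sup>+s. ennreal (ball_kernel \<beta> r s * (s * exp (- s\<^sup>2 / 2))) \<partial>lborel)
    = ennreal (2 powr \<beta> * Gamma (\<beta> + 1) * exp (- r\<^sup>2 / 2))"
proof -
  define f where "f = (\<lambda>u::real. indicator {0..} u * ((2 * u) powr \<beta> * exp (- u - r\<^sup>2 / 2)))"
  define g where "g = (\<lambda>s::real. (s\<^sup>2 - r\<^sup>2) / 2)"
  have fm[measurable]: "f \<in> borel_measurable borel" unfolding f_def by measurable
  have fn: "f u \<ge> 0" for u by (simp add: f_def)
  \<comment> \<open>Substitution is available on compact intervals; \<open>r + real n\<close>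
    exhausts the half-line, and both sides converge monotonically.\<close>
  have sub: "(\<integral>\<^sup>+u. ennreal (f u * indicator {g r..g (r + real n)} u) \<partial>lborel)
     = (\<integral>\<^sup>+s. ennreal (f (g s) * s * indicator {r..r + real n} s) \<partial>lborel)" for n
  proof (rule nn_integral_substitution)
    show "set_borel_measurable borel {g r..g (r + real n)} f" unfolding set_borel_measurable_def by measurable
    show "(g has_real_derivative s) (at s)" for s
      unfolding g_def by (auto intro!: derivative_eq_intros)
  qed (use r in \<open>auto intro!: continuous_intros\<close>)
  have g0: "g r = 0" by (simp add: g_def)
  have gn: "g (r + real n) \<ge> real n ^ 2 / 2" for n
    using r by (simp add: g_def power2_sum)
  have "(\<lambda>n. \<integral>\<^sup>+u. ennreal (f u * indicator {g r..g (r + real n)} u) \<partial>lborel) \<longlonglongrightarrow> (\<integral>\<^sup>+u. ennreal (f u) \<partial>lborel)"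
  proof (rule nn_integral_LIMSEQ)
    show "incseq (\<lambda>n u. ennreal (f u * indicator {g r..g (r + real n)} u))"
    proof (intro incseq_SucI le_funI ennreal_leI mult_left_mono fn)
      fix n u
      have "g (r + real n) \<le> g (r + real (Suc n))" using r by (simp add: g_def power_mono)
      then show "indicator {g r..g (r + real n)} u \<le> (indicator {g r..g (r + real (Suc n))} u :: real)"
        by (auto simp: indicator_def)
    qed
    fix u :: real
    show "(\<lambda>n. ennreal (f u * indicator {g r..g (r + real n)} u)) \<longlonglongrightarrow> ennreal (f u)"
    proof (cases "u \<ge> 0")
      case True
      obtain N where N: "2 * u + 1 \<le> real N" using real_arch_simple by blast
      show ?thesis
      proof (rule tendsto_eventually, rule eventually_sequentiallyI)
        fix n assume "N \<le> n"
        then have n: "real n \<ge> 2 * u + 1" using N by (meson of_nat_le_iff order_trans)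
        then have "2 * u \<le> real n * 1" by simp
        also have "\<dots> \<le> real n * real n" using n True by (intro mult_left_mono) auto
        finally have "u \<le> g (r + real n)" using gn[of n] by (simp add: power2_eq_square)
        then show "ennreal (f u * indicator {g r..g (r + real n)} u) = ennreal (f u)"
          using True g0 by simp
      qed
    next
      case False then show ?thesis by (simp add: f_def)
    qed
  qed simp
  moreover have "(\<lambda>n. \<integral>\<^sup>+s. ennreal (f (g s) * s * indicator {r..r + real n} s) \<partial>lborel)
      \<longlonglongrightarrow> (\<integral>\<^sup>+s. ennreal (ball_kernel \<beta> r s * (s * exp (- s\<^sup>2 / 2))) \<partial>lborel)"
  proof (rule nn_integral_LIMSEQ)
    have eq: "f (g s) * s * indicator {r..r + real n} s = ball_kernel \<beta> r s * (s * exp (- s\<^sup>2 / 2)) * indicator {r..r + real n} s" for n s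
    proof (cases "r \<le> s")
      case True
      then have "r\<^sup>2 \<le> s\<^sup>2" using r by (intro power_mono) auto
      then have "g s \<ge> 0" by (simp add: g_def)
      moreover have e1: "- g s - r\<^sup>2 / 2 = - s\<^sup>2 / 2" by (simp add: g_def field_simps)
      moreover have e2: "2 * g s = s\<^sup>2 - r\<^sup>2" by (simp add: g_def)
      ultimately show ?thesis unfolding f_def e1 e2 using True by (simp add: ball_kernel_def)
    qed simp
    show "incseq (\<lambda>n s. ennreal (f (g s) * s * indicator {r..r + real n} s))"
    proof (intro incseq_SucI le_funI ennreal_leI)
      fix n s
      show "f (g s) * s * indicator {r..r + real n} s \<le> f (g s) * s * indicator {r..r + real (Suc n)} s"
        using r fn[of "g s"] by (auto simp: indicator_def)
    qed
    show "(\<lambda>s. ennreal (f (g s) * s * indicator {r..r + real n} s)) \<in> borel_measurable lborel" for n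
      unfolding g_def by measurable
    fix s :: real
    obtain N where N: "s \<le> real N" using real_arch_simple by blast
    show "(\<lambda>n. ennreal (f (g s) * s * indicator {r..r + real n} s)) \<longlonglongrightarrow> ennreal (ball_kernel \<beta> r s * (s * exp (- s\<^sup>2 / 2)))"
    proof (rule tendsto_eventually, rule eventually_sequentiallyI)
      fix n assume "N \<le> n"
      then have "s \<le> r + real n" using N r by (smt (verit) of_nat_le_iff)
      then show "ennreal (f (g s) * s * indicator {r..r + real n} s) = ennreal (ball_kernel \<beta> r s * (s * exp (- s\<^sup>2 / 2)))"
        unfolding eq by (cases "r \<le> s") (auto simp: ball_kernel_def)
    qed
  qed
  ultimately have "(\<integral>\<^sup>+s. ennreal (ball_kernel \<beta> r s * (s * exp (- s\<^sup>2 / 2))) \<partial>lborel) = (\<integral>\<^sup>+u. ennreal (f u) \<partial>lborel)"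
    unfolding sub using LIMSEQ_unique by blast
  also have "\<dots> = (\<integral>\<^sup>+u. ennreal (2 powr \<beta> * exp (- r\<^sup>2 / 2)) * ennreal (indicator {0..} u * u powr ((\<beta> + 1) - 1) / exp u) \<partial>lborel)"
  proof (rule nn_integral_cong)
    fix u :: real
    have fu: "f u = (2 powr \<beta> * exp (- r\<^sup>2 / 2)) * (indicator {0..} u * u powr ((\<beta> + 1) - 1) / exp u)"
    proof (cases "u \<ge> 0")
      case True
      have "- u - r\<^sup>2 / 2 = - r\<^sup>2 / 2 - u" by simp
      then have "exp (- u - r\<^sup>2 / 2) = exp (- r\<^sup>2 / 2) / exp u" by (simp only: exp_diff)
      then show ?thesis using True unfolding f_def by (simp add: powr_mult)
    qed (simp add: f_def)
    show "ennreal (f u) = ennreal (2 powr \<beta> * exp (- r\<^sup>2 / 2)) * ennreal (indicator {0..} u * u powr ((\<beta> + 1) - 1) / exp u)"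
      unfolding fu by (rule ennreal_mult) auto
  qed
  also have "\<dots> = ennreal (2 powr \<beta> * exp (- r\<^sup>2 / 2)) * ennreal (Gamma (\<beta> + 1))"
    using \<beta> by (subst nn_integral_cmult) (auto simp: Gamma_conv_nn_integral_real)
  also have "\<dots> = ennreal (2 powr \<beta> * Gamma (\<beta> + 1) * exp (- r\<^sup>2 / 2))"
    using \<beta> Gamma_real_pos[of "\<beta> + 1"] by (subst ennreal_mult[symmetric]) (auto simp: mult_ac)
  finally show ?thesis .
qed

section \<open>Moments of homogeneous functions against the kernels\<close>

context
  fixes p :: "'a::euclidean_space \<Rightarrow> real" and m :: nat and \<beta> :: real
  assumes pm [measurable]: "p \<in> borel_measurable borel" and p0: "\<And>x. p x \<ge> 0"
    and hom: "\<And>c x. c > 0 \<Longrightarrow> p (c *\<^sub>R x) = c ^ m * p x" and \<beta>: "\<beta> > -1"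
begin

lemma ball_kernel_scale:
  assumes s: "s > 0"
  shows "(\<integral>\<^sup>+x. ennreal (p x * ball_kernel \<beta> (norm x) s) \<partial>lborel)
    = ennreal (s powr (real (m + DIM('a)) + 2 * \<beta>)) * (\<integral>\<^sup>+x. ennreal (p x * ball_kernel \<beta> (norm x) 1) \<partial>lborel)"
proof -
  have eq: "p (0 + s *\<^sub>R x) * ball_kernel \<beta> (norm (0 + s *\<^sub>R x)) s = (s ^ m * s powr (2 * \<beta>)) * (p x * ball_kernel \<beta> (norm x) 1)" for x
  proof -
    have i: "indicator {s * norm x..} s = (indicator {norm x..} 1 :: real)"
      using s by (auto simp: indicator_def)
    have "(s\<^sup>2 - (s * norm x)\<^sup>2) powr \<beta> = s powr (2 * \<beta>) * (1 - (norm x)\<^sup>2) powr \<beta>" if "norm x \<le> 1"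
    proof -
      have "1 - (norm x)\<^sup>2 \<ge> 0" using that by (simp add: power_le_one)
      moreover have "s\<^sup>2 - (s * norm x)\<^sup>2 = s\<^sup>2 * (1 - (norm x)\<^sup>2)" by (simp add: power_mult_distrib algebra_simps)
      moreover have "(s\<^sup>2) powr \<beta> = s powr (2 * \<beta>)" using s by (simp add: powr_powr flip: powr_numeral)
      ultimately show ?thesis using s by (simp add: powr_mult)
    qed
    then show ?thesis using s i by (auto simp: ball_kernel_def hom indicator_def)
  qed
  have "(\<integral>\<^sup>+x. ennreal (p x * ball_kernel \<beta> (norm x) s) \<partial>lborel)
    = ennreal (\<bar>s\<bar> ^ DIM('a)) * (\<integral>\<^sup>+x. ennreal (p (0 + s *\<^sub>R x) * ball_kernel \<beta> (norm (0 + s *\<^sub>R x)) s) \<partial>lborel)"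
    using s by (intro nn_integral_lborel_affine) auto
  also have "\<dots> = ennreal (s ^ DIM('a)) * (ennreal (s ^ m * s powr (2 * \<beta>)) * (\<integral>\<^sup>+x. ennreal (p x * ball_kernel \<beta> (norm x) 1) \<partial>lborel))"
    unfolding eq using s p0 by (subst nn_integral_cmult[symmetric]) (auto simp: ennreal_mult)
  also have "\<dots> = ennreal (s ^ DIM('a) * (s ^ m * s powr (2 * \<beta>))) * (\<integral>\<^sup>+x. ennreal (p x * ball_kernel \<beta> (norm x) 1) \<partial>lborel)"
    using s by (subst ennreal_mult) (auto simp: mult.assoc)
  also have "s ^ DIM('a) * (s ^ m * s powr (2 * \<beta>)) = s powr (real (m + DIM('a)) + 2 * \<beta>)"
    using s by (simp add: powr_add powr_realpow)
  finally show ?thesis .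
qed

text \<open>By Tonelli and homogeneity the moment of any mixture factorises: one factor depends on
  the weight \<open>v\<close>, the other is the same for all weights. A single explicit weight hence
  determines the common constant.\<close>

lemma ball_kernel_moment_weighted:
  assumes [measurable]: "v \<in> borel_measurable borel" and v: "\<And>s. v s \<ge> 0"
  shows "(\<integral>\<^sup>+x. ennreal (p x) * (\<integral>\<^sup>+s. ennreal (ball_kernel \<beta> (norm x) s * v s) \<partial>lborel) \<partial>lborel)
    = (\<integral>\<^sup>+s. ennreal (indicator {0..} s * (v s * s powr (real (m + DIM('a)) + 2 * \<beta>))) \<partial>lborel)
      * (\<integral>\<^sup>+x. ennreal (p x * ball_kernel \<beta> (norm x) 1) \<partial>lborel)" (is "?L = ?R * ?c")
proof -
  have "?L = (\<integral>\<^sup>+x. (\<integral>\<^sup>+s. ennreal (p x * ball_kernel \<beta> (norm x) s * v s) \<partial>lborel) \<partial>lborel)"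
    using p0 v by (subst nn_integral_cmult[symmetric]) (auto simp: ennreal_mult mult.assoc)
  also have "\<dots> = (\<integral>\<^sup>+s. (\<integral>\<^sup>+x. ennreal (p x * ball_kernel \<beta> (norm x) s * v s) \<partial>lborel) \<partial>lborel)"
    by (rule pair_sigma_finite.Fubini'[OF pair_sigma_finite.intro[OF sigma_finite_lborel sigma_finite_lborel]]) measurable
  also have "\<dots> = (\<integral>\<^sup>+s. ennreal (indicator {0..} s * (v s * s powr (real (m + DIM('a)) + 2 * \<beta>))) * ?c \<partial>lborel)"
  proof (rule nn_integral_cong_AE)
    \<comment> \<open>Scaling requires s > 0. For s < 0 both sides vanish, and s = 0 is a null
      set.\<close>
    have "AE s in lborel. s \<noteq> (0::real)" by (rule AE_lborel_singleton)
    then show "AE s in lborel. (\<integral>\<^sup>+x. ennreal (p x * ball_kernel \<beta> (norm x) s * v s) \<partial>lborel)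
        = ennreal (indicator {0..} s * (v s * s powr (real (m + DIM('a)) + 2 * \<beta>))) * ?c"
    proof eventually_elim
      case (elim s)
      show ?case
      proof (cases "s > 0")
        case True
        have "(\<integral>\<^sup>+x. ennreal (p x * ball_kernel \<beta> (norm x) s * v s) \<partial>lborel) = ennreal (v s) * (\<integral>\<^sup>+x. ennreal (p x * ball_kernel \<beta> (norm x) s) \<partial>lborel)"
          using p0 v by (subst nn_integral_cmult[symmetric]) (auto simp: ennreal_mult mult.commute)
        moreover have "indicator {0..} s * (v s * s powr (real (m + DIM('a)) + 2 * \<beta>)) = v s * s powr (real (m + DIM('a)) + 2 * \<beta>)"
          using True by simp
        ultimately show ?thesis
          by (simp only: ball_kernel_scale[OF True] ennreal_mult[OF v powr_ge_zero] mult.assoc)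
      next
        case False
        have "ball_kernel \<beta> (norm x) s = 0" for x :: 'a
        proof -
          have "\<not> norm x \<le> s" using False elim norm_ge_zero[of x] by linarith
          then show ?thesis by (simp add: ball_kernel_def)
        qed
        then show ?thesis using False elim by (simp add: indicator_def)
      qed
    qed
  qed
  also have "\<dots> = ?R * ?c" by (rule nn_integral_multc) measurable
  finally show ?thesis .
qed

text \<open>With the weight s exp(- s^2 / 2) both sides of the factorisation are instances of
  \<open>gauss_kernel_1d\<close>: the mixture itself, and the weight integral as the case r = 0 with
  exponent N / 2 + \<beta>, where N is \<open>m + DIM('a)\<close>.\<close>

lemma ball_kernel_moment_gauss:
  "(\<integral>\<^sup>+x. ennreal (p x * ball_kernel \<beta> (norm x) 1) \<partial>lborel)
    = ennreal (2 powr (- real (m + DIM('a)) / 2) * Gamma (\<beta> + 1) / Gamma (real (m + DIM('a)) / 2 + \<beta> + 1))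
      * (\<integral>\<^sup>+x. ennreal (p x * gauss 1 x) \<partial>lborel)"
proof -
  let ?c = "\<integral>\<^sup>+x. ennreal (p x * ball_kernel \<beta> (norm x) 1) \<partial>lborel" and ?N = "real (m + DIM('a)) :: real"
  let ?g = "\<integral>\<^sup>+x. ennreal (p x * gauss 1 x) \<partial>lborel"
  define v where "v = (\<lambda>s::real. indicator {0..} s * (s * exp (- s\<^sup>2 / 2)))"
  have vm[measurable]: "v \<in> borel_measurable borel" unfolding v_def by measurable
  have v0: "v s \<ge> 0" for s by (cases "s \<ge> 0") (auto simp: v_def)
  have N: "?N \<ge> 1" using DIM_positive[where 'a = 'a] by linarith
  define K where "K = 2 powr \<beta> * Gamma (\<beta> + 1)"
  have K: "K > 0" using \<beta> by (simp add: K_def Gamma_real_pos)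
  define L where "L = 2 powr (?N / 2 + \<beta>) * Gamma (?N / 2 + \<beta> + 1)"
  have "?N / 2 > 0" using N by (intro divide_pos_pos) auto
  then have L0: "?N / 2 + \<beta> + 1 > 0" using \<beta> by linarith
  have L: "L > 0" unfolding L_def by (intro mult_pos_pos Gamma_real_pos L0) simp
  have 1: "(\<integral>\<^sup>+s. ennreal (ball_kernel \<beta> (norm x) s * v s) \<partial>lborel) = ennreal (K * gauss 1 x)" for x :: 'a
  proof -
    have eq: "ball_kernel \<beta> (norm x) s * v s = ball_kernel \<beta> (norm x) s * (s * exp (- s\<^sup>2 / 2))" for s
    proof (cases "s \<ge> 0")
      case False
      then have "\<not> norm x \<le> s" using norm_ge_zero[of x] by linarith
      then show ?thesis by (simp add: ball_kernel_def)
    qed (simp add: v_def)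
    show ?thesis unfolding eq gauss_kernel_1d[OF norm_ge_zero \<beta>] by (simp add: K_def gauss_def)
  qed
  have 2: "(\<integral>\<^sup>+s. ennreal (indicator {0..} s * (v s * s powr (?N + 2 * \<beta>))) \<partial>lborel) = ennreal L"
  proof -
    have b: "?N / 2 + \<beta> > - 1" using L0 by linarith
    have eq: "indicator {0..} s * (v s * s powr (?N + 2 * \<beta>)) = ball_kernel (?N / 2 + \<beta>) 0 s * (s * exp (- s\<^sup>2 / 2))" for s
    proof (cases "s > 0")
      case True
      then have "(s\<^sup>2) powr (?N / 2 + \<beta>) = s powr (2 * (?N / 2 + \<beta>))" by (simp add: powr_powr flip: powr_numeral)
      also have "2 * (?N / 2 + \<beta>) = ?N + 2 * \<beta>" by simp
      finally show ?thesis using True by (simp add: v_def ball_kernel_def)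
    next
      case False then show ?thesis by (auto simp: v_def ball_kernel_def indicator_def)
    qed
    show ?thesis unfolding eq gauss_kernel_1d[OF order_refl b] by (simp add: L_def)
  qed
  have "(\<integral>\<^sup>+x. ennreal (p x) * ennreal (K * gauss 1 x) \<partial>lborel) = ennreal K * ?g"
    using K p0 by (subst nn_integral_cmult[symmetric]) (auto simp: ennreal_mult mult_ac intro!: nn_integral_cong)
  then have "ennreal K * ?g = ennreal L * ?c"
    using ball_kernel_moment_weighted[OF vm v0] unfolding 1 2 by simp
  then have "ennreal (1 / L) * (ennreal K * ?g) = ennreal (1 / L) * (ennreal L * ?c)" by simp
  also have "\<dots> = ?c" using L by (simp add: mult.assoc[symmetric] ennreal_mult[symmetric])
  also have "ennreal (1 / L) * (ennreal K * ?g) = ennreal (K / L) * ?g"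
    using K L by (simp add: mult.assoc[symmetric] ennreal_mult[symmetric])
  also have "K / L = 2 powr (- ?N / 2) * Gamma (\<beta> + 1) / Gamma (?N / 2 + \<beta> + 1)"
  proof -
    have e: "2 powr (- ?N / 2) = 1 / 2 powr (?N / 2)"
      using powr_minus_divide[of 2 "?N / 2"] by (simp only: minus_divide_left)
    show ?thesis unfolding K_def L_def e powr_add by simp
  qed
  finally show ?thesis by simp
qed

end

text \<open>Under the normalised Gaussian measure the functional given by \<eta> is standard normal:
  \<open>gauss_1_fourier\<close> yields its characteristic function, and Levy's uniqueness theorem
  replaces a rotation of coordinates. The moments are then the classical ones.\<close>

lemma gauss_moment_unit:
  fixes \<eta> :: "'a::euclidean_space"
  assumes \<eta>: "norm \<eta> = 1"
  shows "(\<integral>\<^sup>+x. ennreal ((\<eta> \<bullet> x) ^ (2 * k) * gauss 1 x) \<partial>lborel)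
    = ennreal ((2 * pi) powr (real DIM('a) / 2) * (fact (2 * k) / (2 ^ k * fact k)))"
proof -
  define C where "C = (2 * pi) powr (real DIM('a) / 2)"
  have C: "C > 0" by (simp add: C_def)
  define M where "M = density (lborel :: 'a measure) (\<lambda>x. ennreal (gauss 1 x / C))"
  have ig: "integrable lborel (gauss 1 :: 'a \<Rightarrow> real)" by (rule integrable_gauss) simp
  interpret M: prob_space M
  proof
    have "emeasure M (space M) = (\<integral>\<^sup>+x. ennreal (gauss 1 x / C) \<partial>(lborel :: 'a measure))"
      unfolding M_def by (subst emeasure_density) auto
    also have "\<dots> = ennreal (\<integral>x. gauss 1 x / C \<partial>(lborel :: 'a measure))"
      using ig C by (intro nn_integral_eq_integral) auto
    also have "(\<integral>x. gauss 1 x / C \<partial>(lborel :: 'a measure)) = 1" using C by (simp add: integral_gauss_1 C_def)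
    finally show "emeasure M (space M) = 1" by simp
  qed
  define D where "D = distr M borel (\<lambda>x. \<eta> \<bullet> x)"
  have me[measurable]: "(\<lambda>x. \<eta> \<bullet> x) \<in> borel_measurable M" by (simp add: M_def)
  have D: "real_distribution D"
    unfolding D_def real_distribution_def real_distribution_axioms_def
    using M.prob_space_distr[OF me] by simp
  have "char D t = complex_of_real (exp (- t\<^sup>2 / 2))" for t
  proof -
    have "char D t = (\<integral>x. iexp (t * (\<eta> \<bullet> x)) \<partial>M)"
      unfolding char_def D_def by (subst integral_distr[OF me]) auto
    also have "\<dots> = (\<integral>x. (gauss 1 x / C) *\<^sub>R iexp (t * (\<eta> \<bullet> x)) \<partial>lborel)"
      unfolding M_def using C by (subst integral_density) auto
    also have "\<dots> = complex_of_real (1 / C) * fourier (\<lambda>x. complex_of_real (gauss 1 x)) (- t *\<^sub>R \<eta>)"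
      unfolding fourier_def by (subst integral_mult_right_zero[symmetric]) (simp add: scaleR_conv_of_real mult_ac)
    also have "\<dots> = complex_of_real (exp (- t\<^sup>2 / 2))"
      unfolding gauss_1_fourier(2) using C \<eta> by (simp add: C_def gauss_def power_mult_distrib)
    finally show ?thesis .
  qed
  then have "char D = char std_normal_distribution"
    by (simp add: char_std_normal_distribution fun_eq_iff)
  then have DN: "D = std_normal_distribution"
    using Levy_uniqueness D real_dist_normal_dist by blast
  have p: "0 \<le> t ^ (2 * k)" for t :: real by (simp add: zero_le_even_power)
  have "(\<integral>\<^sup>+x. ennreal ((\<eta> \<bullet> x) ^ (2 * k) * gauss 1 x) \<partial>lborel) = ennreal C * (\<integral>\<^sup>+x. ennreal (gauss 1 x / C) * ennreal ((\<eta> \<bullet> x) ^ (2 * k)) \<partial>lborel)"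
    using C p by (subst nn_integral_cmult[symmetric]) (auto simp: ennreal_mult[symmetric] mult.commute)
  also have "(\<integral>\<^sup>+x. ennreal (gauss 1 x / C) * ennreal ((\<eta> \<bullet> x) ^ (2 * k)) \<partial>lborel) = (\<integral>\<^sup>+x. ennreal ((\<eta> \<bullet> x) ^ (2 * k)) \<partial>M)"
    unfolding M_def by (subst nn_integral_density) auto
  also have "\<dots> = (\<integral>\<^sup>+t. ennreal (t ^ (2 * k)) \<partial>D)"
    unfolding D_def by (subst nn_integral_distr) auto
  also have "\<dots> = (\<integral>\<^sup>+t. ennreal (std_normal_density t * t ^ (2 * k)) \<partial>lborel)"
    unfolding DN using p by (subst nn_integral_density) (auto simp: ennreal_mult)
  also have "\<dots> = ennreal (fact (2 * k) / (2 ^ k * fact k))"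
    using std_normal_moment_even[of k] p
    by (subst nn_integral_eq_integral) (auto simp: integral_std_normal_moment_even has_bochner_integral_iff)
  also have "ennreal C * ennreal (fact (2 * k) / (2 ^ k * fact k)) = ennreal (C * (fact (2 * k) / (2 ^ k * fact k)))"
    by (rule ennreal_mult[symmetric]) (use C in auto)
  finally show ?thesis unfolding C_def .
qed

lemma gauss_moment:
  fixes \<xi> :: "'a::euclidean_space"
  shows "(\<integral>\<^sup>+x. ennreal ((\<xi> \<bullet> x) ^ (2 * k) * gauss 1 x) \<partial>lborel)
    = ennreal ((2 * pi) powr (real DIM('a) / 2) * (fact (2 * k) / (2 ^ k * fact k)) * norm \<xi> ^ (2 * k))"
proof -
  \<comment> \<open>For \<xi> = 0 any unit vector will do.\<close>
  obtain \<eta> :: 'a where \<eta>: "norm \<eta> = 1" "\<xi> = norm \<xi> *\<^sub>R \<eta>"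
  proof (cases "\<xi> = 0")
    case True
    obtain b :: 'a where "b \<in> Basis" using nonempty_Basis by blast
    then show ?thesis using True that[of b] by simp
  next
    case False then show ?thesis using that[of "\<xi> /\<^sub>R norm \<xi>"] by simp
  qed
  have p: "0 \<le> t ^ (2 * k)" for t :: real by (simp add: zero_le_even_power)
  have e: "(\<xi> \<bullet> x) ^ (2 * k) * gauss 1 x = norm \<xi> ^ (2 * k) * ((\<eta> \<bullet> x) ^ (2 * k) * gauss 1 x)" for x
    by (subst \<eta>(2)) (simp add: power_mult_distrib)
  have "(\<integral>\<^sup>+x. ennreal ((\<xi> \<bullet> x) ^ (2 * k) * gauss 1 x) \<partial>lborel) = ennreal (norm \<xi> ^ (2 * k)) * (\<integral>\<^sup>+x. ennreal ((\<eta> \<bullet> x) ^ (2 * k) * gauss 1 x) \<partial>lborel)"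
    unfolding e using p by (subst nn_integral_cmult[symmetric]) (auto simp: ennreal_mult)
  also have "\<dots> = ennreal (norm \<xi> ^ (2 * k) * ((2 * pi) powr (real DIM('a) / 2) * (fact (2 * k) / (2 ^ k * fact k))))"
    unfolding gauss_moment_unit[OF \<eta>(1)] by (subst ennreal_mult[symmetric]) auto
  finally show ?thesis by (simp add: mult.commute)
qed

lemma Gamma_duplication_real:
  fixes x :: real
  assumes x: "x > 0"
  shows "Gamma (2 * x) = 2 powr (2 * x - 1) * Gamma x * Gamma (x + 1/2) / sqrt pi"
proof -
  have "complex_of_real x \<notin> \<int>\<^sub>\<le>\<^sub>0" "complex_of_real x + 1/2 \<notin> \<int>\<^sub>\<le>\<^sub>0"
  proof -
    show "complex_of_real x \<notin> \<int>\<^sub>\<le>\<^sub>0" using x by (auto elim!: nonpos_Ints_cases simp: complex_eq_iff)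
    show "complex_of_real x + 1/2 \<notin> \<int>\<^sub>\<le>\<^sub>0" using x by (auto elim!: nonpos_Ints_cases simp: complex_eq_iff)
  qed
  from Gamma_legendre_duplication[OF this]
  have "complex_of_real (Gamma x * Gamma (x + 1/2)) = complex_of_real (exp ((1 - 2 * x) * ln 2) * sqrt pi * Gamma (2 * x))"
    using Gamma_complex_of_real[of x] Gamma_complex_of_real[of "x + 1/2"] Gamma_complex_of_real[of "2 * x"]
    by (simp add: exp_of_real[symmetric])
  then have "Gamma x * Gamma (x + 1/2) = exp ((1 - 2 * x) * ln 2) * sqrt pi * Gamma (2 * x)"
    using of_real_eq_iff by blast
  moreover have "exp ((1 - 2 * x) * ln 2) = inverse (2 powr (2 * x - 1))"
    by (simp add: powr_def exp_minus[symmetric] algebra_simps)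
  moreover have "g = a * p * q / s" if "p * q = inverse a * s * g" "a > 0" "s > 0" for a g p q s :: real
  proof -
    have "a * p * q = (a * inverse a) * (s * g)" using that(1) by (simp only: mult_ac)
    also have "\<dots> = s * g" using that(2) by simp
    finally show ?thesis using that(3) by simp
  qed
  ultimately show ?thesis by simp
qed

text \<open>The left side is the product of the constants gathered in \<open>Phi_moment\<close>,
  without \<open>fact (2 * k)\<close>. Legendre duplication splits Gamma(2 \<delta> - d) and Gamma(2
  k + 2 \<delta>), the factors at half-integer shifts cancel, and the quotients of Gamma values are
  Pochhammer symbols.\<close>

lemma phi_moment_constant:
  fixes \<delta> :: real and d k :: nat
  assumes d: "d \<ge> 1" and \<delta>: "\<delta> > 1" and \<delta>d: "2 * \<delta> > real d"
  shows "1 / Beta (2 * \<delta> - real d) \<delta> * Beta (2 * real k + 2 * \<delta>) \<delta>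
      * (2 powr (- real (2 * k + d) / 2) * Gamma (\<delta> - (real d + 1) / 2 + 1) / Gamma (real k + \<delta> + 1/2))
      * ((2 * pi) powr (real d / 2) * (1 / (2 ^ k * fact k)))
    = zeta_const d \<delta> * W_coeff \<delta> k / 4 ^ k"
proof -
  define G where "G = (Gamma :: real \<Rightarrow> real)"
  have Gp: "G x > 0" if "x > 0" for x using that by (simp add: G_def Gamma_real_pos)
  define b where "b = \<delta> - real d / 2"
  have b: "b > 0" using \<delta>d by (simp add: b_def)
  have b1: "\<delta> - (real d + 1) / 2 + 1 = b + 1/2" by (simp add: b_def field_simps)
  have d1: "G (2 * \<delta> - real d) = 2 powr (2 * b - 1) * G b * G (b + 1/2) / sqrt pi"
    using Gamma_duplication_real[OF b] by (simp add: G_def b_def)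
  have d2: "G (2 * real k + 2 * \<delta>) = 2 powr (2 * (real k + \<delta>) - 1) * G (real k + \<delta>) * G (real k + \<delta> + 1/2) / sqrt pi"
    using Gamma_duplication_real[of "real k + \<delta>"] \<delta> by (simp add: G_def distrib_left)
  have pd: "pochhammer \<delta> k = G (real k + \<delta>) / G \<delta>"
  proof -
    have "\<delta> \<notin> \<int>\<^sub>\<le>\<^sub>0" using \<delta> by (auto elim!: nonpos_Ints_cases)
    then show ?thesis unfolding G_def using pochhammer_Gamma[of \<delta> k] by (simp add: add.commute)
  qed
  have p3: "pochhammer (3 * \<delta> / 2) k * pochhammer ((3 * \<delta> + 1) / 2) k = G (2 * real k + 3 * \<delta>) / G (3 * \<delta>) / 4 ^ k"
  proof -
    have "3 * \<delta> \<notin> \<int>\<^sub>\<le>\<^sub>0" using \<delta> by (auto elim!: nonpos_Ints_cases)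
    then have "G (2 * real k + 3 * \<delta>) / G (3 * \<delta>) = pochhammer (3 * \<delta>) (2 * k)"
      unfolding G_def using pochhammer_Gamma[of "3 * \<delta>" "2 * k"] by (simp add: add.commute)
    also have "\<dots> = 4 ^ k * pochhammer (3 * \<delta> / 2) k * pochhammer (3 * \<delta> / 2 + 1/2) k"
      using pochhammer_double[of "3 * \<delta> / 2" k] by (simp add: power_mult)
    also have "3 * \<delta> / 2 + 1/2 = (3 * \<delta> + 1) / 2" by (simp add: field_simps)
    finally show ?thesis by simp
  qed
  define K where "K = real k"
  \<comment> \<open>The powers of 2 are named and collected separately; together they reduce to 2^d,
    the power hidden in \<open>omega_const\<close>.\<close>
  define A where "A = 2 powr (2 * b - 1)"
  define B where "B = 2 powr (2 * (K + \<delta>) - 1)"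
  define C where "C = 2 powr (- (2 * K + real d) / 2)"
  define D where "D = 2 powr (real d / 2)"
  have ABCD: "B * C * D / (A * 2 ^ k) = 2 powr (real d)"
  proof -
    have "(2::real) ^ k = 2 powr K" by (simp add: K_def powr_realpow)
    then have "B * C * D / (A * 2 ^ k) = 2 powr ((2 * (K + \<delta>) - 1) + (- (2 * K + real d) / 2) + real d / 2 - ((2 * b - 1) + K))"
      unfolding A_def B_def C_def D_def by (simp only: powr_add[symmetric] powr_diff[symmetric])
    also have "(2 * (K + \<delta>) - 1) + (- (2 * K + real d) / 2) + real d / 2 - ((2 * b - 1) + K) = real d"
      by (simp add: b_def field_simps)
    finally show ?thesis .
  qed
  have ABCDp: "A > 0" "B > 0" "C > 0" "D > 0" by (simp_all add: A_def B_def C_def D_def)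
  have two: "2 * (1 / 2 powr (1 - real d)) = 2 powr real d"
    by (simp add: powr_diff)
  have Gs: "G b > 0" "G (b + 1/2) > 0" "G \<delta> > 0" "G (K + \<delta>) > 0" "G (K + \<delta> + 1/2) > 0" "G (2 * K + 3 * \<delta>) > 0"
    "G (3 * \<delta>) > 0" "G (3 * \<delta> - real d) > 0" "G (real d / 2) > 0" "sqrt pi > 0"
    using b \<delta> \<delta>d d by (auto intro!: Gp simp: K_def add_pos_nonneg)
  have e1: "2 * \<delta> - real d + \<delta> = 3 * \<delta> - real d" "2 * K + 2 * \<delta> + \<delta> = 2 * K + 3 * \<delta>" by simp_all
  have "1 / Beta (2 * \<delta> - real d) \<delta> * Beta (2 * real k + 2 * \<delta>) \<delta>
      * (2 powr (- real (2 * k + d) / 2) * Gamma (\<delta> - (real d + 1) / 2 + 1) / Gamma (real k + \<delta> + 1/2))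
      * ((2 * pi) powr (real d / 2) * (1 / (2 ^ k * fact k)))
    = G (3 * \<delta> - real d) / (A * G b * G (b + 1/2) / sqrt pi * G \<delta>)
      * (B * G (K + \<delta>) * G (K + \<delta> + 1/2) / sqrt pi * G \<delta> / G (2 * K + 3 * \<delta>))
      * (C * G (b + 1/2) / G (K + \<delta> + 1/2)) * (D * pi powr (real d / 2) * (1 / (2 ^ k * fact k)))"
  proof -
    have "real (2 * k + d) = 2 * K + real d" by (simp add: K_def)
    moreover have "(2 * pi) powr (real d / 2) = D * pi powr (real d / 2)" by (simp add: D_def powr_mult)
    ultimately show ?thesis
      unfolding Beta_def b1 G_def[symmetric] K_def[symmetric] d1 d2[folded K_def] A_def[symmetric] B_def[symmetric] e1 C_def
      by (simp only: divide_divide_eq_right mult_1 divide_divide_eq_left times_divide_eq_left times_divide_eq_right mult_ac)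
  qed
  also have "\<dots> = (B * C * D / (A * 2 ^ k)) * (G (3 * \<delta> - real d) * G (K + \<delta>) * pi powr (real d / 2) / (G b * G (2 * K + 3 * \<delta>) * fact k))"
    using Gs ABCDp by (simp add: divide_simps)
  also have "\<dots> = 2 powr (real d) * (G (3 * \<delta> - real d) * G (K + \<delta>) * pi powr (real d / 2) / (G b * G (2 * K + 3 * \<delta>) * fact k))"
    unfolding ABCD ..
  also have "\<dots> = zeta_const d \<delta> * W_coeff \<delta> k / 4 ^ k"
    unfolding zeta_const_def omega_const_def W_coeff_def pd p3 two[symmetric] G_def[symmetric] K_def[symmetric] b_def[symmetric]
    using Gs by (simp add: divide_simps)
  finally show ?thesis .
qed

section \<open>Integrability and continuity of the radial function\<close>

context
  fixes d :: nat and \<delta> :: real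
  assumes d: "d \<ge> 1" and \<delta>: "\<delta> > 1" and \<delta>d: "2 * \<delta> > real d"
begin

definition "phi_integrand t s = ball_kernel (\<delta> - (real d + 1) / 2) t s * (indicator {0..1} s * (1 - s) powr (\<delta> - 1))"

text \<open>The substitution \<open>s = t + (1 - t) \<sigma>\<close> makes the range of integration independent of \<open>t\<close>, so that
  continuity in \<open>t\<close> follows by dominated convergence.\<close>

definition "phi_profile t \<sigma> = indicator {0..1} \<sigma> * (\<sigma> powr (\<delta> - (real d + 1) / 2)
    * (2 * t + (1 - t) * \<sigma>) powr (\<delta> - (real d + 1) / 2) * (1 - \<sigma>) powr (\<delta> - 1))"

lemma phi_integrand_nonneg: "phi_integrand t s \<ge> 0"
  by (simp add: phi_integrand_def)

lemma phi_profile_measurable [measurable]: "phi_profile t \<in> borel_measurable borel"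
  unfolding phi_profile_def[abs_def] by measurable

lemma phi_integrand_affine:
  assumes t: "0 \<le> t" "t < 1"
  shows "phi_integrand t (t + (1 - t) * \<sigma>) = (1 - t) powr (\<delta> - (real d + 1) / 2 + \<delta> - 1) * phi_profile t \<sigma>"
proof (cases "\<sigma> \<in> {0..1}")
  case True
  define \<beta> where "\<beta> = \<delta> - (real d + 1) / 2"
  have s: "0 \<le> \<sigma>" "\<sigma> \<le> 1" using True by auto
  have a: "(1 - t) * \<sigma> \<ge> 0" using s t by simp
  define z where "z = (1 - t) * \<sigma>"
  have "z \<le> (1 - t) * 1" unfolding z_def using s t by (intro mult_left_mono) auto
  then have "z \<le> 1 - t" "z \<ge> 0" using a by (simp_all add: z_def)
  then have "t \<le> t + z" "t + z \<le> 1" "0 \<le> t + z" using t by linarith+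
  then have i: "t \<le> t + (1 - t) * \<sigma>" "t + (1 - t) * \<sigma> \<le> 1" "0 \<le> t + (1 - t) * \<sigma>" unfolding z_def by auto
  have e1: "(t + (1 - t) * \<sigma>)\<^sup>2 - t\<^sup>2 = (1 - t) * \<sigma> * (2 * t + (1 - t) * \<sigma>)" by (simp add: power2_eq_square algebra_simps)
  have e2: "1 - (t + (1 - t) * \<sigma>) = (1 - t) * (1 - \<sigma>)" by (simp add: algebra_simps)
  have "phi_integrand t (t + (1 - t) * \<sigma>) = ((1 - t) * \<sigma> * (2 * t + (1 - t) * \<sigma>)) powr \<beta> * ((1 - t) * (1 - \<sigma>)) powr (\<delta> - 1)"
    unfolding phi_integrand_def ball_kernel_def e1 e2 \<beta>_def using i by simp
  also have "\<dots> = ((1 - t) powr \<beta> * \<sigma> powr \<beta> * (2 * t + (1 - t) * \<sigma>) powr \<beta>) * ((1 - t) powr (\<delta> - 1) * (1 - \<sigma>) powr (\<delta> - 1))"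
    using a t s by (simp add: powr_mult)
  also have "\<dots> = (1 - t) powr (\<beta> + \<delta> - 1) * phi_profile t \<sigma>"
  proof -
    have "(1 - t) powr (\<beta> + \<delta> - 1) = (1 - t) powr \<beta> * (1 - t) powr (\<delta> - 1)" by (simp add: powr_add[symmetric] add_diff_eq)
    then show ?thesis using s unfolding phi_profile_def \<beta>_def[symmetric] by simp
  qed
  finally show ?thesis unfolding \<beta>_def .
next
  case False
  then consider "\<sigma> < 0" | "\<sigma> > 1" by force
  then have "t + (1 - t) * \<sigma> < t \<or> t + (1 - t) * \<sigma> > 1"
  proof cases
    case 1 then show ?thesis using t by (simp add: mult_pos_neg)
  next
    case 2
    then have "(1 - t) * 1 < (1 - t) * \<sigma>" using t by (intro mult_strict_left_mono) auto
    then show ?thesis by simp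
  qed
  then show ?thesis using False by (auto simp: phi_integrand_def phi_profile_def ball_kernel_def indicator_def)
qed

text \<open>The base 2t + (1 - t) \<sigma> lies between \<sigma> and 2, so its power is at most the
  sum of the two extreme powers, whatever the sign of the exponent. The bound does not depend on
  t.\<close>

definition "phi_dominant \<sigma> = indicator {0..1} \<sigma> * (\<sigma> powr (\<delta> - (real d + 1) / 2)
    * (2 powr (\<delta> - (real d + 1) / 2) + \<sigma> powr (\<delta> - (real d + 1) / 2)) * (1 - \<sigma>) powr (\<delta> - 1))"

text \<open>A sum of two Beta integrals. With exponent \<beta> = \<delta> - (d + 1) / 2 the worse
  singularity at 0 is \<sigma>^(2 \<beta>), integrable because 2 \<beta> + 1 = 2 \<delta> - d >
  0.\<close>

lemma integrable_phi_dominant: "integrable lborel phi_dominant"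
proof -
  define \<beta> where "\<beta> = \<delta> - (real d + 1) / 2"
  have b: "\<beta> + 1 > 0" "2 * \<beta> + 1 > 0" using \<delta>d by (auto simp: \<beta>_def field_simps)
  have "0 < \<delta>" using \<delta> by simp
  note integrable_Beta[OF b(1) this] integrable_Beta[OF b(2) this]
  then have "integrable lborel (\<lambda>t. 2 powr \<beta> * (indicator {0..1} t *\<^sub>R (t powr ((\<beta> + 1) - 1) * (1 - t) powr (\<delta> - 1)))
    + indicator {0..1} t *\<^sub>R (t powr ((2 * \<beta> + 1) - 1) * (1 - t) powr (\<delta> - 1)))"
    unfolding set_integrable_def by (intro Bochner_Integration.integrable_add integrable_mult_right)
  moreover have "phi_dominant t = 2 powr \<beta> * (indicator {0..1} t *\<^sub>R (t powr ((\<beta> + 1) - 1) * (1 - t) powr (\<delta> - 1)))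
    + indicator {0..1} t *\<^sub>R (t powr ((2 * \<beta> + 1) - 1) * (1 - t) powr (\<delta> - 1))" for t
  proof -
    have "t powr (2 * \<beta>) = t powr \<beta> * t powr \<beta>" by (simp add: powr_add[symmetric])
    then show ?thesis unfolding phi_dominant_def \<beta>_def[symmetric] by (simp add: algebra_simps)
  qed
  ultimately show ?thesis by (simp cong: Bochner_Integration.integrable_cong)
qed

lemma phi_profile_le:
  assumes t: "0 \<le> t" "t \<le> 1"
  shows "norm (phi_profile t \<sigma>) \<le> phi_dominant \<sigma>"
proof (cases "\<sigma> \<in> {0<..1}")
  case True
  define \<beta> where "\<beta> = \<delta> - (real d + 1) / 2"
  define y where "y = 2 * t + (1 - t) * \<sigma>"
  have s: "0 < \<sigma>" "\<sigma> \<le> 1" using True by auto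
  have "y = \<sigma> + t * (2 - \<sigma>)" by (simp add: y_def algebra_simps)
  then have y1: "\<sigma> \<le> y" using s t by simp
  define z where "z = (1 - t) * \<sigma>"
  have "z \<le> (1 - t) * 1" unfolding z_def using s t by (intro mult_left_mono) auto
  then have "z \<le> 1 - t" by simp
  then have y2: "y \<le> 2" using t unfolding y_def z_def[symmetric] by linarith
  have "y powr \<beta> \<le> 2 powr \<beta> + \<sigma> powr \<beta>"
  proof (cases "\<beta> \<ge> 0")
    case True
    then have "y powr \<beta> \<le> 2 powr \<beta>" using y1 y2 s by (intro powr_mono2) auto
    then show ?thesis using powr_ge_zero[of \<sigma> \<beta>] by linarith
  next
    case False
    then have "y powr \<beta> \<le> \<sigma> powr \<beta>" using y1 s by (intro powr_mono2') auto
    then show ?thesis using powr_ge_zero[of 2 \<beta>] by linarith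
  qed
  then have "\<sigma> powr \<beta> * y powr \<beta> * (1 - \<sigma>) powr (\<delta> - 1) \<le> \<sigma> powr \<beta> * (2 powr \<beta> + \<sigma> powr \<beta>) * (1 - \<sigma>) powr (\<delta> - 1)"
    by (intro mult_right_mono mult_left_mono) auto
  then show ?thesis using s unfolding phi_profile_def phi_dominant_def \<beta>_def y_def by simp
next
  case False
  \<comment> \<open>At \<sigma> = 0 both functions vanish, as \<open>powr\<close> with base 0 is 0
    even for a negative exponent.\<close>
  then have "\<sigma> = 0 \<or> \<sigma> \<notin> {0..1}" by auto
  then show ?thesis by (auto simp: phi_profile_def phi_dominant_def)
qed

lemma integrable_phi_profile: "0 \<le> t \<Longrightarrow> t \<le> 1 \<Longrightarrow> integrable lborel (phi_profile t)"
  by (rule Bochner_Integration.integrable_bound[OF integrable_phi_dominant])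
    (use phi_profile_le in \<open>auto intro: order_trans[OF _ abs_ge_self]\<close>)

lemma phi_integrand_0:
  assumes "t \<ge> 1" shows "phi_integrand t s = 0"
  using assms \<delta> by (cases "s = 1") (auto simp: phi_integrand_def ball_kernel_def indicator_def)

lemma integrable_phi_integrand:
  assumes t: "0 \<le> t" shows "integrable lborel (phi_integrand t)"
proof (cases "t < 1")
  case True
  have "integrable lborel (\<lambda>\<sigma>. phi_integrand t (t + (1 - t) * \<sigma>))"
    unfolding phi_integrand_affine[OF t True] using t True by (intro integrable_mult_right integrable_phi_profile) auto
  then show ?thesis using True by (subst (asm) lborel_integrable_real_affine_iff) auto
next
  case False
  then have "phi_integrand t = (\<lambda>_. 0)" using phi_integrand_0 by auto
  then show ?thesis by simp
qed

lemma integral_phi_integrand: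
  assumes t: "0 \<le> t" "t \<le> 1"
  shows "(\<integral>s. phi_integrand t s \<partial>lborel) = (1 - t) powr (2 * \<delta> - (real d + 1) / 2) * (\<integral>\<sigma>. phi_profile t \<sigma> \<partial>lborel)"
proof (cases "t < 1")
  case True
  have "(\<integral>s. phi_integrand t s \<partial>lborel) = \<bar>1 - t\<bar> *\<^sub>R (\<integral>\<sigma>. phi_integrand t (t + (1 - t) * \<sigma>) \<partial>lborel)"
    using True by (intro lborel_integral_real_affine) auto
  also have "\<dots> = (1 - t) * ((1 - t) powr (\<delta> - (real d + 1) / 2 + \<delta> - 1) * (\<integral>\<sigma>. phi_profile t \<sigma> \<partial>lborel))"
    unfolding phi_integrand_affine[OF t(1) True] using True by simp
  also have "\<dots> = ((1 - t) powr 1 * (1 - t) powr (\<delta> - (real d + 1) / 2 + \<delta> - 1)) * (\<integral>\<sigma>. phi_profile t \<sigma> \<partial>lborel)"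
    using True by simp
  also have "(1 - t) powr 1 * (1 - t) powr (\<delta> - (real d + 1) / 2 + \<delta> - 1) = (1 - t) powr (2 * \<delta> - (real d + 1) / 2)"
    unfolding powr_add[symmetric] by (rule arg_cong[where f = "\<lambda>e. (1 - t) powr e"]) simp
  finally show ?thesis .
next
  case False
  then have "t = 1" using t by simp
  then show ?thesis using phi_integrand_0[of 1] by simp
qed

lemma Phi_radial_eq:
  assumes t: "t \<ge> 0"
  shows "Phi_radial d \<delta> t = 1 / Beta (2 * \<delta> - real d) \<delta> * (\<integral>s. phi_integrand t s \<partial>lborel)"
proof (cases "t \<le> 1")
  case True
  have "(LINT s:{t..1}|lborel. (s\<^sup>2 - t\<^sup>2) powr (\<delta> - (real d + 1) / 2) * (1 - s) powr (\<delta> - 1)) = (\<integral>s. phi_integrand t s \<partial>lborel)"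
    unfolding set_lebesgue_integral_def
    by (rule Bochner_Integration.integral_cong[OF refl]) (use t in \<open>auto simp: phi_integrand_def ball_kernel_def indicator_def\<close>)
  then show ?thesis using t True by (simp add: Phi_radial_def)
next
  case False then show ?thesis using phi_integrand_0[of t] by (simp add: Phi_radial_def)
qed

lemma Beta_pos_const: "Beta (2 * \<delta> - real d) \<delta> > 0"
  using \<delta> \<delta>d by (auto simp: Beta_def intro!: divide_pos_pos mult_pos_pos Gamma_real_pos)

lemma Phi_radial_nonneg: "t \<ge> 0 \<Longrightarrow> Phi_radial d \<delta> t \<ge> 0"
  using Beta_pos_const by (simp add: Phi_radial_eq phi_integrand_nonneg)

lemma Phi_radial_outside: "t \<ge> 1 \<Longrightarrow> Phi_radial d \<delta> t = 0"
  using phi_integrand_0 by (simp add: Phi_radial_eq)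

lemma continuous_phi_profile_integral: "continuous_on {0..1} (\<lambda>t. \<integral>\<sigma>. phi_profile t \<sigma> \<partial>lborel)"
  unfolding continuous_on_sequentially o_def
proof (intro allI ballI impI, elim conjE)
  fix x :: "nat \<Rightarrow> real" and a assume a: "a \<in> {0..1}" and x: "\<forall>n. x n \<in> {0..1}" "x \<longlonglongrightarrow> a"
  show "(\<lambda>n. \<integral>\<sigma>. phi_profile (x n) \<sigma> \<partial>lborel) \<longlonglongrightarrow> (\<integral>\<sigma>. phi_profile a \<sigma> \<partial>lborel)"
  proof (rule integral_dominated_convergence[OF _ _ integrable_phi_dominant])
    show "AE \<sigma> in lborel. (\<lambda>n. phi_profile (x n) \<sigma>) \<longlonglongrightarrow> phi_profile a \<sigma>"
    proof (rule AE_I2)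
      fix \<sigma> :: real
      show "(\<lambda>n. phi_profile (x n) \<sigma>) \<longlonglongrightarrow> phi_profile a \<sigma>"
      proof (cases "\<sigma> \<in> {0<..1}")
        case True
        have "2 * a + (1 - a) * \<sigma> = \<sigma> + a * (2 - \<sigma>)" by (simp add: algebra_simps)
        then have "2 * a + (1 - a) * \<sigma> > 0" using True a by (simp add: add_pos_nonneg)
        then show ?thesis unfolding phi_profile_def by (intro tendsto_intros x) auto
      next
        case False
        then have "\<sigma> = 0 \<or> \<sigma> \<notin> {0..1}" by auto
        then show ?thesis by (auto simp: phi_profile_def)
      qed
    qed
    show "AE \<sigma> in lborel. norm (phi_profile (x n) \<sigma>) \<le> phi_dominant \<sigma>" for n
      using x(1) by (intro AE_I2 phi_profile_le) auto
  qed measurable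
qed

text \<open>On the unit interval the function is a power of 1 - t times a continuous integral; the
  power has the positive exponent 2 \<delta> - (d + 1) / 2, so the pieces match with value 0 at t =
  1.\<close>

lemma continuous_Phi_radial: "continuous_on {0..} (Phi_radial d \<delta>)"
proof -
  have e: "2 * \<delta> - (real d + 1) / 2 > 0" using \<delta>d d by (simp add: field_simps)
  have "continuous_on {0..1} (\<lambda>t. 1 / Beta (2 * \<delta> - real d) \<delta> * ((1 - t) powr (2 * \<delta> - (real d + 1) / 2) * (\<integral>\<sigma>. phi_profile t \<sigma> \<partial>lborel)))"
    using e by (intro continuous_intros continuous_on_powr' continuous_phi_profile_integral) auto
  then have 1: "continuous_on {0..1} (Phi_radial d \<delta>)"
    by (rule continuous_on_eq) (auto simp: Phi_radial_eq integral_phi_integrand)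
  have "continuous_on {1..} (\<lambda>_::real. 0::real)" by simp
  then have 2: "continuous_on {1..} (Phi_radial d \<delta>)"
    by (rule continuous_on_eq) (auto simp: Phi_radial_outside)
  have "continuous_on ({0..1} \<union> {1..}) (Phi_radial d \<delta>)"
    by (rule continuous_on_closed_Un) (use 1 2 in auto)
  moreover have "{0..1} \<union> {1..} = {0::real..}" by auto
  ultimately show ?thesis by simp
qed

lemma Phi_radial_bounded: "\<exists>M. \<forall>t\<ge>0. Phi_radial d \<delta> t \<le> M"
proof -
  have "\<exists>x\<in>{0..1}. \<forall>y\<in>{0..1}. Phi_radial d \<delta> y \<le> Phi_radial d \<delta> x"
    by (intro continuous_attains_sup continuous_on_subset[OF continuous_Phi_radial]) auto
  then obtain x where x: "x \<in> {0..1}" "\<And>y. y \<in> {0..1} \<Longrightarrow> Phi_radial d \<delta> y \<le> Phi_radial d \<delta> x" by blast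
  have "Phi_radial d \<delta> t \<le> Phi_radial d \<delta> x" if "t \<ge> 0" for t
    using x that Phi_radial_nonneg[of x] Phi_radial_outside[of t] by (cases "t \<le> 1") auto
  then show ?thesis by blast
qed

end

section \<open>Moments and Fourier transform of the kernel\<close>

lemma inner_scaleR_power_even:
  fixes \<xi> x :: "'a::real_inner"
  shows "(\<xi> \<bullet> (c *\<^sub>R x)) ^ (2 * k) = c ^ (2 * k) * (\<xi> \<bullet> x) ^ (2 * k)"
  by (simp add: power_mult_distrib)

context
  fixes \<delta> :: real and \<Phi> :: "'a::euclidean_space \<Rightarrow> real"
  assumes \<delta>: "\<delta> > 1" and \<delta>d: "2 * \<delta> > real DIM('a)"
  defines "\<Phi> \<equiv> \<lambda>x. Phi_radial DIM('a) \<delta> (norm x)"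
begin

lemma DIM_ge_one: "DIM('a) \<ge> 1"
  using DIM_positive[where 'a = 'a] by simp

lemma Phi_nonneg: "\<Phi> x \<ge> 0"
  unfolding \<Phi>_def by (rule Phi_radial_nonneg[OF DIM_ge_one \<delta> \<delta>d]) simp

lemma Phi_outside: "norm x \<ge> 1 \<Longrightarrow> \<Phi> x = 0"
  unfolding \<Phi>_def by (rule Phi_radial_outside[OF DIM_ge_one \<delta> \<delta>d])

lemma continuous_Phi: "continuous_on UNIV \<Phi>"
  unfolding \<Phi>_def
  by (rule continuous_on_compose2[OF continuous_Phi_radial[OF DIM_ge_one \<delta> \<delta>d]]) (auto intro!: continuous_intros)

lemma Phi_measurable [measurable]: "\<Phi> \<in> borel_measurable borel"
  by (rule borel_measurable_continuous_onI[OF continuous_Phi])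

text \<open>The kernel is the mixture with weight (1 - s)^(\<delta> - 1) on the unit interval, so
  the weight factor of \<open>ball_kernel_moment_weighted\<close> is Beta(2k + 2 \<delta>,
  \<delta>).\<close>

lemma Phi_moment:
  fixes \<xi> :: 'a
  shows "(\<integral>\<^sup>+x. ennreal ((\<xi> \<bullet> x) ^ (2 * k) * \<Phi> x) \<partial>lborel)
    = ennreal (zeta_const DIM('a) \<delta> * W_coeff \<delta> k / 4 ^ k * fact (2 * k) * norm \<xi> ^ (2 * k))"
proof -
  let ?d = "DIM('a)"
  define \<beta> where "\<beta> = \<delta> - (real ?d + 1) / 2"
  have \<beta>: "\<beta> > -1" using \<delta>d by (simp add: \<beta>_def field_simps)
  define p where "p = (\<lambda>x. (\<xi> \<bullet> x) ^ (2 * k))"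
  have pm[measurable]: "p \<in> borel_measurable borel" unfolding p_def by measurable
  have p0: "p x \<ge> 0" for x by (simp add: p_def zero_le_even_power)
  have hom: "p (c *\<^sub>R x) = c ^ (2 * k) * p x" for c x by (simp only: p_def inner_scaleR_power_even)
  define v where "v = (\<lambda>s::real. indicator {0..1} s * (1 - s) powr (\<delta> - 1))"
  have vm[measurable]: "v \<in> borel_measurable borel" unfolding v_def by measurable
  have v0: "v s \<ge> 0" for s by (simp add: v_def)
  define B0 where "B0 = Beta (2 * \<delta> - real ?d) \<delta>"
  have B0: "B0 > 0" unfolding B0_def by (rule Beta_pos_const[OF DIM_ge_one \<delta> \<delta>d])
  define B1 where "B1 = Beta (2 * real k + 2 * \<delta>) \<delta>"
  have B1: "B1 > 0" using \<delta> by (auto simp: B1_def Beta_def intro!: divide_pos_pos mult_pos_pos Gamma_real_pos)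
  define Q where "Q = 2 powr (- real (2 * k + ?d) / 2) * Gamma (\<beta> + 1) / Gamma (real (2 * k + ?d) / 2 + \<beta> + 1)"
  have e: "real (2 * k + ?d) / 2 + \<beta> + 1 = real k + \<delta> + 1/2" by (simp add: \<beta>_def field_simps)
  have Q: "Q > 0" unfolding Q_def e using \<beta> \<delta> by (intro divide_pos_pos mult_pos_pos Gamma_real_pos) auto
  define R where "R = (2 * pi) powr (real ?d / 2) * (fact (2 * k) / (2 ^ k * fact k)) * norm \<xi> ^ (2 * k)"
  have R: "R \<ge> 0" by (simp add: R_def)
  have 1: "ennreal (\<Phi> x) = ennreal (1 / B0) * (\<integral>\<^sup>+s. ennreal (ball_kernel \<beta> (norm x) s * v s) \<partial>lborel)" for x :: 'a
  proof -
    have eq: "ball_kernel \<beta> (norm x) s * v s = phi_integrand ?d \<delta> (norm x) s" for s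
      unfolding phi_integrand_def[OF DIM_ge_one \<delta> \<delta>d] \<beta>_def v_def by simp
    have "ennreal (\<Phi> x) = ennreal (1 / B0) * ennreal (\<integral>s. phi_integrand ?d \<delta> (norm x) s \<partial>lborel)"
      unfolding \<Phi>_def Phi_radial_eq[OF DIM_ge_one \<delta> \<delta>d norm_ge_zero] B0_def[symmetric]
      by (rule ennreal_mult) (use B0 in \<open>auto simp: phi_integrand_nonneg[OF DIM_ge_one \<delta> \<delta>d]\<close>)
    also have "ennreal (\<integral>s. phi_integrand ?d \<delta> (norm x) s \<partial>lborel) = (\<integral>\<^sup>+s. ennreal (phi_integrand ?d \<delta> (norm x) s) \<partial>lborel)"
      by (rule nn_integral_eq_integral[symmetric, OF integrable_phi_integrand[OF DIM_ge_one \<delta> \<delta>d norm_ge_zero]]) (auto simp: phi_integrand_nonneg[OF DIM_ge_one \<delta> \<delta>d])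
    finally show ?thesis unfolding eq .
  qed
  have "(\<integral>\<^sup>+x. ennreal (p x * \<Phi> x) \<partial>lborel)
     = (\<integral>\<^sup>+x. ennreal (1 / B0) * (ennreal (p x) * (\<integral>\<^sup>+s. ennreal (ball_kernel \<beta> (norm x) s * v s) \<partial>lborel)) \<partial>lborel)"
    using p0 Phi_nonneg by (intro nn_integral_cong) (simp only: ennreal_mult 1 mult.left_commute)
  also have "\<dots> = ennreal (1 / B0) * (\<integral>\<^sup>+x. ennreal (p x) * (\<integral>\<^sup>+s. ennreal (ball_kernel \<beta> (norm x) s * v s) \<partial>lborel) \<partial>lborel)"
    by (rule nn_integral_cmult) measurable
  also have "(\<integral>\<^sup>+x. ennreal (p x) * (\<integral>\<^sup>+s. ennreal (ball_kernel \<beta> (norm x) s * v s) \<partial>lborel) \<partial>lborel)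
    = (\<integral>\<^sup>+s. ennreal (indicator {0..} s * (v s * s powr (real (2 * k + ?d) + 2 * \<beta>))) \<partial>lborel)
      * (\<integral>\<^sup>+x. ennreal (p x * ball_kernel \<beta> (norm x) 1) \<partial>lborel)"
    by (rule ball_kernel_moment_weighted[OF pm p0 hom \<beta> vm v0])
  also have "(\<integral>\<^sup>+s. ennreal (indicator {0..} s * (v s * s powr (real (2 * k + ?d) + 2 * \<beta>))) \<partial>lborel) = ennreal B1"
  proof -
    have ex: "real (2 * k + ?d) + 2 * \<beta> = (2 * real k + 2 * \<delta>) - 1" by (simp add: \<beta>_def field_simps)
    have eq: "indicator {0..} s * (v s * s powr (real (2 * k + ?d) + 2 * \<beta>))
      = indicator {0..1} s * (s powr ((2 * real k + 2 * \<delta>) - 1) * (1 - s) powr (\<delta> - 1))" for s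
      unfolding ex by (auto simp: v_def indicator_def)
    have "2 * real k + 2 * \<delta> > 0" "\<delta> > 0" using \<delta> by auto
    from nn_integral_has_integral_lebesgue[OF _ has_integral_Beta_real[OF this]]
    show ?thesis unfolding eq B1_def by simp
  qed
  also have "(\<integral>\<^sup>+x. ennreal (p x * ball_kernel \<beta> (norm x) 1) \<partial>lborel) = ennreal Q * (\<integral>\<^sup>+x. ennreal (p x * gauss 1 x) \<partial>lborel)"
    unfolding Q_def by (rule ball_kernel_moment_gauss[OF pm p0 hom \<beta>])
  also have "(\<integral>\<^sup>+x. ennreal (p x * gauss 1 x) \<partial>lborel) = ennreal R"
    unfolding p_def R_def by (rule gauss_moment)
  also have "ennreal (1 / B0) * (ennreal B1 * (ennreal Q * ennreal R)) = ennreal (1 / B0 * (B1 * (Q * R)))"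
    using B0 B1 Q R by (simp only: ennreal_mult[symmetric] mult_nonneg_nonneg less_imp_le divide_nonneg_pos zero_le_one)
  also have "1 / B0 * (B1 * (Q * R)) = (1 / B0 * B1 * Q * ((2 * pi) powr (real ?d / 2) * (1 / (2 ^ k * fact k)))) * (fact (2 * k) * norm \<xi> ^ (2 * k))"
    unfolding R_def by simp
  also have "1 / B0 * B1 * Q * ((2 * pi) powr (real ?d / 2) * (1 / (2 ^ k * fact k))) = zeta_const ?d \<delta> * W_coeff \<delta> k / 4 ^ k"
    using phi_moment_constant[OF DIM_ge_one \<delta> \<delta>d, of k, folded \<beta>_def]
    unfolding B0_def[symmetric] B1_def[symmetric] Q_def e .
  also have "zeta_const ?d \<delta> * W_coeff \<delta> k / 4 ^ k * (fact (2 * k) * norm \<xi> ^ (2 * k))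
      = zeta_const ?d \<delta> * W_coeff \<delta> k / 4 ^ k * fact (2 * k) * norm \<xi> ^ (2 * k)"
    by (simp only: mult.assoc)
  finally show ?thesis unfolding p_def .
qed

lemma zeta_W_coeff_nonneg: "zeta_const DIM('a) \<delta> > 0" "W_coeff \<delta> k \<ge> 0"
proof -
  have "3 * \<delta> - real DIM('a) > 0" "\<delta> - real DIM('a) / 2 > 0" "real DIM('a) / 2 > 0" using \<delta> \<delta>d DIM_ge_one by auto
  then show "zeta_const DIM('a) \<delta> > 0"
    unfolding zeta_const_def omega_const_def using \<delta>
    by (intro mult_pos_pos divide_pos_pos Gamma_real_pos) auto
  show "W_coeff \<delta> k \<ge> 0" unfolding W_coeff_def using \<delta>
    by (auto intro!: divide_nonneg_nonneg mult_nonneg_nonneg pochhammer_nonneg)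
qed

text \<open>Finiteness of the moments in \<open>ennreal\<close> gives integrability; the case k = 0
  covers the kernel itself.\<close>

lemma Phi_moment_integral:
  fixes \<xi> :: 'a
  shows "integrable lborel (\<lambda>x. (\<xi> \<bullet> x) ^ (2 * k) * \<Phi> x)"
    "(\<integral>x. (\<xi> \<bullet> x) ^ (2 * k) * \<Phi> x \<partial>lborel) = zeta_const DIM('a) \<delta> * W_coeff \<delta> k / 4 ^ k * fact (2 * k) * norm \<xi> ^ (2 * k)"
proof -
  have n: "(\<xi> \<bullet> x) ^ (2 * k) * \<Phi> x \<ge> 0" for x using Phi_nonneg by (simp add: zero_le_even_power)
  have m: "zeta_const DIM('a) \<delta> * W_coeff \<delta> k / 4 ^ k * fact (2 * k) * norm \<xi> ^ (2 * k) \<ge> 0"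
    using zeta_W_coeff_nonneg(1) zeta_W_coeff_nonneg(2)[of k] by simp
  show i: "integrable lborel (\<lambda>x. (\<xi> \<bullet> x) ^ (2 * k) * \<Phi> x)"
    using n Phi_moment[of \<xi> k] unfolding integrable_iff_bounded by simp
  have "ennreal (\<integral>x. (\<xi> \<bullet> x) ^ (2 * k) * \<Phi> x \<partial>lborel) = ennreal (zeta_const DIM('a) \<delta> * W_coeff \<delta> k / 4 ^ k * fact (2 * k) * norm \<xi> ^ (2 * k))"
    unfolding Phi_moment[symmetric] using i n by (intro nn_integral_eq_integral[symmetric]) auto
  then show "(\<integral>x. (\<xi> \<bullet> x) ^ (2 * k) * \<Phi> x \<partial>lborel) = zeta_const DIM('a) \<delta> * W_coeff \<delta> k / 4 ^ k * fact (2 * k) * norm \<xi> ^ (2 * k)"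
    using n m by (subst (asm) ennreal_inj) auto
qed

lemma integrable_Phi: "integrable lborel \<Phi>"
  using Phi_moment_integral(1)[of 0 0] by simp

text \<open>Termwise integration of the cosine series. The integrals of the absolute values are the
  terms \<open>m k\<close> of the series of W with all signs positive, which converges because W is
  entire.\<close>

lemma integral_cos_Phi:
  fixes \<xi> :: 'a
  shows "(\<integral>x. cos (\<xi> \<bullet> x) * \<Phi> x \<partial>lborel) = zeta_const DIM('a) \<delta> * W_fun \<delta> (norm \<xi>)"
proof -
  let ?f = "\<lambda>k x. (-1) ^ k / fact (2 * k) * ((\<xi> \<bullet> x) ^ (2 * k) * \<Phi> x)"
  define m where "m = (\<lambda>k. zeta_const DIM('a) \<delta> * (W_coeff \<delta> k * (norm \<xi> ^ 2 / 4) ^ k))"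
  have i: "integrable lborel (?f k)" for k by (intro integrable_mult_right Phi_moment_integral)
  have mom: "(\<integral>x. (\<xi> \<bullet> x) ^ (2 * k) * \<Phi> x \<partial>lborel) = fact (2 * k) * m k" for k
    unfolding Phi_moment_integral(2) m_def by (simp add: power_divide power_mult)
  have nf: "norm (?f k x) = 1 / fact (2 * k) * ((\<xi> \<bullet> x) ^ (2 * k) * \<Phi> x)" for k x
    using Phi_nonneg[of x] by (simp add: abs_mult power_even_abs)
  have sm: "summable m"
    unfolding m_def using entire_W[OF \<delta>] by (intro summable_mult) (auto simp: entire_coeffs_def)
  have cs: "(\<lambda>k. ?f k x) sums (cos (\<xi> \<bullet> x) * \<Phi> x)" for x
  proof -
    have "(\<lambda>k. (-1) ^ k / fact (2 * k) * (\<xi> \<bullet> x) ^ (2 * k)) sums cos (\<xi> \<bullet> x)"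
      by (rule cos_paired)
    from sums_mult2[OF this, of "\<Phi> x"] show ?thesis by (simp add: mult.assoc)
  qed
  have an: "summable (\<lambda>k. norm (?f k x))" for x
  proof -
    have "summable (\<lambda>n. (\<xi> \<bullet> x)\<^sup>2 ^ n / fact n)" using summable_exp[of "(\<xi> \<bullet> x)\<^sup>2"] by (simp add: field_simps)
    then have s: "summable (\<lambda>n. (\<xi> \<bullet> x)\<^sup>2 ^ n / fact n * \<Phi> x)" by (rule summable_mult2)
    show ?thesis
    proof (rule summable_comparison_test'[OF s, of 0])
      fix k
      have "1 / fact (2 * k) \<le> (1 / fact k :: real)" by (intro divide_left_mono fact_mono) auto
      then show "norm (norm (?f k x)) \<le> (\<xi> \<bullet> x)\<^sup>2 ^ k / fact k * \<Phi> x"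
        unfolding nf using Phi_nonneg[of x] mult_right_mono[of "1 / fact (2 * k)" "1 / fact k" "(\<xi> \<bullet> x) ^ (2 * k) * \<Phi> x"]
        by (simp add: power_mult zero_le_even_power)
    qed
  qed
  have "(\<lambda>k. \<integral>x. ?f k x \<partial>lborel) sums (\<integral>x. (\<Sum>k. ?f k x) \<partial>lborel)"
  proof (rule sums_integral)
    show "integrable lborel (?f k)" for k by (rule i)
    show "AE x in lborel. summable (\<lambda>k. norm (?f k x))" using an by simp
    show "summable (\<lambda>k. \<integral>x. norm (?f k x) \<partial>lborel)"
      unfolding nf using sm by (simp add: mom)
  qed
  moreover have "(\<integral>x. ?f k x \<partial>lborel) = zeta_const DIM('a) \<delta> * (W_coeff \<delta> k * (- (norm \<xi> ^ 2) / 4) ^ k)" for k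
  proof -
    have "(- (norm \<xi> ^ 2) / 4) ^ k = (-1) ^ k * (norm \<xi> ^ 2 / 4) ^ k" by (simp flip: power_mult_distrib)
    then show ?thesis by (simp add: mom m_def)
  qed
  moreover have "(\<Sum>k. ?f k x) = cos (\<xi> \<bullet> x) * \<Phi> x" for x using cs by (simp add: sums_iff)
  ultimately have "(\<lambda>k. zeta_const DIM('a) \<delta> * (W_coeff \<delta> k * (- (norm \<xi> ^ 2) / 4) ^ k)) sums (\<integral>x. cos (\<xi> \<bullet> x) * \<Phi> x \<partial>lborel)"
    by simp
  moreover have "(\<lambda>k. zeta_const DIM('a) \<delta> * (W_coeff \<delta> k * (- (norm \<xi> ^ 2) / 4) ^ k)) sums (zeta_const DIM('a) \<delta> * W_fun \<delta> (norm \<xi>))"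
    unfolding W_fun_eq using entire_W[OF \<delta>] by (intro sums_mult summable_sums) (simp add: entire_coeffs_def)
  ultimately show ?thesis by (rule sums_unique2)
qed

text \<open>The kernel is even, so the sine part integrates to 0 and the cosine part
  remains.\<close>

lemma fourier_Phi:
  fixes \<xi> :: 'a
  shows "fourier (\<lambda>x. complex_of_real (\<Phi> x)) \<xi> = complex_of_real (zeta_const DIM('a) \<delta> * W_fun \<delta> (norm \<xi>))"
proof -
  have ic: "integrable lborel (\<lambda>x. cos (\<xi> \<bullet> x) * \<Phi> x)" "integrable lborel (\<lambda>x. sin (\<xi> \<bullet> x) * \<Phi> x)"
    by (rule Bochner_Integration.integrable_bound[OF integrable_Phi];
      auto simp: abs_mult intro!: mult_left_le_one_le)+
  have "(\<integral>x. sin (\<xi> \<bullet> (- x)) * \<Phi> (- x) \<partial>lborel) = (\<integral>x. sin (\<xi> \<bullet> x) * \<Phi> x \<partial>lborel)"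
    by (rule integral_lborel_reflect) measurable
  moreover have "\<Phi> (- x) = \<Phi> x" for x by (simp add: \<Phi>_def)
  ultimately have s: "(\<integral>x. sin (\<xi> \<bullet> x) * \<Phi> x \<partial>lborel) = 0" by simp
  have "fourier (\<lambda>x. complex_of_real (\<Phi> x)) \<xi> = (\<integral>x. complex_of_real (cos (\<xi> \<bullet> x) * \<Phi> x) - \<i> * complex_of_real (sin (\<xi> \<bullet> x) * \<Phi> x) \<partial>lborel)"
    unfolding fourier_def
  proof (rule Bochner_Integration.integral_cong[OF refl])
    fix x
    have "exp (- \<i> * complex_of_real (\<xi> \<bullet> x)) = complex_of_real (cos (\<xi> \<bullet> x)) - \<i> * complex_of_real (sin (\<xi> \<bullet> x))"
      using cis_conv_exp[of "- (\<xi> \<bullet> x)"] by (simp add: complex_eq_iff)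
    then show "exp (- \<i> * complex_of_real (\<xi> \<bullet> x)) * complex_of_real (\<Phi> x) = complex_of_real (cos (\<xi> \<bullet> x) * \<Phi> x) - \<i> * complex_of_real (sin (\<xi> \<bullet> x) * \<Phi> x)"
      by (simp only: left_diff_distrib of_real_mult mult.assoc)
  qed
  also have "\<dots> = complex_of_real (\<integral>x. cos (\<xi> \<bullet> x) * \<Phi> x \<partial>lborel) - \<i> * complex_of_real (\<integral>x. sin (\<xi> \<bullet> x) * \<Phi> x \<partial>lborel)"
  proof -
    have "integrable lborel (\<lambda>x. complex_of_real (cos (\<xi> \<bullet> x) * \<Phi> x))" "integrable lborel (\<lambda>x. complex_of_real (sin (\<xi> \<bullet> x) * \<Phi> x))"
      using ic unfolding complex_of_real_integrable_eq .
    then show ?thesis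
      by (simp only: Bochner_Integration.integral_diff integrable_mult_right integral_mult_right_zero integral_complex_of_real)
  qed
  finally show ?thesis unfolding s integral_cos_Phi by simp
qed

lemma Phi_in_L2: "(\<lambda>x. complex_of_real (\<Phi> x)) \<in> L2_fun"
proof -
  obtain M where M: "\<And>t. t \<ge> 0 \<Longrightarrow> Phi_radial DIM('a) \<delta> t \<le> M" using Phi_radial_bounded[OF DIM_ge_one \<delta> \<delta>d] by blast
  have "integrable lborel (\<lambda>x. (\<Phi> x)\<^sup>2)"
  proof (rule Bochner_Integration.integrable_bound)
    show "integrable lborel (\<lambda>x. M * \<Phi> x)" using integrable_Phi by (rule integrable_mult_right)
    have "norm ((\<Phi> x)\<^sup>2) \<le> norm (M * \<Phi> x)" for x
    proof -
      have "\<Phi> x \<le> M" unfolding \<Phi>_def by (rule M) simp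
      then have "\<Phi> x * \<Phi> x \<le> M * \<Phi> x" by (intro mult_right_mono Phi_nonneg)
      moreover have "M \<ge> 0" using \<open>\<Phi> x \<le> M\<close> Phi_nonneg[of x] by linarith
      ultimately show ?thesis using Phi_nonneg[of x] by (simp add: power2_eq_square abs_mult)
    qed
    then show "AE x in lborel. norm ((\<Phi> x)\<^sup>2) \<le> norm (M * \<Phi> x)" by simp
  qed measurable
  then show ?thesis by (simp add: L2_fun_def)
qed

end

section \<open>Reproducing kernels\<close>

lemma inner_product_onD:
  assumes "inner_product_on H ip"
  shows "(\<lambda>x. 0) \<in> H" "u \<in> H \<Longrightarrow> v \<in> H \<Longrightarrow> (\<lambda>x. u x + v x) \<in> H" "u \<in> H \<Longrightarrow> (\<lambda>x. c * u x) \<in> H"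
    "u \<in> H \<Longrightarrow> v \<in> H \<Longrightarrow> w \<in> H \<Longrightarrow> ip (\<lambda>x. u x + v x) w = ip u w + ip v w"
    "u \<in> H \<Longrightarrow> v \<in> H \<Longrightarrow> ip (\<lambda>x. c * u x) v = c * ip u v"
    "u \<in> H \<Longrightarrow> v \<in> H \<Longrightarrow> ip v u = cnj (ip u v)"
    "u \<in> H \<Longrightarrow> ip u u \<in> \<real>" "u \<in> H \<Longrightarrow> Re (ip u u) \<ge> 0"
    "u \<in> H \<Longrightarrow> ip u u = 0 \<Longrightarrow> u = (\<lambda>x. 0)"
  using assms unfolding inner_product_on_def by blast+

lemma inner_product_on_diff:
  assumes ip: "inner_product_on H ip" and u: "u \<in> H" and v: "v \<in> H"
  shows "(\<lambda>x. u x - v x) \<in> H"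
  using inner_product_onD(2)[OF ip u inner_product_onD(3)[OF ip v, of "-1"]] by simp

lemma inner_product_on_add_right:
  assumes ip: "inner_product_on H ip" and H: "u \<in> H" "v \<in> H" "w \<in> H"
  shows "ip u (\<lambda>x. v x + w x) = ip u v + ip u w"
proof -
  have vw: "(\<lambda>x. v x + w x) \<in> H" by (rule inner_product_onD(2)[OF ip H(2,3)])
  have "ip u (\<lambda>x. v x + w x) = cnj (ip (\<lambda>x. v x + w x) u)" by (rule inner_product_onD(6)[OF ip vw H(1)])
  also have "\<dots> = cnj (ip v u) + cnj (ip w u)"
    by (simp only: inner_product_onD(4)[OF ip H(2,3,1)] complex_cnj_add)
  also have "\<dots> = ip u v + ip u w"
    by (simp only: inner_product_onD(6)[OF ip H(2,1), symmetric] inner_product_onD(6)[OF ip H(3,1), symmetric])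
  finally show ?thesis .
qed

lemma inner_product_on_cmult_right:
  assumes ip: "inner_product_on H ip" and H: "u \<in> H" "v \<in> H"
  shows "ip u (\<lambda>x. c * v x) = cnj c * ip u v"
proof -
  have cv: "(\<lambda>x. c * v x) \<in> H" by (rule inner_product_onD(3)[OF ip H(2)])
  have "ip u (\<lambda>x. c * v x) = cnj (ip (\<lambda>x. c * v x) u)" by (rule inner_product_onD(6)[OF ip cv H(1)])
  also have "\<dots> = cnj c * cnj (ip v u)"
    by (simp only: inner_product_onD(5)[OF ip H(2,1)] complex_cnj_mult)
  also have "\<dots> = cnj c * ip u v" by (simp only: inner_product_onD(6)[OF ip H(2,1), symmetric])
  finally show ?thesis .
qed

text \<open>The discriminant argument with a real parameter t; the real part is all that the
  triangle inequality requires.\<close>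

lemma inner_product_on_Cauchy_Schwarz:
  assumes ip: "inner_product_on H ip" and u: "u \<in> H" and v: "v \<in> H"
  shows "\<bar>Re (ip u v)\<bar> \<le> sqrt (Re (ip u u)) * sqrt (Re (ip v v))"
proof -
  let ?a = "Re (ip u u)" and ?b = "Re (ip u v)" and ?c = "Re (ip v v)"
  have nn: "?a \<ge> 0" "?c \<ge> 0" using inner_product_onD(8)[OF ip] u v by auto
  have q: "0 \<le> ?a + 2 * t * ?b + t\<^sup>2 * ?c" for t
  proof -
    let ?w = "\<lambda>x. complex_of_real t * v x"
    have w: "?w \<in> H" by (rule inner_product_onD(3)[OF ip v])
    have uw: "(\<lambda>x. u x + ?w x) \<in> H" by (rule inner_product_onD(2)[OF ip u w])
    have vu: "ip v u = cnj (ip u v)" by (rule inner_product_onD(6)[OF ip u v])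
    have "ip (\<lambda>x. u x + ?w x) (\<lambda>x. u x + ?w x) = ip u (\<lambda>x. u x + ?w x) + ip ?w (\<lambda>x. u x + ?w x)"
      by (rule inner_product_onD(4)[OF ip u w uw])
    also have "\<dots> = ip u u + ip u ?w + (ip ?w u + ip ?w ?w)"
      by (simp only: inner_product_on_add_right[OF ip u u w] inner_product_on_add_right[OF ip w u w])
    also have "\<dots> = ip u u + complex_of_real t * ip u v + (complex_of_real t * cnj (ip u v) + complex_of_real t * (complex_of_real t * ip v v))"
      by (simp only: inner_product_on_cmult_right[OF ip u v] inner_product_onD(5)[OF ip v u] inner_product_onD(5)[OF ip v w]
          inner_product_on_cmult_right[OF ip v v] complex_cnj_complex_of_real vu)
    finally have "Re (ip (\<lambda>x. u x + ?w x) (\<lambda>x. u x + ?w x)) = ?a + 2 * t * ?b + t\<^sup>2 * ?c"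
      by (simp add: power2_eq_square)
    then show ?thesis using inner_product_onD(8)[OF ip uw] by simp
  qed
  have "?b\<^sup>2 \<le> ?a * ?c"
  proof (cases "?c = 0")
    case False
    then have c: "?c > 0" using nn by simp
    have "0 \<le> ?a + 2 * (- ?b / ?c) * ?b + (- ?b / ?c)\<^sup>2 * ?c" by (rule q)
    also have "\<dots> = ?a - ?b\<^sup>2 / ?c" using c by (simp add: field_simps power2_eq_square)
    finally show ?thesis using c by (simp add: field_simps)
  next
    case True
    \<comment> \<open>With no quadratic term the expression is affine in t and could be made
      negative; t = - (a + 1) / b would give - a - 2.\<close>
    have "?b = 0"
    proof (rule ccontr)
      assume b: "?b \<noteq> 0"
      have "0 \<le> ?a + 2 * (- (?a + 1) / ?b) * ?b" using q[of "- (?a + 1) / ?b"] True by simp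
      then show False using b nn by simp
    qed
    then show ?thesis using True by simp
  qed
  then have "\<bar>?b\<bar> \<le> sqrt (?a * ?c)" by (intro real_le_rsqrt) simp
  then show ?thesis by (simp only: real_sqrt_mult)
qed

lemma inner_product_on_norm_triangle:
  assumes ip: "inner_product_on H ip" and u: "u \<in> H" and v: "v \<in> H"
  shows "sqrt (Re (ip (\<lambda>x. u x + v x) (\<lambda>x. u x + v x))) \<le> sqrt (Re (ip u u)) + sqrt (Re (ip v v))"
proof -
  have nn: "Re (ip u u) \<ge> 0" "Re (ip v v) \<ge> 0" using inner_product_onD(8)[OF ip] u v by auto
  have uv: "(\<lambda>x. u x + v x) \<in> H" by (rule inner_product_onD(2)[OF ip u v])
  have vu: "ip v u = cnj (ip u v)" by (rule inner_product_onD(6)[OF ip u v])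
  have "ip (\<lambda>x. u x + v x) (\<lambda>x. u x + v x) = ip u u + ip u v + (ip v u + ip v v)"
    by (simp only: inner_product_onD(4)[OF ip u v uv] inner_product_on_add_right[OF ip u u v] inner_product_on_add_right[OF ip v u v])
  then have "Re (ip (\<lambda>x. u x + v x) (\<lambda>x. u x + v x)) = Re (ip u u) + 2 * Re (ip u v) + Re (ip v v)"
    unfolding vu by simp
  also have "\<dots> \<le> Re (ip u u) + 2 * (sqrt (Re (ip u u)) * sqrt (Re (ip v v))) + Re (ip v v)"
    using inner_product_on_Cauchy_Schwarz[OF ip u v] by simp
  also have "\<dots> = (sqrt (Re (ip u u)) + sqrt (Re (ip v v)))\<^sup>2" using nn by (simp add: power2_sum)
  finally show ?thesis using nn by (intro real_le_lsqrt) auto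
qed

text \<open>The locale \<open>Metric_space\<close> demands nonnegativity and symmetry of the
  distance for all functions, inside \<open>H\<close> or not. Hence \<open>nn\<close> and
  \<open>sym\<close> range over all \<open>f\<close>.\<close>

lemma Metric_space_ip_dist:
  assumes ip: "inner_product_on H ip" and nn: "\<And>f. Re (ip f f) \<ge> 0"
    and sym: "\<And>f. ip (\<lambda>x. - f x) (\<lambda>x. - f x) = ip f f"
  shows "Metric_space H (ip_dist ip)"
proof
  fix u v :: "'a \<Rightarrow> complex"
  show "0 \<le> ip_dist ip u v" using nn by (simp add: ip_dist_def)
  show "ip_dist ip u v = ip_dist ip v u" using sym[of "\<lambda>x. u x - v x"] by (simp add: ip_dist_def)
next
  fix u v assume u: "u \<in> H" and v: "v \<in> H"
  note uv = inner_product_on_diff[OF ip u v]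
  show "ip_dist ip u v = 0 \<longleftrightarrow> u = v"
  proof
    assume "ip_dist ip u v = 0"
    then have "Re (ip (\<lambda>x. u x - v x) (\<lambda>x. u x - v x)) = 0" by (simp add: ip_dist_def)
    moreover have "ip (\<lambda>x. u x - v x) (\<lambda>x. u x - v x) \<in> \<real>" by (rule inner_product_onD(7)[OF ip uv])
    ultimately have "ip (\<lambda>x. u x - v x) (\<lambda>x. u x - v x) = 0" by (simp add: complex_is_Real_iff complex_eq_iff)
    then have z: "(\<lambda>x. u x - v x) = (\<lambda>x. 0)" by (rule inner_product_onD(9)[OF ip uv])
    show "u = v" by (rule ext) (use fun_cong[OF z] in simp)
  next
    assume "u = v"
    moreover have "ip (\<lambda>x. 0) (\<lambda>x. 0) = 0"
      using inner_product_onD(5)[OF ip inner_product_onD(1)[OF ip] inner_product_onD(1)[OF ip], of 0] by simp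
    ultimately show "ip_dist ip u v = 0" by (simp add: ip_dist_def)
  qed
next
  fix u v w assume u: "u \<in> H" and v: "v \<in> H" and w: "w \<in> H"
  show "ip_dist ip u w \<le> ip_dist ip u v + ip_dist ip v w"
    using inner_product_on_norm_triangle[OF ip inner_product_on_diff[OF ip u v] inner_product_on_diff[OF ip v w]]
    by (simp add: ip_dist_def)
qed

text \<open>The quadratic form is the squared norm of a combination of translates. If it vanishes,
  then so does the combination, and pairing it with functions that separate the points isolates each
  coefficient.\<close>

lemma reproducing_kernel_positive_definite:
  fixes \<Phi> :: "'a::euclidean_space \<Rightarrow> complex"
  assumes k: "translation_reproducing_kernel \<Phi> H ip"
    and sep: "\<And>A a. finite A \<Longrightarrow> a \<in> A \<Longrightarrow> \<exists>u\<in>H. u a \<noteq> 0 \<and> (\<forall>b\<in>A - {a}. u b = 0)"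
  shows "positive_definite_fun \<Phi>"
  unfolding positive_definite_fun_def
proof (intro allI impI)
  fix N :: nat and x :: "nat \<Rightarrow> 'a" and z :: "nat \<Rightarrow> complex"
  assume inj: "inj_on x {1..N}"
  have ip: "inner_product_on H ip" using k by (simp add: translation_reproducing_kernel_def hilbert_space_on_def)
  \<comment> \<open>Membership of the translates is stated under some u in \<open>H\<close>; the
    zero function supplies one.\<close>
  have PH: "(\<lambda>y. \<Phi> (y - a)) \<in> H" for a
    using k inner_product_onD(1)[OF ip] unfolding translation_reproducing_kernel_def by blast
  have rep: "ip u (\<lambda>y. \<Phi> (y - a)) = u a" if "u \<in> H" for u a
  proof -
    have "u a = ip u (\<lambda>y. \<Phi> (y - a))" using k that unfolding translation_reproducing_kernel_def by blast
    then show ?thesis by (rule sym)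
  qed
  \<comment> \<open>The conjugates compensate for the conjugate linearity in the second argument:
    pairing u with this function gives the sum of \<open>z k * u (x k)\<close>.\<close>
  define f where "f = (\<lambda>A y. \<Sum>k\<in>A. cnj (z k) * \<Phi> (y - x k))"
  have f: "f A \<in> H \<and> (\<forall>u\<in>H. ip u (f A) = (\<Sum>k\<in>A. z k * u (x k)))" if "finite A" for A
    using that
  proof (induction A rule: finite_induct)
    case empty
    have "ip u (\<lambda>x. 0) = 0" if "u \<in> H" for u
      using inner_product_on_cmult_right[OF ip that inner_product_onD(1)[OF ip], of 0] by simp
    then show ?case using inner_product_onD(1)[OF ip] by (simp add: f_def)
  next
    case (insert a A)
    have fa: "f (insert a A) = (\<lambda>y. cnj (z a) * \<Phi> (y - x a) + f A y)"
      using insert by (simp add: f_def)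
    have 1: "(\<lambda>y. cnj (z a) * \<Phi> (y - x a)) \<in> H" by (rule inner_product_onD(3)[OF ip PH])
    have 2: "f A \<in> H" using insert by simp
    have "f (insert a A) \<in> H" unfolding fa by (rule inner_product_onD(2)[OF ip 1 2])
    moreover have "ip u (f (insert a A)) = (\<Sum>k\<in>insert a A. z k * u (x k))" if u: "u \<in> H" for u
      unfolding fa inner_product_on_add_right[OF ip u 1 2] inner_product_on_cmult_right[OF ip u PH] rep[OF u]
      using insert u by simp
    ultimately show ?case by simp
  qed
  let ?A = "{1..N}"
  define S where "S = (\<Sum>j = 1..N. \<Sum>k = 1..N. \<Phi> (x j - x k) * z j * cnj (z k))"
  have fA: "f ?A \<in> H" "\<And>u. u \<in> H \<Longrightarrow> ip u (f ?A) = (\<Sum>k\<in>?A. z k * u (x k))" using f[of ?A] by auto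
  have S: "ip (f ?A) (f ?A) = S"
    unfolding fA(2)[OF fA(1)] S_def
    by (intro sum.cong refl) (simp add: f_def sum_distrib_left mult_ac)
  have "z j = 0" if S0: "S = 0" and j: "j \<in> ?A" for j
  proof -
    have f0: "f ?A = (\<lambda>x. 0)" using inner_product_onD(9)[OF ip fA(1)] S S0 by simp
    obtain u where u: "u \<in> H" "u (x j) \<noteq> 0" "\<And>b. b \<in> x ` ?A - {x j} \<Longrightarrow> u b = 0"
      using sep[of "x ` ?A" "x j"] j by auto
    have "ip u (\<lambda>x. 0) = 0"
      using inner_product_on_cmult_right[OF ip u(1) inner_product_onD(1)[OF ip], of 0] by simp
    then have "0 = (\<Sum>k\<in>?A. z k * u (x k))" using fA(2)[OF u(1)] f0 by simp
    also have "\<dots> = (\<Sum>k\<in>?A. if k = j then z j * u (x j) else 0)"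
    proof (intro sum.cong refl)
      fix k assume k: "k \<in> ?A"
      have "u (x k) = 0" if "k \<noteq> j"
      proof -
        have "x k \<noteq> x j" using inj_onD[OF inj, of k j] k j that by blast
        then show ?thesis using u(3)[of "x k"] k by blast
      qed
      then show "z k * u (x k) = (if k = j then z j * u (x j) else 0)" by simp
    qed
    also have "\<dots> = z j * u (x j)" using j by simp
    finally show ?thesis using u(2) by simp
  qed
  moreover have "S \<in> \<real>" "Re S \<ge> 0" using inner_product_onD(7,8)[OF ip fA(1)] S by auto
  ultimately show "let S = \<Sum>j = 1..N. \<Sum>k = 1..N. \<Phi> (x j - x k) * z j * cnj (z k)
     in S \<in> \<real> \<and> 0 \<le> Re S \<and> (S = 0 \<longrightarrow> (\<forall>j\<in>{1..N}. z j = 0))"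
    unfolding S_def[symmetric] Let_def by auto
qed

section \<open>The Sobolev space as native space\<close>

lemma norm_le_norm_nonneg: "0 \<le> a \<Longrightarrow> a \<le> b \<Longrightarrow> norm a \<le> norm b" for a b :: real
  by simp

lemma norm_le_norm_real: "norm a \<le> b \<Longrightarrow> norm a \<le> norm b" for b :: real
  by simp

lemma powr_half_squared: "(y powr (a / 2))\<^sup>2 = y powr a" for y a :: real
  unfolding power2_eq_square powr_add[symmetric] by simp

text \<open>Gamma(\<delta>) (1 + |x|^2)^(-\<delta>) is the integral of t^(\<delta> - 1) exp(-t)
  exp(-t |x|^2) over t > 0. By Tonelli the Gaussian is integrated first and contributes (pi /
  t)^(d/2), which leaves Gamma(\<delta> - d/2), finite because 2 \<delta> > d.\<close>

lemma integrable_bessel_potential: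
  assumes \<delta>: "2 * \<delta> > real DIM('a::euclidean_space)"
  shows "integrable lborel (\<lambda>x::'a. (1 + (norm x)\<^sup>2) powr (- \<delta>))"
proof -
  let ?d = "DIM('a)"
  have d0: "\<delta> > 0" using \<delta> DIM_positive[where 'a = 'a] by linarith
  have G: "Gamma \<delta> > 0" using d0 by (rule Gamma_real_pos)
  define h where "h = (\<lambda>t::real. indicator {0..} t * t powr (\<delta> - 1) / exp t)"
  have [measurable]: "h \<in> borel_measurable borel" unfolding h_def by measurable
  have h0: "h t \<ge> 0" for t by (simp add: h_def)
  have "ennreal (Gamma \<delta> * (1 + (norm x)\<^sup>2) powr (- \<delta>)) = (\<integral>\<^sup>+t. ennreal (h t * gauss (2 * t) x) \<partial>lborel)" for x :: 'a
  proof -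
    define c where "c = 1 + (norm x)\<^sup>2"
    have c: "c > 0" by (simp add: c_def add_pos_nonneg)
    have "ennreal (Gamma \<delta>) = (\<integral>\<^sup>+t. ennreal (h t) \<partial>lborel)"
      unfolding h_def by (rule Gamma_conv_nn_integral_real[OF d0])
    also have "\<dots> = ennreal \<bar>c\<bar> * (\<integral>\<^sup>+t. ennreal (h (0 + c * t)) \<partial>lborel)"
      using c by (intro nn_integral_real_affine) auto
    also have "\<dots> = (\<integral>\<^sup>+t. ennreal (c powr \<delta>) * ennreal (h t * gauss (2 * t) x) \<partial>lborel)"
    proof -
      have "c * h (0 + c * t) = c powr \<delta> * (h t * gauss (2 * t) x)" for t
      proof (cases "t \<ge> 0")
        case True
        have "exp (c * t) = exp t * exp (t * (norm x)\<^sup>2)" unfolding exp_add[symmetric] by (simp add: c_def algebra_simps)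
        moreover have "- (2 * t) * (norm x)\<^sup>2 / 2 = - (t * (norm x)\<^sup>2)" by simp
        then have "gauss (2 * t) x = 1 / exp (t * (norm x)\<^sup>2)"
          unfolding gauss_def by (simp only: exp_minus inverse_eq_divide)
        ultimately have g: "1 / exp (c * t) = gauss (2 * t) x / exp t" by simp
        have "c * h (0 + c * t) = c * ((c * t) powr (\<delta> - 1)) * (1 / exp (c * t))"
          using True c by (simp add: h_def)
        also have "(c * t) powr (\<delta> - 1) = c powr (\<delta> - 1) * t powr (\<delta> - 1)" using True c by (simp add: powr_mult)
        also have "c * (c powr (\<delta> - 1) * t powr (\<delta> - 1)) = c powr \<delta> * t powr (\<delta> - 1)"
          using c by (simp add: powr_diff)
        finally show ?thesis unfolding g using True by (simp add: h_def)
      next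
        case False
        then have "c * t < 0" using c by (simp add: mult_pos_neg)
        then show ?thesis using False by (simp add: h_def)
      qed
      then have "ennreal \<bar>c\<bar> * ennreal (h (0 + c * t)) = ennreal (c powr \<delta>) * ennreal (h t * gauss (2 * t) x)" for t
        using c h0 by (simp add: ennreal_mult[symmetric])
      then show ?thesis by (subst nn_integral_cmult[symmetric]) auto
    qed
    also have "\<dots> = ennreal (c powr \<delta>) * (\<integral>\<^sup>+t. ennreal (h t * gauss (2 * t) x) \<partial>lborel)"
      unfolding gauss_def by (rule nn_integral_cmult) measurable
    finally have "ennreal (c powr (- \<delta>)) * ennreal (Gamma \<delta>) = ennreal (c powr (- \<delta>)) * (ennreal (c powr \<delta>) * (\<integral>\<^sup>+t. ennreal (h t * gauss (2 * t) x) \<partial>lborel))"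
      by simp
    also have "\<dots> = (\<integral>\<^sup>+t. ennreal (h t * gauss (2 * t) x) \<partial>lborel)"
      unfolding mult.assoc[symmetric] using c by (subst ennreal_mult[symmetric]) (auto simp: powr_minus)
    finally show ?thesis using G by (simp add: c_def ennreal_mult mult.commute)
  qed
  note eq = this
  have "(\<integral>\<^sup>+x. ennreal (Gamma \<delta> * (1 + (norm x)\<^sup>2) powr (- \<delta>)) \<partial>(lborel :: 'a measure))
      = (\<integral>\<^sup>+x. (\<integral>\<^sup>+t. ennreal (h t * gauss (2 * t) x) \<partial>lborel) \<partial>(lborel :: 'a measure))"
    unfolding eq ..
  also have "\<dots> = (\<integral>\<^sup>+t. (\<integral>\<^sup>+x. ennreal (h t * gauss (2 * t) x) \<partial>(lborel :: 'a measure)) \<partial>lborel)"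
    unfolding gauss_def
    by (rule pair_sigma_finite.Fubini'[OF pair_sigma_finite.intro[OF sigma_finite_lborel sigma_finite_lborel]]) measurable
  also have "\<dots> = (\<integral>\<^sup>+t. ennreal (pi powr (real ?d / 2)) * ennreal (indicator {0..} t * t powr ((\<delta> - real ?d / 2) - 1) / exp t) \<partial>lborel)"
  proof (rule nn_integral_cong_AE)
    have "AE t in lborel. t \<noteq> (0::real)" by (rule AE_lborel_singleton)
    then show "AE t in lborel. (\<integral>\<^sup>+x. ennreal (h t * gauss (2 * t) x) \<partial>(lborel :: 'a measure))
        = ennreal (pi powr (real ?d / 2)) * ennreal (indicator {0..} t * t powr ((\<delta> - real ?d / 2) - 1) / exp t)"
    proof eventually_elim
      case (elim t)
      show ?case
      proof (cases "t > 0")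
        case True
        have ig: "integrable lborel (gauss (2 * t) :: 'a \<Rightarrow> real)" using True by (intro integrable_gauss) simp
        have "complex_of_real (\<integral>x. gauss (2 * t) x \<partial>(lborel :: 'a measure)) = complex_of_real ((2 * pi / (2 * t)) powr (real ?d / 2))"
          using gauss_fourier[of "2 * t" "0::'a"] True unfolding fourier_def by (simp add: gauss_def)
        then have gi: "(\<integral>x. gauss (2 * t) x \<partial>(lborel :: 'a measure)) = (pi / t) powr (real ?d / 2)"
          unfolding of_real_eq_iff by simp
        have "(\<integral>\<^sup>+x. ennreal (h t * gauss (2 * t) x) \<partial>(lborel :: 'a measure)) = ennreal (h t) * (\<integral>\<^sup>+x. ennreal (gauss (2 * t) x) \<partial>(lborel :: 'a measure))"
          using h0 by (subst nn_integral_cmult[symmetric]) (auto simp: ennreal_mult)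
        also have "(\<integral>\<^sup>+x. ennreal (gauss (2 * t) x) \<partial>(lborel :: 'a measure)) = ennreal ((pi / t) powr (real ?d / 2))"
          unfolding gi[symmetric] by (rule nn_integral_eq_integral[OF ig]) simp
        also have "ennreal (h t) * ennreal ((pi / t) powr (real ?d / 2)) = ennreal (h t * (pi / t) powr (real ?d / 2))"
          using h0 by (simp add: ennreal_mult)
        also have "h t * (pi / t) powr (real ?d / 2) = pi powr (real ?d / 2) * (indicator {0..} t * t powr ((\<delta> - real ?d / 2) - 1) / exp t)"
        proof -
          have "t powr (\<delta> - 1) / t powr (real ?d / 2) = t powr ((\<delta> - real ?d / 2) - 1)"
            unfolding powr_diff[symmetric] by (rule arg_cong[where f = "\<lambda>e. t powr e"]) simp
          moreover have "h t * (pi / t) powr (real ?d / 2) = pi powr (real ?d / 2) * ((t powr (\<delta> - 1) / t powr (real ?d / 2)) / exp t)"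
            using True by (simp add: h_def powr_divide mult_ac)
          ultimately show ?thesis using True by simp
        qed
        also have "ennreal (pi powr (real ?d / 2) * (indicator {0..} t * t powr ((\<delta> - real ?d / 2) - 1) / exp t))
            = ennreal (pi powr (real ?d / 2)) * ennreal (indicator {0..} t * t powr ((\<delta> - real ?d / 2) - 1) / exp t)"
          by (rule ennreal_mult) auto
        finally show ?thesis .
      next
        case False
        then show ?thesis using elim by (simp add: h_def)
      qed
    qed
  qed
  also have "\<dots> = ennreal (pi powr (real ?d / 2)) * ennreal (Gamma (\<delta> - real ?d / 2))"
    using \<delta> by (subst nn_integral_cmult) (auto simp: Gamma_conv_nn_integral_real)
  also have "\<dots> < \<infinity>" by (simp add: ennreal_mult_less_top)
  finally have "integrable lborel (\<lambda>x::'a. Gamma \<delta> * (1 + (norm x)\<^sup>2) powr (- \<delta>))"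
    using G unfolding integrable_iff_bounded by simp
  then show ?thesis using G by simp
qed

section \<open>The Sobolev norm expressed with the weight 1 / W\<close>

context
  fixes \<delta> :: real
  assumes \<delta>: "\<delta> > 1"
begin

lemma W_norm_pos: "W_fun \<delta> (norm \<xi>) > 0"
  by (rule W_pos[OF \<delta>]) simp

lemma W_norm_measurable [measurable]: "(\<lambda>\<xi>::'a::euclidean_space. W_fun \<delta> (norm \<xi>)) \<in> borel_measurable borel"
  by (intro borel_measurable_continuous_onI continuous_on_compose2[OF continuous_W[OF \<delta>]] continuous_intros) auto

text \<open>The lower bound of W gives one implication and the upper bound the other: 1 / W and (1 +
  |\<xi>|^2)^\<delta> are comparable.\<close>

lemma sobolev_weight:
  fixes g :: "'a::euclidean_space \<Rightarrow> complex"
  assumes [measurable]: "g \<in> borel_measurable borel"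
  shows "(\<lambda>\<xi>. complex_of_real ((1 + (norm \<xi>)\<^sup>2) powr (\<delta> / 2)) * g \<xi>) \<in> L2_fun
    \<longleftrightarrow> integrable lborel (\<lambda>\<xi>. (cmod (g \<xi>))\<^sup>2 / W_fun \<delta> (norm \<xi>))"
proof -
  let ?j = "\<lambda>\<xi>::'a. (1 + (norm \<xi>)\<^sup>2) powr \<delta>" and ?w = "\<lambda>\<xi>::'a. W_fun \<delta> (norm \<xi>)"
  obtain c where c: "c > 0" "\<And>r. r \<ge> 0 \<Longrightarrow> c \<le> W_fun \<delta> r * (1 + r\<^sup>2) powr \<delta>" using W_lower[OF \<delta>] by blast
  obtain C where C: "C > 0" "\<And>r. r \<ge> 0 \<Longrightarrow> W_fun \<delta> r * (1 + r\<^sup>2) powr \<delta> \<le> C" using W_upper[OF \<delta>] by blast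
  have sq: "(cmod (complex_of_real ((1 + (norm \<xi>)\<^sup>2) powr (\<delta> / 2)) * g \<xi>))\<^sup>2 = ?j \<xi> * (cmod (g \<xi>))\<^sup>2" for \<xi>
    by (simp add: norm_mult power_mult_distrib powr_half_squared)
  have "(\<lambda>\<xi>. complex_of_real ((1 + (norm \<xi>)\<^sup>2) powr (\<delta> / 2)) * g \<xi>) \<in> L2_fun \<longleftrightarrow> integrable lborel (\<lambda>\<xi>. ?j \<xi> * (cmod (g \<xi>))\<^sup>2)"
    unfolding L2_fun_def mem_Collect_eq sq by simp
  also have "\<dots> \<longleftrightarrow> integrable lborel (\<lambda>\<xi>. (cmod (g \<xi>))\<^sup>2 / ?w \<xi>)"
  proof
    assume "integrable lborel (\<lambda>\<xi>. ?j \<xi> * (cmod (g \<xi>))\<^sup>2)"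
    then have "integrable lborel (\<lambda>\<xi>. 1 / c * (?j \<xi> * (cmod (g \<xi>))\<^sup>2))" by simp
    then show "integrable lborel (\<lambda>\<xi>. (cmod (g \<xi>))\<^sup>2 / ?w \<xi>)"
    proof (rule Bochner_Integration.integrable_bound)
      have "1 / ?w \<xi> \<le> 1 / c * ?j \<xi>" for \<xi> :: 'a
        using c(2)[of "norm \<xi>"] c(1) W_norm_pos[of \<xi>] by (simp add: field_simps)
      from mult_right_mono[OF this, of "(cmod (g _))\<^sup>2"]
      have "(cmod (g \<xi>))\<^sup>2 / ?w \<xi> \<le> 1 / c * (?j \<xi> * (cmod (g \<xi>))\<^sup>2)" for \<xi> by simp
      moreover have "(cmod (g \<xi>))\<^sup>2 / ?w \<xi> \<ge> 0" for \<xi> using W_norm_pos[of \<xi>] by simp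
      ultimately show "AE \<xi> in lborel. norm ((cmod (g \<xi>))\<^sup>2 / ?w \<xi>) \<le> norm (1 / c * (?j \<xi> * (cmod (g \<xi>))\<^sup>2))"
        by (intro AE_I2 norm_le_norm_nonneg)
    qed measurable
  next
    assume "integrable lborel (\<lambda>\<xi>. (cmod (g \<xi>))\<^sup>2 / ?w \<xi>)"
    then have "integrable lborel (\<lambda>\<xi>. C * ((cmod (g \<xi>))\<^sup>2 / ?w \<xi>))" by (rule integrable_mult_right)
    then show "integrable lborel (\<lambda>\<xi>. ?j \<xi> * (cmod (g \<xi>))\<^sup>2)"
    proof (rule Bochner_Integration.integrable_bound)
      have "?j \<xi> \<le> C / ?w \<xi>" for \<xi> :: 'a
        using C(2)[of "norm \<xi>"] W_norm_pos[of \<xi>] by (simp add: field_simps)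
      from mult_right_mono[OF this, of "(cmod (g _))\<^sup>2"]
      have "?j \<xi> * (cmod (g \<xi>))\<^sup>2 \<le> C * ((cmod (g \<xi>))\<^sup>2 / ?w \<xi>)" for \<xi> by simp
      moreover have "?j \<xi> * (cmod (g \<xi>))\<^sup>2 \<ge> 0" for \<xi> by simp
      ultimately show "AE \<xi> in lborel. norm (?j \<xi> * (cmod (g \<xi>))\<^sup>2) \<le> norm (C * ((cmod (g \<xi>))\<^sup>2 / ?w \<xi>))"
        by (intro AE_I2 norm_le_norm_nonneg)
    qed measurable
  qed
  finally show ?thesis .
qed

lemma weighted_integrable:
  fixes g :: "'a::euclidean_space \<Rightarrow> complex"
  assumes \<delta>d: "2 * \<delta> > real DIM('a)"
    and gm[measurable]: "g \<in> borel_measurable borel" and g: "integrable lborel (\<lambda>\<xi>. (cmod (g \<xi>))\<^sup>2 / W_fun \<delta> (norm \<xi>))"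
  shows "integrable lborel g" "g \<in> L2_fun"
proof -
  let ?j = "\<lambda>\<xi>::'a. (1 + (norm \<xi>)\<^sup>2) powr \<delta>"
  have jp: "?j \<xi> > 0" for \<xi> by (simp add: add_nonneg_eq_0_iff)
  have j1: "?j \<xi> \<ge> 1" for \<xi> using \<delta> by (intro ge_one_powr_ge_zero) auto
  have sq: "(cmod (complex_of_real ((1 + (norm \<xi>)\<^sup>2) powr (\<delta> / 2)) * g \<xi>))\<^sup>2 = ?j \<xi> * (cmod (g \<xi>))\<^sup>2" for \<xi>
    by (simp add: norm_mult power_mult_distrib powr_half_squared)
  have ij: "integrable lborel (\<lambda>\<xi>. ?j \<xi> * (cmod (g \<xi>))\<^sup>2)"
    using sobolev_weight[OF gm] g unfolding L2_fun_def mem_Collect_eq sq by simp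
  show "g \<in> L2_fun"
    unfolding L2_fun_def mem_Collect_eq
  proof
    show "integrable lborel (\<lambda>x. (cmod (g x))\<^sup>2)"
    proof (rule Bochner_Integration.integrable_bound[OF ij])
      show "AE \<xi> in lborel. norm ((cmod (g \<xi>))\<^sup>2) \<le> norm (?j \<xi> * (cmod (g \<xi>))\<^sup>2)"
        using j1 by (intro AE_I2) (simp add: abs_mult mult_le_cancel_right1)
    qed measurable
  qed simp
  have "integrable lborel (\<lambda>\<xi>::'a. (1 + (norm \<xi>)\<^sup>2) powr (- \<delta>) + ?j \<xi> * (cmod (g \<xi>))\<^sup>2)"
    using integrable_bessel_potential[OF \<delta>d] ij by (rule Bochner_Integration.integrable_add)
  then show "integrable lborel g"
  proof (rule Bochner_Integration.integrable_bound)
    have "cmod (g \<xi>) \<le> (1 + (norm \<xi>)\<^sup>2) powr (- \<delta>) + ?j \<xi> * (cmod (g \<xi>))\<^sup>2" for \<xi>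
    proof -
      let ?J = "?j \<xi>" and ?x = "cmod (g \<xi>)"
      have "y \<le> 1 + y\<^sup>2" if "y \<ge> 0" for y :: real
      proof -
        have "2 * y \<le> 1 + y\<^sup>2" using zero_le_power2[of "1 - y"] by (simp add: power2_diff)
        then show ?thesis using that by linarith
      qed
      \<comment> \<open>Divided by J this bounds |g| by 1 / J + J |g|^2; the first term is
        integrable since 2 \<delta> exceeds the dimension, the second by the weighted
        condition.\<close>
      from this[of "?J * ?x"] have "?J * ?x \<le> 1 + (?J * ?x)\<^sup>2" by simp
      then have "?J * ?x / ?J \<le> (1 + (?J * ?x)\<^sup>2) / ?J" using jp[of \<xi>] by (intro divide_right_mono) auto
      also have "(1 + (?J * ?x)\<^sup>2) / ?J = 1 / ?J + ?J * ?x\<^sup>2" using jp[of \<xi>] by (simp add: add_divide_distrib power2_eq_square)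
      finally show ?thesis using jp[of \<xi>] by (simp add: powr_minus_divide)
    qed
    then show "AE \<xi> in lborel. norm (g \<xi>) \<le> norm ((1 + (norm \<xi>)\<^sup>2) powr (- \<delta>) + ?j \<xi> * (cmod (g \<xi>))\<^sup>2)"
      by (intro AE_I2 norm_le_norm_real)
  qed measurable
qed

lemma sobolev_fourier:
  fixes u :: "'a::euclidean_space \<Rightarrow> complex"
  assumes \<delta>d: "2 * \<delta> > real DIM('a)" and u: "u \<in> sobolev_space \<delta>"
  shows "is_fourier_L2 u (fourier_L2 u)" "fourier_L2 u \<in> borel_measurable borel"
    "integrable lborel (\<lambda>\<xi>. (cmod (fourier_L2 u \<xi>))\<^sup>2 / W_fun \<delta> (norm \<xi>))"
    "integrable lborel (fourier_L2 u)" "u = inverse_fourier (fourier_L2 u)"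
proof -
  have uc: "continuous_on UNIV u" and uL: "u \<in> L2_fun"
    and w: "(\<lambda>\<xi>. complex_of_real ((1 + (norm \<xi>)\<^sup>2) powr (\<delta> / 2)) * fourier_L2 u \<xi>) \<in> L2_fun"
    using u by (auto simp: sobolev_space_def)
  show 1: "is_fourier_L2 u (fourier_L2 u)" by (rule is_fourier_L2_fourier_L2[OF uL])
  then show 2: "fourier_L2 u \<in> borel_measurable borel" using L2_measurable by (auto simp: is_fourier_L2_def)
  show 3: "integrable lborel (\<lambda>\<xi>. (cmod (fourier_L2 u \<xi>))\<^sup>2 / W_fun \<delta> (norm \<xi>))"
    using sobolev_weight[OF 2] w by simp
  show 4: "integrable lborel (fourier_L2 u)" by (rule weighted_integrable(1)[OF \<delta>d 2 3])
  show "u = inverse_fourier (fourier_L2 u)" by (rule fourier_inversion[OF uc 1 4])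
qed

text \<open>Membership can be tested on any version \<open>g\<close> of the transform, whereas
  \<open>sobolev_space\<close> mentions the chosen representative.\<close>

lemma sobolevI:
  fixes u g :: "'a::euclidean_space \<Rightarrow> complex"
  assumes uc: "continuous_on UNIV u" and ug: "is_fourier_L2 u g"
    and g: "integrable lborel (\<lambda>\<xi>. (cmod (g \<xi>))\<^sup>2 / W_fun \<delta> (norm \<xi>))"
  shows "u \<in> sobolev_space \<delta>"
proof -
  have uL: "u \<in> L2_fun" and gm[measurable]: "g \<in> borel_measurable borel"
    using ug L2_measurable by (auto simp: is_fourier_L2_def)
  have hm[measurable]: "fourier_L2 u \<in> borel_measurable borel"
    using is_fourier_L2_fourier_L2[OF uL] L2_measurable by (auto simp: is_fourier_L2_def)
  have "integrable lborel (\<lambda>\<xi>. (cmod (fourier_L2 u \<xi>))\<^sup>2 / W_fun \<delta> (norm \<xi>))"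
    using g
  proof (rule integrable_cong_AE_imp)
    show "AE \<xi> in lborel. (cmod (g \<xi>))\<^sup>2 / W_fun \<delta> (norm \<xi>) = (cmod (fourier_L2 u \<xi>))\<^sup>2 / W_fun \<delta> (norm \<xi>)"
      using fourier_L2_AE_eq[OF ug] by eventually_elim simp
  qed measurable
  then show ?thesis using uc uL sobolev_weight[OF hm] by (simp add: sobolev_space_def)
qed

lemma weighted_mult_integrable:
  fixes g h :: "'a::euclidean_space \<Rightarrow> complex"
  assumes [measurable]: "g \<in> borel_measurable borel" "h \<in> borel_measurable borel"
    and g: "integrable lborel (\<lambda>\<xi>. (cmod (g \<xi>))\<^sup>2 / W_fun \<delta> (norm \<xi>))"
    and h: "integrable lborel (\<lambda>\<xi>. (cmod (h \<xi>))\<^sup>2 / W_fun \<delta> (norm \<xi>))"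
  shows "integrable lborel (\<lambda>\<xi>. g \<xi> * cnj (h \<xi>) / complex_of_real (W_fun \<delta> (norm \<xi>)))"
proof (rule Bochner_Integration.integrable_bound[OF Bochner_Integration.integrable_add[OF g h]])
  have "cmod (g \<xi> * cnj (h \<xi>) / complex_of_real (W_fun \<delta> (norm \<xi>))) \<le> (cmod (g \<xi>))\<^sup>2 / W_fun \<delta> (norm \<xi>) + (cmod (h \<xi>))\<^sup>2 / W_fun \<delta> (norm \<xi>)" for \<xi>
  proof -
    have "\<bar>cmod (g \<xi>) * cmod (h \<xi>)\<bar> \<le> (cmod (g \<xi>))\<^sup>2 + (cmod (h \<xi>))\<^sup>2"
      by (rule order_trans[OF abs_mult_le_squares]) simp
    then have "cmod (g \<xi>) * cmod (h \<xi>) / W_fun \<delta> (norm \<xi>) \<le> ((cmod (g \<xi>))\<^sup>2 + (cmod (h \<xi>))\<^sup>2) / W_fun \<delta> (norm \<xi>)"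
      using W_norm_pos[of \<xi>] by (intro divide_right_mono) auto
    then show ?thesis using W_norm_pos[of \<xi>] by (simp add: norm_mult norm_divide add_divide_distrib)
  qed
  then show "AE \<xi> in lborel. norm (g \<xi> * cnj (h \<xi>) / complex_of_real (W_fun \<delta> (norm \<xi>)))
     \<le> norm ((cmod (g \<xi>))\<^sup>2 / W_fun \<delta> (norm \<xi>) + (cmod (h \<xi>))\<^sup>2 / W_fun \<delta> (norm \<xi>))"
    by (intro AE_I2 norm_le_norm_real)
qed measurable

lemma weighted_add_cmult:
  fixes g h :: "'a::euclidean_space \<Rightarrow> complex"
  assumes [measurable]: "g \<in> borel_measurable borel" "h \<in> borel_measurable borel"
    and g: "integrable lborel (\<lambda>\<xi>. (cmod (g \<xi>))\<^sup>2 / W_fun \<delta> (norm \<xi>))"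
    and h: "integrable lborel (\<lambda>\<xi>. (cmod (h \<xi>))\<^sup>2 / W_fun \<delta> (norm \<xi>))"
  shows "integrable lborel (\<lambda>\<xi>. (cmod (g \<xi> + c * h \<xi>))\<^sup>2 / W_fun \<delta> (norm \<xi>))"
proof (rule Bochner_Integration.integrable_bound)
  show "integrable lborel (\<lambda>\<xi>. 2 * ((cmod (g \<xi>))\<^sup>2 / W_fun \<delta> (norm \<xi>)) + 2 * (cmod c)\<^sup>2 * ((cmod (h \<xi>))\<^sup>2 / W_fun \<delta> (norm \<xi>)))"
    using g h by (intro Bochner_Integration.integrable_add integrable_mult_right)
  have "(cmod (g \<xi> + c * h \<xi>))\<^sup>2 / W_fun \<delta> (norm \<xi>)
      \<le> 2 * ((cmod (g \<xi>))\<^sup>2 / W_fun \<delta> (norm \<xi>)) + 2 * (cmod c)\<^sup>2 * ((cmod (h \<xi>))\<^sup>2 / W_fun \<delta> (norm \<xi>))" for \<xi>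
  proof -
    have "(cmod (g \<xi> + c * h \<xi>))\<^sup>2 / W_fun \<delta> (norm \<xi>) \<le> (2 * (cmod (g \<xi>))\<^sup>2 + 2 * (cmod (c * h \<xi>))\<^sup>2) / W_fun \<delta> (norm \<xi>)"
      using W_norm_pos[of \<xi>] by (intro divide_right_mono norm_add_sq_le) auto
    also have "\<dots> = 2 * ((cmod (g \<xi>))\<^sup>2 / W_fun \<delta> (norm \<xi>)) + 2 * (cmod c)\<^sup>2 * ((cmod (h \<xi>))\<^sup>2 / W_fun \<delta> (norm \<xi>))"
      by (simp add: norm_mult power_mult_distrib add_divide_distrib)
    finally show ?thesis .
  qed
  moreover have "(cmod (g \<xi> + c * h \<xi>))\<^sup>2 / W_fun \<delta> (norm \<xi>) \<ge> 0" for \<xi> using W_norm_pos[of \<xi>] by simp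
  ultimately show "AE \<xi> in lborel. norm ((cmod (g \<xi> + c * h \<xi>))\<^sup>2 / W_fun \<delta> (norm \<xi>))
     \<le> norm (2 * ((cmod (g \<xi>))\<^sup>2 / W_fun \<delta> (norm \<xi>)) + 2 * (cmod c)\<^sup>2 * ((cmod (h \<xi>))\<^sup>2 / W_fun \<delta> (norm \<xi>)))"
    by (intro AE_I2 norm_le_norm_nonneg)
qed measurable

lemma sobolev_add_cmult:
  fixes u v :: "'a::euclidean_space \<Rightarrow> complex"
  assumes \<delta>d: "2 * \<delta> > real DIM('a)" and u: "u \<in> sobolev_space \<delta>" and v: "v \<in> sobolev_space \<delta>"
  shows "(\<lambda>x. u x + c * v x) \<in> sobolev_space \<delta>"
    "AE \<xi> in lborel. fourier_L2 (\<lambda>x. u x + c * v x) \<xi> = fourier_L2 u \<xi> + c * fourier_L2 v \<xi>"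
proof -
  note fu = sobolev_fourier[OF \<delta>d u] and fv = sobolev_fourier[OF \<delta>d v]
  note f = is_fourier_L2_add_cmult[OF fu(1) fv(1), of c]
  show "AE \<xi> in lborel. fourier_L2 (\<lambda>x. u x + c * v x) \<xi> = fourier_L2 u \<xi> + c * fourier_L2 v \<xi>"
    by (rule fourier_L2_AE_eq[OF f])
  have "continuous_on UNIV (\<lambda>x. u x + c * v x)"
    using u v by (auto simp: sobolev_space_def intro!: continuous_intros)
  then show "(\<lambda>x. u x + c * v x) \<in> sobolev_space \<delta>"
    by (rule sobolevI[OF _ f weighted_add_cmult[OF fu(2) fv(2) fu(3) fv(3)]])
qed

end

section \<open>The native inner product on the Sobolev space\<close>

context
  fixes \<delta> :: real
  assumes \<delta>: "\<delta> > 1" and \<delta>d: "2 * \<delta> > real CARD('n::finite)"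
begin

lemma \<delta>_DIM: "2 * \<delta> > real DIM(real ^ 'n)"
  using \<delta>d by simp

lemma zeta_pos: "zeta_const CARD('n) \<delta> > 0"
  using zeta_W_coeff_nonneg(1)[OF \<delta> \<delta>_DIM] by simp

definition "ip_const = (2 * pi) powr (- real CARD('n)) * (1 / zeta_const CARD('n) \<delta>)"

lemma ip_const_pos: "ip_const > 0"
  unfolding ip_const_def using zeta_pos by simp

lemma Phi_inner_self:
  "Phi_inner \<delta> f f = complex_of_real (ip_const * (\<integral>\<xi>. (cmod (fourier_L2 f \<xi>))\<^sup>2 / W_fun \<delta> (norm \<xi>) \<partial>lborel))"
  for f :: "real ^ 'n \<Rightarrow> complex"
proof -
  have "fourier_L2 f \<xi> * cnj (fourier_L2 f \<xi>) / complex_of_real (W_fun \<delta> (norm \<xi>))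
      = complex_of_real ((cmod (fourier_L2 f \<xi>))\<^sup>2 / W_fun \<delta> (norm \<xi>))" for \<xi>
    by (simp add: complex_norm_square del: of_real_power)
  then show ?thesis by (simp only: Phi_inner_def ip_const_def[symmetric] integral_complex_of_real of_real_mult)
qed

lemma Phi_inner_self_nonneg: "Re (Phi_inner \<delta> f f) \<ge> 0" for f :: "real ^ 'n \<Rightarrow> complex"
proof -
  have "(\<integral>\<xi>. (cmod (fourier_L2 f \<xi>))\<^sup>2 / W_fun \<delta> (norm \<xi>) \<partial>(lborel :: (real ^ 'n) measure)) \<ge> 0"
    by (rule Bochner_Integration.integral_nonneg) (use W_norm_pos[OF \<delta>] less_imp_le in \<open>auto intro!: divide_nonneg_pos\<close>)
  then show ?thesis unfolding Phi_inner_self Re_complex_of_real using ip_const_pos by (intro mult_nonneg_nonneg) auto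
qed

text \<open>Required for all functions by \<open>Metric_space_ip_dist\<close>. Outside L2 the
  predicate \<open>is_fourier_L2\<close> is empty for \<open>f\<close> and for its negative, so
  \<open>SOME\<close> returns the same function for both.\<close>

lemma Phi_inner_neg: "Phi_inner \<delta> (\<lambda>x. - f x) (\<lambda>x. - f x) = Phi_inner \<delta> f f" for f :: "real ^ 'n \<Rightarrow> complex"
proof (cases "f \<in> L2_fun")
  case True
  have f: "is_fourier_L2 f (fourier_L2 f)" by (rule is_fourier_L2_fourier_L2[OF True])
  have nf: "is_fourier_L2 (\<lambda>x. - f x) (\<lambda>\<xi>. - fourier_L2 f \<xi>)" using is_fourier_L2_cmult[OF f, of "-1"] by simp
  have "is_fourier_L2 (\<lambda>x. - f x) (fourier_L2 (\<lambda>x. - f x))" by (rule is_fourier_L2_fourier_L2) (use nf in \<open>simp add: is_fourier_L2_def\<close>)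
  then have [measurable]: "fourier_L2 f \<in> borel_measurable borel" "fourier_L2 (\<lambda>x. - f x) \<in> borel_measurable borel"
    using f L2_measurable by (auto simp: is_fourier_L2_def)
  note [measurable] = W_norm_measurable[OF \<delta>]
  have "(\<integral>\<xi>. (cmod (fourier_L2 (\<lambda>x. - f x) \<xi>))\<^sup>2 / W_fun \<delta> (norm \<xi>) \<partial>lborel) = (\<integral>\<xi>. (cmod (fourier_L2 f \<xi>))\<^sup>2 / W_fun \<delta> (norm \<xi>) \<partial>lborel)"
  proof (rule integral_cong_AE)
    show "AE \<xi> in lborel. (cmod (fourier_L2 (\<lambda>x. - f x) \<xi>))\<^sup>2 / W_fun \<delta> (norm \<xi>) = (cmod (fourier_L2 f \<xi>))\<^sup>2 / W_fun \<delta> (norm \<xi>)"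
      using fourier_L2_AE_eq[OF nf] by eventually_elim simp
  qed measurable
  then show ?thesis unfolding Phi_inner_self by simp
next
  case False
  have "(\<lambda>x. - f x) \<notin> L2_fun"
  proof
    assume "(\<lambda>x. - f x) \<in> L2_fun"
    from L2_fun_cmult[OF this, of "-1"] show False using False by simp
  qed
  then have "is_fourier_L2 (\<lambda>x. - f x) = (\<lambda>g. False)" "is_fourier_L2 f = (\<lambda>g. False)"
    using False by (auto simp: is_fourier_L2_def)
  then have "fourier_L2 (\<lambda>x. - f x) = fourier_L2 f" by (simp add: fourier_L2_def)
  then show ?thesis by (simp add: Phi_inner_def)
qed

lemma Phi_inner_add_cmult:
  fixes u v w :: "real ^ 'n \<Rightarrow> complex"
  assumes u: "u \<in> sobolev_space \<delta>" and v: "v \<in> sobolev_space \<delta>" and w: "w \<in> sobolev_space \<delta>"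
  shows "Phi_inner \<delta> (\<lambda>x. u x + c * v x) w = Phi_inner \<delta> u w + c * Phi_inner \<delta> v w"
proof -
  note uv = sobolev_add_cmult[OF \<delta> \<delta>_DIM u v, of c]
  note fu = sobolev_fourier[OF \<delta> \<delta>_DIM u] and fv = sobolev_fourier[OF \<delta> \<delta>_DIM v] and fw = sobolev_fourier[OF \<delta> \<delta>_DIM w]
    and fuv = sobolev_fourier[OF \<delta> \<delta>_DIM uv(1)]
  note [measurable] = fu(2) fv(2) fw(2) fuv(2) W_norm_measurable[OF \<delta>]
  let ?W = "\<lambda>\<xi>. complex_of_real (W_fun \<delta> (norm \<xi>))"
  have "(\<integral>\<xi>. fourier_L2 (\<lambda>x. u x + c * v x) \<xi> * cnj (fourier_L2 w \<xi>) / ?W \<xi> \<partial>lborel)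
    = (\<integral>\<xi>. fourier_L2 u \<xi> * cnj (fourier_L2 w \<xi>) / ?W \<xi> + c * (fourier_L2 v \<xi> * cnj (fourier_L2 w \<xi>) / ?W \<xi>) \<partial>lborel)"
  proof (rule integral_cong_AE)
    show "AE \<xi> in lborel. fourier_L2 (\<lambda>x. u x + c * v x) \<xi> * cnj (fourier_L2 w \<xi>) / ?W \<xi>
       = fourier_L2 u \<xi> * cnj (fourier_L2 w \<xi>) / ?W \<xi> + c * (fourier_L2 v \<xi> * cnj (fourier_L2 w \<xi>) / ?W \<xi>)"
      using uv(2) by eventually_elim (simp add: algebra_simps add_divide_distrib)
  qed measurable
  also have "\<dots> = (\<integral>\<xi>. fourier_L2 u \<xi> * cnj (fourier_L2 w \<xi>) / ?W \<xi> \<partial>lborel) + c * (\<integral>\<xi>. fourier_L2 v \<xi> * cnj (fourier_L2 w \<xi>) / ?W \<xi> \<partial>lborel)"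
    using weighted_mult_integrable[OF \<delta> fu(2) fw(2) fu(3) fw(3)] weighted_mult_integrable[OF \<delta> fv(2) fw(2) fv(3) fw(3)]
    by (simp only: Bochner_Integration.integral_add integrable_mult_right integral_mult_right_zero)
  finally show ?thesis by (simp add: Phi_inner_def distrib_left mult.left_commute)
qed

lemma zero_in_sobolev: "(\<lambda>x. 0) \<in> (sobolev_space \<delta> :: (real ^ 'n \<Rightarrow> complex) set)"
proof (rule sobolevI[OF \<delta>])
  have "(\<lambda>x. 0) \<in> (L2_fun :: (real ^ 'n \<Rightarrow> complex) set)" by (simp add: L2_fun_iff L2_sq_def)
  then have "is_fourier_L2 (\<lambda>x. 0) (fourier (\<lambda>x :: real ^ 'n. 0))" by (intro is_fourier_L2_L1) auto
  then show "is_fourier_L2 (\<lambda>x. 0) (\<lambda>x :: real ^ 'n. 0)" by (simp add: fourier_def[abs_def])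
qed auto

lemma inner_product_sobolev: "inner_product_on (sobolev_space \<delta>) (Phi_inner \<delta> :: (real ^ 'n \<Rightarrow> complex) \<Rightarrow> _)"
  unfolding inner_product_on_def
proof (intro conjI ballI allI impI)
  show "(\<lambda>x. 0) \<in> (sobolev_space \<delta> :: (real ^ 'n \<Rightarrow> complex) set)" by (rule zero_in_sobolev)
next
  fix u v :: "real ^ 'n \<Rightarrow> complex" assume u: "u \<in> sobolev_space \<delta>" and v: "v \<in> sobolev_space \<delta>"
  show "(\<lambda>x. u x + v x) \<in> sobolev_space \<delta>" using sobolev_add_cmult(1)[OF \<delta> \<delta>_DIM u v, of 1] by simp
next
  fix c and u :: "real ^ 'n \<Rightarrow> complex" assume u: "u \<in> sobolev_space \<delta>"
  show "(\<lambda>x. c * u x) \<in> sobolev_space \<delta>" using sobolev_add_cmult(1)[OF \<delta> \<delta>_DIM zero_in_sobolev u, of c] by simp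
next
  fix u v w :: "real ^ 'n \<Rightarrow> complex" assume u: "u \<in> sobolev_space \<delta>" and v: "v \<in> sobolev_space \<delta>" and w: "w \<in> sobolev_space \<delta>"
  show "Phi_inner \<delta> (\<lambda>x. u x + v x) w = Phi_inner \<delta> u w + Phi_inner \<delta> v w"
    using Phi_inner_add_cmult[OF u v w, of 1] by simp
next
  fix c and u v :: "real ^ 'n \<Rightarrow> complex" assume u: "u \<in> sobolev_space \<delta>" and v: "v \<in> sobolev_space \<delta>"
  \<comment> \<open>Writing c u as u + (c - 1) u makes homogeneity a case of the combined linearity
    lemma.\<close>
  have "Phi_inner \<delta> (\<lambda>x. u x + (c - 1) * u x) v = Phi_inner \<delta> u v + (c - 1) * Phi_inner \<delta> u v"
    by (rule Phi_inner_add_cmult[OF u u v])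
  moreover have "(\<lambda>x. u x + (c - 1) * u x) = (\<lambda>x. c * u x)" by (simp add: algebra_simps)
  ultimately show "Phi_inner \<delta> (\<lambda>x. c * u x) v = c * Phi_inner \<delta> u v" by (simp add: algebra_simps)
next
  fix u v :: "real ^ 'n \<Rightarrow> complex" assume u: "u \<in> sobolev_space \<delta>" and v: "v \<in> sobolev_space \<delta>"
  show "Phi_inner \<delta> v u = cnj (Phi_inner \<delta> u v)"
    unfolding Phi_inner_def complex_cnj_mult Bochner_Integration.integral_cnj[symmetric] by (simp add: mult.commute)
next
  fix u :: "real ^ 'n \<Rightarrow> complex" assume u: "u \<in> sobolev_space \<delta>"
  show "Phi_inner \<delta> u u \<in> \<real>" unfolding Phi_inner_self by (rule Reals_of_real)
  show "0 \<le> Re (Phi_inner \<delta> u u)" by (rule Phi_inner_self_nonneg)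
next
  fix u :: "real ^ 'n \<Rightarrow> complex" assume u: "u \<in> sobolev_space \<delta>" and z: "Phi_inner \<delta> u u = 0"
  note fu = sobolev_fourier[OF \<delta> \<delta>_DIM u]
  have "(\<integral>\<xi>. (cmod (fourier_L2 u \<xi>))\<^sup>2 / W_fun \<delta> (norm \<xi>) \<partial>lborel) = 0"
    using z ip_const_pos unfolding Phi_inner_self by (simp only: of_real_eq_0_iff mult_eq_0_iff) simp
  moreover have "(cmod (fourier_L2 u \<xi>))\<^sup>2 / W_fun \<delta> (norm \<xi>) \<ge> 0" for \<xi> using W_norm_pos[OF \<delta>, of \<xi>] by simp
  ultimately have "AE \<xi> in lborel. (cmod (fourier_L2 u \<xi>))\<^sup>2 / W_fun \<delta> (norm \<xi>) = 0"
    using integral_nonneg_eq_0_iff_AE[OF fu(3)] by simp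
  then have ae: "AE \<xi> in lborel. fourier_L2 u \<xi> = 0"
  proof eventually_elim
    case (elim \<xi>)
    then show ?case using W_norm_pos[OF \<delta>, of \<xi>] by simp
  qed
  \<comment> \<open>A transform that vanishes almost everywhere has a vanishing inversion integral
    at every point, so u is 0 everywhere.\<close>
  have "fourier (fourier_L2 u) x = 0" for x
    unfolding fourier_def by (rule integral_eq_zero_AE) (use ae in \<open>eventually_elim, simp\<close>)
  then show "u = (\<lambda>x. 0)" by (subst fu(5)) (simp add: inverse_fourier_def[abs_def])
qed

text \<open>Division by the square root of W turns the weighted norm into the plain one: applied to
  transforms, it embeds the native space into L2 isometrically up to
  \<open>ip_const\<close>.\<close>

definition "half_weight g \<xi> = g \<xi> / complex_of_real (sqrt (W_fun \<delta> (norm \<xi>)))" for g :: "real ^ 'n \<Rightarrow> complex"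

lemma half_weight_sq: "(cmod (half_weight g \<xi>))\<^sup>2 = (cmod (g \<xi>))\<^sup>2 / W_fun \<delta> (norm \<xi>)"
  using W_norm_pos[OF \<delta>, of \<xi>] by (simp add: half_weight_def norm_divide power_divide)

lemma half_weight_measurable [measurable]: "g \<in> borel_measurable borel \<Longrightarrow> half_weight g \<in> borel_measurable borel"
proof -
  assume [measurable]: "g \<in> borel_measurable borel"
  note [measurable] = W_norm_measurable[OF \<delta>]
  show ?thesis unfolding half_weight_def[abs_def] by measurable
qed

lemma half_weight_L2:
  assumes [measurable]: "g \<in> borel_measurable borel"
  shows "half_weight g \<in> L2_fun \<longleftrightarrow> integrable lborel (\<lambda>\<xi>. (cmod (g \<xi>))\<^sup>2 / W_fun \<delta> (norm \<xi>))"
  by (simp add: L2_fun_def half_weight_sq)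

lemma ip_dist_L2:
  fixes u v g :: "real ^ 'n \<Rightarrow> complex"
  assumes u: "u \<in> sobolev_space \<delta>" and v: "v \<in> sobolev_space \<delta>" and g: "is_fourier_L2 v g"
  shows "ennreal ((ip_dist (Phi_inner \<delta>) u v)\<^sup>2) = ennreal ip_const * L2_sq (\<lambda>\<xi>. half_weight (fourier_L2 u) \<xi> - half_weight g \<xi>)"
proof -
  have uv: "(\<lambda>x. u x - v x) \<in> sobolev_space \<delta>" using sobolev_add_cmult(1)[OF \<delta> \<delta>_DIM u v, of "-1"] by simp
  note fuv = sobolev_fourier[OF \<delta> \<delta>_DIM uv]
  have d: "is_fourier_L2 (\<lambda>x. u x - v x) (\<lambda>\<xi>. fourier_L2 u \<xi> - g \<xi>)"
    by (rule is_fourier_L2_diff[OF sobolev_fourier(1)[OF \<delta> \<delta>_DIM u] g])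
  have p: "(cmod (fourier_L2 (\<lambda>x. u x - v x) \<xi>))\<^sup>2 / W_fun \<delta> (norm \<xi>) \<ge> 0" for \<xi> using W_norm_pos[OF \<delta>, of \<xi>] by simp
  let ?I = "\<integral>\<xi>. (cmod (fourier_L2 (\<lambda>x. u x - v x) \<xi>))\<^sup>2 / W_fun \<delta> (norm \<xi>) \<partial>lborel"
  have I0: "?I \<ge> 0" by (rule Bochner_Integration.integral_nonneg) (rule p)
  have "(ip_dist (Phi_inner \<delta>) u v)\<^sup>2 = ip_const * ?I"
    unfolding ip_dist_def Phi_inner_self Re_complex_of_real using I0 ip_const_pos by simp
  then have "ennreal ((ip_dist (Phi_inner \<delta>) u v)\<^sup>2) = ennreal ip_const * ennreal ?I"
    using I0 ip_const_pos by (simp add: ennreal_mult)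
  also have "ennreal ?I = (\<integral>\<^sup>+\<xi>. ennreal ((cmod (fourier_L2 (\<lambda>x. u x - v x) \<xi>))\<^sup>2 / W_fun \<delta> (norm \<xi>)) \<partial>lborel)"
    by (rule nn_integral_eq_integral[symmetric, OF fuv(3)]) (simp add: p)
  also have "\<dots> = L2_sq (\<lambda>\<xi>. half_weight (fourier_L2 u) \<xi> - half_weight g \<xi>)"
    unfolding L2_sq_def
  proof (rule nn_integral_cong_AE)
    show "AE \<xi> in lborel. ennreal ((cmod (fourier_L2 (\<lambda>x. u x - v x) \<xi>))\<^sup>2 / W_fun \<delta> (norm \<xi>))
       = ennreal ((cmod (half_weight (fourier_L2 u) \<xi> - half_weight g \<xi>))\<^sup>2)"
      using fourier_L2_AE_eq[OF d]
    proof eventually_elim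
      case (elim \<xi>)
      have "half_weight (fourier_L2 u) \<xi> - half_weight g \<xi> = half_weight (\<lambda>\<xi>. fourier_L2 u \<xi> - g \<xi>) \<xi>"
        by (simp add: half_weight_def diff_divide_distrib)
      then show ?case using elim by (simp only: half_weight_sq)
    qed
  qed
  finally show ?thesis .
qed

lemma Metric_space_sobolev: "Metric_space (sobolev_space \<delta>) (ip_dist (Phi_inner \<delta> :: (real ^ 'n \<Rightarrow> complex) \<Rightarrow> _))"
  by (rule Metric_space_ip_dist[OF inner_product_sobolev Phi_inner_self_nonneg Phi_inner_neg])

lemma mcomplete_sobolev: "Metric_space.mcomplete (sobolev_space \<delta>) (ip_dist (Phi_inner \<delta> :: (real ^ 'n \<Rightarrow> complex) \<Rightarrow> _))"
proof -
  interpret Metric_space "sobolev_space \<delta>" "ip_dist (Phi_inner \<delta> :: (real ^ 'n \<Rightarrow> complex) \<Rightarrow> _)" by (rule Metric_space_sobolev)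
  let ?d = "ip_dist (Phi_inner \<delta> :: (real ^ 'n \<Rightarrow> complex) \<Rightarrow> _)"
  show ?thesis
    unfolding mcomplete_def
  proof (intro allI impI)
    fix s :: "nat \<Rightarrow> real ^ 'n \<Rightarrow> complex"
    assume C: "MCauchy s"
    then have sH: "s n \<in> sobolev_space \<delta>" for n by (auto simp: MCauchy_def)
    note fs = sobolev_fourier[OF \<delta> \<delta>_DIM sH]
    define h where "h = (\<lambda>n. half_weight (fourier_L2 (s n)))"
    have hL: "h n \<in> L2_fun" for n unfolding h_def using half_weight_L2[OF fs(2)] fs(3) by simp
    have dist: "ennreal ((?d (s m) (s n))\<^sup>2) = ennreal ip_const * L2_sq (\<lambda>\<xi>. h m \<xi> - h n \<xi>)" for m n
      unfolding h_def by (rule ip_dist_L2[OF sH sH fs(1)])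
    have cancel: "L = ennreal (1 / ip_const) * (ennreal ip_const * L)" for L
      using ip_const_pos by (simp add: mult.assoc[symmetric] ennreal_mult[symmetric])
    have hC: "L2_Cauchy h"
      unfolding L2_Cauchy_def
    proof (intro allI impI)
      fix e :: real assume e: "e > 0"
      define r where "r = sqrt (e * ip_const)"
      have r: "r > 0" using e ip_const_pos by (simp add: r_def)
      obtain N where N: "\<And>m n. N \<le> m \<Longrightarrow> N \<le> n \<Longrightarrow> ?d (s m) (s n) < r" using C r unfolding MCauchy_def by blast
      show "\<exists>N. \<forall>m\<ge>N. \<forall>n\<ge>N. L2_sq (\<lambda>x. h m x - h n x) \<le> ennreal e"
      proof (intro exI[of _ N] allI impI)
        fix m n assume mn: "m \<ge> N" "n \<ge> N"
        have "(?d (s m) (s n))\<^sup>2 \<le> r\<^sup>2" using N[OF mn] by (intro power_mono) auto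
        also have "r\<^sup>2 = e * ip_const" using e ip_const_pos by (simp add: r_def)
        finally have le: "(?d (s m) (s n))\<^sup>2 \<le> e * ip_const" .
        have "L2_sq (\<lambda>x. h m x - h n x) = ennreal (1 / ip_const) * ennreal ((?d (s m) (s n))\<^sup>2)"
          unfolding dist by (rule cancel)
        also have "\<dots> \<le> ennreal (1 / ip_const) * ennreal (e * ip_const)"
          using le by (intro mult_left_mono ennreal_leI) auto
        also have "\<dots> = ennreal e" using e ip_const_pos by (simp add: ennreal_mult[symmetric])
        finally show "L2_sq (\<lambda>x. h m x - h n x) \<le> ennreal e" .
      qed
    qed
    then obtain H where H: "H \<in> L2_fun" "L2_tendsto h H" using riesz_fischer[of h, OF hL hC] by blast
    have Hm[measurable]: "H \<in> borel_measurable borel" using H(1) by (rule L2_measurable)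
    note [measurable] = W_norm_measurable[OF \<delta>]
    \<comment> \<open>The L2 limit with the half weight undone. By
      \<open>weighted_integrable\<close> it is integrable, so its inversion integral is a continuous
      function with transform \<open>g\<close>.\<close>
    define g where "g = (\<lambda>\<xi>. H \<xi> * complex_of_real (sqrt (W_fun \<delta> (norm \<xi>))))"
    have gm[measurable]: "g \<in> borel_measurable borel" unfolding g_def by measurable
    have hg: "half_weight g = H"
    proof
      fix \<xi> show "half_weight g \<xi> = H \<xi>" using W_norm_pos[OF \<delta>, of \<xi>] by (simp add: half_weight_def g_def)
    qed
    have gi: "integrable lborel (\<lambda>\<xi>. (cmod (g \<xi>))\<^sup>2 / W_fun \<delta> (norm \<xi>))"
      using half_weight_L2[OF gm] H(1) hg by simp
    have g1: "integrable lborel g" and g2: "g \<in> L2_fun" using weighted_integrable[OF \<delta> \<delta>_DIM gm gi] by auto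
    define u where "u = inverse_fourier g"
    have ug: "is_fourier_L2 u g" unfolding u_def by (rule is_fourier_L2_inverse_fourier[OF g1 g2])
    have uH: "u \<in> sobolev_space \<delta>"
      by (rule sobolevI[OF \<delta> _ ug gi]) (simp add: u_def continuous_inverse_fourier[OF g1])
    have du: "ennreal ((?d (s n) u)\<^sup>2) = ennreal ip_const * L2_sq (\<lambda>\<xi>. h n \<xi> - H \<xi>)" for n
      using ip_dist_L2[OF sH uH ug] unfolding hg h_def .
    show "\<exists>x. limitin mtopology s x sequentially"
      unfolding limit_metric_sequentially
    proof (intro exI[of _ u] conjI allI impI uH)
      fix e :: real assume e: "e > 0"
      have "ennreal (e\<^sup>2 / ip_const) > 0" using e ip_const_pos by simp
      then obtain N where N: "\<And>n. n \<ge> N \<Longrightarrow> L2_sq (\<lambda>\<xi>. h n \<xi> - H \<xi>) < ennreal (e\<^sup>2 / ip_const)"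
        using ennreal_tendsto_0D[OF H(2)[unfolded L2_tendsto_iff]] by blast
      show "\<exists>N. \<forall>n\<ge>N. s n \<in> sobolev_space \<delta> \<and> ?d (s n) u < e"
      proof (intro exI[of _ N] allI impI conjI sH)
        fix n assume n: "n \<ge> N"
        have "ennreal ip_const * L2_sq (\<lambda>\<xi>. h n \<xi> - H \<xi>) < ennreal ip_const * ennreal (e\<^sup>2 / ip_const)"
          using N[OF n] ip_const_pos by (intro ennreal_mult_strict_left_mono) auto
        then have "ennreal ((?d (s n) u)\<^sup>2) < ennreal (e\<^sup>2)"
          unfolding du using ip_const_pos by (simp add: ennreal_mult[symmetric])
        then have "(?d (s n) u)\<^sup>2 < e\<^sup>2" by (simp add: ennreal_less_iff)
        then show "?d (s n) u < e" using e by (simp add: power_less_imp_less_base)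
      qed
    qed
  qed
qed

text \<open>One computation for three uses: the kernel itself, its translates (N = 1), and the
  shrunken copies that separate points.\<close>

lemma fourier_Phi_affine:
  fixes a :: "real ^ 'n"
  assumes N: "N > 0"
  shows "integrable lborel (\<lambda>y. Phi \<delta> (N *\<^sub>R (y - a)))" "(\<lambda>y. Phi \<delta> (N *\<^sub>R (y - a))) \<in> L2_fun"
    "fourier (\<lambda>y. Phi \<delta> (N *\<^sub>R (y - a))) \<xi> = complex_of_real ((1 / N) ^ CARD('n) * zeta_const CARD('n) \<delta> * W_fun \<delta> (norm \<xi> / N))
       * exp (- \<i> * complex_of_real (\<xi> \<bullet> a))"
proof -
  have Phi: "Phi \<delta> = (\<lambda>x :: real ^ 'n. complex_of_real (Phi_radial DIM(real ^ 'n) \<delta> (norm x)))"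
    by (simp add: Phi_def fun_eq_iff)
  have i: "integrable lborel (Phi \<delta> :: real ^ 'n \<Rightarrow> complex)"
    unfolding Phi complex_of_real_integrable_eq by (rule integrable_Phi[OF \<delta> \<delta>_DIM])
  have L: "(Phi \<delta> :: real ^ 'n \<Rightarrow> complex) \<in> L2_fun" unfolding Phi by (rule Phi_in_L2[OF \<delta> \<delta>_DIM])
  have m[measurable]: "(Phi \<delta> :: real ^ 'n \<Rightarrow> complex) \<in> borel_measurable borel" using L by (rule L2_measurable)
  have e: "N *\<^sub>R (y - a) = (- N *\<^sub>R a) + N *\<^sub>R y" for y by (simp add: algebra_simps)
  show "integrable lborel (\<lambda>y. Phi \<delta> (N *\<^sub>R (y - a)))"
    unfolding e using N by (intro integrable_lborel_affine[OF i]) simp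
  have "integrable lborel (\<lambda>x :: real ^ 'n. (cmod (Phi \<delta> x))\<^sup>2)" using L by (simp add: L2_fun_def)
  then have "integrable lborel (\<lambda>y. (cmod (Phi \<delta> (- N *\<^sub>R a + N *\<^sub>R y)))\<^sup>2)"
    using N integrable_lborel_affine[of "\<lambda>x. (cmod (Phi \<delta> x))\<^sup>2" N "- N *\<^sub>R a"] by simp
  moreover have "(\<lambda>y. Phi \<delta> (- N *\<^sub>R a + N *\<^sub>R y)) \<in> borel_measurable lborel" by measurable
  ultimately show "(\<lambda>y. Phi \<delta> (N *\<^sub>R (y - a))) \<in> L2_fun"
    unfolding L2_fun_def mem_Collect_eq e by blast
  have "fourier (\<lambda>y. Phi \<delta> (N *\<^sub>R (y - a))) \<xi>
    = (\<bar>1 / N\<bar> ^ DIM(real ^ 'n)) *\<^sub>R (\<integral>y. exp (- \<i> * complex_of_real (\<xi> \<bullet> (a + (1 / N) *\<^sub>R y))) * Phi \<delta> (N *\<^sub>R (a + (1 / N) *\<^sub>R y - a)) \<partial>lborel)"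
    unfolding fourier_def using N by (intro integral_lborel_affine) auto
  also have "(\<integral>y. exp (- \<i> * complex_of_real (\<xi> \<bullet> (a + (1 / N) *\<^sub>R y))) * Phi \<delta> (N *\<^sub>R (a + (1 / N) *\<^sub>R y - a)) \<partial>lborel)
    = (\<integral>y. exp (- \<i> * complex_of_real (\<xi> \<bullet> a)) * (exp (- \<i> * complex_of_real (((1 / N) *\<^sub>R \<xi>) \<bullet> y)) * Phi \<delta> y) \<partial>lborel)"
  proof (rule Bochner_Integration.integral_cong[OF refl])
    fix y :: "real ^ 'n"
    have "N *\<^sub>R (a + (1 / N) *\<^sub>R y - a) = y" using N by simp
    moreover have "exp (- \<i> * complex_of_real (\<xi> \<bullet> (a + (1 / N) *\<^sub>R y))) = exp (- \<i> * complex_of_real (\<xi> \<bullet> a)) * exp (- \<i> * complex_of_real (((1 / N) *\<^sub>R \<xi>) \<bullet> y))"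
      unfolding exp_add[symmetric] by (simp add: inner_add_right algebra_simps)
    ultimately show "exp (- \<i> * complex_of_real (\<xi> \<bullet> (a + (1 / N) *\<^sub>R y))) * Phi \<delta> (N *\<^sub>R (a + (1 / N) *\<^sub>R y - a))
      = exp (- \<i> * complex_of_real (\<xi> \<bullet> a)) * (exp (- \<i> * complex_of_real (((1 / N) *\<^sub>R \<xi>) \<bullet> y)) * Phi \<delta> y)"
      by (simp only: mult.assoc)
  qed
  also have "\<dots> = exp (- \<i> * complex_of_real (\<xi> \<bullet> a)) * fourier (Phi \<delta>) ((1 / N) *\<^sub>R \<xi>)"
    unfolding fourier_def by (rule integral_mult_right_zero)
  also have "fourier (Phi \<delta>) ((1 / N) *\<^sub>R \<xi>) = complex_of_real (zeta_const CARD('n) \<delta> * W_fun \<delta> (norm \<xi> / N))"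
    unfolding Phi using fourier_Phi[OF \<delta> \<delta>_DIM, of "(1 / N) *\<^sub>R \<xi>"] N by simp
  finally show "fourier (\<lambda>y. Phi \<delta> (N *\<^sub>R (y - a))) \<xi> = complex_of_real ((1 / N) ^ CARD('n) * zeta_const CARD('n) \<delta> * W_fun \<delta> (norm \<xi> / N))
       * exp (- \<i> * complex_of_real (\<xi> \<bullet> a))"
    using N by (simp add: scaleR_conv_of_real mult_ac)
qed

lemma continuous_Phi_cart: "continuous_on UNIV (Phi \<delta> :: real ^ 'n \<Rightarrow> complex)"
proof -
  have "continuous_on UNIV (\<lambda>x :: real ^ 'n. complex_of_real (Phi_radial DIM(real ^ 'n) \<delta> (norm x)))"
    by (intro continuous_intros continuous_Phi[OF \<delta> \<delta>_DIM])
  then show ?thesis by (simp add: Phi_def[abs_def])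
qed

text \<open>Dilation preserves the decay rate: 1 + r^2 is at most N^2 (1 + (r / N)^2), so the upper
  bound of W at r / N and the lower bound at r leave a multiple of (1 + r^2)^(-\<delta>).\<close>

lemma W_scaled_bound:
  assumes N: "N \<ge> 1"
  shows "integrable lborel (\<lambda>\<xi> :: real ^ 'n. (W_fun \<delta> (norm \<xi> / N))\<^sup>2 / W_fun \<delta> (norm \<xi>))"
proof -
  obtain c where c: "c > 0" "\<And>r. r \<ge> 0 \<Longrightarrow> c \<le> W_fun \<delta> r * (1 + r\<^sup>2) powr \<delta>" using W_lower[OF \<delta>] by blast
  obtain C where C: "C > 0" "\<And>r. r \<ge> 0 \<Longrightarrow> W_fun \<delta> r * (1 + r\<^sup>2) powr \<delta> \<le> C" using W_upper[OF \<delta>] by blast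
  define D where "D = C\<^sup>2 * ((N\<^sup>2) powr \<delta>)\<^sup>2 / c"
  have "(W_fun \<delta> (r / N))\<^sup>2 / W_fun \<delta> r \<le> D * (1 + r\<^sup>2) powr (- \<delta>)" if r: "r \<ge> 0" for r
  proof -
    define J where "J = (1 + r\<^sup>2) powr \<delta>"
    define J' where "J' = (1 + (r / N)\<^sup>2) powr \<delta>"
    define E where "E = (N\<^sup>2) powr \<delta>"
    define w where "w = W_fun \<delta> r"
    define w' where "w' = W_fun \<delta> (r / N)"
    have J: "J > 0" "J' > 0" by (simp_all add: J_def J'_def add_nonneg_eq_0_iff)
    have w: "w > 0" "w' > 0" unfolding w_def w'_def using r N by (auto intro!: W_pos[OF \<delta>])
    have "1 \<le> N\<^sup>2" using N by (simp add: one_le_power)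
    moreover have "N\<^sup>2 * (1 + (r / N)\<^sup>2) = N\<^sup>2 + r\<^sup>2" using N by (simp add: distrib_left power_divide)
    ultimately have "1 + r\<^sup>2 \<le> N\<^sup>2 * (1 + (r / N)\<^sup>2)" by linarith
    then have "J \<le> (N\<^sup>2 * (1 + (r / N)\<^sup>2)) powr \<delta>" unfolding J_def using \<delta> by (intro powr_mono2) auto
    also have "\<dots> = E * J'" unfolding E_def J'_def by (rule powr_mult)
    finally have JE: "J \<le> E * J'" .
    have cw: "c \<le> w * J" unfolding w_def J_def by (rule c(2)[OF r])
    have Cw: "w' * J' \<le> C" unfolding w'_def J'_def using r N by (intro C(2)) auto
    have "w' * J \<le> w' * (E * J')" using JE w by (intro mult_left_mono) auto
    also have "\<dots> = E * (w' * J')" by simp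
    also have "\<dots> \<le> E * C" using Cw by (intro mult_left_mono) (auto simp: E_def)
    finally have "(w' * J)\<^sup>2 \<le> (E * C)\<^sup>2" using w J by (intro power_mono) auto
    then have "(w' * J)\<^sup>2 * c \<le> (E * C)\<^sup>2 * (w * J)" using cw c(1) by (intro mult_mono) auto
    then have "w'\<^sup>2 / w \<le> D * (1 / J)"
      using w J c(1) unfolding D_def E_def[symmetric] by (simp add: field_simps power2_eq_square)
    then show ?thesis unfolding w_def w'_def J_def by (simp add: powr_minus_divide)
  qed
  then have le: "(W_fun \<delta> (norm \<xi> / N))\<^sup>2 / W_fun \<delta> (norm \<xi>) \<le> D * (1 + (norm \<xi>)\<^sup>2) powr (- \<delta>)" for \<xi> :: "real ^ 'n" by simp
  have "integrable lborel (\<lambda>\<xi> :: real ^ 'n. D * (1 + (norm \<xi>)\<^sup>2) powr (- \<delta>))"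
    by (intro integrable_mult_right integrable_bessel_potential \<delta>_DIM)
  then show ?thesis
  proof (rule Bochner_Integration.integrable_bound)
    note W_norm_measurable[OF \<delta>, measurable]
    have [measurable]: "(\<lambda>\<xi> :: real ^ 'n. W_fun \<delta> (norm \<xi> / N)) \<in> borel_measurable borel"
      by (intro borel_measurable_continuous_onI continuous_on_compose2[OF continuous_W[OF \<delta>]] continuous_intros) (use N in auto)
    show "(\<lambda>\<xi> :: real ^ 'n. (W_fun \<delta> (norm \<xi> / N))\<^sup>2 / W_fun \<delta> (norm \<xi>)) \<in> borel_measurable lborel"
      by measurable
    show "AE \<xi> :: real ^ 'n in lborel. norm ((W_fun \<delta> (norm \<xi> / N))\<^sup>2 / W_fun \<delta> (norm \<xi>)) \<le> norm (D * (1 + (norm \<xi>)\<^sup>2) powr (- \<delta>))"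
      using le W_norm_pos[OF \<delta>] by (intro AE_I2 norm_le_norm_nonneg divide_nonneg_pos) auto
  qed
qed

lemma Phi_affine_in_sobolev:
  fixes a :: "real ^ 'n"
  assumes N: "N \<ge> 1"
  shows "(\<lambda>y. Phi \<delta> (N *\<^sub>R (y - a))) \<in> sobolev_space \<delta>"
proof (rule sobolevI[OF \<delta>])
  have N0: "N > 0" using N by simp
  show "continuous_on UNIV (\<lambda>y. Phi \<delta> (N *\<^sub>R (y - a)))"
    by (rule continuous_on_compose2[OF continuous_Phi_cart]) (auto intro!: continuous_intros)
  show "is_fourier_L2 (\<lambda>y. Phi \<delta> (N *\<^sub>R (y - a))) (fourier (\<lambda>y. Phi \<delta> (N *\<^sub>R (y - a))))"
    by (rule is_fourier_L2_L1[OF fourier_Phi_affine(1,2)[OF N0]])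
  let ?K = "(1 / N) ^ CARD('n) * zeta_const CARD('n) \<delta>"
  have "(cmod (fourier (\<lambda>y. Phi \<delta> (N *\<^sub>R (y - a))) \<xi>))\<^sup>2 / W_fun \<delta> (norm \<xi>) = ?K\<^sup>2 * ((W_fun \<delta> (norm \<xi> / N))\<^sup>2 / W_fun \<delta> (norm \<xi>))" for \<xi>
  proof -
    have e: "cmod (exp (- \<i> * complex_of_real (\<xi> \<bullet> a))) = 1" by simp
    show ?thesis
      unfolding fourier_Phi_affine(3)[OF N0] norm_mult e norm_of_real by (simp only: mult_1_right power2_abs power_mult_distrib times_divide_eq_right)
  qed
  then show "integrable lborel (\<lambda>\<xi>. (cmod (fourier (\<lambda>y. Phi \<delta> (N *\<^sub>R (y - a))) \<xi>))\<^sup>2 / W_fun \<delta> (norm \<xi>))"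
    by (simp only:) (intro integrable_mult_right W_scaled_bound N)
qed

text \<open>The transform of the translate is \<zeta> W times a character. W cancels the weight of
  the inner product, and what remains is the inversion integral of u, with \<open>ip_const\<close>
  times \<zeta> equal to its normalisation.\<close>

lemma Phi_reproducing:
  fixes u :: "real ^ 'n \<Rightarrow> complex"
  assumes u: "u \<in> sobolev_space \<delta>"
  shows "u x = Phi_inner \<delta> u (\<lambda>y. Phi \<delta> (y - x))"
proof -
  note fu = sobolev_fourier[OF \<delta> \<delta>_DIM u]
  note A = fourier_Phi_affine[of 1 x, simplified]
  have H: "(\<lambda>y. Phi \<delta> (y - x)) \<in> sobolev_space \<delta>" using Phi_affine_in_sobolev[of 1 x] by simp
  note fH = sobolev_fourier[OF \<delta> \<delta>_DIM H]
  have ae: "AE \<xi> in lborel. fourier_L2 (\<lambda>y. Phi \<delta> (y - x)) \<xi> = fourier (\<lambda>y. Phi \<delta> (y - x)) \<xi>"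
    by (rule fourier_L2_AE_eq[OF is_fourier_L2_L1[OF A(1,2)]])
  note [measurable] = fu(2) fH(2) W_norm_measurable[OF \<delta>]
  let ?z = "zeta_const CARD('n) \<delta>"
  have "(\<integral>\<xi>. fourier_L2 u \<xi> * cnj (fourier_L2 (\<lambda>y. Phi \<delta> (y - x)) \<xi>) / complex_of_real (W_fun \<delta> (norm \<xi>)) \<partial>lborel)
    = (\<integral>\<xi>. complex_of_real ?z * (exp (- \<i> * complex_of_real ((- x) \<bullet> \<xi>)) * fourier_L2 u \<xi>) \<partial>lborel)"
  proof (rule integral_cong_AE)
    show "AE \<xi> in lborel. fourier_L2 u \<xi> * cnj (fourier_L2 (\<lambda>y. Phi \<delta> (y - x)) \<xi>) / complex_of_real (W_fun \<delta> (norm \<xi>))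
      = complex_of_real ?z * (exp (- \<i> * complex_of_real ((- x) \<bullet> \<xi>)) * fourier_L2 u \<xi>)"
      using ae
    proof eventually_elim
      case (elim \<xi>)
      have w: "W_fun \<delta> (norm \<xi>) \<noteq> 0" using W_norm_pos[OF \<delta>, of \<xi>] by simp
      have "fourier (\<lambda>y. Phi \<delta> (y - x)) \<xi> = complex_of_real (?z * W_fun \<delta> (norm \<xi>)) * exp (- \<i> * complex_of_real (\<xi> \<bullet> x))"
        using fourier_Phi_affine(3)[of 1 x \<xi>] by simp
      then have "cnj (fourier_L2 (\<lambda>y. Phi \<delta> (y - x)) \<xi>) = complex_of_real (?z * W_fun \<delta> (norm \<xi>)) * exp (- \<i> * complex_of_real ((- x) \<bullet> \<xi>))"
        unfolding elim by (simp add: exp_cnj inner_commute)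
      then show ?case using w by (simp add: field_simps)
    qed
  qed measurable
  also have "\<dots> = complex_of_real ?z * fourier (fourier_L2 u) (- x)"
    unfolding fourier_def by (rule integral_mult_right_zero)
  finally have "Phi_inner \<delta> u (\<lambda>y. Phi \<delta> (y - x)) = complex_of_real ip_const * (complex_of_real ?z * fourier (fourier_L2 u) (- x))"
    unfolding Phi_inner_def ip_const_def by simp
  also have "\<dots> = complex_of_real (ip_const * ?z) * fourier (fourier_L2 u) (- x)" by simp
  also have "ip_const * ?z = 1 / (2 * pi) ^ DIM(real ^ 'n)"
    unfolding ip_const_def using zeta_pos by (simp add: powr_minus_divide powr_realpow)
  also have "complex_of_real (1 / (2 * pi) ^ DIM(real ^ 'n)) * fourier (fourier_L2 u) (- x) = u x"
    by (subst (2) fu(5)) (simp add: inverse_fourier_def)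
  finally show ?thesis by simp
qed

lemma Phi_kernel: "translation_reproducing_kernel (Phi \<delta> :: real ^ 'n \<Rightarrow> complex) (sobolev_space \<delta>) (Phi_inner \<delta>)"
  unfolding translation_reproducing_kernel_def hilbert_space_on_def
proof (intro conjI ballI allI)
  show "(\<lambda>y. Phi \<delta> (y - x)) \<in> (sobolev_space \<delta> :: (real ^ 'n \<Rightarrow> complex) set)" for x
    using Phi_affine_in_sobolev[of 1 x] by simp
qed (auto intro: inner_product_sobolev mcomplete_sobolev Phi_reproducing)

text \<open>The value at 0 is the squared native norm of the kernel; if it were 0, the kernel would
  vanish, yet its transform at 0 is \<zeta> > 0.\<close>

lemma Phi_0_nonzero: "Phi \<delta> (0 :: real ^ 'n) \<noteq> 0"
proof
  let ?P = "Phi \<delta> :: real ^ 'n \<Rightarrow> complex"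
  assume z: "?P 0 = 0"
  have H: "?P \<in> sobolev_space \<delta>" using Phi_affine_in_sobolev[of 1 0] by simp
  have "Phi_inner \<delta> ?P ?P = 0" using Phi_reproducing[OF H, of 0] z by simp
  then have "?P = (\<lambda>x. 0)" by (rule inner_product_onD(9)[OF inner_product_sobolev H])
  then have "fourier ?P 0 = 0" by (simp add: fourier_def)
  moreover have "fourier ?P 0 = complex_of_real (zeta_const CARD('n) \<delta>)"
    using fourier_Phi_affine(3)[of 1 0 0] by simp
  ultimately show False using zeta_pos by simp
qed

lemma sobolev_separates:
  fixes A :: "(real ^ 'n) set"
  assumes A: "finite A" and a: "a \<in> A"
  shows "\<exists>u\<in>sobolev_space \<delta>. u a \<noteq> 0 \<and> (\<forall>b\<in>A - {a}. u b = 0)"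
proof -
  \<comment> \<open>Large enough that the copy centred at \<open>a\<close> vanishes at all other
    points of \<open>A\<close>. The inserted 1 ensures N \<ge> 1 and a nonempty set when
    \<open>A\<close> is a singleton.\<close>
  define N where "N = Max (insert 1 ((\<lambda>b. 1 / norm (b - a)) ` (A - {a})))"
  have fin: "finite (insert 1 ((\<lambda>b. 1 / norm (b - a)) ` (A - {a})))" using A by simp
  have N1: "N \<ge> 1" unfolding N_def by (rule Max_ge[OF fin]) simp
  have Nb: "1 / norm (b - a) \<le> N" if "b \<in> A - {a}" for b unfolding N_def by (rule Max_ge[OF fin]) (use that in auto)
  have "Phi \<delta> (N *\<^sub>R (b - a)) = 0" if b: "b \<in> A - {a}" for b
  proof -
    have "norm (b - a) > 0" using b by simp
    then have "1 \<le> N * norm (b - a)" using Nb[OF b] by (simp add: pos_divide_le_eq)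
    moreover have "norm (N *\<^sub>R (b - a)) = N * norm (b - a)" using N1 by (simp only: norm_scaleR)
    ultimately have "norm (N *\<^sub>R (b - a)) \<ge> 1" by linarith
    then show ?thesis using Phi_outside[OF \<delta> \<delta>_DIM, of "N *\<^sub>R (b - a)"] by (simp add: Phi_def)
  qed
  then show ?thesis
    using Phi_affine_in_sobolev[OF N1, of a] Phi_0_nonzero
    by (intro bexI[of _ "\<lambda>y. Phi \<delta> (N *\<^sub>R (y - a))"]) auto
qed

end

theorem corollary6p1:
  fixes \<delta> :: real
  assumes "\<delta> > max 1 (real CARD('n::finite) / 2)"
  shows "continuous_on UNIV (Phi \<delta> :: real ^ 'n \<Rightarrow> complex)
    \<and> positive_definite_fun (Phi \<delta> :: real ^ 'n \<Rightarrow> complex)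
    \<and> (\<forall>\<xi> :: real ^ 'n.
         fourier (Phi \<delta>) \<xi> = complex_of_real (zeta_const CARD('n) \<delta> * W_fun \<delta> (norm \<xi>)))
    \<and> translation_reproducing_kernel (Phi \<delta> :: real ^ 'n \<Rightarrow> complex)
         (sobolev_space \<delta>) (Phi_inner \<delta>)"
proof -
  have \<delta>: "\<delta> > 1" "2 * \<delta> > real CARD('n)" using assms by auto
  have "fourier (Phi \<delta>) \<xi> = complex_of_real (zeta_const CARD('n) \<delta> * W_fun \<delta> (norm \<xi>))" for \<xi> :: "real ^ 'n"
    using fourier_Phi_affine(3)[OF \<delta>, of 1 0 \<xi>] by simp
  then show ?thesis
    using continuous_Phi_cart[OF \<delta>] Phi_kernel[OF \<delta>]
      reproducing_kernel_positive_definite[OF Phi_kernel[OF \<delta>] sobolev_separates[OF \<delta>]]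
    by blast
qed

end
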